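(* Let $A=([\mathfrak b]_\sim,(t_1,\dots,t_n))$ and $A'=([\mathfrak b']_\sim,(t_1',\dots,t_n'))$ be elements of $\mathrm{Rep}^f(K)$. (a) There exists a minimal $\ell\in\mathbb G$ such that $B_\ell:=B(\mathfrak b\mathfrak b',(t_1+t_1',\dots,t_n+t_n',\ell))\setminus\{0\}$ is non-empty. If, for this $\ell$, $\mu$ is a smallest element of $B_\ell$ with respect to $\le$, then $$B:=([\tfrac1\mu\mathfrak b\mathfrak b']_\sim,(t_1+t_1'+\nu_{\mathfrak p_1}(\mu),\dots,t_n+t_n'+\nu_{\mathfrak p_n}(\mu)))\in\mathrm{Rep}^f(K)$$ and $\Phi(A)+\Phi(A')=\Phi(B)$. (b) There exists a minimal $\ell\in\mathbb G$ such that $B_\ell:=B(\mathfrak b^{-1},(-t_1,\dots,-t_n,\ell))\setminus\{0\}$ is non-empty. If, for this $\ell$, $\mu$ is a smallest element of $B_\ell$ with respect to $\le$, then $$C:=([\tfrac1\mu\mathfrak b^{-1}]_\sim,(-t_1+\nu_{\mathfrak p_1}(\mu),\dots,-t_n+\nu_{\mathfrak p_n}(\mu)))\in\mathrm{Rep}^f(K)$$ and $-\Phi(A)=\Phi(C)$.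
   Context: **Fields and places.** $K$ is either a number field, or an algebraic function field in one variable with exact field of constants $k$ ($k$ not assumed finite). *Number field case:* $\mathcal O_K$ is the ring of integers, $S$ the set of archimedean places, $\mathbb G=\mathbb R$, $q=e$; for $\mathfrak p\in S$ corresponding to an embedding $\sigma:K\to\mathbb C$, $\deg\mathfrak p=1$ if $\sigma(K)\subseteq\mathbb R$ and $\deg\mathfrak p=2$ otherwise, and $\nu_{\mathfrak p}(f)=-\log|\sigma(f)|$ for $f\in K^*$; for a finite place $\mathfrak p$, $\nu_{\mathfrak p}$ is the normalized valuation and $\deg\mathfrak p=\log|\mathcal O_{\mathfrak p}/\mathfrak m_{\mathfrak p}|$, where $\mathcal O_{\mathfrak p}$ is the valuation ring of $\mathfrak p$ and $\mathfrak m_{\mathfrak p}$ its maximal ideal. *Function field case:* $x\in K$ is a fixed element transcendental over $k$, $\mathcal O_K$ is the integral closure of $k[x]$ in $K$, $S$ is the set of places of $K$ above the infinite place of $k(x)$, $\mathbb G=\mathbb Z$, $q=|k|$ if $k$ is finite and otherwise $q>1$ is an arbitrary fixed real number; $\nu_{\mathfrak p}$ is the normalized valuation and $\deg\mathfrak p$ the usual degree over $k$. In both cases $|f|_{\mathfrak p}=q^{-\nu_{\mathfrak p}(f)\deg\mathfrak p}$ for $f\in K^*$ and $|0|_{\mathfrak p}=0$. Write $S=\{\mathfrak p_1,\dots,\mathfrak p_{n+1}\}$ with $n=|S|-1$ (fixed ordering). **Divisors.** For a function field, $\mathrm{Div}(K)$ is the free abelian group on all places. For a number field, $\mathrm{Div}(K)$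 is the direct product of the free abelian group on the finite places and $\mathbb R^S$. $\deg\sum n_{\mathfrak p}\mathfrak p=\sum n_{\mathfrak p}\deg\mathfrak p$; $(f)=\sum_{\mathfrak p}\nu_{\mathfrak p}(f)\mathfrak p$ for $f\in K^*$. $\mathrm{Pic}(K)$ is $\mathrm{Div}(K)$ modulo principal divisors, and $\mathrm{Pic}^0(K)$ is the subgroup of classes of degree $0$. For an ideal $\mathfrak b=\prod_{\mathfrak p\notin S}(\mathfrak m_{\mathfrak p}\cap\mathcal O_K)^{n_{\mathfrak p}}$ put $\mathrm{div}(\mathfrak b)=-\sum_{\mathfrak p\notin S}n_{\mathfrak p}\mathfrak p$, where $\mathfrak m_{\mathfrak p}$ is the valuation ideal of $\mathfrak p$. **Ideals.** "Ideal" means nonzero fractional ideal of $\mathcal O_K$; $\mathrm{Id}(\mathcal O_K)$ is the group of these. For an ideal $\mathfrak b$ and $t_1,\dots,t_{n+1}\in\mathbb G$ let $B(\mathfrak b,(t_1,\dots,t_{n+1}))=\{h\in\mathfrak b: |h|_{\mathfrak p_i}\le q^{t_i\deg\mathfrak p_i},\ 1\le i\le n+1\}$. An ideal $\mathfrak b$ is *reduced* if $1\in\mathfrak b$ and every nonzero $h\in B(\mathfrak b,(0,\dots,0))$ satisfies $|h|_{\mathfrak p}=1$ for all $\mathfrak p\in S$. $\mathrm{Red}(\mathfrak a)$ is the set of reduced ideals of the form $\frac1\mu\mathfrak a$, $\mu\in K^*$. Define $\mathfrak b\sim\mathfrak b'$ iff there is $h\in K^*$ with $\mathfrak b=h\mathfrak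 b'$ and $|h|_{\mathfrak p}=1$ for all $\mathfrak p\in S$; $[\mathfrak b]_\sim$ is the class. **$f$-representations.** Define a total preorder on $K^*$ by $h\le h'$ iff $(|h|_{\mathfrak p_{n+1}},|h|_{\mathfrak p_1},\dots,|h|_{\mathfrak p_n})\le_{lex}(|h'|_{\mathfrak p_{n+1}},|h'|_{\mathfrak p_1},\dots,|h'|_{\mathfrak p_n})$ in the lexicographic order on $\mathbb R^{n+1}$. $\mathrm{Rep}^{f}(\mathfrak a)$ is the set of $([\mathfrak b]_\sim,(t_1,\dots,t_n))\in\mathrm{Red}(\mathfrak a)/_\sim\times\mathbb G^n$ such that $1$ is an element of $B(\mathfrak b,(t_1,\dots,t_n,0))\setminus\{0\}$ and is a smallest element of this set with respect to $\le$ (this does not depend on the representative $\mathfrak b$). $\mathrm{Rep}^f(K)=\bigcup_{\mathfrak a\in\mathrm{Id}(\mathcal O_K)}\mathrm{Rep}^f(\mathfrak a)$. **The map $\Phi$.** For a number field, $\Phi:\mathrm{Rep}^f(K)\to\mathrm{Pic}^0(K)$ sends $([\mathfrak b]_\sim,(t_i))$ to $\bigl[\mathrm{div}(\mathfrak b)+\sum_{i=1}^n t_i\mathfrak p_i-\frac{\deg\mathrm{div}(\mathfrak b)+\sum_{i=1}^n t_i\deg\mathfrak p_i}{\deg\mathfrak p_{n+1}}\mathfrak p_{n+1}\bigr]$. For a function field, $\Phi:\mathrm{Rep}^f(K)\to\mathrm{Pic}(K)/\langle[\mathfrak p_{n+1}]\rangle$ sends $([\mathfrak b]_\sim,(t_i))$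 to $\bigl[\mathrm{div}(\mathfrak b)+\sum_{i=1}^n t_i\mathfrak p_i\bigr]+\langle[\mathfrak p_{n+1}]\rangle$. *)

theory Defs
  imports
    Complex_Main
    "HOL-Library.FuncSet"
    "HOL-Computational_Algebra.Polynomial"
    "HOL-Algebra.Algebra"
    "HOL-Algebra.Algebraic_Closure_Type"
begin

section \<open>The field\<close>

text \<open>
  The field \<open>K\<close> is represented by a whole type \<open>'a\<close> of class \<open>field\<close>; subfields, rings and ideals inside \<open>K\<close>
  are subsets of \<open>'a\<close>. Notions of HOL-Algebra are applied to \<open>K\<close> through
  \<^const>\<open>ring_of_type_algebra\<close>, the record of all elements of the type.
\<close>

abbreviation KR :: "'a::field ring"
  where "KR \<equiv> ring_of_type_algebra"

definition polys_over :: "'a::field set \<Rightarrow> 'a poly set"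
  where "polys_over R = {p. \<forall>i. Polynomial.coeff p i \<in> R}"

definition integral_closure :: "'a::field set \<Rightarrow> 'a set"
  where "integral_closure R =
    {z. \<exists>p \<in> polys_over R. Polynomial.lead_coeff p = 1 \<and> poly p z = 0}"

definition algebraic_over :: "'a::field set \<Rightarrow> 'a \<Rightarrow> bool"
  where "algebraic_over k z \<longleftrightarrow> (\<exists>p \<in> polys_over k. p \<noteq> 0 \<and> poly p z = 0)"

abbreviation finite_extension_of :: "'a::field set \<Rightarrow> bool"
  where "finite_extension_of F \<equiv> ring.finite_dimension (KR :: 'a ring) F (carrier KR)"

definition rational_subfield :: "'a::field set"
  where "rational_subfield = {of_int a / of_int b | a b. of_int b \<noteq> (0::'a)}"

definition is_number_field :: "'a::field itself \<Rightarrow> bool"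
  where "is_number_field _ \<longleftrightarrow>
    CHAR('a) = 0 \<and> finite_extension_of (rational_subfield :: 'a set)"

definition rational_functions :: "'a::field set \<Rightarrow> 'a \<Rightarrow> 'a set"
  where "rational_functions k x = generate_field KR (insert x k)"

definition is_function_field :: "'a::field set \<Rightarrow> bool"
  where "is_function_field k \<longleftrightarrow>
    subfield k KR \<and>
    (\<exists>y. \<not> algebraic_over k y \<and> finite_extension_of (rational_functions k y)) \<and>
    (\<forall>z. algebraic_over k z \<longrightarrow> z \<in> k)"

text \<open>
  The two cases, with the data fixed in each of them: \<open>Function_Field k x q\<close> records the field of
  constants, the element \<open>x\<close> and the base \<open>q\<close> of the absolute values.
\<close>

datatype 'a setting = Number_Field | Function_Field "'a set" 'a real

fun valid_setting :: "'a::field setting \<Rightarrow> bool" where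
  "valid_setting Number_Field \<longleftrightarrow> is_number_field TYPE('a)"
| "valid_setting (Function_Field k x q) \<longleftrightarrow>
     is_function_field k \<and> \<not> algebraic_over k x \<and>
     (if finite k then q = real (card k) else q > 1)"

fun base :: "'a::field setting \<Rightarrow> real" where
  "base Number_Field = exp 1"
| "base (Function_Field k x q) = q"

text \<open>The group \<open>\<real>\<close> or \<open>\<int>\<close>; the integers are taken as a subset of the reals in both cases.\<close>

fun GG :: "'a::field setting \<Rightarrow> real set" where
  "GG Number_Field = UNIV"
| "GG (Function_Field k x q) = \<int>"

fun OK :: "'a::field setting \<Rightarrow> 'a set" where
  "OK Number_Field = integral_closure \<int>"
| "OK (Function_Field k x q) = integral_closure {poly p x | p. p \<in> polys_over k}"

lemma OK_Number_Field_iff: "z \<in> OK Number_Field \<longleftrightarrow> algebraic_int z"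
  by (auto simp: integral_closure_def polys_over_def algebraic_int.simps)


section \<open>Places\<close>

text \<open>
  A non-archimedean place is given by its normalized valuation, an archimedean one by the set
  consisting of an embedding into \<open>\<complex>\<close> and its complex conjugate. The value at \<open>0\<close> carries no
  meaning; it is fixed so that a place determines its valuation as a function.
\<close>

datatype 'a place = Nonarch "'a \<Rightarrow> int" | Arch "('a \<Rightarrow> complex) set"

definition normalized_valuation :: "('a::field \<Rightarrow> int) \<Rightarrow> bool"
  where "normalized_valuation v \<longleftrightarrow>
    v 0 = 0 \<and> v ` (UNIV - {0}) = UNIV \<and>
    (\<forall>f g. f \<noteq> 0 \<longrightarrow> g \<noteq> 0 \<longrightarrow> v (f * g) = v f + v g) \<and>
    (\<forall>f g. f \<noteq> 0 \<longrightarrow> g \<noteq> 0 \<longrightarrow> f + g \<noteq> 0 \<longrightarrow> min (v f) (v g) \<le> v (f + g))"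

definition valuation_ring :: "('a::field \<Rightarrow> int) \<Rightarrow> 'a set"
  where "valuation_ring v = {f. f = 0 \<or> v f \<ge> 0}"

definition valuation_ideal :: "('a::field \<Rightarrow> int) \<Rightarrow> 'a set"
  where "valuation_ideal v = {f. f = 0 \<or> v f > 0}"

abbreviation valuation_ring_rec :: "('a::field \<Rightarrow> int) \<Rightarrow> 'a ring"
  where "valuation_ring_rec v \<equiv> KR\<lparr>carrier := valuation_ring v\<rparr>"

definition residue_field :: "('a::field \<Rightarrow> int) \<Rightarrow> 'a set ring"
  where "residue_field v = valuation_ring_rec v Quot valuation_ideal v"

definition residue_constants :: "'a::field set \<Rightarrow> ('a \<Rightarrow> int) \<Rightarrow> 'a set set"
  where "residue_constants k v =
    (\<lambda>c. valuation_ideal v +>\<^bsub>valuation_ring_rec v\<^esub> c) ` k"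

definition complex_embeddings :: "('a::field \<Rightarrow> complex) set"
  where "complex_embeddings = ring_hom KR KR"

fun places :: "'a::field setting \<Rightarrow> 'a place set" where
  "places Number_Field =
     {Nonarch v | v. normalized_valuation v} \<union>
     {Arch {\<sigma>, cnj \<circ> \<sigma>} | \<sigma>. \<sigma> \<in> complex_embeddings}"
| "places (Function_Field k x q) =
     {Nonarch v | v. normalized_valuation v \<and> (\<forall>c \<in> k - {0}. v c = 0)}"

text \<open>The valuation ring of the infinite place of \<open>k(x)\<close>.\<close>

definition infinite_valuation_ring :: "'a::field set \<Rightarrow> 'a \<Rightarrow> 'a set"
  where "infinite_valuation_ring k x =
    {poly f x / poly g x | f g. f \<in> polys_over k \<and> g \<in> polys_over k \<and> g \<noteq> 0 \<and>
       Polynomial.degree f \<le> Polynomial.degree g}"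

fun SS :: "'a::field setting \<Rightarrow> 'a place set" where
  "SS Number_Field = {Arch {\<sigma>, cnj \<circ> \<sigma>} | \<sigma>. \<sigma> \<in> complex_embeddings}"
| "SS (Function_Field k x q) =
     {Nonarch v | v. Nonarch v \<in> places (Function_Field k x q) \<and>
        valuation_ring v \<inter> rational_functions k x = infinite_valuation_ring k x}"

fun nu :: "'a::field place \<Rightarrow> 'a \<Rightarrow> real" where
  "nu (Nonarch v) f = real_of_int (v f)"
| "nu (Arch E) f = - ln (cmod ((SOME \<sigma>. \<sigma> \<in> E) f))"

fun place_deg :: "'a::field setting \<Rightarrow> 'a place \<Rightarrow> real" where
  "place_deg Number_Field (Arch E) =
     (if range (SOME \<sigma>. \<sigma> \<in> E) \<subseteq> \<real> then 1 else 2)"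
| "place_deg Number_Field (Nonarch v) = ln (real (card (carrier (residue_field v))))"
| "place_deg (Function_Field k x q) (Nonarch v) =
     real (ring.dim (residue_field v) (residue_constants k v) (carrier (residue_field v)))"
| "place_deg (Function_Field k x q) (Arch E) = undefined"

definition absval :: "'a::field setting \<Rightarrow> 'a place \<Rightarrow> 'a \<Rightarrow> real"
  where "absval s p f = (if f = 0 then 0 else base s powr (- nu p f * place_deg s p))"


section \<open>Fractional ideals\<close>

definition frac_ideal :: "'a::field setting \<Rightarrow> 'a set \<Rightarrow> bool"
  where "frac_ideal s b \<longleftrightarrow>
    0 \<in> b \<and> b \<noteq> {0} \<and> (\<forall>f \<in> b. \<forall>g \<in> b. f + g \<in> b) \<and> (\<forall>c \<in> OK s. \<forall>f \<in> b. c * f \<in> b) \<and>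
    (\<exists>d \<in> OK s - {0}. \<forall>f \<in> b. d * f \<in> OK s)"

definition Id_group :: "'a::field setting \<Rightarrow> 'a set monoid"
  where "Id_group s = \<lparr>carrier = {b. frac_ideal s b}, monoid.mult = ideal_prod KR, one = OK s\<rparr>"

definition scale_ideal :: "'a::field \<Rightarrow> 'a set \<Rightarrow> 'a set"
  where "scale_ideal h b = (\<lambda>f. h * f) ` b"

fun place_ideal :: "'a::field setting \<Rightarrow> 'a place \<Rightarrow> 'a set" where
  "place_ideal s (Nonarch v) = valuation_ideal v \<inter> OK s"
| "place_ideal s (Arch E) = undefined"

definition ideal_exponents :: "'a::field setting \<Rightarrow> 'a set \<Rightarrow> 'a place \<Rightarrow> int"
  where "ideal_exponents s b =
    (THE e. {p. e p \<noteq> 0} \<subseteq> places s - SS s \<and> finite {p. e p \<noteq> 0} \<and>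
       b = (\<Otimes>\<^bsub>Id_group s\<^esub>p \<in> {p. e p \<noteq> 0}. place_ideal s p [^]\<^bsub>Id_group s\<^esub> e p))"


section \<open>Divisors\<close>

text \<open>
  Divisors are real-valued functions on places with finite support, zero outside the set of
  places. Coefficients are integers, except at the places of \<open>S\<close> of a number field; as \<open>S\<close> is
  finite there, the finiteness condition does not restrict the \<open>\<real>\<^sup>S\<close> part.
\<close>

definition Div :: "'a::field setting \<Rightarrow> ('a place \<Rightarrow> real) monoid"
  where "Div s = \<lparr>
    carrier = {D. {p. D p \<noteq> 0} \<subseteq> places s \<and> finite {p. D p \<noteq> 0} \<and>
                  (\<forall>p \<in> SS s. D p \<in> GG s) \<and>
                  (\<forall>p \<in> places s - SS s. D p \<in> \<int>)},
    monoid.mult = (\<lambda>D E p. D p + E p),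
    one = (\<lambda>p. 0)\<rparr>"

definition div_deg :: "'a::field setting \<Rightarrow> ('a place \<Rightarrow> real) \<Rightarrow> real"
  where "div_deg s D = (\<Sum>p | D p \<noteq> 0. D p * place_deg s p)"

definition principal_div :: "'a::field setting \<Rightarrow> 'a \<Rightarrow> 'a place \<Rightarrow> real"
  where "principal_div s f p = (if p \<in> places s then nu p f else 0)"

definition Prin :: "'a::field setting \<Rightarrow> ('a place \<Rightarrow> real) set"
  where "Prin s = principal_div s ` (UNIV - {0})"

definition Pic :: "'a::field setting \<Rightarrow> ('a place \<Rightarrow> real) set monoid"
  where "Pic s = Div s Mod Prin s"

definition div_class :: "'a::field setting \<Rightarrow> ('a place \<Rightarrow> real) \<Rightarrow> ('a place \<Rightarrow> real) set"
  where "div_class s D = Prin s #>\<^bsub>Div s\<^esub> D"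

definition Pic0 :: "'a::field setting \<Rightarrow> ('a place \<Rightarrow> real) set monoid"
  where "Pic0 s = (Pic s)\<lparr>carrier := {div_class s D | D. D \<in> carrier (Div s) \<and> div_deg s D = 0}\<rparr>"

definition point :: "'a place \<Rightarrow> 'a place \<Rightarrow> real"
  where "point p = (\<lambda>p'. if p' = p then 1 else 0)"

definition ideal_div :: "'a::field setting \<Rightarrow> 'a set \<Rightarrow> 'a place \<Rightarrow> real"
  where "ideal_div s b p = - real_of_int (ideal_exponents s b p)"

definition Pic_mod :: "'a::field setting \<Rightarrow> 'a place \<Rightarrow> ('a place \<Rightarrow> real) set set monoid"
  where "Pic_mod s p = Pic s Mod generate (Pic s) {div_class s (point p)}"


section \<open>Reduced ideals and f-representations\<close>

text \<open>
  From here on \<open>P 1, \<dots>, P (n + 1)\<close> is an enumeration of \<open>S\<close>. Tuples \<open>(t\<^sub>1, \<dots>, t\<^sub>n)\<close> are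
  extensional functions on \<open>{1..n}\<close>, and \<open>t(Suc n := l)\<close> is \<open>(t\<^sub>1, \<dots>, t\<^sub>n, l)\<close>.
\<close>

definition tuples :: "'a::field setting \<Rightarrow> nat \<Rightarrow> (nat \<Rightarrow> real) set"
  where "tuples s n = {1..n} \<rightarrow>\<^sub>E GG s"

definition Box ::
    "'a::field setting \<Rightarrow> (nat \<Rightarrow> 'a place) \<Rightarrow> nat \<Rightarrow> 'a set \<Rightarrow> (nat \<Rightarrow> real) \<Rightarrow> 'a set"
  where "Box s P n b t =
    {h \<in> b. \<forall>i \<in> {1..Suc n}. absval s (P i) h \<le> base s powr (t i * place_deg s (P i))}"

definition reduced :: "'a::field setting \<Rightarrow> (nat \<Rightarrow> 'a place) \<Rightarrow> nat \<Rightarrow> 'a set \<Rightarrow> bool"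
  where "reduced s P n b \<longleftrightarrow>
    frac_ideal s b \<and> 1 \<in> b \<and>
    (\<forall>h \<in> Box s P n b (\<lambda>_. 0) - {0}. \<forall>p \<in> SS s. absval s p h = 1)"

definition Red :: "'a::field setting \<Rightarrow> (nat \<Rightarrow> 'a place) \<Rightarrow> nat \<Rightarrow> 'a set \<Rightarrow> 'a set set"
  where "Red s P n a = {b. reduced s P n b \<and> (\<exists>\<mu>. \<mu> \<noteq> 0 \<and> b = scale_ideal (1 / \<mu>) a)}"

text \<open>
  The relation \<open>\<sim>\<close>, restricted to reduced ideals. An ideal that is equivalent to a reduced one need
  not contain \<open>1\<close>, so the classes of \<open>Red(a)/\<sim>\<close> must be formed inside the set of reduced
  ideals; the class of \<open>b \<in> Red(a)\<close> is then contained in \<open>Red(a)\<close>.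
\<close>

definition sim :: "'a::field setting \<Rightarrow> (nat \<Rightarrow> 'a place) \<Rightarrow> nat \<Rightarrow> ('a set \<times> 'a set) set"
  where "sim s P n =
    {(b, b'). reduced s P n b \<and> reduced s P n b' \<and>
       (\<exists>h. h \<noteq> 0 \<and> b = scale_ideal h b' \<and> (\<forall>p \<in> SS s. absval s p h = 1))}"

definition sim_class :: "'a::field setting \<Rightarrow> (nat \<Rightarrow> 'a place) \<Rightarrow> nat \<Rightarrow> 'a set \<Rightarrow> 'a set set"
  where "sim_class s P n b = sim s P n `` {b}"

definition absval_vector :: "'a::field setting \<Rightarrow> (nat \<Rightarrow> 'a place) \<Rightarrow> nat \<Rightarrow> 'a \<Rightarrow> real list"
  where "absval_vector s P n h =
    absval s (P (Suc n)) h # map (\<lambda>i. absval s (P i) h) [1..<Suc n]"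

definition pre_le :: "'a::field setting \<Rightarrow> (nat \<Rightarrow> 'a place) \<Rightarrow> nat \<Rightarrow> 'a \<Rightarrow> 'a \<Rightarrow> bool"
  where "pre_le s P n h h' \<longleftrightarrow>
    ord_class.lexordp_eq (absval_vector s P n h) (absval_vector s P n h')"

definition is_smallest :: "'a::field setting \<Rightarrow> (nat \<Rightarrow> 'a place) \<Rightarrow> nat \<Rightarrow> 'a set \<Rightarrow> 'a \<Rightarrow> bool"
  where "is_smallest s P n M m \<longleftrightarrow> m \<in> M \<and> (\<forall>h \<in> M. pre_le s P n m h)"

type_synonym 'a rep = "'a set set \<times> (nat \<Rightarrow> real)"

definition Rep_f :: "'a::field setting \<Rightarrow> (nat \<Rightarrow> 'a place) \<Rightarrow> nat \<Rightarrow> 'a set \<Rightarrow> 'a rep set"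
  where "Rep_f s P n a =
    {(\<beta>, t). \<beta> \<in> Red s P n a // sim s P n \<and> t \<in> tuples s n \<and>
       (\<forall>b \<in> \<beta>. is_smallest s P n (Box s P n b (t(Suc n := 0)) - {0}) 1)}"

definition Rep_f_K :: "'a::field setting \<Rightarrow> (nat \<Rightarrow> 'a place) \<Rightarrow> nat \<Rightarrow> 'a rep set"
  where "Rep_f_K s P n = (\<Union>a \<in> carrier (Id_group s). Rep_f s P n a)"

definition minimal_level ::
    "'a::field setting \<Rightarrow> (nat \<Rightarrow> 'a place) \<Rightarrow> nat \<Rightarrow> 'a set \<Rightarrow> (nat \<Rightarrow> real) \<Rightarrow> real \<Rightarrow> bool"
  where "minimal_level s P n b t l \<longleftrightarrow>
    l \<in> GG s \<and> Box s P n b (t(Suc n := l)) - {0} \<noteq> {} \<and>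
    (\<forall>l' \<in> GG s. Box s P n b (t(Suc n := l')) - {0} \<noteq> {} \<longrightarrow> l \<le> l')"


section \<open>The map Phi\<close>

text \<open>
  The divisor \<open>div(b) + \<Sum> t\<^sub>i p\<^sub>i\<close> of a representation, for a representative \<open>b\<close> chosen from
  the class; its image in the target group does not depend on that choice.
\<close>

definition rep_div ::
    "'a::field setting \<Rightarrow> (nat \<Rightarrow> 'a place) \<Rightarrow> nat \<Rightarrow> 'a rep \<Rightarrow> 'a place \<Rightarrow> real"
  where "rep_div s P n A =
    (\<lambda>p. ideal_div s (SOME b. b \<in> fst A) p + (\<Sum>i = 1..n. snd A i * point (P i) p))"

definition rep_div_deg :: "'a::field setting \<Rightarrow> (nat \<Rightarrow> 'a place) \<Rightarrow> nat \<Rightarrow> 'a rep \<Rightarrow> real"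
  where "rep_div_deg s P n A =
    div_deg s (ideal_div s (SOME b. b \<in> fst A)) + (\<Sum>i = 1..n. snd A i * place_deg s (P i))"

definition Phi_number_field ::
    "'a::field setting \<Rightarrow> (nat \<Rightarrow> 'a place) \<Rightarrow> nat \<Rightarrow> 'a rep \<Rightarrow> ('a place \<Rightarrow> real) set"
  where "Phi_number_field s P n A =
    div_class s (\<lambda>p. rep_div s P n A p
      - rep_div_deg s P n A / place_deg s (P (Suc n)) * point (P (Suc n)) p)"

definition Phi_function_field ::
    "'a::field setting \<Rightarrow> (nat \<Rightarrow> 'a place) \<Rightarrow> nat \<Rightarrow> 'a rep \<Rightarrow> ('a place \<Rightarrow> real) set set"
  where "Phi_function_field s P n A =
    generate (Pic s) {div_class s (point (P (Suc n)))} #>\<^bsub>Pic s\<^esub> div_class s (rep_div s P n A)"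

text \<open>The two maps have different targets, so each identity is stated in the group of its case.\<close>

fun Phi_add :: "'a::field setting \<Rightarrow> (nat \<Rightarrow> 'a place) \<Rightarrow> nat \<Rightarrow> 'a rep \<Rightarrow> 'a rep \<Rightarrow> 'a rep \<Rightarrow> bool"
  where
  "Phi_add Number_Field P n A A' B \<longleftrightarrow>
     Phi_number_field Number_Field P n A \<otimes>\<^bsub>Pic0 Number_Field\<^esub> Phi_number_field Number_Field P n A' =
     Phi_number_field Number_Field P n B"
| "Phi_add (Function_Field k x q) P n A A' B \<longleftrightarrow>
     Phi_function_field (Function_Field k x q) P n A
       \<otimes>\<^bsub>Pic_mod (Function_Field k x q) (P (Suc n))\<^esub>
     Phi_function_field (Function_Field k x q) P n A' =
     Phi_function_field (Function_Field k x q) P n B"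

fun Phi_neg :: "'a::field setting \<Rightarrow> (nat \<Rightarrow> 'a place) \<Rightarrow> nat \<Rightarrow> 'a rep \<Rightarrow> 'a rep \<Rightarrow> bool"
  where
  "Phi_neg Number_Field P n A C \<longleftrightarrow>
     inv\<^bsub>Pic0 Number_Field\<^esub> (Phi_number_field Number_Field P n A) =
     Phi_number_field Number_Field P n C"
| "Phi_neg (Function_Field k x q) P n A C \<longleftrightarrow>
     inv\<^bsub>Pic_mod (Function_Field k x q) (P (Suc n))\<^esub>
       (Phi_function_field (Function_Field k x q) P n A) =
     Phi_function_field (Function_Field k x q) P n C"

end

theory Submission
  imports Defs "Jordan_Normal_Form.Char_Poly"
begin

text \<open>
  Both cases are treated as integral closures of a Euclidean ring \<open>R\<close> (the integers or \<open>k[x]\<close>) in a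
  finite extension. Such a closure is a Dedekind ring: for a prime \<open>M\<close> and any \<open>z\<close>, an equation of \<open>z\<close>
  with a coefficient outside \<open>M\<close> puts \<open>z\<close> or \<open>1 / z\<close> into the localization at \<open>M\<close>, which is discrete
  because elements of increasing value below that of a prime element of \<open>R\<close> are independent over \<open>R\<close>.
  So fractional ideals correspond to exponent vectors, and \<open>div\<close> is additive. Dividing by a smallest
  element \<open>\<mu>\<close> of the box makes \<open>1\<close> smallest, hence the ideal reduced, and changes the divisor by
  \<open>(\<mu>)\<close>; this proves the membership and the identities for \<open>\<Phi>\<close>.

  The minimal \<open>\<ell>\<close> exists because the boxes are nonempty for large \<open>\<ell>\<close> and the values at the last place
  that occur in a box are finite in number. For number fields this is the pigeonhole principle and the
  finiteness of algebraic integers with bounded conjugates; applied to the powers of \<open>f\<close>, the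
  pigeonhole bound also shows that the product of \<open>|f|\<close> over the archimedean places is at most the
  index of \<open>(f)\<close>, and comparison with the elements of \<open>R\<close> gives the product formula needed for degree
  \<open>0\<close>. For function fields, elements without poles outside the last place are found by counting
  dimensions over \<open>k\<close>, and upper bounds for their values come from minimal polynomials.
\<close>

section \<open>Integral closure\<close>

text \<open>All finiteness statements are drawn from one fact, that any \<open>d + 1\<close>
  elements are dependent over \<open>R\<close>. It is sharpened by dividing a relation by a prime of
  \<open>R\<close> until some coefficient lies outside a given prime; finite generation or a chain
  condition for the integral closure is never established. The product formula is obtained without
  norms, discriminants or a lattice theorem. The pigeonhole principle loses a constant, which
  disappears when it is applied to all powers of one element, and it yields one inequality only. The
  opposite one is proved for generators of primes of the integers, where counting residues modulo
  the generator suffices, and spreads by multiplicativity. Over an infinite field of constants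
  cardinalities carry no information and are replaced by dimensions. The decisive gain there is one
  dimension: each further pole order at all places of S except the last costs at most
  \<open>d - 1\<close> dimensions, whereas each power of \<open>x\<close> adds \<open>d\<close>
  independent elements.\<close>

locale coeff_ring =
  fixes R :: "'a::field set"
  assumes R_zero [simp]: "0 \<in> R" and R_one [simp]: "1 \<in> R"
    and R_add [simp]: "a \<in> R \<Longrightarrow> b \<in> R \<Longrightarrow> a + b \<in> R"
    and R_mult [simp]: "a \<in> R \<Longrightarrow> b \<in> R \<Longrightarrow> a * b \<in> R"
    and R_uminus [simp]: "a \<in> R \<Longrightarrow> - a \<in> R"
begin

lemma R_diff [simp]: "a \<in> R \<Longrightarrow> b \<in> R \<Longrightarrow> a - b \<in> R"
  using R_add[of a "- b"] by simp

lemma R_sum: "(\<And>i. i \<in> I \<Longrightarrow> f i \<in> R) \<Longrightarrow> sum f I \<in> R"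
  by (induction I rule: infinite_finite_induct) auto

lemma R_prod: "(\<And>i. i \<in> I \<Longrightarrow> f i \<in> R) \<Longrightarrow> prod f I \<in> R"
  by (induction I rule: infinite_finite_induct) auto

lemma R_power [simp]: "a \<in> R \<Longrightarrow> a ^ n \<in> R"
  by (induction n) auto

lemma polys_over_0 [simp]: "0 \<in> polys_over R"
  by (simp add: polys_over_def)

lemma polys_over_add [simp]: "p \<in> polys_over R \<Longrightarrow> q \<in> polys_over R \<Longrightarrow> p + q \<in> polys_over R"
  by (simp add: polys_over_def)

lemma polys_over_diff [simp]: "p \<in> polys_over R \<Longrightarrow> q \<in> polys_over R \<Longrightarrow> p - q \<in> polys_over R"
  by (simp add: polys_over_def)

lemma polys_over_mult [simp]: "p \<in> polys_over R \<Longrightarrow> q \<in> polys_over R \<Longrightarrow> p * q \<in> polys_over R"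
  by (auto simp: polys_over_def coeff_mult intro!: R_sum)

lemma polys_over_uminus [simp]: "p \<in> polys_over R \<Longrightarrow> - p \<in> polys_over R"
  by (simp add: polys_over_def)

lemma polys_over_smult [simp]: "a \<in> R \<Longrightarrow> p \<in> polys_over R \<Longrightarrow> Polynomial.smult a p \<in> polys_over R"
  by (simp add: polys_over_def)

lemma polys_over_monom [simp]: "a \<in> R \<Longrightarrow> Polynomial.monom a n \<in> polys_over R"
  by (simp add: polys_over_def)

lemma polys_over_pCons [simp]: "pCons a p \<in> polys_over R \<longleftrightarrow> a \<in> R \<and> p \<in> polys_over R"
  by (auto simp: polys_over_def coeff_pCons split: nat.splits)

lemma polys_over_1 [simp]: "1 \<in> polys_over R"
  by (simp add: one_pCons)

lemma polys_over_sum: "(\<And>i. i \<in> I \<Longrightarrow> f i \<in> polys_over R) \<Longrightarrow> sum f I \<in> polys_over R"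
  by (induction I rule: infinite_finite_induct) auto

lemma polys_over_prod: "(\<And>i. i \<in> I \<Longrightarrow> f i \<in> polys_over R) \<Longrightarrow> prod f I \<in> polys_over R"
  by (induction I rule: infinite_finite_induct) auto

lemma polys_over_coeff [simp]: "p \<in> polys_over R \<Longrightarrow> Polynomial.coeff p i \<in> R"
  by (simp add: polys_over_def)

lemma poly_in_R: "p \<in> polys_over R \<Longrightarrow> x \<in> R \<Longrightarrow> poly p x \<in> R"
  by (auto simp: poly_altdef intro!: R_sum)

section \<open>Stable finite modules and integrality\<close>

definition lspan :: "'a set \<Rightarrow> 'a set"
  where "lspan G = {\<Sum>g\<in>G. c g * g | c. \<forall>g \<in> G. c g \<in> R}"

text \<open>The elements stable on a fixed finite \<open>G\<close> form a ring, and by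
  \<open>stable_imp_integral\<close> all of them are integral if \<open>G\<close> contains 1.
  Enlarging \<open>G\<close> until one more element becomes stable is then all that sums, products
  and transitivity need.\<close>

definition stable :: "'a set \<Rightarrow> 'a \<Rightarrow> bool"
  where "stable G z \<longleftrightarrow> (\<forall>g \<in> G. z * g \<in> lspan G)"

lemma lspan_0: "0 \<in> lspan G"
  unfolding lspan_def by (rule CollectI, rule exI[of _ "\<lambda>_. 0"]) simp

lemma lspan_add: "x \<in> lspan G \<Longrightarrow> y \<in> lspan G \<Longrightarrow> x + y \<in> lspan G"
  unfolding lspan_def
proof clarify
  fix c d assume "\<forall>g\<in>G. c g \<in> R" "\<forall>g\<in>G. d g \<in> R"
  then show "\<exists>e. (\<Sum>g\<in>G. c g * g) + (\<Sum>g\<in>G. d g * g) = (\<Sum>g\<in>G. e g * g) \<and> (\<forall>g\<in>G. e g \<in> R)"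
    by (intro exI[of _ "\<lambda>g. c g + d g"]) (simp add: sum.distrib distrib_right)
qed

lemma lspan_smult: "r \<in> R \<Longrightarrow> x \<in> lspan G \<Longrightarrow> r * x \<in> lspan G"
  unfolding lspan_def
proof clarify
  fix c assume "r \<in> R" "\<forall>g\<in>G. c g \<in> R"
  then show "\<exists>e. r * (\<Sum>g\<in>G. c g * g) = (\<Sum>g\<in>G. e g * g) \<and> (\<forall>g\<in>G. e g \<in> R)"
    by (intro exI[of _ "\<lambda>g. r * c g"]) (simp add: sum_distrib_left mult.assoc)
qed

lemma lspan_sum: "(\<And>i. i \<in> I \<Longrightarrow> f i \<in> lspan G) \<Longrightarrow> sum f I \<in> lspan G"
  by (induction I rule: infinite_finite_induct) (auto simp: lspan_0 lspan_add)

lemma lspan_lincomb: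
  "(\<And>i. i \<in> I \<Longrightarrow> c i \<in> R) \<Longrightarrow> (\<And>i. i \<in> I \<Longrightarrow> f i \<in> lspan G) \<Longrightarrow> (\<Sum>i\<in>I. c i * f i) \<in> lspan G"
  by (simp add: lspan_smult lspan_sum)

lemma lspan_base: "finite G \<Longrightarrow> g \<in> G \<Longrightarrow> g \<in> lspan G"
  unfolding lspan_def
  by (rule CollectI, rule exI[of _ "\<lambda>h. if h = g then 1 else 0"])
     (auto simp: if_distrib[of "\<lambda>c. c * _"] sum.delta cong: if_cong)

lemma stable_lspan:
  assumes "stable G z" "x \<in> lspan G"
  shows "z * x \<in> lspan G"
proof -
  obtain c where c: "x = (\<Sum>g\<in>G. c g * g)" "\<forall>g\<in>G. c g \<in> R"
    using assms(2) by (auto simp: lspan_def)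
  have "z * x = (\<Sum>g\<in>G. c g * (z * g))"
    by (simp add: c sum_distrib_left mult_ac)
  also have "\<dots> \<in> lspan G"
    using assms(1) c by (intro lspan_lincomb) (auto simp: stable_def)
  finally show ?thesis .
qed

lemma stable_add: "stable G z \<Longrightarrow> stable G w \<Longrightarrow> stable G (z + w)"
  by (auto simp: stable_def distrib_right lspan_add)

lemma stable_mult: "stable G z \<Longrightarrow> stable G w \<Longrightarrow> stable G (z * w)"
  using stable_lspan by (auto simp: stable_def mult.assoc)

lemma stable_R: "finite G \<Longrightarrow> r \<in> R \<Longrightarrow> stable G r"
  by (auto simp: stable_def lspan_smult lspan_base)

text \<open>Multiplication by \<open>z\<close> acts on the generators through a matrix over
  \<open>R\<close> that has the vector of the generators as an eigenvector, nonzero because 1 occurs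
  in it. So \<open>z\<close> is a root of the characteristic polynomial, even if the generators
  satisfy relations.\<close>

lemma stable_imp_integral:
  assumes "finite G" "1 \<in> G" "stable G z"
  shows "z \<in> integral_closure R"
proof -
  obtain gs where gs: "set gs = G" "distinct gs"
    using finite_distinct_list[OF assms(1)] by blast
  define n where "n = length gs"
  have "\<exists>c. \<forall>g\<in>G. z * g = (\<Sum>h\<in>G. c g h * h) \<and> (\<forall>h\<in>G. c g h \<in> R)"
    using assms(3) unfolding stable_def lspan_def by (intro bchoice) auto
  then obtain c where c: "\<And>g. g \<in> G \<Longrightarrow> z * g = (\<Sum>h\<in>G. c g h * h)"
      "\<And>g h. g \<in> G \<Longrightarrow> h \<in> G \<Longrightarrow> c g h \<in> R" by blast
  define A where "A = mat n n (\<lambda>(i, j). c (gs ! i) (gs ! j))"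
  define v where "v = vec n (\<lambda>i. gs ! i)"
  have A: "A \<in> carrier_mat n n" by (simp add: A_def)
  have bij: "bij_betw (\<lambda>i. gs ! i) {..<n} G"
    using gs by (auto simp: n_def bij_betw_def inj_on_nth set_conv_nth)
  have "A *\<^sub>v v = z \<cdot>\<^sub>v v"
  proof (rule eq_vecI)
    fix i assume "i < dim_vec (z \<cdot>\<^sub>v v)"
    then have i: "i < n" by (simp add: v_def)
    have "(A *\<^sub>v v) $ i = (\<Sum>j<n. c (gs ! i) (gs ! j) * gs ! j)"
      using i by (simp add: A_def v_def scalar_prod_def atLeast0LessThan)
    also have "\<dots> = (\<Sum>h\<in>G. c (gs ! i) h * h)"
      by (rule sum.reindex_bij_betw[OF bij])
    also have "\<dots> = z * gs ! i"
      using c(1)[of "gs ! i"] i gs by (metis n_def nth_mem)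
    finally show "(A *\<^sub>v v) $ i = (z \<cdot>\<^sub>v v) $ i"
      using i by (simp add: v_def)
  qed (simp add: A_def v_def)
  moreover have "v \<noteq> 0\<^sub>v n"
  proof
    assume v0: "v = 0\<^sub>v n"
    obtain i where i: "i < n" "gs ! i = 1"
      using assms(2) gs by (metis in_set_conv_nth n_def)
    have "v $ i = 0" using v0 i by simp
    then show False using i by (simp add: v_def)
  qed
  ultimately have "eigenvalue A z"
    unfolding eigenvalue_def eigenvector_def using A by (intro exI[of _ v]) (auto simp: v_def)
  then have "poly (char_poly A) z = 0"
    using eigenvalue_root_char_poly[OF A] by simp
  moreover have "Polynomial.lead_coeff (char_poly A) = 1"
    using degree_monic_char_poly[OF A] by simp
  moreover have "char_poly A \<in> polys_over R"
  proof -
    let ?M = "char_poly_matrix A"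
    have M: "?M $$ (i, j) \<in> polys_over R" if "i < n" "j < n" for i j
      using that gs c(2)[of "gs ! i" "gs ! j"] A
      by (auto simp: char_poly_matrix_def A_def n_def)
    have "?M \<in> carrier_mat n n" using A by simp
    then have "char_poly A = (\<Sum>p | p permutes {0..<n}. signof p * (\<Prod>i = 0..<n. ?M $$ (i, p i)))"
      unfolding char_poly_def by (rule det_def')
    also have "\<dots> \<in> polys_over R"
    proof (rule polys_over_sum)
      fix p assume p: "p \<in> {p. p permutes {0..<n}}"
      have "(signof p :: 'a poly) \<in> polys_over R" by (simp add: sign_def)
      moreover have "(\<Prod>i = 0..<n. ?M $$ (i, p i)) \<in> polys_over R"
        using p by (intro polys_over_prod M) (auto simp: permutes_in_image dest: permutes_in_image)
      ultimately show "signof p * (\<Prod>i = 0..<n. ?M $$ (i, p i)) \<in> polys_over R" by simp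
    qed
    finally show ?thesis .
  qed
  ultimately show ?thesis unfolding integral_closure_def by blast
qed

text \<open>The products of \<open>G\<close> with the powers of \<open>z\<close> below the degree of
  \<open>p\<close> suffice: multiplication by \<open>z\<close> raises exponents, and the top power
  is rewritten by the monic equation. The coefficients of \<open>p\<close> are merely stable on
  \<open>G\<close> instead of lying in \<open>R\<close>; this is what makes integrality
  transitive.\<close>

lemma stable_extend:
  assumes "finite G" "1 \<in> G" "\<And>i. stable G (Polynomial.coeff p i)"
    and p: "Polynomial.lead_coeff p = 1" "poly p z = 0"
  obtains G' where "finite G'" "1 \<in> G'" "stable G' z" "\<And>w. stable G w \<Longrightarrow> stable G' w"
proof -
  define n where "n = Polynomial.degree p"
  have n: "n > 0"
  proof (rule ccontr)
    assume "\<not> n > 0"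
    then obtain a where "p = [:a:]" unfolding n_def by (metis degree_eq_zeroE gr0I)
    then show False using p by simp
  qed
  define G' where "G' = (\<lambda>(g, i). g * z ^ i) ` (G \<times> {..<n})"
  have fin: "finite G'" using assms(1) by (simp add: G'_def)
  have one: "1 \<in> G'" unfolding G'_def using assms(2) n
    by (intro image_eqI[of _ _ "(1, 0)"]) auto
  have incl: "x * z ^ i \<in> lspan G'" if x: "x \<in> lspan G" and i: "i < n" for x i
  proof -
    obtain c where c: "x = (\<Sum>g\<in>G. c g * g)" "\<forall>g\<in>G. c g \<in> R"
      using x by (auto simp: lspan_def)
    have "x * z ^ i = (\<Sum>g\<in>G. c g * (g * z ^ i))"
      by (simp add: c sum_distrib_right mult.assoc)
    also have "\<dots> \<in> lspan G'"
      using c i by (intro lspan_lincomb lspan_base[OF fin]) (auto simp: G'_def)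
    finally show ?thesis .
  qed
  have top: "g * z ^ n \<in> lspan G'" if g: "g \<in> G" for g
  proof -
    have "poly p z = (\<Sum>i<n. Polynomial.coeff p i * z ^ i) + z ^ n"
      using p unfolding poly_altdef n_def[symmetric]
      by (simp add: n_def lessThan_Suc_atMost[symmetric])
    then have "z ^ n = - (\<Sum>i<n. Polynomial.coeff p i * z ^ i)"
      using p(2) by (simp add: eq_neg_iff_add_eq_0 add.commute)
    then have "g * z ^ n = (\<Sum>i<n. (-1) * ((Polynomial.coeff p i * g) * z ^ i))"
      by (simp add: sum_distrib_left sum_negf mult_ac)
    also have "\<dots> \<in> lspan G'"
      using assms(3) g by (intro lspan_lincomb incl) (auto simp: stable_def)
    finally show ?thesis .
  qed
  have "stable G' z"
    unfolding stable_def
  proof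
    fix h assume "h \<in> G'"
    then obtain g i where h: "h = g * z ^ i" "g \<in> G" "i < n" by (auto simp: G'_def)
    have "g * z ^ Suc i \<in> lspan G'"
    proof (cases "Suc i = n")
      case True then show ?thesis using top[OF h(2)] by metis
    next
      case False then show ?thesis using h assms(1) by (intro incl lspan_base) auto
    qed
    then show "z * h \<in> lspan G'" by (simp add: h mult_ac)
  qed
  moreover have "stable G' w" if w: "stable G w" for w
    unfolding stable_def
  proof
    fix h assume "h \<in> G'"
    then obtain g i where h: "h = g * z ^ i" "g \<in> G" "i < n" by (auto simp: G'_def)
    have "(w * g) * z ^ i \<in> lspan G'"
      using w h by (intro incl) (auto simp: stable_def)
    then show "w * h \<in> lspan G'" by (simp add: h mult_ac)
  qed
  ultimately show ?thesis using that fin one by blast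
qed

lemma integral_stable:
  assumes "finite G" "1 \<in> G" "z \<in> integral_closure R"
  obtains G' where "finite G'" "1 \<in> G'" "stable G' z" "\<And>w. stable G w \<Longrightarrow> stable G' w"
proof -
  obtain p where p: "p \<in> polys_over R" "Polynomial.lead_coeff p = 1" "poly p z = 0"
    using assms(3) by (auto simp: integral_closure_def)
  show ?thesis
  proof (rule stable_extend[OF assms(1,2) _ p(2,3)])
    show "stable G (Polynomial.coeff p i)" for i
      using p by (intro stable_R assms) auto
  qed (use that in blast)
qed

lemma R_subset_integral_closure: "R \<subseteq> integral_closure R"
proof
  fix r assume r: "r \<in> R"
  then show "r \<in> integral_closure R" unfolding integral_closure_def
    by (intro CollectI bexI[of _ "[:- r, 1:]"]) auto
qed

lemma coeff_ring_integral_closure: "coeff_ring (integral_closure R)"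
proof
  show "0 \<in> integral_closure R" "1 \<in> integral_closure R"
    using R_subset_integral_closure by auto
next
  fix z w assume z: "z \<in> integral_closure R" and w: "w \<in> integral_closure R"
  obtain G where G: "finite G" "1 \<in> G" "stable G z"
    using integral_stable[of "{1}" z] z by (metis finite.emptyI finite_insert insertI1)
  obtain G' where G': "finite G'" "1 \<in> G'" "stable G' w" "\<And>w. stable G w \<Longrightarrow> stable G' w"
    using integral_stable[OF G(1,2) w] by metis
  show "z + w \<in> integral_closure R" "z * w \<in> integral_closure R"
    using stable_imp_integral[OF G'(1,2)] stable_add[OF G'(4)[OF G(3)] G'(3)]
      stable_mult[OF G'(4)[OF G(3)] G'(3)] by auto
next
  fix z assume z: "z \<in> integral_closure R"
  obtain G where G: "finite G" "1 \<in> G" "stable G z"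
    using integral_stable[of "{1}" z] z by (metis finite.emptyI finite_insert insertI1)
  have "stable G ((-1) * z)" by (rule stable_mult[OF stable_R[OF G(1)] G(3)]) simp
  then show "- z \<in> integral_closure R" using stable_imp_integral[OF G(1,2)] by simp
qed

text \<open>A polynomial has finitely many coefficients, so repeated use of
  \<open>integral_stable\<close> yields one finite \<open>G\<close> on which all of them are stable,
  and \<open>stable_extend\<close> adds the root.\<close>

lemma integrally_closed:
  assumes "p \<in> polys_over (integral_closure R)" "Polynomial.lead_coeff p = 1" "poly p z = 0"
  shows "z \<in> integral_closure R"
proof -
  have "\<exists>G. finite G \<and> 1 \<in> G \<and> (\<forall>c\<in>C. stable G c)" if "finite C" "C \<subseteq> integral_closure R" for C
    using that
  proof (induction C)
    case empty then show ?case by (intro exI[of _ "{1}"]) auto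
  next
    case (insert c C)
    then obtain G where G: "finite G" "1 \<in> G" "\<forall>c\<in>C. stable G c" by auto
    obtain G' where "finite G'" "1 \<in> G'" "stable G' c" "\<And>w. stable G w \<Longrightarrow> stable G' w"
      using integral_stable[OF G(1,2)] insert.prems by (metis insert_subset)
    then show ?case using G by blast
  qed
  moreover have "finite (range (Polynomial.coeff p))"
  proof (rule finite_subset)
    show "range (Polynomial.coeff p) \<subseteq> insert 0 (Polynomial.coeff p ` {..Polynomial.degree p})"
    proof
      fix x assume "x \<in> range (Polynomial.coeff p)"
      then obtain i where "x = Polynomial.coeff p i" by blast
      then show "x \<in> insert 0 (Polynomial.coeff p ` {..Polynomial.degree p})"
        by (cases "i \<le> Polynomial.degree p") (auto simp: coeff_eq_0)
    qed
  qed auto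
  moreover have "range (Polynomial.coeff p) \<subseteq> integral_closure R"
    using assms(1) by (auto simp: polys_over_def)
  ultimately obtain G where G: "finite G" "1 \<in> G" "\<And>i. stable G (Polynomial.coeff p i)"
    by (metis rangeI)
  show ?thesis
    by (rule stable_extend[OF G assms(2,3)]) (auto intro: stable_imp_integral)
qed

end

lemma polys_overI: "(\<And>i. Polynomial.coeff p i \<in> R) \<Longrightarrow> p \<in> polys_over R"
  by (simp add: polys_over_def)

lemma polys_over_mono: "p \<in> polys_over R \<Longrightarrow> R \<subseteq> R' \<Longrightarrow> p \<in> polys_over R'"
  by (auto simp: polys_over_def)

section \<open>Normalized valuations\<close>

locale nval =
  fixes v :: "'a::field \<Rightarrow> int"
  assumes nv: "normalized_valuation v"
begin

lemma v_mult: "f \<noteq> 0 \<Longrightarrow> g \<noteq> 0 \<Longrightarrow> v (f * g) = v f + v g"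
  using nv by (auto simp: normalized_valuation_def)

lemma v_add: "f \<noteq> 0 \<Longrightarrow> g \<noteq> 0 \<Longrightarrow> f + g \<noteq> 0 \<Longrightarrow> min (v f) (v g) \<le> v (f + g)"
  using nv by (auto simp: normalized_valuation_def)

lemma v_surj: obtains f where "f \<noteq> 0" "v f = k"
proof -
  have "k \<in> v ` (UNIV - {0})" using nv unfolding normalized_valuation_def by simp
  then show ?thesis using that by auto
qed

lemma v_zero [simp]: "v 0 = 0"
  using nv by (auto simp: normalized_valuation_def)

lemma v_one [simp]: "v 1 = 0"
  using v_mult[of 1 1] by simp

lemma v_inverse: "v (1 / f) = - v f"
proof (cases "f = 0")
  case False then show ?thesis using v_mult[of f "1 / f"] by simp
qed simp

lemma v_divide: "f \<noteq> 0 \<Longrightarrow> g \<noteq> 0 \<Longrightarrow> v (f / g) = v f - v g"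
  using v_mult[of f "1 / g"] by (simp add: v_inverse)

lemma v_uminus [simp]: "v (- f) = v f"
proof (cases "f = 0")
  case False
  have "v ((-1) * (-1)) = v (-1) + v (-1)" by (rule v_mult) auto
  then have "v (-1) = 0" by simp
  then show ?thesis using v_mult[of "-1" f] False by simp
qed simp

lemma v_power: "f \<noteq> 0 \<Longrightarrow> v (f ^ n) = int n * v f"
  by (induction n) (auto simp: v_mult distrib_right)

lemma v_powi: "f \<noteq> 0 \<Longrightarrow> v (f powi k) = k * v f"
  by (cases "k \<ge> 0") (auto simp: power_int_def v_power v_inverse[unfolded divide_inverse, simplified])

lemma v_prod: "finite I \<Longrightarrow> (\<And>i. i \<in> I \<Longrightarrow> f i \<noteq> 0) \<Longrightarrow> v (prod f I) = (\<Sum>i\<in>I. v (f i))"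
  by (induction I rule: finite_induct) (auto simp: v_mult)

text \<open>The powers, also negative ones, of the valuation ideal. Zero is added by hand, since the
  stored value \<open>v 0 = 0\<close> is a convention; sums and products can then be estimated
  without case distinctions.\<close>

definition ball :: "int \<Rightarrow> 'a set" where "ball k = {f. f = 0 \<or> v f \<ge> k}"

lemma ball_0 [simp]: "0 \<in> ball k" by (simp add: ball_def)

lemma ball_add: "f \<in> ball k \<Longrightarrow> g \<in> ball k \<Longrightarrow> f + g \<in> ball k"
  using v_add[of f g] by (fastforce simp: ball_def)

lemma ball_mult: "f \<in> ball k \<Longrightarrow> g \<in> ball l \<Longrightarrow> f * g \<in> ball (k + l)"
  by (auto simp: ball_def v_mult)

lemma ball_uminus: "f \<in> ball k \<Longrightarrow> - f \<in> ball k"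
  by (auto simp: ball_def)

lemma ball_diff: "f \<in> ball k \<Longrightarrow> g \<in> ball k \<Longrightarrow> f - g \<in> ball k"
  using ball_add[of f k "- g"] ball_uminus by simp

lemma ball_sum: "(\<And>i. i \<in> I \<Longrightarrow> f i \<in> ball k) \<Longrightarrow> sum f I \<in> ball k"
  by (induction I rule: infinite_finite_induct) (auto simp: ball_add)

lemma ball_mono: "k \<le> l \<Longrightarrow> f \<in> ball l \<Longrightarrow> f \<in> ball k"
  by (auto simp: ball_def)

lemma ball_1 [simp]: "1 \<in> ball k \<longleftrightarrow> k \<le> 0"
  by (auto simp: ball_def)

lemma valuation_ring_ball: "valuation_ring v = ball 0"
  by (simp add: valuation_ring_def ball_def)

lemma valuation_ideal_ball: "valuation_ideal v = ball 1"
  by (auto simp: valuation_ideal_def ball_def)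

text \<open>If \<open>v (f + g)\<close> exceeded \<open>v f\<close>, then \<open>f\<close>, as the
  difference of \<open>f + g\<close> and \<open>g\<close>, would violate the ultrametric inequality.
  Several independence arguments below rest on such a dominant term.\<close>

lemma v_add_eq: "f \<noteq> 0 \<Longrightarrow> g \<in> ball (v f + 1) \<Longrightarrow> f + g \<noteq> 0 \<and> v (f + g) = v f"
proof -
  assume f: "f \<noteq> 0" and g: "g \<in> ball (v f + 1)"
  show "f + g \<noteq> 0 \<and> v (f + g) = v f"
  proof (cases "g = 0")
    case False
    then have gf: "v g \<ge> v f + 1" using g by (auto simp: ball_def)
    have nz: "f + g \<noteq> 0"
      using gf by (metis add_eq_0_iff v_uminus zle_add1_eq_le less_irrefl)
    have "min (v (f + g)) (v (- g)) \<le> v (f + g + (- g))"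
      using f False nz by (intro v_add) auto
    then have "v (f + g) \<le> v f" using gf by auto
    then show ?thesis using nz v_add[OF f False nz] gf by auto
  qed (use f in auto)
qed

lemma coeff_ring_valuation_ring: "coeff_ring (valuation_ring v)"
  unfolding valuation_ring_ball
  by unfold_locales (use ball_mult[of _ 0 _ 0] in \<open>auto simp: ball_add ball_uminus\<close>)

text \<open>In a monic equation for an element of negative value, the leading power would be the
  unique term of least value and could not be cancelled.\<close>

lemma integral_closure_valuation_ring:
  assumes "p \<in> polys_over (valuation_ring v)" "Polynomial.lead_coeff p = 1" "poly p z = 0"
  shows "z \<in> valuation_ring v"
proof (rule ccontr)
  assume "z \<notin> valuation_ring v"
  then have z: "z \<noteq> 0" "v z \<le> -1" by (auto simp: valuation_ring_def)
  define n where "n = Polynomial.degree p"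
  have "poly p z = (\<Sum>i<n. Polynomial.coeff p i * z ^ i) + z ^ n"
    using assms(2) unfolding poly_altdef n_def[symmetric]
    by (simp add: n_def lessThan_Suc_atMost[symmetric])
  moreover have "(\<Sum>i<n. Polynomial.coeff p i * z ^ i) \<in> ball (v (z ^ n) + 1)"
  proof (rule ball_sum)
    fix i assume i: "i \<in> {..<n}"
    have "Polynomial.coeff p i \<in> ball 0"
      using assms(1) by (auto simp: polys_over_def valuation_ring_ball)
    moreover have "z ^ i \<in> ball (v (z ^ n) + 1)"
    proof -
      have "int n * v z - int i * v z = (int n - int i) * v z" by (simp add: algebra_simps)
      also have "\<dots> \<le> 1 * v z" using i z by (intro mult_right_mono_neg) auto
      finally show ?thesis using z by (auto simp: ball_def v_power)
    qed
    ultimately show "Polynomial.coeff p i * z ^ i \<in> ball (v (z ^ n) + 1)"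
      using ball_mult[of _ 0] by force
  qed
  ultimately show False using v_add_eq[of "z ^ n"] z assms(3) by (metis add.commute power_not_zero)
qed

end

text \<open>Units for \<open>v\<close> are units for \<open>w\<close>, hence \<open>w\<close> is
  \<open>v\<close> times the value under \<open>w\<close> of a uniformizer of \<open>v\<close>;
  surjectivity of \<open>w\<close> and the inclusion force this factor to be 1. So an inclusion of
  discrete valuation rings is an equality.\<close>

lemma valuation_ring_inject:
  assumes "normalized_valuation v" "normalized_valuation w" "valuation_ring v \<subseteq> valuation_ring w"
  shows "v = w"
proof -
  interpret v: nval v by unfold_locales fact
  interpret w: nval w by unfold_locales fact
  have nonneg: "w f \<ge> 0" if "f \<noteq> 0" "v f \<ge> 0" for f
    using assms(3) that by (auto simp: valuation_ring_def)
  have zero: "w f = 0" if "f \<noteq> 0" "v f = 0" for f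
    using nonneg[of f] nonneg[of "1 / f"] that by (auto simp: v.v_inverse w.v_inverse)
  obtain t where t: "t \<noteq> 0" "v t = 1" by (rule v.v_surj)
  have scale: "w f = v f * w t" if f: "f \<noteq> 0" for f
  proof -
    have "v (f / t powi v f) = 0" using f t by (simp add: v.v_divide v.v_powi)
    then have "w (f / t powi v f) = 0" using f t by (intro zero) auto
    then show ?thesis using f t by (simp add: w.v_divide w.v_powi)
  qed
  obtain s where s: "s \<noteq> 0" "w s = 1" by (rule w.v_surj)
  have "w t = 1"
    using scale[OF s(1)] s(2) nonneg[of t] t by (metis zmult_eq_1_iff abs_of_nonneg abs_minus_cancel abs_one zero_le_one mult.commute)
  then show ?thesis
  proof (intro ext)
    fix f show "v f = w f" using scale[of f] \<open>w t = 1\<close> by (cases "f = 0") auto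
  qed
qed

text \<open>\<open>A\<close> is a valuation ring by \<open>tot\<close>, \<open>t\<close> divides all
  its nonunits by \<open>unif\<close>, and by \<open>sep\<close> no nonzero element is divisible by
  all powers of \<open>t\<close>. So every nonzero element of the field is a unit times a unique
  power of \<open>t\<close>, whose exponent is the value.\<close>

lemma discrete_valuation_exists:
  fixes A :: "'a::field set"
  assumes A: "coeff_ring A" and tot: "\<And>z. z \<in> A \<or> 1 / z \<in> A"
    and t: "t \<in> A" "t \<noteq> 0" "1 / t \<notin> A"
    and unif: "\<And>z. z \<in> A \<Longrightarrow> z \<noteq> 0 \<Longrightarrow> 1 / z \<notin> A \<Longrightarrow> z / t \<in> A"
    and sep: "\<And>z. z \<in> A \<Longrightarrow> z \<noteq> 0 \<Longrightarrow> \<exists>k. z / t ^ k \<notin> A"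
  obtains v where "normalized_valuation v" "valuation_ring v = A"
proof -
  interpret coeff_ring A by fact
  define U where "U = {u. u \<noteq> 0 \<and> u \<in> A \<and> 1 / u \<in> A}"
  have U_mult: "u * w \<in> U" if "u \<in> U" "w \<in> U" for u w
    using that R_mult[of "1 / u" "1 / w"] by (auto simp: U_def)
  have U_inv: "1 / u \<in> U" if "u \<in> U" for u
    using that by (auto simp: U_def)
  have tU: "k = 0" if "t powi k \<in> U" for k
  proof (rule ccontr)
    have pos: "t powi k \<notin> U" if "k > 0" for k :: int
    proof
      assume "t powi k \<in> U"
      then have "1 / t powi k \<in> A" by (auto simp: U_def)
      moreover have "t ^ (nat (k - 1)) \<in> A" using t by auto
      ultimately have "t ^ nat (k - 1) * (1 / t powi k) \<in> A" by (rule R_mult[rotated])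
      moreover have "t powi k = t * t ^ (nat (k - 1))"
        using that t by (simp add: power_int_def flip: power_Suc) (metis Suc_nat_eq_nat_zadd1 diff_add_cancel diff_ge_0_iff_ge int_one_le_iff_zero_less add.commute)
      ultimately show False using t by (simp add: divide_simps)
    qed
    assume "k \<noteq> 0"
    then show False using pos[of k] pos[of "- k"] that U_inv[OF that]
      by (cases "k > 0") (auto simp: power_int_minus divide_inverse)
  qed
  have ex0: "\<exists>k. z / t powi k \<in> U" if z: "z \<in> A" "z \<noteq> 0" for z
  proof -
    \<comment> \<open>With \<open>k = Suc j\<close>, the quotient by \<open>t ^ j\<close> is still
      in \<open>A\<close> but no longer divisible by \<open>t\<close> there, so \<open>unif\<close>
      makes it a unit.\<close>
    define k where "k = (LEAST k. z / t ^ k \<notin> A)"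
    have k: "z / t ^ k \<notin> A" unfolding k_def using sep[OF z] by (rule LeastI_ex)
    then obtain j where j: "k = Suc j" using z by (cases k) auto
    have jA: "z / t ^ j \<in> A"
      using not_less_Least[of j "\<lambda>k. z / t ^ k \<notin> A"] j unfolding k_def by auto
    have "1 / (z / t ^ j) \<in> A"
      using unif[OF jA] z t k j by (auto simp: mult.commute)
    then have "z / t powi int j \<in> U" using jA z t by (auto simp: U_def)
    then show ?thesis by blast
  qed
  have ex: "\<exists>k. z / t powi k \<in> U" if z: "z \<noteq> 0" for z
  proof (cases "z \<in> A")
    case False
    then have "1 / z \<in> A" using tot by blast
    then obtain k where "1 / z / t powi k \<in> U" using ex0[of "1 / z"] z by auto
    from U_inv[OF this] have "z / t powi (- k) \<in> U"
      by (simp add: power_int_minus divide_inverse mult.commute)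
    then show ?thesis by blast
  qed (use ex0 z in auto)
  define v where "v z = (if z = 0 then 0 else THE k. z / t powi k \<in> U)" for z
  have vI: "v z = k" if "z \<noteq> 0" "z / t powi k \<in> U" for z k
  proof -
    have "(THE k. z / t powi k \<in> U) = k"
    proof (rule the_equality)
      show "z / t powi k \<in> U" by fact
      fix l assume l: "z / t powi l \<in> U"
      have "(z / t powi l) * (1 / (z / t powi k)) \<in> U"
        by (rule U_mult[OF l U_inv[OF that(2)]])
      also have "(z / t powi l) * (1 / (z / t powi k)) = t powi (k - l)"
        using that(1) t by (simp add: power_int_diff)
      finally show "l = k" using tU by fastforce
    qed
    then show ?thesis using that(1) by (simp add: v_def)
  qed
  have vU: "z / t powi v z \<in> U" if "z \<noteq> 0" for z
    using ex[OF that] vI[OF that] by metis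
  have mult: "v (f * g) = v f + v g" if "f \<noteq> 0" "g \<noteq> 0" for f g
  proof (rule vI)
    show "f * g / t powi (v f + v g) \<in> U"
      using U_mult[OF vU vU, OF that] t by (simp add: power_int_add)
  qed (use that in auto)
  have pow_A: "t powi k \<in> A" if "k \<ge> 0" for k
    using that t by (simp add: power_int_def)
  have nonneg: "v f \<ge> 0 \<longleftrightarrow> f \<in> A" if f: "f \<noteq> 0" for f
  proof
    assume "v f \<ge> 0"
    then have "(f / t powi v f) * t powi v f \<in> A"
      using vU[OF f] pow_A by (intro R_mult) (auto simp: U_def)
    then show "f \<in> A" using t by simp
  next
    assume "f \<in> A"
    show "v f \<ge> 0"
    proof (rule ccontr)
      assume neg: "\<not> v f \<ge> 0"
      have "f * (1 / (f / t powi v f)) \<in> A"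
        using vU[OF f] \<open>f \<in> A\<close> by (intro R_mult) (auto simp: U_def)
      then have 1: "t powi v f \<in> A" using f by simp
      then have "1 / t powi v f \<in> A" using pow_A[of "- v f"] neg
        by (simp add: power_int_minus divide_inverse)
      with 1 have "t powi v f \<in> U" using t by (simp add: U_def)
      then show False using tU neg by fastforce
    qed
  qed
  have inv: "v (1 / f) = - v f" if "f \<noteq> 0" for f
    using mult[of f "1 / f"] that vI[of 1 0] by (simp add: U_def)
  have add: "v f \<le> v (f + g)" if "f \<noteq> 0" "g \<noteq> 0" "f + g \<noteq> 0" "v f \<le> v g" for f g
  proof -
    have "v (g * (1 / f)) \<ge> 0" using mult[of g "1 / f"] inv[of f] that by simp
    then have "1 + g * (1 / f) \<in> A" using nonneg[of "g * (1 / f)"] that by auto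
    moreover have "1 + g * (1 / f) = (f + g) * (1 / f)" using that by (simp add: divide_simps)
    ultimately have "v ((f + g) * (1 / f)) \<ge> 0" using nonneg[of "(f + g) * (1 / f)"] that by auto
    then show ?thesis using mult[of "f + g" "1 / f"] inv[of f] that by simp
  qed
  have "normalized_valuation v"
    unfolding normalized_valuation_def
  proof (intro conjI allI impI)
    show "v 0 = 0" by (simp add: v_def)
    show "v ` (UNIV - {0}) = UNIV"
    proof (intro equalityI subset_UNIV subsetI)
      fix k :: int
      have "v (t powi k) = k" by (rule vI) (use t in \<open>auto simp: U_def\<close>)
      then show "k \<in> v ` (UNIV - {0})" using t by (intro image_eqI[of _ _ "t powi k"]) auto
    qed
    show "v (f * g) = v f + v g" if "f \<noteq> 0" "g \<noteq> 0" for f g by (rule mult[OF that])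
    show "min (v f) (v g) \<le> v (f + g)" if "f \<noteq> 0" "g \<noteq> 0" "f + g \<noteq> 0" for f g
      using add[of f g] add[of g f] that
      by (cases "v f \<le> v g") (auto simp: add.commute min_def)
  qed
  moreover have "valuation_ring v = A"
  proof -
    have "f \<in> valuation_ring v \<longleftrightarrow> f \<in> A" for f
      using nonneg[of f] by (cases "f = 0") (auto simp: valuation_ring_def)
    then show ?thesis by blast
  qed
  ultimately show ?thesis using that by blast
qed

section \<open>Integral closures of Euclidean rings\<close>

text \<open>
  A Euclidean ring \<open>R\<close> in a field such that any \<open>d + 1\<close> elements of the field are linearly
  dependent over \<open>R\<close>. Integral closures of such rings are treated without finiteness of the
  integral closure over \<open>R\<close>, which holds in the separable case only by the trace form.
\<close>

locale euclid_ext = coeff_ring R for R :: "'a::field set" +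
  fixes \<delta> :: "'a \<Rightarrow> nat" and d :: nat
  assumes euclid: "\<And>a b. a \<in> R \<Longrightarrow> b \<in> R \<Longrightarrow> b \<noteq> 0 \<Longrightarrow> \<exists>q \<in> R. a - q * b = 0 \<or> \<delta> (a - q * b) < \<delta> b"
    and \<delta>_mult: "\<And>a b. a \<in> R \<Longrightarrow> b \<in> R \<Longrightarrow> a \<noteq> 0 \<Longrightarrow> b \<noteq> 0 \<Longrightarrow> 1 / b \<notin> R \<Longrightarrow> \<delta> a < \<delta> (a * b)"
    and dep: "\<And>(I :: nat set) g. finite I \<Longrightarrow> card I > d \<Longrightarrow>
      \<exists>c. (\<forall>i\<in>I. c i \<in> R) \<and> (\<exists>i\<in>I. c i \<noteq> 0) \<and> (\<Sum>i\<in>I. c i * g i) = 0"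
begin

abbreviation "Oc \<equiv> integral_closure R"

sublocale O: coeff_ring Oc by (rule coeff_ring_integral_closure)

lemmas R_Oc = subsetD[OF R_subset_integral_closure]

definition is_prime :: "'a set \<Rightarrow> bool"
  where "is_prime M \<longleftrightarrow> M \<subseteq> Oc \<and> 0 \<in> M \<and> M \<noteq> {0} \<and> 1 \<notin> M \<and>
    (\<forall>a\<in>M. \<forall>b\<in>M. a + b \<in> M) \<and> (\<forall>a\<in>Oc. \<forall>b\<in>M. a * b \<in> M) \<and>
    (\<forall>a\<in>Oc. \<forall>b\<in>Oc. a * b \<in> M \<longrightarrow> a \<in> M \<or> b \<in> M)"

lemma annihilator_exists:
  obtains p where "p \<in> polys_over R" "p \<noteq> 0" "poly p z = 0" "Polynomial.degree p \<le> d"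
proof -
  obtain c where c: "\<forall>i\<in>{..d}. c i \<in> R" "\<exists>i\<in>{..d}. c i \<noteq> 0" "(\<Sum>i\<le>d. c i * z ^ i) = 0"
    using dep[of "{..d}" "\<lambda>i. z ^ i"] by auto
  define p where "p = (\<Sum>i\<le>d. Polynomial.monom (c i) i)"
  have coeff: "Polynomial.coeff p i = (if i \<le> d then c i else 0)" for i
    by (simp add: p_def coeff_sum)
  show ?thesis
  proof (rule that)
    show "p \<in> polys_over R" using c(1) coeff by (intro polys_overI) simp
    show "p \<noteq> 0" using c(2) coeff by (metis atMost_iff coeff_0)
    show "poly p z = 0" using c(3) by (simp add: p_def poly_sum poly_monom)
    show "Polynomial.degree p \<le> d" by (rule degree_le) (simp add: coeff)
  qed
qed

text \<open>With \<open>a\<close> the leading coefficient and \<open>n\<close> the degree,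
  multiplying the equation by \<open>a ^ (n - 1)\<close> turns it into a monic one for
  \<open>a * z\<close>, the coefficient of index \<open>i\<close> acquiring the factor
  \<open>a ^ (n - 1 - i)\<close>. As the coefficients lie in \<open>Oc\<close>, transitivity of
  integrality finishes the argument.\<close>

lemma lead_coeff_mult_integral:
  assumes p: "p \<in> polys_over Oc" "p \<noteq> 0" "poly p z = 0"
  shows "Polynomial.lead_coeff p * z \<in> Oc"
proof -
  define n where "n = Polynomial.degree p"
  define a where "a = Polynomial.lead_coeff p"
  have "n \<noteq> 0"
  proof
    assume "n = 0"
    then obtain b where "p = [:b:]" unfolding n_def by (metis degree_eq_zeroE)
    then show False using p by simp
  qed
  define q where "q = (\<Sum>i<n. Polynomial.monom (Polynomial.coeff p i * a ^ (n - 1 - i)) i)"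
  define r where "r = q + Polynomial.monom 1 n"
  have coeff_q: "Polynomial.coeff q i = (if i < n then Polynomial.coeff p i * a ^ (n - 1 - i) else 0)" for i
    by (simp add: q_def coeff_sum)
  have a: "a \<in> Oc" unfolding a_def using p by simp
  have q: "q \<in> polys_over Oc"
    using p(1) a by (intro polys_overI) (simp add: coeff_q)
  have "Polynomial.degree r = n"
  proof (rule antisym)
    show "Polynomial.degree r \<le> n" by (rule degree_le) (simp add: r_def coeff_q)
    show "n \<le> Polynomial.degree r" by (rule le_degree) (simp add: r_def coeff_q)
  qed
  then have "Polynomial.lead_coeff r = 1" by (simp add: r_def coeff_q)
  moreover have "r \<in> polys_over Oc" using q by (simp add: r_def)
  moreover have "poly r (a * z) = 0"
  proof -
    have "poly q (a * z) = (\<Sum>i<n. a ^ (n - 1) * (Polynomial.coeff p i * z ^ i))"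
      unfolding q_def poly_sum poly_monom
    proof (rule sum.cong)
      fix i assume i: "i \<in> {..<n}"
      then have "a ^ (n - 1) = a ^ (n - 1 - i) * a ^ i" by (simp flip: power_add)
      then show "Polynomial.coeff p i * a ^ (n - 1 - i) * (a * z) ^ i = a ^ (n - 1) * (Polynomial.coeff p i * z ^ i)"
        by (simp add: power_mult_distrib)
    qed simp
    also have "\<dots> = a ^ (n - 1) * (\<Sum>i<n. Polynomial.coeff p i * z ^ i)"
      by (simp add: sum_distrib_left)
    finally have "poly r (a * z) = a ^ (n - 1) * (\<Sum>i<n. Polynomial.coeff p i * z ^ i) + (a * z) ^ n"
      by (simp add: r_def poly_monom)
    also have "(a * z) ^ n = a ^ (n - 1) * (a * z ^ n)"
      using \<open>n \<noteq> 0\<close> by (cases n) (auto simp: power_mult_distrib)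
    also have "a ^ (n - 1) * (\<Sum>i<n. Polynomial.coeff p i * z ^ i) + a ^ (n - 1) * (a * z ^ n) = a ^ (n - 1) * poly p z"
      unfolding poly_altdef n_def[symmetric]
      by (simp add: lessThan_Suc_atMost[symmetric] a_def n_def distrib_left)
    finally show ?thesis using p by simp
  qed
  ultimately show ?thesis unfolding a_def by (intro integrally_closed)
qed

lemma fraction_exists:
  obtains a s where "a \<in> Oc" "s \<in> R" "s \<noteq> 0" "z = a / s"
proof -
  obtain p where p: "p \<in> polys_over R" "p \<noteq> 0" "poly p z = 0" by (rule annihilator_exists)
  have "Polynomial.lead_coeff p * z \<in> Oc"
    using p R_subset_integral_closure by (intro lead_coeff_mult_integral) (auto intro: polys_over_mono)
  then show ?thesis
    by (rule that[of _ "Polynomial.lead_coeff p"]) (use p in auto)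
qed

text \<open>The constant coefficient of an equation is a multiple of the root; vanishing ones are
  stripped off first by dividing by \<open>z\<close>. Through such multiples, statements about
  nonzero elements of \<open>R\<close> reach all of \<open>Oc\<close>.\<close>

lemma divides_R:
  assumes "z \<in> Oc" "z \<noteq> 0"
  obtains w where "w \<in> Oc" "z * w \<in> R" "z * w \<noteq> 0"
proof -
  obtain p where p: "p \<in> polys_over R" "p \<noteq> 0" "poly p z = 0" by (rule annihilator_exists)
  then have "\<exists>w\<in>Oc. z * w \<in> R \<and> z * w \<noteq> 0"
  proof (induction p)
    case (pCons a p)
    show ?case
    proof (cases "a = 0")
      case True
      then have "p \<noteq> 0" using pCons.prems by auto
      then show ?thesis using pCons assms(2) True by simp
    next
      case False
      have "poly p z \<in> Oc"
        using pCons.prems R_subset_integral_closure assms by (intro O.poly_in_R) (auto intro: polys_over_mono)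
      moreover have "z * - poly p z = a" using pCons.prems by (simp add: minus_equation_iff add_eq_0_iff2)
      ultimately show ?thesis using False pCons.prems by (intro bexI[of _ "- poly p z"]) auto
    qed
  qed auto
  then show ?thesis using that by blast
qed

end

section \<open>Localization of the integral closure at a prime\<close>

locale euclid_ext_prime = euclid_ext +
  fixes M :: "'a set"
  assumes prime: "is_prime M"
begin

lemma M_Oc: "a \<in> M \<Longrightarrow> a \<in> Oc" and M_0 [simp]: "0 \<in> M" and M_1: "1 \<notin> M"
  and M_add: "a \<in> M \<Longrightarrow> b \<in> M \<Longrightarrow> a + b \<in> M" and M_mult: "a \<in> Oc \<Longrightarrow> b \<in> M \<Longrightarrow> a * b \<in> M"
  and M_prime: "a \<in> Oc \<Longrightarrow> b \<in> Oc \<Longrightarrow> a * b \<in> M \<Longrightarrow> a \<in> M \<or> b \<in> M"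
  using prime by (auto simp: is_prime_def)

lemma M_uminus: "a \<in> M \<Longrightarrow> - a \<in> M"
  using M_mult[of "-1" a] by simp

lemma M_diff: "a \<in> M \<Longrightarrow> b \<in> M \<Longrightarrow> a - b \<in> M"
  using M_add[of a "- b"] M_uminus by simp

lemma generator_exists:
  obtains \<pi> where "\<pi> \<in> R" "\<pi> \<in> M" "\<pi> \<noteq> 0" "\<And>r. r \<in> R \<Longrightarrow> r \<in> M \<Longrightarrow> \<exists>q\<in>R. r = q * \<pi>"
proof -
  obtain m where m: "m \<in> M" "m \<noteq> 0" using prime by (auto simp: is_prime_def)
  obtain w where "w \<in> Oc" "m * w \<in> R" "m * w \<noteq> 0" using divides_R m M_Oc by metis
  then have "\<exists>r. r \<in> R \<and> r \<in> M \<and> r \<noteq> 0" using M_mult[of w m] m by (auto simp: mult.commute)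
  then obtain \<pi> where \<pi>: "\<pi> \<in> R" "\<pi> \<in> M" "\<pi> \<noteq> 0"
    and least: "\<And>r. r \<in> R \<Longrightarrow> r \<in> M \<Longrightarrow> r \<noteq> 0 \<Longrightarrow> \<delta> \<pi> \<le> \<delta> r"
    using exists_least_iff[of "\<lambda>k. \<exists>r. r \<in> R \<and> r \<in> M \<and> r \<noteq> 0 \<and> \<delta> r = k"] by (metis not_le)
  show ?thesis
  proof (rule that[OF \<pi>])
    fix r assume r: "r \<in> R" "r \<in> M"
    obtain q where q: "q \<in> R" "r - q * \<pi> = 0 \<or> \<delta> (r - q * \<pi>) < \<delta> \<pi>"
      using euclid[OF r(1) \<pi>(1,3)] by blast
    have "r - q * \<pi> \<in> M" using r q \<pi> R_Oc by (intro M_diff M_mult) auto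
    then have "r - q * \<pi> = 0" using least[of "r - q * \<pi>"] q r \<pi> by fastforce
    then show "\<exists>q\<in>R. r = q * \<pi>" using q(1) by auto
  qed
qed

definition "gen = (SOME \<pi>. \<pi> \<in> R \<and> \<pi> \<in> M \<and> \<pi> \<noteq> 0 \<and> (\<forall>r. r \<in> R \<longrightarrow> r \<in> M \<longrightarrow> (\<exists>q\<in>R. r = q * \<pi>)))"

lemma gen: "gen \<in> R" "gen \<in> M" "gen \<noteq> 0" "\<And>r. r \<in> R \<Longrightarrow> r \<in> M \<Longrightarrow> \<exists>q\<in>R. r = q * gen"
proof -
  have "\<exists>\<pi>. \<pi> \<in> R \<and> \<pi> \<in> M \<and> \<pi> \<noteq> 0 \<and> (\<forall>r. r \<in> R \<longrightarrow> r \<in> M \<longrightarrow> (\<exists>q\<in>R. r = q * \<pi>))"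
    by (rule generator_exists) blast
  from someI_ex[OF this, folded gen_def]
  show "gen \<in> R" "gen \<in> M" "gen \<noteq> 0" "\<And>r. r \<in> R \<Longrightarrow> r \<in> M \<Longrightarrow> \<exists>q\<in>R. r = q * gen" by auto
qed

text \<open>The generator is not a unit of \<open>R\<close>, as 1 is outside \<open>M\<close>, so
  \<open>\<delta>_mult\<close> applies. The strict decrease of \<open>\<delta>\<close> takes the
  role of unique factorization in \<open>R\<close> in the inductions below.\<close>

lemma gen_descent:
  assumes "r \<in> R" "r \<in> M" "r \<noteq> 0"
  obtains q where "q \<in> R" "r = q * gen" "\<delta> q < \<delta> r"
proof -
  obtain q where q: "q \<in> R" "r = q * gen" using gen(4) assms by blast
  have "1 / gen \<notin> R"
    using M_mult[of "1 / gen" gen] M_1 gen R_Oc by auto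
  then have "\<delta> q < \<delta> r" using \<delta>_mult[of q gen] q assms gen by auto
  then show ?thesis using that q by blast
qed

text \<open>Dividing a relation by the generator as often as possible.\<close>

lemma primitive_dep:
  assumes "finite (I :: nat set)" "card I > d"
  obtains c where "\<forall>i\<in>I. c i \<in> R" "\<exists>i\<in>I. c i \<notin> M" "(\<Sum>i\<in>I. c i * g i) = 0"
proof -
  have *: "\<exists>c. (\<forall>i\<in>I. c i \<in> R) \<and> (\<exists>i\<in>I. c i \<notin> M) \<and> (\<Sum>i\<in>I. c i * g i) = 0"
    if "\<forall>i\<in>I. c i \<in> R" "(\<Sum>i\<in>I. c i * g i) = 0" "j \<in> I" "c j \<noteq> 0" for c j
    using that
  proof (induction "\<delta> (c j)" arbitrary: c rule: less_induct)
    case less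
    show ?case
    proof (cases "\<exists>i\<in>I. c i \<notin> M")
      case True then show ?thesis using less.prems by blast
    next
      case False
      define e where "e i = c i / gen" for i
      have e: "e i \<in> R" if "i \<in> I" for i
        using gen(4)[of "c i"] that False less.prems(1) gen(3) by (auto simp: e_def)
      obtain q where q: "c j = q * gen" "\<delta> q < \<delta> (c j)"
        using gen_descent[of "c j"] False less.prems by blast
      have "(\<Sum>i\<in>I. e i * g i) = (\<Sum>i\<in>I. c i * g i) / gen"
        by (simp add: e_def sum_divide_distrib)
      then show ?thesis
        using less.hyps[of e] e q less.prems gen(3) by (simp add: e_def)
    qed
  qed
  obtain c j where "\<forall>i\<in>I. c i \<in> R" "(\<Sum>i\<in>I. c i * g i) = 0" "j \<in> I" "c j \<noteq> 0"
    using dep[OF assms] by blast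
  from *[OF this] that show ?thesis by blast
qed

definition loc :: "'a set" where "loc = {a / s | a s. a \<in> Oc \<and> s \<in> Oc \<and> s \<notin> M}"

lemma locI: "a \<in> Oc \<Longrightarrow> s \<in> Oc \<Longrightarrow> s \<notin> M \<Longrightarrow> a / s \<in> loc"
  by (auto simp: loc_def)

lemma Oc_loc: "a \<in> Oc \<Longrightarrow> a \<in> loc"
  using locI[of a 1] M_1 by simp

lemma coeff_ring_loc: "coeff_ring loc"
proof
  show "0 \<in> loc" "1 \<in> loc" by (simp_all add: Oc_loc)
  fix x y assume "x \<in> loc" "y \<in> loc"
  then obtain a s b t where *: "x = a / s" "a \<in> Oc" "s \<in> Oc" "s \<notin> M" "y = b / t" "b \<in> Oc" "t \<in> Oc" "t \<notin> M"
    by (auto simp: loc_def)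
  then have st: "s * t \<notin> M" "s * t \<in> Oc" "s \<noteq> 0" "t \<noteq> 0" using M_prime by auto
  have "x + y = (a * t + b * s) / (s * t)" "x * y = (a * b) / (s * t)"
    using st * by (auto simp: field_simps)
  then show "x + y \<in> loc" "x * y \<in> loc" using * st by (auto intro!: locI)
next
  fix x assume "x \<in> loc"
  then obtain a s where *: "x = a / s" "a \<in> Oc" "s \<in> Oc" "s \<notin> M" by (auto simp: loc_def)
  then show "- x \<in> loc" using locI[of "- a" s] by simp
qed

sublocale L: coeff_ring loc by (rule coeff_ring_loc)

lemma loc_inverse_iff: "z \<in> Oc \<Longrightarrow> z \<noteq> 0 \<Longrightarrow> 1 / z \<in> loc \<longleftrightarrow> z \<notin> M"
proof
  assume z: "z \<in> Oc" "z \<noteq> 0" and "1 / z \<in> loc"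
  then obtain a s where *: "1 / z = a / s" "a \<in> Oc" "s \<in> Oc" "s \<notin> M" by (auto simp: loc_def)
  then have "s = a * z" using z by (auto simp: field_simps split: if_splits)
  then show "z \<notin> M" using M_mult * by metis
qed (auto intro: locI)

text \<open>Induction on the degree, with \<open>a\<close> the leading coefficient;
  \<open>a * z\<close> is integral. If \<open>a\<close> is outside \<open>M\<close>, then
  \<open>z\<close> is the fraction of \<open>a * z\<close> by \<open>a\<close>. Otherwise the two
  top terms are merged into one, its coefficient increased by \<open>a * z\<close>, which lowers the
  degree. Should this leave no coefficient outside \<open>M\<close>, then \<open>a * z\<close> is
  outside \<open>M\<close>, and \<open>1 / z = a / (a * z)\<close>.\<close>

lemma prufer_aux:
  assumes "p \<in> polys_over Oc" "poly p z = 0" "Polynomial.coeff p i \<notin> M"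
  shows "z \<in> loc \<or> 1 / z \<in> loc"
  using assms
proof (induction "Polynomial.degree p" arbitrary: p i rule: less_induct)
  case less
  define n where "n = Polynomial.degree p"
  define a where "a = Polynomial.lead_coeff p"
  have p0: "p \<noteq> 0" using less.prems by auto
  have n: "n \<noteq> 0"
  proof
    assume "n = 0"
    then obtain b where "p = [:b:]" unfolding n_def by (metis degree_eq_zeroE)
    then show False using less.prems p0 by simp
  qed
  have a: "a \<in> Oc" using less.prems by (simp add: a_def)
  have az: "a * z \<in> Oc" unfolding a_def by (rule lead_coeff_mult_integral) (use less.prems p0 in auto)
  show ?case
  proof (cases "a \<in> M")
    case False
    then have "a * z / a \<in> loc" using az a by (intro locI)
    then show ?thesis using p0 by (simp add: a_def)
  next
    case True
    define q where "q = p - Polynomial.monom a n + Polynomial.monom (a * z) (n - 1)"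
    have coeff_q: "Polynomial.coeff q j = (if j = n - 1 then Polynomial.coeff p j + a * z else
        if j = n then 0 else Polynomial.coeff p j)" for j
      using n by (auto simp: q_def a_def n_def)
    have deg: "Polynomial.degree q < n"
    proof -
      have "Polynomial.degree q \<le> n - 1"
        by (rule degree_le) (use n in \<open>auto simp: coeff_q n_def coeff_eq_0\<close>)
      then show ?thesis using n by simp
    qed
    have q: "q \<in> polys_over Oc" using less.prems a az by (simp add: q_def)
    have "a * z * z ^ (n - 1) = a * z ^ n" using n by (cases n) auto
    then have qz: "poly q z = 0" using less.prems by (simp add: q_def poly_monom)
    show ?thesis
    proof (cases "\<exists>j. Polynomial.coeff q j \<notin> M")
      case True
      then show ?thesis using less.hyps[OF _ q qz] deg by (auto simp: n_def)
    next
      case False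
      \<comment> \<open>Besides the leading coefficient, which is in \<open>M\<close>, only the one
        of index \<open>n - 1\<close> was changed, so the one outside \<open>M\<close> must have
        been there.\<close>
      have "i = n - 1"
      proof (rule ccontr)
        assume "i \<noteq> n - 1"
        have "Polynomial.coeff q i \<in> M" using False by blast
        then have "i = n" using \<open>i \<noteq> n - 1\<close> less.prems(3) coeff_q[of i] by (cases "i = n") auto
        then show False using less.prems(3) True by (simp add: a_def n_def)
      qed
      have "Polynomial.coeff p i + a * z \<in> M" using False coeff_q[of i] \<open>i = n - 1\<close> by metis
      then have "a * z \<notin> M" using M_diff[of "Polynomial.coeff p i + a * z" "a * z"] less.prems(3) by auto
      then have "a / (a * z) \<in> loc" using a az by (intro locI)
      then show ?thesis using p0 by (simp add: a_def)
    qed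
  qed
qed

lemma loc_total: "z \<in> loc \<or> 1 / z \<in> loc"
proof -
  obtain c where c: "\<forall>i\<in>{..d}. c i \<in> R" "\<exists>i\<in>{..d}. c i \<notin> M" "(\<Sum>i\<le>d. c i * z ^ i) = 0"
    by (rule primitive_dep[of "{..d}" "\<lambda>i. z ^ i"]) auto
  define p where "p = (\<Sum>i\<le>d. Polynomial.monom (c i) i)"
  have coeff: "Polynomial.coeff p i = (if i \<le> d then c i else 0)" for i
    by (simp add: p_def coeff_sum)
  obtain i where "i \<le> d" "c i \<notin> M" using c by auto
  show ?thesis
  proof (rule prufer_aux[of p z i])
    show "p \<in> polys_over Oc" using c(1) R_Oc by (intro polys_overI) (simp add: coeff)
    show "poly p z = 0" using c(3) by (simp add: p_def poly_sum poly_monom)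
  qed (use \<open>i \<le> d\<close> \<open>c i \<notin> M\<close> in \<open>simp add: coeff\<close>)
qed

text \<open>The nonunits of \<open>loc\<close>. They form its maximal ideal, closed under sums
  because of two nonzero elements one divides the other by \<open>loc_total\<close>.\<close>

definition PP :: "'a set" where "PP = {z \<in> loc. z = 0 \<or> 1 / z \<notin> loc}"

lemma PP_0: "0 \<in> PP" by (simp add: PP_def)

lemma PP_loc: "z \<in> PP \<Longrightarrow> z \<in> loc"
  by (simp add: PP_def)

lemma PP_mult: "z \<in> loc \<Longrightarrow> w \<in> PP \<Longrightarrow> z * w \<in> PP"
proof -
  assume z: "z \<in> loc" and w: "w \<in> PP"
  have "1 / w \<in> loc" if "z \<noteq> 0" "1 / (z * w) \<in> loc"
    using L.R_mult[OF z that(2)] that(1) by simp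
  then show ?thesis using z w by (auto simp: PP_def)
qed

lemma PP_add: "z \<in> PP \<Longrightarrow> w \<in> PP \<Longrightarrow> z + w \<in> PP"
proof -
  have *: "z + w \<in> PP" if z: "z \<in> PP" and w: "w \<in> PP" "z \<noteq> 0" and q: "w / z \<in> loc" for z w
  proof -
    have "(1 + w / z) * z \<in> PP" using q z by (intro PP_mult) auto
    then show ?thesis using w(2) by (simp add: distrib_right)
  qed
  assume z: "z \<in> PP" and w: "w \<in> PP"
  show ?thesis
  proof (cases "z = 0 \<or> w = 0")
    case False
    then show ?thesis using *[OF z w] *[OF w z] loc_total[of "w / z"] by (auto simp: add.commute)
  qed (use z w in auto)
qed

lemma PP_sum: "(\<And>i. i \<in> I \<Longrightarrow> f i \<in> PP) \<Longrightarrow> sum f I \<in> PP"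
  by (induction I rule: infinite_finite_induct) (auto intro: PP_add PP_0)

lemma PP_uminus: "z \<in> PP \<Longrightarrow> - z \<in> PP"
  using PP_mult[of "-1" z] by simp

lemma M_PP: "z \<in> M \<Longrightarrow> z \<in> PP"
  using loc_inverse_iff[of z] M_Oc Oc_loc by (auto simp: PP_def)

lemma R_PP: "z \<in> R \<Longrightarrow> z \<in> PP \<Longrightarrow> z \<in> M"
  using loc_inverse_iff[of z] R_Oc M_0 by (cases "z = 0") (auto simp: PP_def)

lemma not_loc: "z \<notin> loc \<Longrightarrow> 1 / z \<in> PP"
  using loc_total[of z] by (auto simp: PP_def)

text \<open>
  The elements of such a chain would be linearly independent modulo the prime element of \<open>R\<close>
  below \<open>M\<close>, since they have different values smaller than the value of that element.
\<close>

lemma chain_bound: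
  assumes g: "\<And>i. i \<le> d \<Longrightarrow> g i \<in> loc" "\<And>i. i \<le> d \<Longrightarrow> g i \<noteq> 0" "\<And>i. i \<le> d \<Longrightarrow> gen / g i \<in> PP"
    and chain: "\<And>i j. i < j \<Longrightarrow> j \<le> d \<Longrightarrow> g j / g i \<in> PP"
  shows False
proof -
  obtain c where c: "\<forall>i\<in>{..d}. c i \<in> R" "\<exists>i\<in>{..d}. c i \<notin> M" "(\<Sum>i\<le>d. c i * g i) = 0"
    by (rule primitive_dep[of "{..d}" g]) auto
  define k where "k = (LEAST i. i \<le> d \<and> c i \<notin> M)"
  have k: "k \<le> d" "c k \<notin> M"
    using LeastI_ex[of "\<lambda>i. i \<le> d \<and> c i \<notin> M"] c(2) unfolding k_def by auto
  have small: "c i \<in> M" if "i < k" for i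
    using not_less_Least[of i "\<lambda>i. i \<le> d \<and> c i \<notin> M"] that k unfolding k_def[symmetric] by auto
  \<comment> \<open>After division by \<open>g k\<close>, the earlier terms contain the factor
    \<open>gen / g k\<close> and the later ones the factor \<open>g i / g k\<close>, all in
    \<open>PP\<close>. So \<open>c k\<close> is in \<open>PP\<close> too, against its choice outside
    \<open>M\<close>.\<close>
  have "(\<Sum>i\<in>{..d}-{k}. c i * (g i / g k)) \<in> PP"
  proof (rule PP_sum)
    fix i assume i: "i \<in> {..d} - {k}"
    show "c i * (g i / g k) \<in> PP"
    proof (cases "i < k")
      case True
      then obtain q where q: "q \<in> R" "c i = q * gen" using gen(4) small c(1) i by (metis DiffD1)
      have "(q * g i) * (gen / g k) \<in> PP"
        using Oc_loc[OF R_Oc[OF q(1)]] i g k by (intro PP_mult L.R_mult) auto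
      then show ?thesis using q by (simp add: mult_ac)
    next
      case False
      then show ?thesis using chain[of k i] i c(1) R_Oc by (intro PP_mult Oc_loc) auto
    qed
  qed
  moreover have "(\<Sum>i\<in>{..d}-{k}. c i * (g i / g k)) + c k = (\<Sum>i\<le>d. c i * g i) / g k"
    using k g(2)[of k] by (simp add: sum.remove[of "{..d}" k] sum_divide_distrib add_divide_distrib)
  ultimately have "- c k \<in> PP" using c(3) by (metis add_eq_0_iff2 div_0)
  then have "c k \<in> PP" using PP_uminus by fastforce
  then show False using R_PP k c(1) by auto
qed

text \<open>Otherwise every nonzero nonunit can be divided by another one with a nonunit quotient.
  Starting from \<open>gen\<close> this gives arbitrarily long chains of proper divisors, contrary
  to \<open>chain_bound\<close>.\<close>

lemma uniformizer_exists:
  obtains t where "t \<in> PP" "t \<noteq> 0" "\<And>s. s \<in> PP \<Longrightarrow> s / t \<in> loc"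
proof -
  have "\<exists>t\<in>PP. t \<noteq> 0 \<and> (\<forall>s\<in>PP. s / t \<in> loc)"
  proof (rule ccontr)
    assume neg: "\<not> ?thesis"
    have step: "\<exists>s. (s \<in> PP \<and> s \<noteq> 0) \<and> t / s \<in> PP" if t: "t \<in> PP \<and> t \<noteq> 0" for t
    proof -
      obtain s where s: "s \<in> PP" "s / t \<notin> loc" using neg t by blast
      then have "t / s \<in> PP" using not_loc[of "s / t"] by simp
      then show ?thesis using s by (intro exI[of _ s]) (auto simp: PP_def)
    qed
    have "\<exists>h. \<forall>n. (h n \<in> PP \<and> h n \<noteq> 0) \<and> (n = 0 \<longrightarrow> h n = gen) \<and> h n / h (Suc n) \<in> PP"
      using dependent_nat_choice[of "\<lambda>n t. (t \<in> PP \<and> t \<noteq> 0) \<and> (n = 0 \<longrightarrow> t = gen)" "\<lambda>n t s. t / s \<in> PP"]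
        step gen M_PP by simp
    then obtain h where h: "\<And>n. h n \<in> PP" "\<And>n. h n \<noteq> 0" "h 0 = gen" "\<And>n. h n / h (Suc n) \<in> PP"
      by metis
    have chain: "h i / h j \<in> PP" if "i < j" for i j
      using that
    proof (induction j)
      case (Suc j)
      show ?case
      proof (cases "i = j")
        case False
        then have "h i / h j \<in> PP" using Suc by auto
        then have "(h i / h j) * (h j / h (Suc j)) \<in> PP" using h(4) by (intro PP_mult PP_loc)
        then show ?thesis using h(2) by simp
      qed (use h in auto)
    qed auto
    \<comment> \<open>The chain is read backwards, since \<open>chain_bound\<close> wants each
      element to divide the later ones. The indices \<open>Suc d - i\<close> are at least 1 and so
      avoid \<open>h 0 = gen\<close> itself.\<close>
    show False
    proof (rule chain_bound[of "\<lambda>i. h (Suc d - i)"])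
      fix i assume "i \<le> d"
      then have "h 0 / h (Suc d - i) \<in> PP" by (intro chain) auto
      then show "gen / h (Suc d - i) \<in> PP" using h by simp
    next
      fix i j assume "i < j" "j \<le> d"
      then show "h (Suc d - j) / h (Suc d - i) \<in> PP" by (intro chain) auto
    qed (use h PP_loc in auto)
  qed
  then show ?thesis using that by blast
qed

text \<open>\<open>t\<close> cannot divide \<open>gen\<close> infinitely often, because its powers
  would violate \<open>chain_bound\<close>. The descent by \<open>gen\<close> extends this to
  \<open>R\<close>, and multiples in \<open>R\<close> extend it to \<open>loc\<close>.\<close>

lemma separated:
  assumes t: "t \<in> PP" "t \<noteq> 0" and z: "z \<in> loc" "z \<noteq> 0"
  obtains k where "z / t ^ k \<notin> loc"
proof -
  have down: "y / t ^ j \<in> loc" if "y / t ^ k \<in> loc" "j \<le> k" for y j k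
  proof -
    have "(y / t ^ k) * t ^ (k - j) \<in> loc" using that t PP_loc by (intro L.R_mult L.R_power) auto
    moreover have "t ^ k = t ^ (k - j) * t ^ j" using that by (simp flip: power_add)
    ultimately show ?thesis using t by simp
  qed
  have "\<exists>k. gen / t ^ k \<notin> loc"
  proof (rule ccontr)
    assume "\<not> ?thesis"
    then have all: "gen / t ^ k \<in> loc" for k by blast
    show False
    proof (rule chain_bound[of "\<lambda>i. t ^ i"])
      fix i assume "i \<le> d"
      have "(gen / t ^ Suc i) * t \<in> PP" by (rule PP_mult[OF all t(1)])
      then show "gen / t ^ i \<in> PP" using t by (simp add: field_simps)
    next
      fix i j :: nat assume ij: "i < j"
      have "t ^ (j - Suc i) * t \<in> PP" using t PP_loc by (intro PP_mult L.R_power) auto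
      moreover have "t ^ (j - Suc i) * t = t ^ j / t ^ i"
        using ij t by (simp add: power_diff flip: power_Suc2)
      ultimately show "t ^ j / t ^ i \<in> PP" by simp
    qed (use t PP_loc in auto)
  qed
  then obtain k0 where k0: "gen / t ^ k0 \<notin> loc" by blast
  have R: "\<exists>k. N / t ^ k \<notin> loc" if "N \<in> R" "N \<noteq> 0" for N
    using that
  proof (induction "\<delta> N" arbitrary: N rule: less_induct)
    case less
    show ?case
    proof (cases "N \<in> M")
      case False
      have "N / t ^ 1 \<notin> loc"
      proof
        assume "N / t ^ 1 \<in> loc"
        then have "N / t * (1 / N) \<in> loc"
          using False loc_inverse_iff[of N] less.prems R_Oc by (intro L.R_mult) auto
        then show False using t less.prems by (simp add: PP_def)
      qed
      then show ?thesis by blast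
    next
      case True
      then obtain q where q: "q \<in> R" "N = q * gen" "\<delta> q < \<delta> N" using gen_descent less.prems by blast
      then obtain k where k: "q / t ^ k \<notin> loc" using less by fastforce
      have "N / t ^ (k + k0) \<notin> loc"
      proof
        assume "N / t ^ (k + k0) \<in> loc"
        moreover have "1 / (gen / t ^ k0) \<in> loc" using loc_total k0 by blast
        ultimately have "N / t ^ (k + k0) * (1 / (gen / t ^ k0)) \<in> loc" by (rule L.R_mult)
        then show False using k q gen t by (simp add: power_add field_simps)
      qed
      then show ?thesis by blast
    qed
  qed
  obtain a s where as: "z = a / s" "a \<in> Oc" "s \<in> Oc" "s \<notin> M" using z by (auto simp: loc_def)
  obtain w where w: "w \<in> Oc" "a * w \<in> R" "a * w \<noteq> 0" using divides_R[of a] as z by auto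
  obtain k where k: "(a * w) / t ^ k \<notin> loc" using R[OF w(2,3)] by blast
  have "z / t ^ k \<notin> loc"
  proof
    assume "z / t ^ k \<in> loc"
    then have "z / t ^ k * (s * w) \<in> loc" using Oc_loc[OF as(3)] Oc_loc[OF w(1)] by (intro L.R_mult) auto
    moreover have "s \<noteq> 0" using as by auto
    ultimately show False using k as by (simp add: mult_ac)
  qed
  then show ?thesis using that by blast
qed

lemma valuation_exists:
  obtains v where "normalized_valuation v" "valuation_ring v = loc" "valuation_ideal v \<inter> Oc = M"
proof -
  obtain t where t: "t \<in> PP" "t \<noteq> 0" "\<And>s. s \<in> PP \<Longrightarrow> s / t \<in> loc" using uniformizer_exists by metis
  obtain v where v: "normalized_valuation v" "valuation_ring v = loc"
  proof (rule discrete_valuation_exists[OF coeff_ring_loc loc_total, of t])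
    show "t \<in> loc" "t \<noteq> 0" "1 / t \<notin> loc" using t by (auto simp: PP_def)
    show "z / t \<in> loc" if "z \<in> loc" "z \<noteq> 0" "1 / z \<notin> loc" for z
      using t(3) that by (auto simp: PP_def)
    show "\<exists>k. z / t ^ k \<notin> loc" if "z \<in> loc" "z \<noteq> 0" for z
      using separated[OF t(1,2) that] by metis
  qed
  interpret nval v by unfold_locales (rule v)
  have "z \<in> valuation_ideal v \<longleftrightarrow> z \<in> M" if z: "z \<in> Oc" for z
  proof (cases "z = 0")
    case False
    have "v z > 0 \<longleftrightarrow> 1 / z \<notin> valuation_ring v"
      using False by (auto simp: valuation_ring_def v_inverse)
    also have "\<dots> \<longleftrightarrow> z \<in> M" using v(2) loc_inverse_iff[OF z False] by simp
    finally show ?thesis using False by (simp add: valuation_ideal_def)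
  qed (simp add: valuation_ideal_def)
  then have "valuation_ideal v \<inter> Oc = M" using M_Oc by auto
  then show ?thesis using that v by blast
qed

end

section \<open>Places of an integral closure\<close>

lemma KR_simps [simp]: "monoid.mult KR = (*)" "ring.add KR = (+)" "monoid.one KR = 1" "ring.zero KR = 0" "carrier KR = UNIV"
  by (auto simp: ring_of_type_algebra_def)

context euclid_ext
begin

text \<open>The nonzero primes of \<open>Oc\<close> in the form of valuations:
  \<open>center_prime\<close> and \<open>prime_VV\<close> pass between both, and
  \<open>VV_fraction\<close> recovers the valuation ring as a localization.\<close>

definition VV :: "('a \<Rightarrow> int) set"
  where "VV = {v. normalized_valuation v \<and> (\<forall>z\<in>R. z \<noteq> 0 \<longrightarrow> 0 \<le> v z)}"

lemma VV_nval: "v \<in> VV \<Longrightarrow> nval v"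
  by (simp add: VV_def nval_def)

lemma VV_ring: "v \<in> VV \<Longrightarrow> Oc \<subseteq> valuation_ring v"
proof
  fix z assume v: "v \<in> VV" and z: "z \<in> Oc"
  interpret nval v by (rule VV_nval[OF v])
  obtain p where p: "p \<in> polys_over R" "Polynomial.lead_coeff p = 1" "poly p z = 0"
    using z by (auto simp: integral_closure_def)
  have "R \<subseteq> valuation_ring v" using v by (auto simp: VV_def valuation_ring_def)
  then show "z \<in> valuation_ring v"
    using p by (intro integral_closure_valuation_ring[of p]) (auto intro: polys_over_mono)
qed

lemma VV_nonneg: "v \<in> VV \<Longrightarrow> z \<in> Oc \<Longrightarrow> 0 \<le> v z"
  using VV_ring[of v] nval.v_zero[OF VV_nval, of v] by (cases "z = 0") (auto simp: valuation_ring_def)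

lemma center_prime: "v \<in> VV \<Longrightarrow> is_prime (valuation_ideal v \<inter> Oc)"
proof -
  assume v: "v \<in> VV"
  interpret nval v by (rule VV_nval[OF v])
  obtain f where f: "f \<noteq> 0" "v f = 1" by (rule v_surj)
  obtain a s where as: "a \<in> Oc" "s \<in> R" "s \<noteq> 0" "f = a / s" by (rule fraction_exists)
  have "v a > 0" using as f v_divide[of a s] VV_nonneg[OF v R_Oc[OF as(2)]] by auto
  then have "valuation_ideal v \<inter> Oc \<noteq> {0}" using as f by (auto simp: valuation_ideal_def)
  moreover have "a * b \<in> ball 1" if "a \<in> Oc" "b \<in> ball 1" for a b
    using ball_mult[of a 0 b 1] that VV_ring[OF v] by (auto simp: valuation_ring_ball)
  moreover have "a \<in> ball 1 \<or> b \<in> ball 1" if "a \<in> Oc" "b \<in> Oc" "a * b \<in> ball 1" for a b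
    using that VV_nonneg[OF v that(1)] VV_nonneg[OF v that(2)] by (auto simp: ball_def v_mult)
  ultimately show ?thesis
    unfolding is_prime_def by (auto simp: valuation_ideal_ball ball_add)
qed

lemma VV_prime: "v \<in> VV \<Longrightarrow> euclid_ext_prime R \<delta> d (valuation_ideal v \<inter> Oc)"
  by unfold_locales (rule center_prime)

lemma prime_VV:
  assumes "is_prime M"
  obtains v where "v \<in> VV" "valuation_ideal v \<inter> Oc = M"
proof -
  interpret euclid_ext_prime R \<delta> d M by unfold_locales fact
  obtain v where v: "normalized_valuation v" "valuation_ring v = loc" "valuation_ideal v \<inter> Oc = M"
    by (rule valuation_exists)
  have "R \<subseteq> valuation_ring v" using v(2) Oc_loc R_subset_integral_closure by blast
  then have "v \<in> VV" using v(1) by (auto simp: VV_def valuation_ring_def)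
  then show ?thesis using that v by blast
qed

text \<open>The localization at the center lies inside the valuation ring of \<open>v\<close> and is
  itself a discrete valuation ring, so the two coincide by
  \<open>valuation_ring_inject\<close>.\<close>

lemma VV_fraction:
  assumes v: "v \<in> VV" and f: "f \<in> valuation_ring v"
  obtains a s where "a \<in> Oc" "s \<in> Oc" "s \<noteq> 0" "v s = 0" "f = a / s"
proof -
  interpret nval v by (rule VV_nval[OF v])
  interpret euclid_ext_prime R \<delta> d "valuation_ideal v \<inter> Oc" by (rule VV_prime[OF v])
  have s0: "s \<noteq> 0 \<and> v s = 0" if "s \<in> Oc" "s \<notin> valuation_ideal v \<inter> Oc" for s
    using that VV_nonneg[OF v that(1)] by (auto simp: valuation_ideal_def)
  obtain w where w: "normalized_valuation w" "valuation_ring w = loc"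
    by (rule valuation_exists)
  have "loc \<subseteq> valuation_ring v"
  proof
    fix z assume "z \<in> loc"
    then obtain a s where "z = a / s" "a \<in> Oc" "s \<in> Oc" "s \<notin> valuation_ideal v \<inter> Oc"
      by (auto simp: loc_def)
    then show "z \<in> valuation_ring v"
      using s0[of s] VV_nonneg[OF v, of a] by (auto simp: valuation_ring_def v_divide)
  qed
  then have "w = v" using valuation_ring_inject[OF w(1) nv] w(2) by simp
  then have "f \<in> loc" using f w by simp
  then obtain a s where "f = a / s" "a \<in> Oc" "s \<in> Oc" "s \<notin> valuation_ideal v \<inter> Oc"
    by (auto simp: loc_def)
  then show ?thesis using s0[of s] that by blast
qed

text \<open>Some element has a pole at \<open>v\<close> but none at \<open>w\<close>; its
  denominator, chosen as a unit at \<open>w\<close>, has positive value at \<open>v\<close>.\<close>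

lemma VV_separate:
  assumes v: "v \<in> VV" and w: "w \<in> VV" and "v \<noteq> w"
  obtains f where "f \<in> Oc" "f \<noteq> 0" "v f > 0" "w f = 0"
proof -
  interpret v: nval v by (rule VV_nval[OF v])
  interpret w: nval w by (rule VV_nval[OF w])
  have "\<not> valuation_ring w \<subseteq> valuation_ring v"
    using valuation_ring_inject[OF w.nv v.nv] assms(3) by auto
  then obtain g where "g \<in> valuation_ring w" "g \<notin> valuation_ring v" by blast
  then have g: "g \<in> valuation_ring w" "g \<noteq> 0" "v g < 0" by (auto simp: valuation_ring_def)
  obtain a s where as: "a \<in> Oc" "s \<in> Oc" "s \<noteq> 0" "w s = 0" "g = a / s" by (rule VV_fraction[OF w g(1)])
  have "v s > 0" using as g v.v_divide[of a s] VV_nonneg[OF v as(1)] by auto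
  then show ?thesis using that as by blast
qed

lemma VV_separate_finite:
  assumes F: "finite F" "F \<subseteq> VV" and w: "w \<in> VV" "w \<notin> F"
  obtains f where "f \<in> Oc" "f \<noteq> 0" "w f = 0" "\<And>v. v \<in> F \<Longrightarrow> v f \<ge> k"
proof -
  interpret w: nval w by (rule VV_nval[OF w(1)])
  have "\<forall>v\<in>F. \<exists>f. f \<in> Oc \<and> f \<noteq> 0 \<and> v f > 0 \<and> w f = 0"
    using VV_separate F w by (metis subsetD)
  then obtain f where f: "\<And>v. v \<in> F \<Longrightarrow> f v \<in> Oc \<and> f v \<noteq> 0 \<and> v (f v) > 0 \<and> w (f v) = 0"
    by metis
  define g where "g = (\<Prod>v\<in>F. f v ^ nat k)"
  have "w g = 0" unfolding g_def using f by (subst w.v_prod[OF F(1)]) (auto simp: w.v_power)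
  moreover have "u g \<ge> k" if u: "u \<in> F" for u
  proof -
    interpret u: nval u by (rule VV_nval) (use u F in auto)
    have "u g = (\<Sum>v\<in>F. u (f v ^ nat k))"
      unfolding g_def using f by (subst u.v_prod[OF F(1)]) auto
    also have "\<dots> \<ge> u (f u ^ nat k)"
    proof (rule member_le_sum[OF u _ F(1)])
      fix v assume "v \<in> F - {u}"
      then show "0 \<le> u (f v ^ nat k)" using f u F by (intro VV_nonneg) auto
    qed
    also have "u (f u ^ nat k) = int (nat k) * u (f u)" using f[OF u] by (simp add: u.v_power)
    moreover have "int (nat k) * 1 \<le> int (nat k) * u (f u)"
      using f[OF u] by (intro mult_left_mono) auto
    ultimately show ?thesis by linarith
  qed
  moreover have "g \<in> Oc" "g \<noteq> 0" using f F by (auto simp: g_def intro!: O.R_prod)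
  ultimately show ?thesis using that by blast
qed

section \<open>Proper ideals and the finiteness of supports\<close>

definition is_ideal :: "'a set \<Rightarrow> bool"
  where "is_ideal I \<longleftrightarrow> 0 \<in> I \<and> (\<forall>a\<in>I. \<forall>b\<in>I. a + b \<in> I) \<and> (\<forall>a\<in>Oc. \<forall>b\<in>I. a * b \<in> I)"

text \<open>Zorn's lemma supplies a maximal ideal above \<open>I\<close>, as no chain condition has
  been established. A maximal ideal is prime, hence the center of a valuation.\<close>

lemma proper_ideal_VV:
  assumes I: "is_ideal I" "I \<subseteq> Oc" "I \<noteq> {0}" "1 \<notin> I"
  obtains v where "v \<in> VV" "I \<subseteq> valuation_ideal v"
proof -
  define \<A> where "\<A> = {J. is_ideal J \<and> J \<subseteq> Oc \<and> I \<subseteq> J \<and> 1 \<notin> J}"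
  have "\<exists>M\<in>\<A>. \<forall>J\<in>\<A>. M \<subseteq> J \<longrightarrow> J = M"
  proof (rule subset_Zorn_nonempty)
    show "\<A> \<noteq> {}" using I by (auto simp: \<A>_def)
  next
    fix \<C> assume ne: "\<C> \<noteq> {}" and ch: "subset.chain \<A> \<C>"
    have sub: "\<And>J. J \<in> \<C> \<Longrightarrow> J \<in> \<A>" and tot: "\<And>J L. J \<in> \<C> \<Longrightarrow> L \<in> \<C> \<Longrightarrow> J \<subseteq> L \<or> L \<subseteq> J"
      using ch by (auto simp: subset_chain_def)
    have "is_ideal (\<Union>\<C>)"
      unfolding is_ideal_def
    proof (intro conjI ballI)
      show "0 \<in> \<Union>\<C>" using ne sub by (auto simp: \<A>_def is_ideal_def)
      fix a b assume "a \<in> \<Union>\<C>" "b \<in> \<Union>\<C>"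
      then obtain J L where "a \<in> J" "J \<in> \<C>" "b \<in> L" "L \<in> \<C>" by blast
      then obtain J where J: "J \<in> \<C>" "a \<in> J" "b \<in> J" using tot by blast
      then have "a + b \<in> J" using sub[of J] by (simp add: \<A>_def is_ideal_def)
      then show "a + b \<in> \<Union>\<C>" using J by blast
    next
      fix a b assume a: "a \<in> Oc" "b \<in> \<Union>\<C>"
      then obtain J where J: "J \<in> \<C>" "b \<in> J" by blast
      then have "a * b \<in> J" using sub[of J] a by (simp add: \<A>_def is_ideal_def)
      then show "a * b \<in> \<Union>\<C>" using J by blast
    qed
    then show "\<Union>\<C> \<in> \<A>" using ne sub by (auto simp: \<A>_def)
  qed
  then obtain M where M: "is_ideal M" "M \<subseteq> Oc" "I \<subseteq> M" "1 \<notin> M"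
    and max: "\<And>J. is_ideal J \<Longrightarrow> J \<subseteq> Oc \<Longrightarrow> 1 \<notin> J \<Longrightarrow> M \<subseteq> J \<Longrightarrow> J = M"
    by (auto simp: \<A>_def)
  have "is_prime M"
    unfolding is_prime_def
  proof (intro conjI ballI impI)
    show "M \<noteq> {0}" using M(3) I(3) I(1) by (auto simp: is_ideal_def)
    fix a b assume ab: "a \<in> Oc" "b \<in> Oc" "a * b \<in> M"
    show "a \<in> M \<or> b \<in> M"
    proof (rule ccontr)
      assume neg: "\<not> ?thesis"
      define J where "J = {m + c * a | m c. m \<in> M \<and> c \<in> Oc}"
      have M_J: "M \<subseteq> J"
      proof
        fix m assume "m \<in> M"
        then show "m \<in> J" unfolding J_def by (intro CollectI exI[of _ m] exI[of _ 0]) auto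
      qed
      have "a \<in> J" unfolding J_def using M
        by (intro CollectI exI[of _ 0] exI[of _ 1]) (auto simp: is_ideal_def)
      moreover have "is_ideal J"
        unfolding is_ideal_def
      proof (intro conjI ballI)
        show "0 \<in> J" using M_J M(1) by (auto simp: is_ideal_def)
      next
        fix x y assume "x \<in> J" "y \<in> J"
        then obtain m c n e where "x = m + c * a" "y = n + e * a" "m \<in> M" "n \<in> M" "c \<in> Oc" "e \<in> Oc"
          by (auto simp: J_def)
        then show "x + y \<in> J" unfolding J_def using M(1)
          by (intro CollectI exI[of _ "m + n"] exI[of _ "c + e"]) (auto simp: is_ideal_def distrib_right)
      next
        fix x y assume "x \<in> Oc" "y \<in> J"
        then obtain m c where "y = m + c * a" "m \<in> M" "c \<in> Oc" "x \<in> Oc" by (auto simp: J_def)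
        then show "x * y \<in> J" unfolding J_def using M(1)
          by (intro CollectI exI[of _ "x * m"] exI[of _ "x * c"]) (auto simp: is_ideal_def distrib_left)
      qed
      moreover have "J \<subseteq> Oc" using M(2) ab by (auto simp: J_def)
      ultimately have "1 \<in> J" using max[of J] M_J neg by blast
      then obtain m c where mc: "1 = m + c * a" "m \<in> M" "c \<in> Oc" by (auto simp: J_def)
      have "b = b * m + c * (a * b)" using arg_cong[OF mc(1), of "\<lambda>x. b * x"] by (simp add: algebra_simps)
      also have "\<dots> \<in> M" using M(1) mc ab by (auto simp: is_ideal_def)
      finally show False using neg by blast
    qed
  qed (use M in \<open>auto simp: is_ideal_def\<close>)
  then obtain v where "v \<in> VV" "valuation_ideal v \<inter> Oc = M" by (rule prime_VV)
  then show ?thesis using that M by blast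
qed

text \<open>All places where \<open>gen\<close> vanishes induce the same prime of \<open>R\<close>.
  For finitely many of them, elements that are units at one place and vanish at the others admit no
  relation over \<open>R\<close> with a coefficient outside that prime, so there are at most
  \<open>d\<close> such places.\<close>

lemma finite_VV_gen:
  assumes v0: "v0 \<in> VV"
  shows "finite {v \<in> VV. v (euclid_ext_prime.gen R (valuation_ideal v0 \<inter> Oc)) > 0}"
proof -
  interpret p: euclid_ext_prime R \<delta> d "valuation_ideal v0 \<inter> Oc" by (rule VV_prime[OF v0])
  \<comment> \<open>If \<open>q.gen\<close>, the generator below \<open>v\<close>, were outside the
    prime of \<open>v0\<close>, then \<open>p.gen = a * q.gen\<close> would put \<open>a\<close>
    into that prime and make \<open>q.gen\<close> a unit of \<open>R\<close>.\<close>
  have mem: "r \<in> valuation_ideal v0 \<inter> Oc" if v: "v \<in> VV" "v p.gen > 0" and r: "r \<in> R" "v r > 0" for v r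
  proof -
    interpret q: euclid_ext_prime R \<delta> d "valuation_ideal v \<inter> Oc" by (rule VV_prime[OF v(1)])
    have "p.gen \<in> valuation_ideal v \<inter> Oc" "r \<in> valuation_ideal v \<inter> Oc"
      using v r p.gen R_Oc by (auto simp: valuation_ideal_def)
    then obtain a b where ab: "a \<in> R" "p.gen = a * q.gen" "b \<in> R" "r = b * q.gen"
      using q.gen(4) p.gen(1) r(1) by metis
    have "q.gen \<in> valuation_ideal v0 \<inter> Oc"
    proof (rule ccontr)
      assume "\<not> ?thesis"
      then have "a \<in> valuation_ideal v0 \<inter> Oc"
        using p.M_prime[of a q.gen] p.gen(2) ab q.gen(1) R_Oc by metis
      then obtain c where c: "c \<in> R" "a = c * p.gen" using p.gen(4) ab by metis
      then have "1 = c * q.gen" using ab p.gen(3) by (simp add: mult_ac)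
      then show False using q.M_mult[of c q.gen] q.M_1 q.gen(2) R_Oc c(1) by metis
    qed
    then show ?thesis using p.M_mult[of b q.gen] ab R_Oc by metis
  qed
  have "card F \<le> d" if F: "F \<subseteq> {v \<in> VV. v p.gen > 0}" "finite F" for F
  proof (rule ccontr)
    assume "\<not> card F \<le> d"
    define m where "m = card F"
    obtain e where e: "bij_betw e {..<m} F"
      using ex_bij_betw_nat_finite[OF F(2)] by (auto simp: m_def atLeast0LessThan)
    have eF: "e i \<in> F" if "i < m" for i using e that by (auto simp: bij_betw_def)
    have "\<forall>i\<in>{..<m}. \<exists>f. f \<in> Oc \<and> f \<noteq> 0 \<and> e i f = 0 \<and> (\<forall>v\<in>F-{e i}. v f \<ge> 1)"
    proof
      fix i assume i: "i \<in> {..<m}"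
      show "\<exists>f. f \<in> Oc \<and> f \<noteq> 0 \<and> e i f = 0 \<and> (\<forall>v\<in>F-{e i}. v f \<ge> 1)"
        by (rule VV_separate_finite[of "F - {e i}" "e i" 1]) (use F eF i in auto)
    qed
    then obtain g where g: "\<And>i. i < m \<Longrightarrow> g i \<in> Oc" "\<And>i. i < m \<Longrightarrow> g i \<noteq> 0" "\<And>i. i < m \<Longrightarrow> e i (g i) = 0"
        "\<And>i v. i < m \<Longrightarrow> v \<in> F - {e i} \<Longrightarrow> v (g i) \<ge> 1"
      unfolding bchoice_iff by auto
    obtain c where c: "\<forall>i\<in>{..<m}. c i \<in> R" "\<exists>i\<in>{..<m}. c i \<notin> valuation_ideal v0 \<inter> Oc" "(\<Sum>i<m. c i * g i) = 0"
      using p.primitive_dep[of "{..<m}" g] \<open>\<not> card F \<le> d\<close> by (auto simp: m_def)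
    then obtain k where k: "k < m" "c k \<notin> valuation_ideal v0 \<inter> Oc" by auto
    have ek: "e k \<in> VV" "e k p.gen > 0" using eF[OF k(1)] F by auto
    interpret v: nval "e k" by (rule VV_nval[OF ek(1)])
    have "\<not> e k (c k) > 0" using mem[OF ek, of "c k"] k c(1) by auto
    moreover have "0 \<le> e k (c k)" using k c(1) R_Oc by (intro VV_nonneg[OF ek(1)]) auto
    moreover have "c k \<noteq> 0" using k by (auto simp: valuation_ideal_def)
    ultimately have ck: "c k \<noteq> 0" "e k (c k) = 0" by auto
    have "(\<Sum>i\<in>{..<m}-{k}. c i * g i) \<in> v.ball (e k (c k * g k) + 1)"
    proof (rule v.ball_sum)
      fix i assume i: "i \<in> {..<m} - {k}"
      have "e k \<noteq> e i" using i k e unfolding bij_betw_def by (metis DiffE inj_on_def lessThan_iff singletonI)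
      then have "e k (g i) \<ge> 1" using g(4)[of i "e k"] i eF[OF k(1)] by auto
      moreover have "c i \<in> v.ball 0"
        using c(1) i R_Oc VV_ring[OF ek(1)] by (auto simp: v.valuation_ring_ball)
      ultimately have "c i * g i \<in> v.ball (0 + 1)" by (intro v.ball_mult) (auto simp: v.ball_def)
      then show "c i * g i \<in> v.ball (e k (c k * g k) + 1)"
        using ck g k by (simp add: v.v_mult)
    qed
    then have "c k * g k + (\<Sum>i\<in>{..<m}-{k}. c i * g i) \<noteq> 0"
      using v.v_add_eq[of "c k * g k"] ck g(2) k by auto
    then show False using c(3) k by (simp add: sum.remove[of "{..<m}" k])
  qed
  then show ?thesis by (meson finite_if_finite_subsets_card_bdd)
qed

text \<open>The descent by generators reduces elements of \<open>R\<close> to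
  \<open>finite_VV_gen\<close>; multiples in \<open>R\<close> treat \<open>Oc\<close>, and quotients
  the rest of the field.\<close>

lemma finite_VV_support: "finite {v \<in> VV. v f \<noteq> 0}"
proof (cases "f = 0")
  case True
  then show ?thesis using VV_nval nval.v_zero by (metis (mono_tags, lifting) empty_Collect_eq finite.emptyI)
next
  case False
  have R: "finite {v \<in> VV. v N > 0}" if "N \<in> R" "N \<noteq> 0" for N
    using that
  proof (induction "\<delta> N" arbitrary: N rule: less_induct)
    case less
    show ?case
    proof (cases "{v \<in> VV. v N > 0} = {}")
      case False
      then obtain v0 where v0: "v0 \<in> VV" "v0 N > 0" by auto
      interpret p: euclid_ext_prime R \<delta> d "valuation_ideal v0 \<inter> Oc" by (rule VV_prime[OF v0(1)])
      obtain q where q: "q \<in> R" "N = q * p.gen" "\<delta> q < \<delta> N"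
        using p.gen_descent[of N] v0 less.prems R_Oc by (auto simp: valuation_ideal_def)
      have "{v \<in> VV. v N > 0} \<subseteq> {v \<in> VV. v q > 0} \<union> {v \<in> VV. v p.gen > 0}"
        using q less.prems p.gen(3) by (auto simp: nval.v_mult[OF VV_nval])
      moreover have "finite {v \<in> VV. v q > 0}" using less q by force
      ultimately show ?thesis using finite_VV_gen[OF v0(1)] finite_subset by blast
    qed (metis finite.emptyI)
  qed
  have Oc: "finite {v \<in> VV. v a > 0}" if a: "a \<in> Oc" "a \<noteq> 0" for a
  proof -
    obtain w where w: "w \<in> Oc" "a * w \<in> R" "a * w \<noteq> 0" by (rule divides_R[OF a])
    have "{v \<in> VV. v a > 0} \<subseteq> {v \<in> VV. v (a * w) > 0}"
      using a w VV_nonneg by (auto simp: nval.v_mult[OF VV_nval]) (metis add_pos_nonneg)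
    then show ?thesis using R[OF w(2,3)] finite_subset by blast
  qed
  obtain a s where as: "a \<in> Oc" "s \<in> R" "s \<noteq> 0" "f = a / s" by (rule fraction_exists)
  have "{v \<in> VV. v f \<noteq> 0} \<subseteq> {v \<in> VV. v a > 0} \<union> {v \<in> VV. v s > 0}"
  proof
    fix v assume v: "v \<in> {v \<in> VV. v f \<noteq> 0}"
    then have "v f = v a - v s" using as False by (auto simp: nval.v_divide[OF VV_nval])
    then show "v \<in> {v \<in> VV. v a > 0} \<union> {v \<in> VV. v s > 0}"
      using v VV_nonneg[of v a] VV_nonneg[of v s] as R_Oc by auto
  qed
  then show ?thesis using Oc[of a] Oc[of s] as False R_Oc by (auto intro: finite_subset)
qed

section \<open>Fractional ideals of an integral closure\<close>

definition fideal :: "'a set \<Rightarrow> bool"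
  where "fideal b \<longleftrightarrow> is_ideal b \<and> b \<noteq> {0} \<and> (\<exists>c \<in> Oc - {0}. \<forall>f \<in> b. c * f \<in> Oc)"

text \<open>The exponent of \<open>v\<close> in the factorization of \<open>b\<close>. It determines
  \<open>b\<close> by \<open>fideal_inject\<close> and is additive by \<open>vmin_prod\<close>, so
  identities between ideals reduce to identities between integers.\<close>

definition vmin :: "'a set \<Rightarrow> ('a \<Rightarrow> int) \<Rightarrow> int"
  where "vmin b v = (THE k. (\<exists>f\<in>b. f \<noteq> 0 \<and> v f = k) \<and> (\<forall>f\<in>b. f \<noteq> 0 \<longrightarrow> k \<le> v f))"

lemma vminI: "f \<in> b \<Longrightarrow> f \<noteq> 0 \<Longrightarrow> v f = k \<Longrightarrow> (\<And>g. g \<in> b \<Longrightarrow> g \<noteq> 0 \<Longrightarrow> k \<le> v g) \<Longrightarrow> vmin b v = k"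
  unfolding vmin_def by (rule the_equality) (auto intro: antisym)

lemma fideal_nonzero: "fideal b \<Longrightarrow> \<exists>f\<in>b. f \<noteq> 0"
  by (auto simp: fideal_def is_ideal_def)

lemma vmin_ex:
  assumes b: "fideal b" and v: "v \<in> VV"
  shows "\<exists>f\<in>b. f \<noteq> 0 \<and> v f = vmin b v" and "\<And>f. f \<in> b \<Longrightarrow> f \<noteq> 0 \<Longrightarrow> vmin b v \<le> v f"
proof -
  interpret nval v by (rule VV_nval[OF v])
  obtain c where c: "c \<in> Oc" "c \<noteq> 0" "\<And>f. f \<in> b \<Longrightarrow> c * f \<in> Oc" using b by (auto simp: fideal_def)
  have bd: "v f \<ge> - v c" if "f \<in> b" "f \<noteq> 0" for f
    using VV_nonneg[OF v c(3)[OF that(1)]] c(2) that by (simp add: v_mult)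
  obtain f0 where f0: "f0 \<in> b" "f0 \<noteq> 0" using fideal_nonzero[OF b] by blast
  obtain f where f: "f \<in> b \<and> f \<noteq> 0" "\<And>g. g \<in> b \<and> g \<noteq> 0 \<Longrightarrow> nat (v f + v c) \<le> nat (v g + v c)"
    using ex_has_least_nat[of "\<lambda>f. f \<in> b \<and> f \<noteq> 0" f0 "\<lambda>f. nat (v f + v c)"] f0 by blast
  have le: "v f \<le> v g" if "g \<in> b" "g \<noteq> 0" for g
    using f(2)[of g] that bd[of f] bd[of g] f(1) by (simp add: nat_le_eq_zle)
  have "vmin b v = v f" by (rule vminI[of f]) (use f le in auto)
  then show "\<exists>f\<in>b. f \<noteq> 0 \<and> v f = vmin b v" "\<And>f. f \<in> b \<Longrightarrow> f \<noteq> 0 \<Longrightarrow> vmin b v \<le> v f"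
    using f le by auto
qed

text \<open>The elements of \<open>Oc\<close> that multiply \<open>f\<close> into \<open>b\<close>
  form an ideal. If it were proper, it would lie in the center of some \<open>v\<close>; but
  dividing \<open>f\<close> by an element of \<open>b\<close> of least value at \<open>v\<close>
  gives a fraction whose denominator is a unit at \<open>v\<close> and belongs to that
  ideal.\<close>

lemma fideal_eq:
  assumes b: "fideal b"
  shows "b = {f. f = 0 \<or> (\<forall>v\<in>VV. vmin b v \<le> v f)}"
proof (intro equalityI subsetI)
  fix f assume "f \<in> {f. f = 0 \<or> (\<forall>v\<in>VV. vmin b v \<le> v f)}"
  then have f: "f = 0 \<or> (\<forall>v\<in>VV. vmin b v \<le> v f)" by simp
  have bI: "is_ideal b" using b by (simp add: fideal_def)
  show "f \<in> b"
  proof (cases "f = 0")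
    case True then show ?thesis using bI by (simp add: is_ideal_def)
  next
    case False
    define I where "I = {a \<in> Oc. a * f \<in> b}"
    have I: "is_ideal I"
      using bI by (auto simp: I_def is_ideal_def distrib_right mult.assoc)
    obtain g where g: "g \<in> b" "g \<noteq> 0" using fideal_nonzero[OF b] by blast
    obtain a s where as: "a \<in> Oc" "s \<in> R" "s \<noteq> 0" "f / g = a / s" by (rule fraction_exists)
    have "s * f = a * g" using as g by (simp add: field_simps)
    then have "s \<in> I" using as g bI R_Oc by (auto simp: I_def is_ideal_def)
    then have "I \<noteq> {0}" using as by auto
    show ?thesis
    proof (rule ccontr)
      assume "f \<notin> b"
      then have "1 \<notin> I" by (simp add: I_def)
      then obtain v where v: "v \<in> VV" "I \<subseteq> valuation_ideal v"
        using proper_ideal_VV[OF I _ \<open>I \<noteq> {0}\<close>] by (auto simp: I_def)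
      interpret nval v by (rule VV_nval[OF v(1)])
      obtain g where g: "g \<in> b" "g \<noteq> 0" "v g = vmin b v" using vmin_ex(1)[OF b v(1)] by blast
      have "f / g \<in> valuation_ring v"
        using f False v(1) g by (auto simp: valuation_ring_def v_divide)
      then obtain a s where as: "a \<in> Oc" "s \<in> Oc" "s \<noteq> 0" "v s = 0" "f / g = a / s"
        by (rule VV_fraction[OF v(1)])
      have "s * f = a * g" using as g by (simp add: field_simps)
      then have "s \<in> I" using as g bI by (auto simp: I_def is_ideal_def)
      then show False using v(2) as by (auto simp: valuation_ideal_def)
    qed
  qed
qed (use vmin_ex(2)[OF b] in auto)

lemma fideal_inject:
  assumes "fideal b" "fideal b'" "\<And>v. v \<in> VV \<Longrightarrow> vmin b v = vmin b' v"
  shows "b = b'"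
  using fideal_eq[OF assms(1)] fideal_eq[OF assms(2)] assms(3) by auto

lemma finite_vmin: "fideal b \<Longrightarrow> finite {v \<in> VV. vmin b v \<noteq> 0}"
proof -
  assume b: "fideal b"
  obtain f where f: "f \<in> b" "f \<noteq> 0" using fideal_nonzero[OF b] by blast
  obtain c where c: "c \<in> Oc" "c \<noteq> 0" "\<And>f. f \<in> b \<Longrightarrow> c * f \<in> Oc" using b by (auto simp: fideal_def)
  have "{v \<in> VV. vmin b v \<noteq> 0} \<subseteq> {v \<in> VV. v f \<noteq> 0} \<union> {v \<in> VV. v c \<noteq> 0}"
  proof
    fix v assume v: "v \<in> {v \<in> VV. vmin b v \<noteq> 0}"
    then interpret nval v using VV_nval by auto
    obtain g where g: "g \<in> b" "g \<noteq> 0" "v g = vmin b v" using vmin_ex(1)[OF b] v by blast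
    have "v c + v g \<ge> 0" using VV_nonneg[of v "c * g"] c g v v_mult[of c g] by auto
    then show "v \<in> {v \<in> VV. v f \<noteq> 0} \<union> {v \<in> VV. v c \<noteq> 0}"
      using vmin_ex(2)[OF b _ f] v g by force
  qed
  then show ?thesis using finite_VV_support finite_subset by blast
qed

lemma fideal_Oc: "fideal Oc"
proof -
  have "1 \<in> Oc" "(1::'a) \<noteq> 0" by simp_all
  then have "Oc \<noteq> {0}" by blast
  then show ?thesis by (auto simp: fideal_def is_ideal_def intro!: bexI[of _ 1])
qed

lemma vmin_Oc: "v \<in> VV \<Longrightarrow> vmin Oc v = 0"
  by (rule vminI[of 1]) (auto simp: VV_nonneg nval.v_one[OF VV_nval])

lemma Oc_eq: "Oc = {f. f = 0 \<or> (\<forall>v\<in>VV. 0 \<le> v f)}"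
  using fideal_eq[OF fideal_Oc] vmin_Oc by auto

section \<open>Ideals with prescribed exponents\<close>

definition idl :: "(('a \<Rightarrow> int) \<Rightarrow> int) \<Rightarrow> 'a set"
  where "idl e = {f. f = 0 \<or> (\<forall>v\<in>VV. e v \<le> v f)}"

lemma is_ideal_idl: "is_ideal (idl e)"
  unfolding is_ideal_def
proof (intro conjI ballI)
  fix a b assume ab: "a \<in> idl e" "b \<in> idl e"
  show "a + b \<in> idl e"
  proof (cases "a = 0 \<or> b = 0 \<or> a + b = 0")
    case False
    have "e v \<le> v (a + b)" if "v \<in> VV" for v
      using nval.v_add[OF VV_nval[OF that], of a b] ab that False unfolding idl_def by fastforce
    then show ?thesis by (simp add: idl_def)
  qed (use ab in \<open>auto simp: idl_def\<close>)
next
  fix a b assume ab: "a \<in> Oc" "b \<in> idl e"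
  show "a * b \<in> idl e"
  proof (cases "a = 0 \<or> b = 0")
    case False
    have "e v \<le> v (a * b)" if "v \<in> VV" for v
      using nval.v_mult[OF VV_nval[OF that], of a b] ab that False VV_nonneg[OF that ab(1)]
      unfolding idl_def by fastforce
    then show ?thesis by (simp add: idl_def)
  qed (auto simp: idl_def)
qed (simp add: idl_def)

text \<open>Start from an element with the right value at \<open>v0\<close>. It falls short of
  \<open>e\<close> at finitely many other places only, and an integral factor that is a unit at
  \<open>v0\<close> and has large values there repairs this.\<close>

lemma idl_attained:
  assumes e: "finite {v \<in> VV. e v \<noteq> 0}" and v0: "v0 \<in> VV"
  obtains h where "h \<in> idl e" "h \<noteq> 0" "v0 h = e v0"
proof -
  interpret v0: nval v0 by (rule VV_nval[OF v0])
  obtain g where g: "g \<noteq> 0" "v0 g = e v0" by (rule v0.v_surj)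
  define B where "B = {w \<in> VV. w g < e w}"
  have "B \<subseteq> {v \<in> VV. e v \<noteq> 0} \<union> {v \<in> VV. v g \<noteq> 0}" by (auto simp: B_def)
  then have B: "finite B" "B \<subseteq> VV" "v0 \<notin> B"
    using e finite_VV_support g by (auto simp: B_def intro: finite_subset)
  obtain f where f: "f \<in> Oc" "f \<noteq> 0" "v0 f = 0" "\<And>v. v \<in> B \<Longrightarrow> v f \<ge> Max (insert 0 ((\<lambda>w. e w - w g) ` B))"
    by (rule VV_separate_finite[OF B(1,2) v0 B(3), of "Max (insert 0 ((\<lambda>w. e w - w g) ` B))"]) blast
  have "e v \<le> v (f * g)" if v: "v \<in> VV" for v
  proof -
    have "v (f * g) = v f + v g" using f g by (simp add: nval.v_mult[OF VV_nval[OF v]])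
    moreover have "e v - v g \<le> v f" if "v \<in> B"
      using f(4)[OF that] B(1) that by (meson Max_ge finite_imageI finite_insert image_eqI insertI2 order_trans)
    ultimately show ?thesis using VV_nonneg[OF v f(1)] v by (cases "v \<in> B") (auto simp: B_def)
  qed
  moreover have "v0 (f * g) = e v0" using f g by (simp add: v0.v_mult)
  ultimately show ?thesis using that[of "f * g"] f g by (simp add: idl_def)
qed

lemma idl_nonzero:
  assumes "finite {v \<in> VV. e v \<noteq> 0}"
  obtains h where "h \<in> idl e" "h \<noteq> 0"
proof (cases "VV = {}")
  case True
  then show ?thesis using that[of 1] by (simp add: idl_def)
qed (use idl_attained[OF assms] that in blast)

lemma fideal_idl:
  assumes "finite {v \<in> VV. e v \<noteq> 0}"
  shows "fideal (idl e)"
proof -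
  obtain h where h: "h \<in> idl e" "h \<noteq> 0" by (rule idl_nonzero[OF assms])
  \<comment> \<open>An element of the ideal with these exponents is integral and cancels all poles
    allowed by \<open>e\<close>; it serves as the common denominator.\<close>
  have "finite {v \<in> VV. max 0 (- e v) \<noteq> 0}"
    using assms by (rule finite_subset[rotated]) auto
  then obtain c where c: "c \<in> idl (\<lambda>v. max 0 (- e v))" "c \<noteq> 0" by (rule idl_nonzero)
  have cv: "v c \<ge> 0" "v c \<ge> - e v" if "v \<in> VV" for v using c that by (auto simp: idl_def)
  have "c \<in> Oc" using cv(1) by (subst Oc_eq) auto
  moreover have "c * f \<in> Oc" if "f \<in> idl e" for f
    using cv(2) that c(2) by (subst Oc_eq) (force simp: idl_def nval.v_mult[OF VV_nval])
  ultimately show ?thesis using is_ideal_idl h c unfolding fideal_def by blast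
qed

lemma vmin_idl:
  assumes "finite {v \<in> VV. e v \<noteq> 0}" "v \<in> VV"
  shows "vmin (idl e) v = e v"
proof -
  obtain h where "h \<in> idl e" "h \<noteq> 0" "v h = e v" by (rule idl_attained[OF assms])
  then show ?thesis using assms(2) by (intro vminI[of h]) (auto simp: idl_def)
qed

section \<open>Scaling and multiplication of fractional ideals\<close>

lemma fideal_scale: "fideal b \<Longrightarrow> h \<noteq> 0 \<Longrightarrow> fideal (scale_ideal h b)"
proof -
  assume b: "fideal b" and h: "h \<noteq> 0"
  obtain c where c: "c \<in> Oc" "c \<noteq> 0" "\<And>f. f \<in> b \<Longrightarrow> c * f \<in> Oc" using b by (auto simp: fideal_def)
  obtain a s where as: "a \<in> Oc" "s \<in> R" "s \<noteq> 0" "h = a / s" by (rule fraction_exists)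
  have ideal: "is_ideal (scale_ideal h b)"
    unfolding is_ideal_def scale_ideal_def
  proof (intro conjI ballI)
    show "0 \<in> (*) h ` b" using b by (intro image_eqI[of _ _ 0]) (auto simp: fideal_def is_ideal_def)
    show "x + y \<in> (*) h ` b" if "x \<in> (*) h ` b" "y \<in> (*) h ` b" for x y
      using that b by (auto simp: fideal_def is_ideal_def simp flip: distrib_left)
    show "x * y \<in> (*) h ` b" if "x \<in> Oc" "y \<in> (*) h ` b" for x y
      using that b by (auto simp: fideal_def is_ideal_def mult.left_commute[of x])
  qed
  moreover obtain f where "f \<in> b" "f \<noteq> 0" using fideal_nonzero[OF b] by blast
  then have "h * f \<in> scale_ideal h b" "h * f \<noteq> 0" using h by (auto simp: scale_ideal_def)
  moreover have "(c * s) * f \<in> Oc" if f: "f \<in> scale_ideal h b" for f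
  proof -
    obtain g where g: "g \<in> b" "f = h * g" using f unfolding scale_ideal_def by blast
    then have "(c * s) * f = a * (c * g)" using as by simp
    also have "\<dots> \<in> Oc" using O.R_mult[OF as(1) c(3)[OF g(1)]] .
    finally show ?thesis .
  qed
  ultimately show ?thesis
    unfolding fideal_def using c as R_Oc by (auto intro!: bexI[of _ "c * s"])
qed

lemma vmin_scale: "fideal b \<Longrightarrow> h \<noteq> 0 \<Longrightarrow> v \<in> VV \<Longrightarrow> vmin (scale_ideal h b) v = v h + vmin b v"
proof -
  assume b: "fideal b" and h: "h \<noteq> 0" and v: "v \<in> VV"
  obtain f where "f \<in> b" "f \<noteq> 0" "v f = vmin b v" using vmin_ex(1)[OF b v] by blast
  then show ?thesis using h vmin_ex(2)[OF b v]
    by (intro vminI[of "h * f"]) (auto simp: scale_ideal_def nval.v_mult[OF VV_nval[OF v]])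
qed

lemma ideal_prod_VV:
  assumes "fideal b" "fideal b'" "f \<in> ideal_prod KR b b'" "f \<noteq> 0" "v \<in> VV"
  shows "vmin b v + vmin b' v \<le> v f"
proof -
  interpret nval v by (rule VV_nval[OF assms(5)])
  from assms(3) have "f \<in> ball (vmin b v + vmin b' v)"
  proof induction
    case (prod i j)
    have "i \<in> ball (vmin b v)" "j \<in> ball (vmin b' v)"
      using prod vmin_ex(2) assms by (auto simp: ball_def)
    then show ?case using ball_mult by simp
  qed (simp add: ball_add)
  then show ?thesis using assms(4) by (simp add: ball_def)
qed

lemma fideal_prod:
  assumes b: "fideal b" and b': "fideal b'"
  shows "fideal (ideal_prod KR b b')"
proof -
  let ?B = "ideal_prod KR b b'"
  obtain c where c: "c \<in> Oc" "c \<noteq> 0" "\<And>f. f \<in> b \<Longrightarrow> c * f \<in> Oc" using b by (auto simp: fideal_def)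
  obtain c' where c': "c' \<in> Oc" "c' \<noteq> 0" "\<And>f. f \<in> b' \<Longrightarrow> c' * f \<in> Oc" using b' by (auto simp: fideal_def)
  have prodI: "i * j \<in> ?B" if "i \<in> b" "j \<in> b'" for i j
    using ideal_prod.prod[OF that, of KR] by simp
  have "is_ideal ?B"
    unfolding is_ideal_def
  proof (intro conjI ballI)
    show "0 \<in> ?B" using prodI[of 0 0] b b' by (auto simp: fideal_def is_ideal_def)
    show "x + y \<in> ?B" if "x \<in> ?B" "y \<in> ?B" for x y
      using ideal_prod.sum[OF that] by simp
    show "a * y \<in> ?B" if a: "a \<in> Oc" and y: "y \<in> ?B" for a y
      using y
    proof induction
      case (prod i j)
      then show ?case using prodI[of "a * i" j] a b by (simp add: fideal_def is_ideal_def mult.assoc)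
    next
      case (sum s1 s2)
      then show ?case using ideal_prod.sum[of "a * s1" KR b b' "a * s2"] by (simp add: distrib_left)
    qed
  qed
  moreover obtain f g where "f \<in> b" "f \<noteq> 0" "g \<in> b'" "g \<noteq> 0"
    using fideal_nonzero[OF b] fideal_nonzero[OF b'] by blast
  then have "f * g \<in> ?B" "f * g \<noteq> 0" using prodI by auto
  moreover have "(c * c') * y \<in> Oc" if "y \<in> ?B" for y
    using that
  proof induction
    case (prod i j)
    have "(c * i) * (c' * j) \<in> Oc" using c c' prod by auto
    then show ?case by (simp add: mult_ac)
  qed (simp add: distrib_left)
  ultimately show ?thesis unfolding fideal_def using c c' by (auto intro!: bexI[of _ "c * c'"])
qed

lemma vmin_prod:
  assumes b: "fideal b" and b': "fideal b'" and v: "v \<in> VV"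
  shows "vmin (ideal_prod KR b b') v = vmin b v + vmin b' v"
proof -
  obtain f g where fg: "f \<in> b" "f \<noteq> 0" "v f = vmin b v" "g \<in> b'" "g \<noteq> 0" "v g = vmin b' v"
    using vmin_ex(1)[OF b v] vmin_ex(1)[OF b' v] by blast
  have "f * g \<in> ideal_prod KR b b'" using ideal_prod.prod[OF fg(1,4), of KR] by simp
  then show ?thesis using fg ideal_prod_VV[OF b b' _ _ v]
    by (intro vminI[of "f * g"]) (auto simp: nval.v_mult[OF VV_nval[OF v]])
qed

end

section \<open>Unique factorization of fractional ideals\<close>

primrec valuation_of :: "'a::zero place \<Rightarrow> 'a \<Rightarrow> int"
  where "valuation_of (Nonarch v) = v" | "valuation_of (Arch E) = (\<lambda>_. 0)"

declare place_ideal.simps [simp del]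

locale setting_ext = euclid_ext R \<delta> d for R :: "'a::field set" and \<delta> d +
  fixes s :: "'a setting"
  assumes OK_eq: "OK s = Oc" and places_eq: "places s - SS s = Nonarch ` VV"
begin

lemma frac_ideal_iff: "frac_ideal s b \<longleftrightarrow> fideal b"
  by (auto simp: frac_ideal_def fideal_def is_ideal_def OK_eq)

abbreviation "G \<equiv> Id_group s"

lemma G_simps [simp]: "carrier G = {b. fideal b}" "monoid.mult G = ideal_prod KR" "monoid.one G = Oc"
  by (simp_all add: Id_group_def frac_ideal_iff OK_eq)

lemma fideal_idl_uminus_vmin:
  assumes "fideal b"
  shows "fideal (idl (\<lambda>v. - vmin b v))" and "v \<in> VV \<Longrightarrow> vmin (idl (\<lambda>v. - vmin b v)) v = - vmin b v"
proof -
  have "finite {v \<in> VV. - vmin b v \<noteq> 0}" using finite_vmin[OF assms] by simp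
  then show "fideal (idl (\<lambda>v. - vmin b v))" "v \<in> VV \<Longrightarrow> vmin (idl (\<lambda>v. - vmin b v)) v = - vmin b v"
    by (simp_all add: fideal_idl vmin_idl)
qed

text \<open>All laws are compared on exponents, where they are those of the integers; the inverse is
  the ideal with the negated exponents.\<close>

lemma comm_group_G: "comm_group G"
proof (rule comm_groupI)
  fix x assume "x \<in> carrier G"
  then have x: "fideal x" by simp
  have "ideal_prod KR (idl (\<lambda>v. - vmin x v)) x = Oc"
    using fideal_idl_uminus_vmin[OF x] x
    by (intro fideal_inject) (simp_all add: fideal_prod fideal_Oc vmin_prod vmin_Oc)
  then show "\<exists>y\<in>carrier G. y \<otimes>\<^bsub>G\<^esub> x = \<one>\<^bsub>G\<^esub>"
    using fideal_idl_uminus_vmin[OF x] by (intro bexI[of _ "idl (\<lambda>v. - vmin x v)"]) simp_all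
next
  fix x y z assume "x \<in> carrier G" "y \<in> carrier G" "z \<in> carrier G"
  then show "x \<otimes>\<^bsub>G\<^esub> y \<otimes>\<^bsub>G\<^esub> z = x \<otimes>\<^bsub>G\<^esub> (y \<otimes>\<^bsub>G\<^esub> z)"
    by (intro fideal_inject) (simp_all add: fideal_prod vmin_prod)
next
  fix x y assume "x \<in> carrier G" "y \<in> carrier G"
  then show "x \<otimes>\<^bsub>G\<^esub> y = y \<otimes>\<^bsub>G\<^esub> x"
    by (intro fideal_inject) (simp_all add: fideal_prod vmin_prod)
next
  fix x assume "x \<in> carrier G"
  then show "\<one>\<^bsub>G\<^esub> \<otimes>\<^bsub>G\<^esub> x = x"
    by (intro fideal_inject) (simp_all add: fideal_prod fideal_Oc vmin_prod vmin_Oc)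
qed (simp_all add: fideal_prod fideal_Oc)

sublocale G: comm_group G by (rule comm_group_G)

lemma fideal_inv: "fideal b \<Longrightarrow> fideal (inv\<^bsub>G\<^esub> b)"
  using G.inv_closed[of b] by simp

lemma vmin_inv: "fideal b \<Longrightarrow> v \<in> VV \<Longrightarrow> vmin (inv\<^bsub>G\<^esub> b) v = - vmin b v"
  using vmin_prod[of b "inv\<^bsub>G\<^esub> b" v] fideal_inv[of b] G.r_inv[of b] by (simp add: vmin_Oc)

lemma fideal_nat_pow: "fideal b \<Longrightarrow> fideal (b [^]\<^bsub>G\<^esub> (k::nat))"
  using G.nat_pow_closed[of b k] by simp

lemma vmin_nat_pow: "fideal b \<Longrightarrow> v \<in> VV \<Longrightarrow> vmin (b [^]\<^bsub>G\<^esub> (k::nat)) v = int k * vmin b v"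
  by (induction k) (simp_all add: vmin_Oc vmin_prod fideal_nat_pow distrib_right)

lemma fideal_int_pow: "fideal b \<Longrightarrow> fideal (b [^]\<^bsub>G\<^esub> (k::int))"
  using G.int_pow_closed[of b k] by simp

lemma vmin_int_pow: "fideal b \<Longrightarrow> v \<in> VV \<Longrightarrow> vmin (b [^]\<^bsub>G\<^esub> (k::int)) v = k * vmin b v"
proof (cases k)
  case (nonneg n)
  then show "fideal b \<Longrightarrow> v \<in> VV \<Longrightarrow> ?thesis" by (simp add: int_pow_int vmin_nat_pow)
next
  case (neg n)
  show "fideal b \<Longrightarrow> v \<in> VV \<Longrightarrow> ?thesis" unfolding neg
    by (subst G.int_pow_neg_int) (simp_all only: vmin_inv[OF fideal_nat_pow] vmin_nat_pow G_simps mem_Collect_eq minus_mult_left)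
qed

lemma fideal_finprod: "(\<And>p. p \<in> A \<Longrightarrow> fideal (f p)) \<Longrightarrow> fideal (finprod G f A)"
  using G.finprod_closed[of f A] by auto

lemma vmin_finprod:
  assumes "finite A" "\<And>p. p \<in> A \<Longrightarrow> fideal (f p)" "v \<in> VV"
  shows "vmin (finprod G f A) v = (\<Sum>p\<in>A. vmin (f p) v)"
  using assms(1,2)
proof (induction A)
  case (insert p A)
  have "finprod G f (insert p A) = f p \<otimes>\<^bsub>G\<^esub> finprod G f A"
    using insert by (intro G.finprod_insert) auto
  then show ?case using insert assms(3) by (simp add: vmin_prod fideal_finprod)
qed (simp add: vmin_Oc assms(3))

lemma place_ideal_idl:
  assumes v: "v \<in> VV"
  shows "place_ideal s (Nonarch v) = idl (\<lambda>w. if w = v then 1 else 0)"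
proof (intro equalityI subsetI)
  have Oc: "f \<in> Oc \<longleftrightarrow> f = 0 \<or> (\<forall>w\<in>VV. 0 \<le> w f)" for f using Oc_eq by blast
  fix f assume "f \<in> place_ideal s (Nonarch v)"
  then have "f = 0 \<or> v f > 0" "f \<in> Oc" by (auto simp: place_ideal.simps OK_eq valuation_ideal_def)
  then show "f \<in> idl (\<lambda>w. if w = v then 1 else 0)" using Oc[of f] by (auto simp: idl_def)
next
  have Oc: "f \<in> Oc \<longleftrightarrow> f = 0 \<or> (\<forall>w\<in>VV. 0 \<le> w f)" for f using Oc_eq by blast
  fix f assume f: "f \<in> idl (\<lambda>w. if w = v then 1 else 0)"
  have "f = 0 \<or> v f > 0" using f v by (auto simp: idl_def)
  moreover have "f \<in> Oc" unfolding Oc using f by (auto simp: idl_def split: if_splits)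
  ultimately show "f \<in> place_ideal s (Nonarch v)" by (auto simp: place_ideal.simps OK_eq valuation_ideal_def)
qed

lemma
  assumes v: "v \<in> VV"
  shows fideal_place_ideal: "fideal (place_ideal s (Nonarch v))"
    and vmin_place_ideal: "w \<in> VV \<Longrightarrow> vmin (place_ideal s (Nonarch v)) w = (if w = v then 1 else 0)"
proof -
  have "finite {w \<in> VV. (if w = v then 1 else 0) \<noteq> (0::int)}"
    by (rule finite_subset[of _ "{v}"]) auto
  then show "fideal (place_ideal s (Nonarch v))"
    "w \<in> VV \<Longrightarrow> vmin (place_ideal s (Nonarch v)) w = (if w = v then 1 else 0)"
    by (simp_all add: place_ideal_idl[OF v] fideal_idl vmin_idl)
qed

section \<open>Factorization into place ideals\<close>

abbreviation factorization :: "('a place \<Rightarrow> int) \<Rightarrow> 'a set"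
  where "factorization e \<equiv> \<Otimes>\<^bsub>G\<^esub>p \<in> {p. e p \<noteq> 0}. place_ideal s p [^]\<^bsub>G\<^esub> e p"

lemma vmin_factorization:
  assumes e: "{p. e p \<noteq> 0} \<subseteq> places s - SS s" "finite {p. e p \<noteq> 0}"
  shows "fideal (factorization e)"
    and "v \<in> VV \<Longrightarrow> vmin (factorization e) v = e (Nonarch v)"
proof -
  have f: "fideal (place_ideal s p [^]\<^bsub>G\<^esub> e p)" if p: "p \<in> {p. e p \<noteq> 0}" for p
    using subsetD[OF e(1) p] places_eq by (auto simp: fideal_place_ideal intro!: fideal_int_pow)
  then show "fideal (factorization e)" by (rule fideal_finprod)
  assume v: "v \<in> VV"
  have "vmin (factorization e) v = (\<Sum>p | e p \<noteq> 0. vmin (place_ideal s p [^]\<^bsub>G\<^esub> e p) v)"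
    by (rule vmin_finprod[OF e(2) f v])
  also have "\<dots> = (\<Sum>p | e p \<noteq> 0. if p = Nonarch v then e p else 0)"
  proof (rule sum.cong)
    fix p assume p: "p \<in> {p. e p \<noteq> 0}"
    obtain w where "p = Nonarch w" "w \<in> VV" using subsetD[OF e(1) p] places_eq by auto
    then show "vmin (place_ideal s p [^]\<^bsub>G\<^esub> e p) v = (if p = Nonarch v then e p else 0)"
      using v by (simp add: vmin_int_pow fideal_place_ideal vmin_place_ideal)
  qed simp
  also have "\<dots> = e (Nonarch v)"
    using sum.delta[OF e(2), of "Nonarch v" e] by simp
  finally show "vmin (factorization e) v = e (Nonarch v)" .
qed

definition exps :: "'a set \<Rightarrow> 'a place \<Rightarrow> int"
  where "exps b p = (if p \<in> Nonarch ` VV then vmin b (valuation_of p) else 0)"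

lemma exps_Nonarch: "v \<in> VV \<Longrightarrow> exps b (Nonarch v) = vmin b v"
  by (simp add: exps_def)

lemma exps_support: "{p. exps b p \<noteq> 0} \<subseteq> places s - SS s"
  unfolding places_eq by (auto simp: exps_def)

lemma exps_finite: "fideal b \<Longrightarrow> finite {p. exps b p \<noteq> 0}"
proof -
  assume b: "fideal b"
  have "{p. exps b p \<noteq> 0} \<subseteq> Nonarch ` {v \<in> VV. vmin b v \<noteq> 0}"
  proof
    fix p assume p: "p \<in> {p. exps b p \<noteq> 0}"
    then obtain v where "p = Nonarch v" "v \<in> VV" using exps_support[of b] places_eq by auto
    then show "p \<in> Nonarch ` {v \<in> VV. vmin b v \<noteq> 0}" using p exps_Nonarch by auto
  qed
  then show ?thesis using finite_vmin[OF b] finite_subset by blast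
qed

text \<open>The exponents of a product of powers of place ideals are the prescribed ones. This
  settles existence and uniqueness of the factorization at once, so the definite description in
  \<open>ideal_exponents\<close> can be replaced by \<open>exps\<close>.\<close>

lemma ideal_exponents_eq:
  assumes b: "fideal b"
  shows "ideal_exponents s b = exps b"
  unfolding ideal_exponents_def
proof (rule the_equality)
  have "b = factorization (exps b)"
    using vmin_factorization[OF exps_support exps_finite, OF b]
    by (intro fideal_inject[OF b]) (simp_all add: exps_Nonarch)
  then show "{p. exps b p \<noteq> 0} \<subseteq> places s - SS s \<and> finite {p. exps b p \<noteq> 0} \<and> b = factorization (exps b)"
    using exps_support exps_finite[OF b] by blast
  fix e assume e: "{p. e p \<noteq> 0} \<subseteq> places s - SS s \<and> finite {p. e p \<noteq> 0} \<and> b = factorization e"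
  have *: "vmin b v = e (Nonarch v)" if "v \<in> VV" for v
    using vmin_factorization(2)[of e v] e that by metis
  show "e = exps b"
  proof
    fix p
    show "e p = exps b p"
    proof (cases "p \<in> Nonarch ` VV")
      case True then show ?thesis using * by (auto simp: exps_Nonarch)
    next
      case False
      then have "e p = 0" using e places_eq by blast
      then show ?thesis using False by (simp add: exps_def)
    qed
  qed
qed

lemma exps_notin: "p \<notin> Nonarch ` VV \<Longrightarrow> exps b p = 0"
  by (simp add: exps_def)

definition fin_div :: "'a \<Rightarrow> 'a place \<Rightarrow> real"
  where "fin_div f p = (if p \<in> places s - SS s then nu p f else 0)"

lemma ideal_div_prod: "fideal b \<Longrightarrow> fideal b' \<Longrightarrow> ideal_div s (ideal_prod KR b b') p = ideal_div s b p + ideal_div s b' p"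
  by (cases "p \<in> Nonarch ` VV")
    (auto simp: ideal_div_def ideal_exponents_eq fideal_prod exps_Nonarch vmin_prod exps_notin)

lemma ideal_div_inv: "fideal b \<Longrightarrow> ideal_div s (inv\<^bsub>G\<^esub> b) p = - ideal_div s b p"
  by (cases "p \<in> Nonarch ` VV")
    (auto simp: ideal_div_def ideal_exponents_eq fideal_inv exps_Nonarch vmin_inv exps_notin)

lemma ideal_div_scale: "fideal b \<Longrightarrow> h \<noteq> 0 \<Longrightarrow> ideal_div s (scale_ideal h b) p = ideal_div s b p - fin_div h p"
  unfolding fin_div_def places_eq
  by (cases "p \<in> Nonarch ` VV")
    (auto simp: ideal_div_def ideal_exponents_eq fideal_scale exps_Nonarch vmin_scale exps_notin)

lemma ideal_div_support: "fideal b \<Longrightarrow> {p. ideal_div s b p \<noteq> 0} \<subseteq> places s - SS s"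
  and ideal_div_finite: "fideal b \<Longrightarrow> finite {p. ideal_div s b p \<noteq> 0}"
  and ideal_div_Ints: "ideal_div s b p \<in> \<int>"
  using exps_support exps_finite by (simp_all add: ideal_div_def ideal_exponents_eq)

lemma fin_div_finite: "finite {p. fin_div h p \<noteq> 0}"
proof (rule finite_subset)
  show "{p. fin_div h p \<noteq> 0} \<subseteq> Nonarch ` {v \<in> VV. v h \<noteq> 0}"
    unfolding fin_div_def places_eq by auto
qed (simp add: finite_VV_support)

lemma fin_div_Ints: "fin_div h p \<in> \<int>"
  unfolding fin_div_def places_eq by auto

end

section \<open>Boxes and representations\<close>

text \<open>At the first difference the order would make \<open>g\<close> larger and the pointwise
  bound would make it smaller. Applied to 1 and an element of the unit box, this yields
  reducedness.\<close>

lemma lexordp_eq_antimono: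
  fixes f g :: "'b \<Rightarrow> real"
  assumes "ord_class.lexordp_eq (map f L) (map g L)" "\<And>i. i \<in> set L \<Longrightarrow> g i \<le> f i" "i \<in> set L"
  shows "f i = g i"
  using assms
proof (induction L)
  case (Cons a L)
  have "g a \<le> f a" using Cons.prems by simp
  then have "f a = g a \<and> ord_class.lexordp_eq (map f L) (map g L)"
    using Cons.prems(1) by (auto simp: lexordp_eq_simps)
  then show ?case using Cons by auto
qed simp

lemma lexordp_eq_scale:
  fixes f g c :: "'b \<Rightarrow> real"
  assumes "\<And>i. i \<in> set L \<Longrightarrow> c i > 0"
  shows "ord_class.lexordp_eq (map (\<lambda>i. c i * f i) L) (map (\<lambda>i. c i * g i) L) \<longleftrightarrow>
    ord_class.lexordp_eq (map f L) (map g L)"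
  using assms
proof (induction L)
  case (Cons a L)
  then have "c a > 0" by simp
  then show ?case using Cons by (simp add: lexordp_eq_simps)
qed simp

lemma GG_closed: "0 \<in> GG s" "x \<in> GG s \<Longrightarrow> y \<in> GG s \<Longrightarrow> x + y \<in> GG s" "x \<in> GG s \<Longrightarrow> - x \<in> GG s"
  by (cases s; simp)+

text \<open>What the common argument needs from each case. Only the values at the last place are
  required to be finite in number, since a box may be infinite when the field of constants is.
  \<open>principal_deg\<close> is restricted to number fields: over a function field,
  \<open>\<Phi>\<close> takes values modulo the class of the last place, so degrees do not
  enter.\<close>

locale rep_setting = setting_ext R \<delta> d s for R :: "'a::field set" and \<delta> d and s :: "'a setting" +
  fixes P :: "nat \<Rightarrow> 'a place" and n :: nat
  assumes enum: "bij_betw P {1..Suc n} (SS s)"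
    and SS_places: "SS s \<subseteq> places s"
    and base_gt: "base s > 1"
    and deg_pos: "\<And>p. p \<in> SS s \<Longrightarrow> place_deg s p > 0"
    and nu_mult: "\<And>p f g. p \<in> SS s \<Longrightarrow> f \<noteq> 0 \<Longrightarrow> g \<noteq> 0 \<Longrightarrow> nu p (f * g) = nu p f + nu p g"
    and nu_GG: "\<And>p f. p \<in> SS s \<Longrightarrow> f \<noteq> 0 \<Longrightarrow> nu p f \<in> GG s"
    and finite_levels: "\<And>b t. fideal b \<Longrightarrow> finite (nu (P (Suc n)) ` (Box s P n b t - {0}))"
    and level_exists: "\<And>b t. fideal b \<Longrightarrow> \<exists>l\<in>GG s. Box s P n b (t(Suc n := l)) - {0} \<noteq> {}"
    and principal_deg: "\<And>f. s = Number_Field \<Longrightarrow> f \<noteq> 0 \<Longrightarrow> div_deg s (principal_div s f) = 0"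
begin

section \<open>Absolute values, boxes and equivalence of reduced ideals\<close>

lemma P_SS: "i \<in> {1..Suc n} \<Longrightarrow> P i \<in> SS s"
  using enum by (auto simp: bij_betw_def)

lemma SS_P: "p \<in> SS s \<Longrightarrow> \<exists>i\<in>{1..Suc n}. p = P i"
  using enum by (auto simp: bij_betw_def)

lemma nu_1: "p \<in> SS s \<Longrightarrow> nu p 1 = 0"
  using nu_mult[of p 1 1] by simp

lemma nu_inverse: "p \<in> SS s \<Longrightarrow> f \<noteq> 0 \<Longrightarrow> nu p (1 / f) = - nu p f"
  using nu_mult[of p f "1 / f"] nu_1[of p] by simp

lemma absval_pos: "f \<noteq> 0 \<Longrightarrow> absval s p f > 0"
  using base_gt by (simp add: absval_def)

lemma absval_mult: "p \<in> SS s \<Longrightarrow> absval s p (f * g) = absval s p f * absval s p g"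
  by (auto simp: absval_def nu_mult algebra_simps simp flip: powr_add)

lemma absval_1: "p \<in> SS s \<Longrightarrow> absval s p 1 = 1"
  using base_gt by (simp add: absval_def nu_1)

lemma absval_le_iff: "p \<in> SS s \<Longrightarrow> f \<noteq> 0 \<Longrightarrow> absval s p f \<le> base s powr (x * place_deg s p) \<longleftrightarrow> - nu p f \<le> x"
  using base_gt deg_pos[of p] by (simp add: absval_def mult_le_cancel_right_pos del: mult_minus_left)

lemma absval_eq_1_iff: "p \<in> SS s \<Longrightarrow> f \<noteq> 0 \<Longrightarrow> absval s p f = 1 \<longleftrightarrow> nu p f = 0"
  using base_gt deg_pos[of p] by (simp add: absval_def powr_eq_one_iff_gen)

lemma Box_iff: "h \<noteq> 0 \<Longrightarrow> h \<in> Box s P n b t \<longleftrightarrow> h \<in> b \<and> (\<forall>i\<in>{1..Suc n}. - nu (P i) h \<le> t i)"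
  using absval_le_iff[OF P_SS] by (auto simp: Box_def)

lemma Box_upd_iff: "h \<noteq> 0 \<Longrightarrow> h \<in> Box s P n b (t(Suc n := l)) \<longleftrightarrow>
    h \<in> b \<and> (\<forall>i\<in>{1..n}. - nu (P i) h \<le> t i) \<and> - nu (P (Suc n)) h \<le> l"
  by (simp add: Box_iff atLeastAtMostSuc_conv conj_commute)

lemma absval_vector_eq: "absval_vector s P n h = map (\<lambda>i. absval s (P i) h) (Suc n # [1..<Suc n])"
  by (simp add: absval_vector_def)

lemma pre_le_scale:
  assumes "m \<noteq> 0"
  shows "pre_le s P n (m * h) (m * h') \<longleftrightarrow> pre_le s P n h h'"
proof -
  have *: "absval_vector s P n (m * g) = map (\<lambda>i. absval s (P i) m * absval s (P i) g) (Suc n # [1..<Suc n])" for g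
    unfolding absval_vector_eq by (rule map_cong) (auto intro!: absval_mult P_SS)
  show ?thesis
    unfolding pre_le_def * unfolding absval_vector_eq
    by (rule lexordp_eq_scale) (rule absval_pos[OF assms])
qed

lemma pre_le_antimono:
  assumes "pre_le s P n h g" "\<And>i. i \<in> {1..Suc n} \<Longrightarrow> absval s (P i) g \<le> absval s (P i) h" "i \<in> {1..Suc n}"
  shows "absval s (P i) h = absval s (P i) g"
  by (rule lexordp_eq_antimono[OF assms(1)[unfolded pre_le_def absval_vector_eq]]) (use assms in auto)

lemma scale_mem_iff: "h \<noteq> 0 \<Longrightarrow> g \<in> scale_ideal h b \<longleftrightarrow> (1 / h) * g \<in> b"
  by (force simp: scale_ideal_def)

lemma scale_scale: "scale_ideal g (scale_ideal h b) = scale_ideal (g * h) b"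
  by (auto simp: scale_ideal_def image_image mult.assoc)

lemma scale_1: "scale_ideal 1 b = b"
  by (simp add: scale_ideal_def)

lemma reduced_fideal: "reduced s P n b \<Longrightarrow> fideal b"
  by (simp add: reduced_def frac_ideal_iff)

lemma sim_refl: "reduced s P n b \<Longrightarrow> (b, b) \<in> sim s P n"
  unfolding sim_def by (auto intro!: exI[of _ 1] simp: scale_1 absval_1)

lemma sim_classD:
  assumes "b' \<in> sim_class s P n b"
  obtains h where "reduced s P n b" "reduced s P n b'" "h \<noteq> 0" "b' = scale_ideal h b" "\<And>p. p \<in> SS s \<Longrightarrow> nu p h = 0"
proof -
  obtain h where h: "reduced s P n b" "reduced s P n b'" "h \<noteq> 0" "b = scale_ideal h b'" "\<forall>p\<in>SS s. absval s p h = 1"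
    using assms by (auto simp: sim_class_def sim_def)
  show ?thesis
  proof (rule that[of "1 / h"])
    show "b' = scale_ideal (1 / h) b" using h by (simp add: scale_scale scale_1)
    show "nu p (1 / h) = 0" if "p \<in> SS s" for p
      using h absval_eq_1_iff[OF that h(3)] that by (simp add: nu_inverse)
  qed (use h in auto)
qed

text \<open>A member of the quotient set is the class of a reduced ideal and contains it, whereas
  the class of an ideal that is not reduced is empty. So \<open>b\<close>, a priori an arbitrary
  set, is reduced.\<close>

lemma Rep_f_KD:
  assumes "(sim_class s P n b, t) \<in> Rep_f_K s P n"
  shows "reduced s P n b" "t \<in> tuples s n"
proof -
  obtain a where a: "sim_class s P n b \<in> Red s P n a // sim s P n" "t \<in> tuples s n"
    using assms by (auto simp: Rep_f_K_def Rep_f_def)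
  then show "t \<in> tuples s n" by simp
  obtain b0 where b0: "b0 \<in> Red s P n a" "sim_class s P n b = sim s P n `` {b0}"
    using a(1) by (auto simp: quotient_def)
  have "b0 \<in> sim_class s P n b" using b0 sim_refl by (auto simp: Red_def)
  then show "reduced s P n b" by (rule sim_classD)
qed

text \<open>Multiplication by \<open>\<mu>\<close> maps the box of the scaled ideal with the new
  bounds into the box in which \<open>\<mu>\<close> is smallest, and it preserves the preorder.
  Hence 1 is smallest in the new box, and reducedness follows from that.\<close>

lemma rep_mem:
  assumes c: "fideal c" and u: "\<forall>i\<in>{1..n}. u i \<in> GG s"
    and \<mu>: "is_smallest s P n (Box s P n c (u(Suc n := l)) - {0}) \<mu>"
  shows "reduced s P n (scale_ideal (1 / \<mu>) c)"
    and "(sim_class s P n (scale_ideal (1 / \<mu>) c), \<lambda>i\<in>{1..n}. u i + nu (P i) \<mu>) \<in> Rep_f_K s P n"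
proof -
  let ?b = "scale_ideal (1 / \<mu>) c"
  define \<tau> where "\<tau> = (\<lambda>i\<in>{1..n}. u i + nu (P i) \<mu>)"
  have \<mu>_mem: "\<mu> \<noteq> 0" "\<mu> \<in> c" "\<And>i. i \<in> {1..Suc n} \<Longrightarrow> - nu (P i) \<mu> \<le> (u(Suc n := l)) i"
    and least: "\<And>h. h \<in> Box s P n c (u(Suc n := l)) \<Longrightarrow> h \<noteq> 0 \<Longrightarrow> pre_le s P n \<mu> h"
    using \<mu> Box_iff[of \<mu>] by (auto simp: is_smallest_def)
  have b_mem: "h \<in> ?b \<longleftrightarrow> \<mu> * h \<in> c" for h using scale_mem_iff[of "1 / \<mu>"] \<mu>_mem by simp
  have one: "1 \<in> ?b" using b_mem \<mu>_mem by simp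
  have smallest: "pre_le s P n 1 h" if h: "h \<in> ?b" "h \<noteq> 0" "\<And>i. i \<in> {1..Suc n} \<Longrightarrow> - nu (P i) h \<le> (\<tau>(Suc n := 0)) i" for h
  proof -
    have "\<mu> * h \<in> Box s P n c (u(Suc n := l))"
    proof (subst Box_iff)
      show "\<mu> * h \<in> c \<and> (\<forall>i\<in>{1..Suc n}. - nu (P i) (\<mu> * h) \<le> (u(Suc n := l)) i)"
      proof (intro conjI ballI)
        fix i assume i: "i \<in> {1..Suc n}"
        show "- nu (P i) (\<mu> * h) \<le> (u(Suc n := l)) i"
          using h(3)[OF i] \<mu>_mem(3)[OF i] i nu_mult[OF P_SS[OF i] \<mu>_mem(1) h(2)]
          by (cases "i = Suc n") (auto simp: \<tau>_def)
      qed (use h b_mem in simp)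
    qed (use h \<mu>_mem in simp)
    then have "pre_le s P n (\<mu> * 1) (\<mu> * h)" using least[of "\<mu> * h"] h \<mu>_mem by simp
    then show ?thesis using pre_le_scale[OF \<mu>_mem(1)] by blast
  qed
  \<comment> \<open>The new bounds are nonnegative because \<open>\<mu>\<close> lies in its own box;
    so the unit box that defines reducedness is contained in the box with bounds
    \<open>\<tau>\<close>.\<close>
  have \<tau>_nonneg: "(\<tau>(Suc n := 0)) i \<ge> 0" if "i \<in> {1..Suc n}" for i
    using \<mu>_mem(3)[OF that] that by (cases "i = Suc n") (auto simp: \<tau>_def)
  show red: "reduced s P n ?b"
    unfolding reduced_def frac_ideal_iff
  proof (intro conjI ballI)
    show "fideal ?b" using c \<mu>_mem by (intro fideal_scale) auto
    show "1 \<in> ?b" by (rule one)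
    fix h p assume h: "h \<in> Box s P n ?b (\<lambda>_. 0) - {0}" and p: "p \<in> SS s"
    then have h': "h \<noteq> 0" "h \<in> ?b" "\<And>i. i \<in> {1..Suc n} \<Longrightarrow> - nu (P i) h \<le> 0" using Box_iff[of h] by auto
    \<comment> \<open>Now 1 precedes \<open>h\<close> lexicographically although no absolute value
      of \<open>h\<close> on S exceeds 1, which forces all of them to be 1.\<close>
    have "pre_le s P n 1 h" using h'(1,2) order_trans[OF h'(3) \<tau>_nonneg] by (intro smallest)
    moreover have "absval s (P i) h \<le> absval s (P i) 1" if "i \<in> {1..Suc n}" for i
      using h'(3)[OF that] absval_le_iff[OF P_SS[OF that] h'(1), of 0] base_gt absval_1[OF P_SS[OF that]] by simp
    moreover obtain i where i: "i \<in> {1..Suc n}" "p = P i" using SS_P[OF p] by blast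
    ultimately have "absval s (P i) 1 = absval s (P i) h" using pre_le_antimono[of 1 h i] by blast
    then show "absval s p h = 1" using i absval_1[OF p] by simp
  qed
  \<comment> \<open>Another representative is the ideal scaled by an element with absolute value 1
    on S; dividing by it changes neither the bounds that an element satisfies nor its place in the
    preorder.\<close>
  have "is_smallest s P n (Box s P n b' (\<tau>(Suc n := 0)) - {0}) 1" if b': "b' \<in> sim_class s P n ?b" for b'
    unfolding is_smallest_def
  proof (intro conjI ballI)
    obtain h where h: "reduced s P n b'" "h \<noteq> 0" "b' = scale_ideal h ?b" "\<And>p. p \<in> SS s \<Longrightarrow> nu p h = 0"
      by (rule sim_classD[OF b']) blast
    have "1 \<in> b'" using h by (simp add: reduced_def)
    then show "1 \<in> Box s P n b' (\<tau>(Suc n := 0)) - {0}"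
      using \<tau>_nonneg nu_1[OF P_SS] by (simp add: Box_iff)
    fix g assume g: "g \<in> Box s P n b' (\<tau>(Suc n := 0)) - {0}"
    then have g': "g \<noteq> 0" "g \<in> b'" "\<And>i. i \<in> {1..Suc n} \<Longrightarrow> - nu (P i) g \<le> (\<tau>(Suc n := 0)) i"
      using Box_iff[of g] by auto
    have nu_eq: "nu p ((1 / h) * g) = nu p g" if "p \<in> SS s" for p
      using nu_mult[OF that, of "1 / h" g] nu_inverse[OF that h(2)] h g' that by simp
    have "pre_le s P n 1 ((1 / h) * g)"
      using g' h nu_eq P_SS scale_mem_iff[OF h(2), of g ?b] by (intro smallest) auto
    moreover have "absval_vector s P n ((1 / h) * g) = absval_vector s P n g"
      unfolding absval_vector_eq using nu_eq[OF P_SS] g'(1) h(2) by (intro map_cong) (auto simp: absval_def)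
    ultimately show "pre_le s P n 1 g" by (simp add: pre_le_def)
  qed
  moreover have "\<tau> \<in> tuples s n"
    using u nu_GG[OF P_SS \<mu>_mem(1)] by (auto simp: tuples_def \<tau>_def intro!: GG_closed)
  moreover have "sim_class s P n ?b \<in> Red s P n c // sim s P n"
    unfolding sim_class_def by (rule quotientI) (use red \<mu>_mem in \<open>auto simp: Red_def\<close>)
  ultimately have "(sim_class s P n ?b, \<tau>) \<in> Rep_f s P n c" by (simp add: Rep_f_def)
  then show "(sim_class s P n ?b, \<lambda>i\<in>{1..n}. u i + nu (P i) \<mu>) \<in> Rep_f_K s P n"
    unfolding Rep_f_K_def \<tau>_def using c by auto
qed

text \<open>Smaller levels correspond to larger values at the last place. Below a level
  \<open>l0\<close> with nonempty box only finitely many values occur, so the largest is attained,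
  and its negative is the least level.\<close>

lemma minimal_level_exists:
  assumes c: "fideal c"
  shows "\<exists>l. minimal_level s P n c u l"
proof -
  obtain l0 where l0: "l0 \<in> GG s" "Box s P n c (u(Suc n := l0)) - {0} \<noteq> {}"
    using level_exists[OF c] by blast
  define L where "L = nu (P (Suc n)) ` (Box s P n c (u(Suc n := l0)) - {0})"
  have L: "finite L" "L \<noteq> {}" using finite_levels[OF c] l0 by (auto simp: L_def)
  have L_GG: "x \<in> GG s" if "x \<in> L" for x using that nu_GG P_SS[of "Suc n"] by (auto simp: L_def)
  have "\<exists>h\<in>Box s P n c (u(Suc n := l0)) - {0}. Max L = nu (P (Suc n)) h"
    using Max_in[OF L] unfolding L_def by blast
  then obtain h where h: "h \<in> Box s P n c (u(Suc n := l0)) - {0}" "nu (P (Suc n)) h = Max L"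
    by metis
  have "minimal_level s P n c u (- Max L)"
    unfolding minimal_level_def
  proof (intro conjI ballI impI)
    show "- Max L \<in> GG s" using L_GG[OF Max_in[OF L]] GG_closed by blast
    have "h \<in> Box s P n c (u(Suc n := - Max L))" using h Box_upd_iff[of h] by auto
    moreover have "h \<noteq> 0" using h by blast
    ultimately show "Box s P n c (u(Suc n := - Max L)) - {0} \<noteq> {}" by blast
    fix l' assume "l' \<in> GG s" "Box s P n c (u(Suc n := l')) - {0} \<noteq> {}"
    then obtain g where g: "g \<in> Box s P n c (u(Suc n := l'))" "g \<noteq> 0" by blast
    have gn: "- nu (P (Suc n)) g \<le> l'" using g Box_upd_iff[of g] by auto
    show "- Max L \<le> l'"
    proof (cases "l' \<le> l0")
      case True
      then have "g \<in> Box s P n c (u(Suc n := l0))" using g gn Box_upd_iff[of g] by auto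
      then have "nu (P (Suc n)) g \<in> L" using g unfolding L_def by blast
      then show ?thesis using Max_ge[OF L(1)] gn by fastforce
    next
      case False
      have "- nu (P (Suc n)) h \<le> l0" using h Box_upd_iff[of h] by auto
      then show ?thesis using h(2) False by linarith
    qed
  qed
  then show ?thesis by blast
qed

end

section \<open>Divisor classes\<close>

lemma div_deg_superset:
  assumes "finite A" "{p. D p \<noteq> 0} \<subseteq> A"
  shows "div_deg s D = (\<Sum>p\<in>A. D p * place_deg s p)"
  unfolding div_deg_def by (rule sum.mono_neutral_left) (use assms in auto)

lemma div_deg_add:
  assumes "finite {p. D p \<noteq> 0}" "finite {p. E p \<noteq> 0}"
  shows "div_deg s (\<lambda>p. D p + E p) = div_deg s D + div_deg s E"
proof -
  let ?A = "{p. D p \<noteq> 0} \<union> {p. E p \<noteq> 0}"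
  have "finite ?A" using assms by simp
  then have "div_deg s (\<lambda>p. D p + E p) = (\<Sum>p\<in>?A. (D p + E p) * place_deg s p)"
    "div_deg s D = (\<Sum>p\<in>?A. D p * place_deg s p)" "div_deg s E = (\<Sum>p\<in>?A. E p * place_deg s p)"
    by (intro div_deg_superset; auto)+
  then show ?thesis by (simp add: distrib_right sum.distrib)
qed

lemma div_deg_scale: "div_deg s (\<lambda>p. c * D p) = c * div_deg s D"
  by (cases "c = 0") (simp_all add: div_deg_def sum_distrib_left mult.assoc)

lemma div_deg_point: "div_deg s (point p) = place_deg s p"
  using div_deg_superset[of "{p}" "point p" s] by (auto simp: point_def)

lemma finite_support_sum:
  assumes "finite I"
  shows "finite {p. (\<Sum>i\<in>I. c i * point (Q i) p) \<noteq> 0}"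
proof (rule finite_subset)
  show "{p. (\<Sum>i\<in>I. c i * point (Q i) p) \<noteq> 0} \<subseteq> Q ` I"
  proof
    fix p assume "p \<in> {p. (\<Sum>i\<in>I. c i * point (Q i) p) \<noteq> 0}"
    then obtain i where "i \<in> I" "c i * point (Q i) p \<noteq> 0" using sum.not_neutral_contains_not_neutral by blast
    then show "p \<in> Q ` I" by (auto simp: point_def split: if_splits)
  qed
qed (use assms in simp)

lemma div_deg_sum:
  assumes "finite I"
  shows "div_deg s (\<lambda>p. \<Sum>i\<in>I. c i * point (Q i) p) = (\<Sum>i\<in>I. c i * place_deg s (Q i))"
  using assms
proof (induction I)
  case empty then show ?case by (simp add: div_deg_def)
next
  case (insert i I)
  have "finite {p. c i * point (Q i) p \<noteq> 0}" using finite_support_sum[of "{i}" c Q] by simp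
  then show ?case
    using insert finite_support_sum[OF insert.hyps(1), of c Q]
    by (simp add: div_deg_add div_deg_scale div_deg_point)
qed

context rep_setting
begin

section \<open>The divisor class group and its quotients\<close>

abbreviation "PN \<equiv> P (Suc n)"

lemma PN_SS: "PN \<in> SS s" using P_SS[of "Suc n"] by simp

lemma Div_carrier: "D \<in> carrier (Div s) \<longleftrightarrow> {p. D p \<noteq> 0} \<subseteq> places s \<and> finite {p. D p \<noteq> 0} \<and>
    (\<forall>p \<in> SS s. D p \<in> GG s) \<and> (\<forall>p \<in> places s - SS s. D p \<in> \<int>)"
  by (simp add: Div_def)

lemma Div_simps [simp]: "monoid.mult (Div s) = (\<lambda>D E p. D p + E p)" "monoid.one (Div s) = (\<lambda>p. 0)"
  by (simp_all add: Div_def)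

lemma Div_add: "D \<in> carrier (Div s) \<Longrightarrow> E \<in> carrier (Div s) \<Longrightarrow> (\<lambda>p. D p + E p) \<in> carrier (Div s)"
proof -
  assume D: "D \<in> carrier (Div s)" and E: "E \<in> carrier (Div s)"
  have "{p. D p + E p \<noteq> 0} \<subseteq> {p. D p \<noteq> 0} \<union> {p. E p \<noteq> 0}" by auto
  then have "finite {p. D p + E p \<noteq> 0}" "{p. D p + E p \<noteq> 0} \<subseteq> places s"
    using D E by (auto simp: Div_carrier intro: finite_subset)
  then show ?thesis using D E by (auto simp: Div_carrier GG_closed)
qed

lemma Div_uminus: "D \<in> carrier (Div s) \<Longrightarrow> (\<lambda>p. - D p) \<in> carrier (Div s)"
  by (auto simp: Div_carrier GG_closed)

lemma comm_group_Div: "comm_group (Div s)"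
proof (rule comm_groupI)
  show "\<one>\<^bsub>Div s\<^esub> \<in> carrier (Div s)" by (simp add: Div_carrier GG_closed)
  fix x assume "x \<in> carrier (Div s)"
  then show "\<exists>y\<in>carrier (Div s). y \<otimes>\<^bsub>Div s\<^esub> x = \<one>\<^bsub>Div s\<^esub>"
    by (intro bexI[of _ "\<lambda>p. - x p"]) (simp_all add: Div_uminus)
qed (simp_all add: Div_add add_ac)

sublocale Dv: comm_group "Div s" by (rule comm_group_Div)

lemma inv_Div: "D \<in> carrier (Div s) \<Longrightarrow> inv\<^bsub>Div s\<^esub> D = (\<lambda>p. - D p)"
  by (rule Dv.inv_equality) (simp_all add: Div_uminus)

lemma principal_div_eq: "principal_div s f p = fin_div f p + (\<Sum>i = 1..Suc n. nu (P i) f * point (P i) p)"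
proof (cases "p \<in> SS s")
  case True
  then obtain j where j: "j \<in> {1..Suc n}" "p = P j" using SS_P by blast
  have "(\<Sum>i = 1..Suc n. nu (P i) f * point (P i) p) = (\<Sum>i = 1..Suc n. if i = j then nu (P i) f else 0)"
  proof (rule sum.cong)
    fix i assume i: "i \<in> {1..Suc n}"
    have "P j = P i \<longleftrightarrow> i = j" using enum i j by (auto simp: bij_betw_def inj_on_def)
    then show "nu (P i) f * point (P i) p = (if i = j then nu (P i) f else 0)" by (auto simp: point_def j)
  qed simp
  also have "\<dots> = nu p f" using j by (simp add: sum.delta)
  finally show ?thesis using True SS_places by (auto simp: principal_div_def fin_div_def)
next
  case False
  then have "point (P i) p = 0" if "i \<in> {1..Suc n}" for i using P_SS[OF that] by (auto simp: point_def)
  then have "(\<Sum>i = 1..Suc n. nu (P i) f * point (P i) p) = 0" by (intro sum.neutral) auto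
  then show ?thesis using False by (auto simp: principal_div_def fin_div_def)
qed

lemma principal_div_Div: "f \<noteq> 0 \<Longrightarrow> principal_div s f \<in> carrier (Div s)"
  unfolding Div_carrier
proof (intro conjI ballI)
  assume f: "f \<noteq> 0"
  have "{p. principal_div s f p \<noteq> 0} \<subseteq> {p. fin_div f p \<noteq> 0} \<union> {p. (\<Sum>i = 1..Suc n. nu (P i) f * point (P i) p) \<noteq> 0}"
    unfolding principal_div_eq by auto
  then show "finite {p. principal_div s f p \<noteq> 0}"
    using fin_div_finite finite_support_sum[of "{1..Suc n}" "\<lambda>i. nu (P i) f" P] by (auto intro: finite_subset)
  show "principal_div s f p \<in> GG s" if "p \<in> SS s" for p
    using that f nu_GG SS_places by (auto simp: principal_div_def)
  show "principal_div s f p \<in> \<int>" if "p \<in> places s - SS s" for p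
    using that fin_div_Ints[of f p] by (auto simp: principal_div_def fin_div_def)
qed (auto simp: principal_div_def)

lemma nu_mult_places: "p \<in> places s \<Longrightarrow> f \<noteq> 0 \<Longrightarrow> g \<noteq> 0 \<Longrightarrow> nu p (f * g) = nu p f + nu p g"
proof (cases "p \<in> SS s")
  case False
  assume p: "p \<in> places s" and fg: "f \<noteq> 0" "g \<noteq> 0"
  then obtain v where "p = Nonarch v" "v \<in> VV" using False places_eq by blast
  then show ?thesis using nval.v_mult[OF VV_nval, of v f g] fg by simp
qed (simp add: nu_mult)

lemma principal_div_mult: "f \<noteq> 0 \<Longrightarrow> g \<noteq> 0 \<Longrightarrow> principal_div s (f * g) p = principal_div s f p + principal_div s g p"
  by (simp add: principal_div_def nu_mult_places)

lemma principal_div_inverse: "f \<noteq> 0 \<Longrightarrow> principal_div s (1 / f) p = - principal_div s f p"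
  using principal_div_mult[of f "1 / f" p] principal_div_mult[of 1 1 p] by simp

lemma subgroup_Prin: "subgroup (Prin s) (Div s)"
proof (rule Dv.subgroupI)
  show "Prin s \<subseteq> carrier (Div s)" using principal_div_Div by (auto simp: Prin_def)
  show "Prin s \<noteq> {}" using one_neq_zero unfolding Prin_def by (metis DiffI UNIV_I empty_is_image ex_in_conv singletonD)
  fix D assume "D \<in> Prin s"
  then obtain f where f: "f \<noteq> 0" "D = principal_div s f" by (auto simp: Prin_def)
  have "inv\<^bsub>Div s\<^esub> D = principal_div s (1 / f)"
    unfolding f(2) inv_Div[OF principal_div_Div[OF f(1)]] using f(1) by (simp add: principal_div_inverse fun_eq_iff)
  then show "inv\<^bsub>Div s\<^esub> D \<in> Prin s" using f by (auto simp: Prin_def)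
  fix E assume "E \<in> Prin s"
  then obtain g where g: "g \<noteq> 0" "E = principal_div s g" by (auto simp: Prin_def)
  have "D \<otimes>\<^bsub>Div s\<^esub> E = principal_div s (f * g)" unfolding f(2) g(2) using f(1) g(1) by (simp add: principal_div_mult fun_eq_iff)
  then show "D \<otimes>\<^bsub>Div s\<^esub> E \<in> Prin s" using f g by (auto simp: Prin_def)
qed

sublocale Pr: normal "Prin s" "Div s"
  by (rule Dv.subgroup_imp_normal[OF subgroup_Prin])

sublocale Pc: comm_group "Pic s"
  unfolding Pic_def by (rule Dv.abelian_FactGroup[OF subgroup_Prin])

lemma div_class_carrier: "D \<in> carrier (Div s) \<Longrightarrow> div_class s D \<in> carrier (Pic s)"
  by (auto simp: Pic_def div_class_def carrier_FactGroup)

lemma div_class_add: "D \<in> carrier (Div s) \<Longrightarrow> E \<in> carrier (Div s) \<Longrightarrow>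
    div_class s D \<otimes>\<^bsub>Pic s\<^esub> div_class s E = div_class s (\<lambda>p. D p + E p)"
  using Pr.rcos_sum[of D E] by (simp add: Pic_def div_class_def)

lemma div_class_zero: "div_class s (\<lambda>p. 0) = \<one>\<^bsub>Pic s\<^esub>"
  using Dv.coset_join2[OF _ subgroup_Prin, of "\<lambda>p. 0"] Dv.one_closed subgroup.one_closed[OF subgroup_Prin]
  by (simp add: Pic_def div_class_def)

lemma div_class_uminus: "D \<in> carrier (Div s) \<Longrightarrow> inv\<^bsub>Pic s\<^esub> div_class s D = div_class s (\<lambda>p. - D p)"
  by (rule Pc.inv_equality) (simp_all add: div_class_add Div_uminus div_class_carrier div_class_zero)

lemma div_class_principal:
  assumes "E \<in> carrier (Div s)" "f \<noteq> 0" "\<And>p. D p = E p + principal_div s f p"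
  shows "div_class s D = div_class s E"
proof -
  have "D \<in> div_class s E"
    unfolding div_class_def r_coset_def Prin_def
    using assms by (auto simp: fun_eq_iff intro!: exI[of _ f])
  then show ?thesis
    using Dv.repr_independence[OF _ assms(1) subgroup_Prin, of D] by (simp add: div_class_def)
qed

abbreviation "ptc \<equiv> div_class s (point PN)"
abbreviation "Npt \<equiv> generate (Pic s) {ptc}"

lemma point_Div: "c \<in> GG s \<Longrightarrow> (\<lambda>p. c * point PN p) \<in> carrier (Div s)"
  using PN_SS SS_places by (auto simp: Div_carrier point_def GG_closed)

lemma point_Div_1: "1 \<in> GG s" by (cases s) auto

lemma ptc_carrier: "ptc \<in> carrier (Pic s)"
  using div_class_carrier[OF point_Div[OF point_Div_1]] by simp

lemma subgroup_Npt: "subgroup Npt (Pic s)"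
  by (rule Pc.generate_is_subgroup) (simp add: ptc_carrier)

sublocale Np: normal Npt "Pic s"
  by (rule Pc.subgroup_imp_normal[OF subgroup_Npt])

lemma int_point_Npt: "div_class s (\<lambda>p. of_int k * point PN p) \<in> Npt"
proof -
  have pt: "(\<lambda>p. of_int k * point PN p) \<in> carrier (Div s)" for k :: int
    by (rule point_Div) (cases s; simp)
  have nat: "div_class s (\<lambda>p. of_int (int m) * point PN p) \<in> Npt" for m
  proof (induction m)
    case 0 then show ?case using subgroup.one_closed[OF subgroup_Npt] by (simp add: div_class_zero)
  next
    case (Suc m)
    have "div_class s (\<lambda>p. of_int (int m) * point PN p) \<otimes>\<^bsub>Pic s\<^esub> ptc \<in> Npt"
      using Suc generate.incl[of ptc "{ptc}" "Pic s"] by (intro subgroup.m_closed[OF subgroup_Npt]) auto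
    then show ?case using div_class_add[OF pt[of "int m"] pt[of 1]] by (simp add: distrib_right add.commute)
  qed
  show ?thesis
  proof (cases k)
    case (nonneg m) then show ?thesis using nat by simp
  next
    case (neg m)
    have "inv\<^bsub>Pic s\<^esub> div_class s (\<lambda>p. of_int (int (Suc m)) * point PN p) \<in> Npt"
      by (intro subgroup.m_inv_closed[OF subgroup_Npt] nat)
    moreover have "(\<lambda>p. of_int k * point PN p) = (\<lambda>p. - (of_int (int (Suc m)) * point PN p))"
      unfolding neg by (simp only: of_int_minus mult_minus_left)
    ultimately show ?thesis using div_class_uminus[OF pt[of "int (Suc m)"]] by metis
  qed
qed

lemma Npt_coset_eq:
  assumes "E \<in> carrier (Div s)" "f \<noteq> 0" "k \<in> \<int>" "\<And>p. D p = E p + principal_div s f p + k * point PN p"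
  shows "Npt #>\<^bsub>Pic s\<^esub> div_class s D = Npt #>\<^bsub>Pic s\<^esub> div_class s E"
proof -
  obtain j :: int where j: "k = of_int j" using assms(3) by (elim Ints_cases)
  have pt: "(\<lambda>p. of_int j * point PN p) \<in> carrier (Div s)"
    by (rule point_Div) (cases s; simp)
  have "div_class s D = div_class s (\<lambda>p. of_int j * point PN p + E p)"
    by (rule div_class_principal[of _ f]) (use assms j Div_add[OF pt assms(1)] in auto)
  also have "\<dots> = div_class s (\<lambda>p. of_int j * point PN p) \<otimes>\<^bsub>Pic s\<^esub> div_class s E"
    using div_class_add[OF pt assms(1)] by simp
  finally have "div_class s D \<in> Npt #>\<^bsub>Pic s\<^esub> div_class s E"
    using int_point_Npt[of j] by (auto simp: r_coset_def)
  then show ?thesis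
    using Pc.repr_independence[OF _ div_class_carrier[OF assms(1)] subgroup_Npt] by simp
qed

text \<open>The projection to degree 0 along the last place. It is additive, and for number fields
  \<open>\<Phi>\<close> is the class of the projected divisor of the representation.\<close>

definition nrm :: "('a place \<Rightarrow> real) \<Rightarrow> 'a place \<Rightarrow> real"
  where "nrm D = (\<lambda>p. D p - div_deg s D / place_deg s PN * point PN p)"

lemma finite_support_point: "finite {p. c * point PN p \<noteq> 0}"
  by (rule finite_subset[of _ "{PN}"]) (auto simp: point_def)

lemma div_deg_nrm: "D \<in> carrier (Div s) \<Longrightarrow> div_deg s (nrm D) = 0"
proof -
  assume D: "D \<in> carrier (Div s)"
  define c where "c = - (div_deg s D / place_deg s PN)"
  have "nrm D = (\<lambda>p. D p + c * point PN p)" by (simp add: nrm_def c_def)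
  then have "div_deg s (nrm D) = div_deg s D + c * place_deg s PN"
    using D finite_support_point by (simp add: div_deg_add div_deg_scale div_deg_point Div_carrier)
  then show ?thesis using deg_pos[OF PN_SS] by (simp add: c_def)
qed

lemma nrm_Div: "s = Number_Field \<Longrightarrow> D \<in> carrier (Div s) \<Longrightarrow> nrm D \<in> carrier (Div s)"
proof -
  assume s: "s = Number_Field" and D: "D \<in> carrier (Div s)"
  have "(\<lambda>p. - (div_deg s D / place_deg s PN) * point PN p) \<in> carrier (Div s)"
    by (rule point_Div) (simp add: s)
  from Div_add[OF D this] show ?thesis by (simp add: nrm_def)
qed

text \<open>The projection annihilates multiples of the last place and fixes principal divisors,
  because their degree is 0. This is where the product formula enters.\<close>

lemma nrm_class_eq:
  assumes s: "s = Number_Field" and E: "E \<in> carrier (Div s)" and "f \<noteq> 0"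
    and D: "\<And>p. D p = E p + principal_div s f p + k * point PN p"
  shows "div_class s (nrm D) = div_class s (nrm E)"
proof (rule div_class_principal[OF nrm_Div[OF s E] \<open>f \<noteq> 0\<close>])
  have fE: "finite {p. E p \<noteq> 0}" using E by (simp add: Div_carrier)
  have ff: "finite {p. principal_div s f p \<noteq> 0}" using principal_div_Div[OF \<open>f \<noteq> 0\<close>] by (simp add: Div_carrier)
  have "finite {p. E p + principal_div s f p \<noteq> 0}"
    by (rule finite_subset[OF _ finite_UnI[OF fE ff]]) auto
  moreover have "D = (\<lambda>p. E p + principal_div s f p + k * point PN p)" using D by auto
  ultimately have "div_deg s D = div_deg s E + k * place_deg s PN"
    using fE ff finite_support_point principal_deg[OF s \<open>f \<noteq> 0\<close>]
    by (simp add: div_deg_add div_deg_scale div_deg_point)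
  then have "div_deg s D / place_deg s PN = div_deg s E / place_deg s PN + k"
    using deg_pos[OF PN_SS] by (simp add: add_divide_distrib)
  then show "nrm D p = nrm E p + principal_div s f p" for p
    unfolding nrm_def D by (simp add: distrib_right)
qed

lemma nrm_add:
  assumes "D \<in> carrier (Div s)" "E \<in> carrier (Div s)"
  shows "nrm (\<lambda>p. D p + E p) = (\<lambda>p. nrm D p + nrm E p)"
  using assms by (simp add: nrm_def div_deg_add Div_carrier fun_eq_iff add_divide_distrib algebra_simps)

lemma nrm_uminus: "nrm (\<lambda>p. - D p) = (\<lambda>p. - nrm D p)"
  using div_deg_scale[of s "-1" D] by (simp add: nrm_def fun_eq_iff)

lemma subgroup_Pic0: "subgroup {div_class s D | D. D \<in> carrier (Div s) \<and> div_deg s D = 0} (Pic s)"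
proof (rule Pc.subgroupI)
  show "{div_class s D | D. D \<in> carrier (Div s) \<and> div_deg s D = 0} \<subseteq> carrier (Pic s)"
    using div_class_carrier by auto
  show "{div_class s D | D. D \<in> carrier (Div s) \<and> div_deg s D = 0} \<noteq> {}"
    using Dv.one_closed by (auto simp: div_deg_def intro!: exI[of _ "\<lambda>p. 0"])
  fix a assume "a \<in> {div_class s D | D. D \<in> carrier (Div s) \<and> div_deg s D = 0}"
  then obtain D where D: "a = div_class s D" "D \<in> carrier (Div s)" "div_deg s D = 0" by auto
  have "div_deg s (\<lambda>p. - D p) = 0" using div_deg_scale[of s "-1" D] D by simp
  then show "inv\<^bsub>Pic s\<^esub> a \<in> {div_class s D | D. D \<in> carrier (Div s) \<and> div_deg s D = 0}"
    using D Div_uminus[OF D(2)] by (auto simp: div_class_uminus)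
  fix b assume "b \<in> {div_class s D | D. D \<in> carrier (Div s) \<and> div_deg s D = 0}"
  then obtain E where E: "b = div_class s E" "E \<in> carrier (Div s)" "div_deg s E = 0" by auto
  have "div_deg s (\<lambda>p. D p + E p) = 0" using D E by (simp add: div_deg_add Div_carrier)
  then show "a \<otimes>\<^bsub>Pic s\<^esub> b \<in> {div_class s D | D. D \<in> carrier (Div s) \<and> div_deg s D = 0}"
    using D E Div_add[OF D(2) E(2)] by (auto simp: div_class_add)
qed

subsection \<open>The divisor of a representation\<close>

lemma sum_point_Div: "\<forall>i\<in>{1..n}. u i \<in> GG s \<Longrightarrow> (\<lambda>p. \<Sum>i = 1..n. u i * point (P i) p) \<in> carrier (Div s)"
proof -
  assume u: "\<forall>i\<in>{1..n}. u i \<in> GG s"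
  have "(\<Sum>i\<in>I. u i * point (P i) p) \<in> GG s" if "I \<subseteq> {1..n}" "finite I" for I p
    using that(2,1) by (induction I) (auto simp: GG_closed u point_def)
  moreover have *: "(\<Sum>i = 1..n. u i * point (P i) p) = 0" if "p \<notin> SS s" for p
    using that P_SS by (intro sum.neutral) (auto simp: point_def)
  ultimately show ?thesis
    using finite_support_sum[of "{1..n}" u P] SS_places unfolding Div_carrier by fastforce
qed

lemma ideal_div_Div: "fideal b \<Longrightarrow> ideal_div s b \<in> carrier (Div s)"
  unfolding Div_carrier
proof (intro conjI ballI)
  assume b: "fideal b"
  show "{p. ideal_div s b p \<noteq> 0} \<subseteq> places s" using ideal_div_support[OF b] by auto
  show "finite {p. ideal_div s b p \<noteq> 0}" by (rule ideal_div_finite[OF b])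
  show "ideal_div s b p \<in> GG s" if "p \<in> SS s" for p
    using that ideal_div_support[OF b] GG_closed(1) by force
qed (rule ideal_div_Ints)

text \<open>The ideal chosen from the class is \<open>b\<close> scaled by some \<open>h\<close> with
  value 0 at all places of S, so the divisor of \<open>h\<close> equals its finite part, which is
  exactly the change of the ideal divisor. The divisor of a representation is thus fixed up to
  principal divisors.\<close>

lemma rep_div_class:
  assumes b: "reduced s P n b" and u: "\<forall>i\<in>{1..n}. u i \<in> GG s"
  shows "rep_div s P n (sim_class s P n b, u) \<in> carrier (Div s)"
    and "rep_div_deg s P n (sim_class s P n b, u) = div_deg s (rep_div s P n (sim_class s P n b, u))"
    and "\<exists>h. h \<noteq> 0 \<and> (\<forall>p\<in>SS s. nu p h = 0) \<and> (\<forall>p. rep_div s P n (sim_class s P n b, u) p =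
      ideal_div s b p + (\<Sum>i = 1..n. u i * point (P i) p) + principal_div s h p)"
proof -
  define b1 where "b1 = (SOME b'. b' \<in> sim_class s P n b)"
  have "b1 \<in> sim_class s P n b" unfolding b1_def
    by (rule someI[of _ b]) (use sim_refl[OF b] in \<open>simp add: sim_class_def\<close>)
  then obtain h where h: "reduced s P n b1" "h \<noteq> 0" "b1 = scale_ideal h b" "\<And>p. p \<in> SS s \<Longrightarrow> nu p h = 0"
    by (rule sim_classD) blast
  have fid: "fideal b1" "fideal b" using reduced_fideal h(1) b by auto
  have rd: "rep_div s P n (sim_class s P n b, u) = (\<lambda>p. ideal_div s b1 p + (\<Sum>i = 1..n. u i * point (P i) p))"
    by (simp add: rep_div_def b1_def)
  show D: "rep_div s P n (sim_class s P n b, u) \<in> carrier (Div s)"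
    unfolding rd by (rule Div_add[OF ideal_div_Div[OF fid(1)] sum_point_Div[OF u]])
  show "rep_div_deg s P n (sim_class s P n b, u) = div_deg s (rep_div s P n (sim_class s P n b, u))"
    unfolding rd using ideal_div_finite[OF fid(1)] finite_support_sum[of "{1..n}" u P]
    by (simp add: rep_div_deg_def div_deg_add div_deg_sum flip: b1_def)
  have "rep_div s P n (sim_class s P n b, u) p =
      ideal_div s b p + (\<Sum>i = 1..n. u i * point (P i) p) + principal_div s (1 / h) p" for p
  proof -
    have "principal_div s h p = fin_div h p"
      unfolding principal_div_eq using h(4) P_SS by (simp add: sum.neutral)
    then show ?thesis using h fid by (simp add: rd ideal_div_scale principal_div_inverse)
  qed
  moreover have "nu p (1 / h) = 0" if "p \<in> SS s" for p using h that by (simp add: nu_inverse)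
  ultimately show "\<exists>h. h \<noteq> 0 \<and> (\<forall>p\<in>SS s. nu p h = 0) \<and> (\<forall>p. rep_div s P n (sim_class s P n b, u) p =
      ideal_div s b p + (\<Sum>i = 1..n. u i * point (P i) p) + principal_div s h p)"
    using h(2) by (intro exI[of _ "1 / h"]) auto
qed

lemma rep_div_obtain:
  assumes b: "reduced s P n b" and u: "\<forall>i\<in>{1..n}. u i \<in> GG s"
  obtains h where "h \<noteq> 0" "\<forall>p. rep_div s P n (sim_class s P n b, u) p =
      ideal_div s b p + (\<Sum>i = 1..n. u i * point (P i) p) + principal_div s h p"
  using rep_div_class(3)[OF b, of u, OF u] by (elim exE conjE)

text \<open>Scaling the ideal contributes the finite part of the divisor of \<open>\<mu>\<close>,
  and the shift of the tuple contributes its part at the first \<open>n\<close> places of S. Only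
  the last place is missing, whence the multiple of \<open>PN\<close>.\<close>

lemma rep_div_shift:
  assumes c: "fideal c" and \<mu>: "\<mu> \<noteq> 0" and red: "reduced s P n (scale_ideal (1 / \<mu>) c)"
    and u: "\<forall>i\<in>{1..n}. u i \<in> GG s"
  obtains g k where "g \<noteq> 0" "k \<in> GG s"
    "\<forall>p. rep_div s P n (sim_class s P n (scale_ideal (1 / \<mu>) c), \<lambda>i\<in>{1..n}. u i + nu (P i) \<mu>) p =
      ideal_div s c p + (\<Sum>i = 1..n. u i * point (P i) p) + principal_div s g p + k * point PN p"
proof -
  let ?u = "\<lambda>i\<in>{1..n}. u i + nu (P i) \<mu>"
  have u': "\<forall>i\<in>{1..n}. ?u i \<in> GG s"
    using u nu_GG[OF P_SS \<mu>] by (auto intro!: GG_closed)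
  obtain h where h: "h \<noteq> 0" "\<forall>p. rep_div s P n (sim_class s P n (scale_ideal (1 / \<mu>) c), ?u) p =
      ideal_div s (scale_ideal (1 / \<mu>) c) p + (\<Sum>i = 1..n. ?u i * point (P i) p) + principal_div s h p"
    by (rule rep_div_obtain[OF red, of ?u, OF u'])
  have fd: "fin_div (1 / \<mu>) p = - fin_div \<mu> p" for p
  proof (cases "p \<in> places s - SS s")
    case True
    then obtain v where "p = Nonarch v" "v \<in> VV" using places_eq by blast
    then show ?thesis using True nval.v_inverse[OF VV_nval, of v \<mu>] by (simp add: fin_div_def)
  qed (auto simp: fin_div_def)
  show ?thesis
  proof (rule that[of "\<mu> * h" "- nu PN \<mu>"])
    show "\<mu> * h \<noteq> 0" using \<mu> h by simp
    show "- nu PN \<mu> \<in> GG s" using nu_GG[OF PN_SS \<mu>] GG_closed by blast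
    show "\<forall>p. rep_div s P n (sim_class s P n (scale_ideal (1 / \<mu>) c), ?u) p =
        ideal_div s c p + (\<Sum>i = 1..n. u i * point (P i) p) + principal_div s (\<mu> * h) p + - nu PN \<mu> * point PN p"
    proof
    fix p
    have "(\<Sum>i = 1..n. ?u i * point (P i) p) = (\<Sum>i = 1..n. u i * point (P i) p) + (\<Sum>i = 1..n. nu (P i) \<mu> * point (P i) p)"
      by (simp add: distrib_right sum.distrib)
    moreover have "principal_div s \<mu> p = fin_div \<mu> p + (\<Sum>i = 1..n. nu (P i) \<mu> * point (P i) p) + nu PN \<mu> * point PN p"
      unfolding principal_div_eq by simp
    ultimately show "rep_div s P n (sim_class s P n (scale_ideal (1 / \<mu>) c), ?u) p =
        ideal_div s c p + (\<Sum>i = 1..n. u i * point (P i) p) + principal_div s (\<mu> * h) p + - nu PN \<mu> * point PN p"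
      using c \<mu> h by (simp add: ideal_div_scale fd principal_div_mult)
    qed
  qed
qed

lemma Phi_nf_nrm:
  assumes "s = Number_Field" "rep_div_deg s P n A = div_deg s (rep_div s P n A)"
  shows "Phi_number_field s P n A = div_class s (nrm (rep_div s P n A))"
  using assms(2) by (simp add: Phi_number_field_def nrm_def)

text \<open>One identity of divisors serves both targets: the multiple of the last place is removed
  by the projection to degree 0, or its class lies in the subgroup divided out.\<close>

lemma Phi_addI:
  assumes A: "rep_div s P n A \<in> carrier (Div s)" "rep_div_deg s P n A = div_deg s (rep_div s P n A)"
    and A': "rep_div s P n A' \<in> carrier (Div s)" "rep_div_deg s P n A' = div_deg s (rep_div s P n A')"
    and B: "rep_div s P n B \<in> carrier (Div s)" "rep_div_deg s P n B = div_deg s (rep_div s P n B)"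
    and g: "g \<noteq> 0" "k \<in> GG s"
      "\<And>p. rep_div s P n A p + rep_div s P n A' p = rep_div s P n B p + principal_div s g p + k * point PN p"
  shows "Phi_add s P n A A' B"
proof (cases s)
  case Number_Field
  have "Phi_number_field s P n A \<otimes>\<^bsub>Pic0 s\<^esub> Phi_number_field s P n A' =
      div_class s (nrm (rep_div s P n A)) \<otimes>\<^bsub>Pic s\<^esub> div_class s (nrm (rep_div s P n A'))"
    using Phi_nf_nrm[OF Number_Field] A A' by (simp add: Pic0_def)
  also have "\<dots> = div_class s (nrm (\<lambda>p. rep_div s P n A p + rep_div s P n A' p))"
    using A A' nrm_Div[OF Number_Field] by (simp add: div_class_add nrm_add)
  also have "\<dots> = div_class s (nrm (rep_div s P n B))"
    by (rule nrm_class_eq[OF Number_Field B(1) g(1,3)])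
  also have "\<dots> = Phi_number_field s P n B" using Phi_nf_nrm[OF Number_Field] B by simp
  finally show ?thesis using Number_Field by simp
next
  case (Function_Field kk x q)
  have "Phi_function_field s P n A \<otimes>\<^bsub>Pic_mod s PN\<^esub> Phi_function_field s P n A' =
      Npt #>\<^bsub>Pic s\<^esub> (div_class s (rep_div s P n A) \<otimes>\<^bsub>Pic s\<^esub> div_class s (rep_div s P n A'))"
    using A A' Np.rcos_sum by (simp add: Phi_function_field_def Pic_mod_def div_class_carrier)
  also have "\<dots> = Npt #>\<^bsub>Pic s\<^esub> div_class s (\<lambda>p. rep_div s P n A p + rep_div s P n A' p)"
    using A A' by (simp add: div_class_add)
  also have "\<dots> = Npt #>\<^bsub>Pic s\<^esub> div_class s (rep_div s P n B)"
    by (rule Npt_coset_eq[OF B(1) g(1) _ g(3)]) (use g Function_Field in simp)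
  finally show ?thesis using Function_Field by (simp add: Phi_function_field_def)
qed

lemma Phi_negI:
  assumes A: "rep_div s P n A \<in> carrier (Div s)" "rep_div_deg s P n A = div_deg s (rep_div s P n A)"
    and B: "rep_div s P n B \<in> carrier (Div s)" "rep_div_deg s P n B = div_deg s (rep_div s P n B)"
    and g: "g \<noteq> 0" "k \<in> GG s"
      "\<And>p. - rep_div s P n A p = rep_div s P n B p + principal_div s g p + k * point PN p"
  shows "Phi_neg s P n A B"
proof (cases s)
  case Number_Field
  have "Phi_number_field s P n A \<in> {div_class s D | D. D \<in> carrier (Div s) \<and> div_deg s D = 0}"
    using Phi_nf_nrm[OF Number_Field] A nrm_Div[OF Number_Field A(1)] div_deg_nrm[OF A(1)] by auto
  \<comment> \<open>Inverses in \<open>Pic0\<close> agree with those in \<open>Pic\<close> on its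
    carrier, so the class first had to be represented by a divisor of degree 0.\<close>
  then have "inv\<^bsub>Pic0 s\<^esub> (Phi_number_field s P n A) = inv\<^bsub>Pic s\<^esub> (Phi_number_field s P n A)"
    unfolding Pic0_def by (rule Pc.m_inv_consistent[OF subgroup_Pic0])
  also have "\<dots> = div_class s (nrm (\<lambda>p. - rep_div s P n A p))"
    using Phi_nf_nrm[OF Number_Field] A nrm_Div[OF Number_Field] by (simp add: div_class_uminus nrm_uminus)
  also have "\<dots> = div_class s (nrm (rep_div s P n B))"
    by (rule nrm_class_eq[OF Number_Field B(1) g(1,3)])
  also have "\<dots> = Phi_number_field s P n B" using Phi_nf_nrm[OF Number_Field] B by simp
  finally show ?thesis using Number_Field by simp
next
  case (Function_Field kk x q)
  have AC: "div_class s (rep_div s P n A) \<in> carrier (Pic s)" using A div_class_carrier by blast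
  have "Npt #>\<^bsub>Pic s\<^esub> div_class s (rep_div s P n A) \<in> carrier (Pic_mod s PN)"
    using AC by (auto simp: Pic_mod_def carrier_FactGroup)
  then have "inv\<^bsub>Pic_mod s PN\<^esub> (Phi_function_field s P n A) =
      Npt #>\<^bsub>Pic s\<^esub> (inv\<^bsub>Pic s\<^esub> div_class s (rep_div s P n A))"
    using Np.inv_FactGroup Np.rcos_inv[OF AC] by (simp add: Phi_function_field_def Pic_mod_def)
  also have "\<dots> = Npt #>\<^bsub>Pic s\<^esub> div_class s (\<lambda>p. - rep_div s P n A p)"
    using A by (simp add: div_class_uminus)
  also have "\<dots> = Npt #>\<^bsub>Pic s\<^esub> div_class s (rep_div s P n B)"
    by (rule Npt_coset_eq[OF B(1) g(1) _ g(3)]) (use g Function_Field in simp)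
  finally show ?thesis using Function_Field by (simp add: Phi_function_field_def)
qed

lemma tuples_GG: "t \<in> tuples s n \<Longrightarrow> \<forall>i\<in>{1..n}. t i \<in> GG s"
  by (auto simp: tuples_def)

lemma Phi_add_rep:
  assumes b: "reduced s P n b" "t \<in> tuples s n" and b': "reduced s P n b'" "t' \<in> tuples s n"
    and \<mu>: "\<mu> \<noteq> 0" "reduced s P n (scale_ideal (1 / \<mu>) (ideal_prod KR b b'))"
  shows "Phi_add s P n (sim_class s P n b, t) (sim_class s P n b', t')
    (sim_class s P n (scale_ideal (1 / \<mu>) (ideal_prod KR b b')), \<lambda>i\<in>{1..n}. t i + t' i + nu (P i) \<mu>)"
proof -
  have fid: "fideal b" "fideal b'" using b b' reduced_fideal by auto
  have tt: "\<forall>i\<in>{1..n}. t i + t' i \<in> GG s"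
    using tuples_GG[OF b(2)] tuples_GG[OF b'(2)] GG_closed(2) by blast
  then have u: "\<forall>i\<in>{1..n}. (\<lambda>i\<in>{1..n}. t i + t' i + nu (P i) \<mu>) i \<in> GG s"
    using nu_GG[OF P_SS \<mu>(1)] by (auto intro!: GG_closed(2)[of "t _ + t' _"])
  obtain g k where g: "g \<noteq> 0" "k \<in> GG s"
    "\<forall>p. rep_div s P n (sim_class s P n (scale_ideal (1 / \<mu>) (ideal_prod KR b b')), \<lambda>i\<in>{1..n}. t i + t' i + nu (P i) \<mu>) p =
      ideal_div s (ideal_prod KR b b') p + (\<Sum>i = 1..n. (t i + t' i) * point (P i) p) + principal_div s g p + k * point PN p"
    by (rule rep_div_shift[OF fideal_prod[OF fid] \<mu>, of "\<lambda>i. t i + t' i", OF tt])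
  note rA = rep_div_class[OF b(1), of t, OF tuples_GG[OF b(2)]]
  note rA' = rep_div_class[OF b'(1), of t', OF tuples_GG[OF b'(2)]]
  note rB = rep_div_class[OF \<mu>(2), of "\<lambda>i\<in>{1..n}. t i + t' i + nu (P i) \<mu>", OF u]
  obtain h where h: "h \<noteq> 0" "\<forall>p. rep_div s P n (sim_class s P n b, t) p =
      ideal_div s b p + (\<Sum>i = 1..n. t i * point (P i) p) + principal_div s h p"
    by (rule rep_div_obtain[OF b(1), of t, OF tuples_GG[OF b(2)]])
  obtain h' where h': "h' \<noteq> 0" "\<forall>p. rep_div s P n (sim_class s P n b', t') p =
      ideal_div s b' p + (\<Sum>i = 1..n. t' i * point (P i) p) + principal_div s h' p"
    by (rule rep_div_obtain[OF b'(1), of t', OF tuples_GG[OF b'(2)]])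
  show ?thesis
  proof (rule Phi_addI[OF rA(1,2) rA'(1,2) rB(1,2), of "h * h' * (1 / g)" "- k"])
    show "h * h' * (1 / g) \<noteq> 0" using g h h' by simp
    have "principal_div s (h * h' * (1 / g)) p = principal_div s h p + principal_div s h' p - principal_div s g p" for p
      using g h h' principal_div_mult[of "h * h'" "1 / g" p] principal_div_mult[of h h' p] principal_div_inverse[of g p] by simp
    then show "rep_div s P n (sim_class s P n b, t) p + rep_div s P n (sim_class s P n b', t') p =
        rep_div s P n (sim_class s P n (scale_ideal (1 / \<mu>) (ideal_prod KR b b')), \<lambda>i\<in>{1..n}. t i + t' i + nu (P i) \<mu>) p +
        principal_div s (h * h' * (1 / g)) p + - k * point PN p" for p
      by (simp only: h(2)[rule_format] h'(2)[rule_format] g(3)[rule_format] ideal_div_prod[OF fid] distrib_right sum.distrib)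
  qed (use g GG_closed in auto)
qed

lemma Phi_neg_rep:
  assumes b: "reduced s P n b" "t \<in> tuples s n"
    and \<mu>: "\<mu> \<noteq> 0" "reduced s P n (scale_ideal (1 / \<mu>) (inv\<^bsub>G\<^esub> b))"
  shows "Phi_neg s P n (sim_class s P n b, t)
    (sim_class s P n (scale_ideal (1 / \<mu>) (inv\<^bsub>G\<^esub> b)), \<lambda>i\<in>{1..n}. - t i + nu (P i) \<mu>)"
proof -
  have fid: "fideal b" using b reduced_fideal by auto
  have tt: "\<forall>i\<in>{1..n}. - t i \<in> GG s"
    using tuples_GG[OF b(2)] GG_closed(3) by blast
  then have u: "\<forall>i\<in>{1..n}. (\<lambda>i\<in>{1..n}. - t i + nu (P i) \<mu>) i \<in> GG s"
    using GG_closed(2)[OF _ nu_GG[OF P_SS \<mu>(1)]] by fastforce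
  obtain g k where g: "g \<noteq> 0" "k \<in> GG s"
    "\<forall>p. rep_div s P n (sim_class s P n (scale_ideal (1 / \<mu>) (inv\<^bsub>G\<^esub> b)), \<lambda>i\<in>{1..n}. - t i + nu (P i) \<mu>) p =
      ideal_div s (inv\<^bsub>G\<^esub> b) p + (\<Sum>i = 1..n. (- t i) * point (P i) p) + principal_div s g p + k * point PN p"
    by (rule rep_div_shift[OF fideal_inv[OF fid] \<mu>, of "\<lambda>i. - t i", OF tt])
  note rA = rep_div_class[OF b(1), of t, OF tuples_GG[OF b(2)]]
  note rB = rep_div_class[OF \<mu>(2), of "\<lambda>i\<in>{1..n}. - t i + nu (P i) \<mu>", OF u]
  obtain h where h: "h \<noteq> 0" "\<forall>p. rep_div s P n (sim_class s P n b, t) p =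
      ideal_div s b p + (\<Sum>i = 1..n. t i * point (P i) p) + principal_div s h p"
    by (rule rep_div_obtain[OF b(1), of t, OF tuples_GG[OF b(2)]])
  show ?thesis
  proof (rule Phi_negI[OF rA(1,2) rB(1,2), of "1 / (h * g)" "- k"])
    show "1 / (h * g) \<noteq> 0" using g h by simp
    have "principal_div s (1 / (h * g)) p = - principal_div s h p - principal_div s g p" for p
      using g h principal_div_mult[of h g p] principal_div_inverse[of "h * g" p] by simp
    then show "- rep_div s P n (sim_class s P n b, t) p =
        rep_div s P n (sim_class s P n (scale_ideal (1 / \<mu>) (inv\<^bsub>G\<^esub> b)), \<lambda>i\<in>{1..n}. - t i + nu (P i) \<mu>) p +
        principal_div s (1 / (h * g)) p + - k * point PN p" for p
      by (simp only: h(2)[rule_format] g(3)[rule_format] ideal_div_inv[OF fid] mult_minus_left sum_negf)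
  qed (use g GG_closed in auto)
qed

theorem representation_arithmetic:
  assumes A: "(sim_class s P n b, t) \<in> Rep_f_K s P n"
    and A': "(sim_class s P n b', t') \<in> Rep_f_K s P n"
  shows
    "(let c = b \<otimes>\<^bsub>Id_group s\<^esub> b'; u = (\<lambda>i\<in>{1..n}. t i + t' i) in
       (\<exists>l. minimal_level s P n c u l) \<and>
       (\<forall>l \<mu>. minimal_level s P n c u l \<longrightarrow>
          is_smallest s P n (Box s P n c (u(Suc n := l)) - {0}) \<mu> \<longrightarrow>
          (let B = (sim_class s P n (scale_ideal (1 / \<mu>) c),
                    \<lambda>i\<in>{1..n}. t i + t' i + nu (P i) \<mu>)
           in B \<in> Rep_f_K s P n \<and>
              Phi_add s P n (sim_class s P n b, t) (sim_class s P n b', t') B)))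
     \<and>
     (let c = inv\<^bsub>Id_group s\<^esub> b; u = (\<lambda>i\<in>{1..n}. - t i) in
       (\<exists>l. minimal_level s P n c u l) \<and>
       (\<forall>l \<mu>. minimal_level s P n c u l \<longrightarrow>
          is_smallest s P n (Box s P n c (u(Suc n := l)) - {0}) \<mu> \<longrightarrow>
          (let C = (sim_class s P n (scale_ideal (1 / \<mu>) c),
                    \<lambda>i\<in>{1..n}. - t i + nu (P i) \<mu>)
           in C \<in> Rep_f_K s P n \<and> Phi_neg s P n (sim_class s P n b, t) C)))"
proof -
  note b = Rep_f_KD[OF A] and b' = Rep_f_KD[OF A']
  have fid: "fideal b" "fideal b'" using b b' reduced_fideal by auto
  have \<mu>0: "\<mu> \<noteq> 0" if "is_smallest s P n (M - {0}) \<mu>" for \<mu> M using that by (auto simp: is_smallest_def)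
  have res: "(\<lambda>i\<in>{1..n}. (\<lambda>i\<in>{1..n}. f i) i + nu (P i) \<mu>) = (\<lambda>i\<in>{1..n}. f i + nu (P i) \<mu>)" for f \<mu>
    by (rule restrict_ext) simp
  show ?thesis
    unfolding Let_def G_simps(2)
  proof (intro conjI allI impI)
    fix l \<mu>
    assume *: "is_smallest s P n (Box s P n (ideal_prod KR b b') ((\<lambda>i\<in>{1..n}. t i + t' i)(Suc n := l)) - {0}) \<mu>"
    have u: "\<forall>i\<in>{1..n}. (\<lambda>i\<in>{1..n}. t i + t' i) i \<in> GG s"
      using tuples_GG[OF b(2)] tuples_GG[OF b'(2)] by (simp add: GG_closed)
    note r = rep_mem[OF fideal_prod[OF fid], of "\<lambda>i\<in>{1..n}. t i + t' i", OF u *, unfolded res]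
    show "(sim_class s P n (scale_ideal (1 / \<mu>) (ideal_prod KR b b')), \<lambda>i\<in>{1..n}. t i + t' i + nu (P i) \<mu>) \<in> Rep_f_K s P n"
      by (rule r(2))
    show "Phi_add s P n (sim_class s P n b, t) (sim_class s P n b', t')
      (sim_class s P n (scale_ideal (1 / \<mu>) (ideal_prod KR b b')), \<lambda>i\<in>{1..n}. t i + t' i + nu (P i) \<mu>)"
      by (rule Phi_add_rep[OF b b' \<mu>0[OF *] r(1)])
  next
    fix l \<mu>
    assume *: "is_smallest s P n (Box s P n (inv\<^bsub>G\<^esub> b) ((\<lambda>i\<in>{1..n}. - t i)(Suc n := l)) - {0}) \<mu>"
    have u: "\<forall>i\<in>{1..n}. (\<lambda>i\<in>{1..n}. - t i) i \<in> GG s"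
      using tuples_GG[OF b(2)] by (simp add: GG_closed)
    note r = rep_mem[OF fideal_inv[OF fid(1)], of "\<lambda>i\<in>{1..n}. - t i", OF u *, unfolded res]
    show "(sim_class s P n (scale_ideal (1 / \<mu>) (inv\<^bsub>G\<^esub> b)), \<lambda>i\<in>{1..n}. - t i + nu (P i) \<mu>) \<in> Rep_f_K s P n"
      by (rule r(2))
    show "Phi_neg s P n (sim_class s P n b, t)
      (sim_class s P n (scale_ideal (1 / \<mu>) (inv\<^bsub>G\<^esub> b)), \<lambda>i\<in>{1..n}. - t i + nu (P i) \<mu>)"
      by (rule Phi_neg_rep[OF b \<mu>0[OF *] r(1)])
  qed (intro minimal_level_exists fideal_prod fideal_inv fid)+
qed

end

section \<open>Bases over subfields\<close>

interpretation KR: cring "KR :: 'a::field ring" by (rule cring_from_type_algebra)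

lemma a_inv_KR [simp]: "a_inv KR x = - x"
  by (rule KR.minus_equality) auto

lemma m_inv_KR: "x \<noteq> 0 \<Longrightarrow> m_inv KR x = 1 / x"
  by (rule KR.comm_inv_char) auto

lemma coeff_ring_subfield: "subfield k KR \<Longrightarrow> coeff_ring k"
proof
  assume k: "subfield k KR"
  then have sr: "subring k KR" by (simp add: subfield_def subcring_def subdomain_def)
  show "0 \<in> k" "1 \<in> k" using subringE(2,3)[OF sr] by auto
  show "a + b \<in> k" "a * b \<in> k" if "a \<in> k" "b \<in> k" for a b using subringE(6,7)[OF sr that] by auto
  show "- a \<in> k" if "a \<in> k" for a using subringE(5)[OF sr that] by simp
qed

lemma subfield_inverse:
  assumes k: "subfield k KR" and c: "c \<in> k"
  shows "1 / c \<in> k"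
proof (cases "c = 0")
  case True
  then show ?thesis using coeff_ring.R_zero[OF coeff_ring_subfield[OF k]] by simp
next
  case False
  interpret field KR by (rule field_from_type_algebra)
  have "m_inv KR c \<in> k" using KR.subfield_m_inv(1)[OF k, of c] False c by simp
  then show ?thesis using False by (simp add: m_inv_KR)
qed

definition fractions :: "'a::field set \<Rightarrow> 'a set"
  where "fractions R = {a / b | a b. a \<in> R \<and> b \<in> R \<and> b \<noteq> 0}"

lemma (in coeff_ring) subfield_fractions: "subfield (fractions R) KR"
proof -
  interpret field KR by (rule field_from_type_algebra)
  show ?thesis
proof (rule subfieldI')
  show "subring (fractions R) KR"
  proof (rule KR.subringI)
    show "fractions R \<subseteq> carrier KR" by simp
    show "\<one>\<^bsub>KR\<^esub> \<in> fractions R" unfolding fractions_def by (auto intro!: exI[of _ 1])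
    fix x assume "x \<in> fractions R"
    then obtain a b where x: "x = a / b" "a \<in> R" "b \<in> R" "b \<noteq> 0" by (auto simp: fractions_def)
    then have "- x = (- a) / b" "- a \<in> R" by auto
    then show "\<ominus>\<^bsub>KR\<^esub> x \<in> fractions R" unfolding fractions_def a_inv_KR using x by blast
    fix y assume "y \<in> fractions R"
    then obtain c e where y: "y = c / e" "c \<in> R" "e \<in> R" "e \<noteq> 0" by (auto simp: fractions_def)
    have "x * y = (a * c) / (b * e)" "x + y = (a * e + c * b) / (b * e)" using x y by (auto simp: field_simps)
    moreover have "a * c \<in> R" "b * e \<in> R" "b * e \<noteq> 0" "a * e + c * b \<in> R" using x y by auto
    ultimately show "x \<otimes>\<^bsub>KR\<^esub> y \<in> fractions R" "x \<oplus>\<^bsub>KR\<^esub> y \<in> fractions R"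
      unfolding fractions_def KR_simps by blast+
  qed
  fix x assume "x \<in> fractions R - {\<zero>\<^bsub>KR\<^esub>}"
  then obtain a b where x: "x = a / b" "a \<in> R" "b \<in> R" "b \<noteq> 0" "x \<noteq> 0" by (auto simp: fractions_def)
  then have "m_inv KR x = b / a" "a \<noteq> 0" by (auto simp: m_inv_KR)
  then show "m_inv KR x \<in> fractions R" unfolding fractions_def using x by blast
qed
qed

lemma (in coeff_ring) R_fractions: "a \<in> R \<Longrightarrow> a \<in> fractions R"
  unfolding fractions_def by (rule CollectI, rule exI[of _ a], rule exI[of _ 1]) simp

lemma combine_KR:
  fixes Ks Us :: "'a::field list"
  shows "length Ks = length Us \<Longrightarrow> KR.combine Ks Us = (\<Sum>i<length Us. Ks ! i * Us ! i)"
proof (induction Ks Us rule: list_induct2)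
  case (Cons x xs y ys)
  then show ?case by (simp add: sum.lessThan_Suc_shift del: sum.lessThan_Suc)
qed simp

text \<open>Over a subfield: dimension at most \<open>d\<close>. Families instead of sets allow
  repetitions, and the condition also makes sense over a subring, to which it passes by clearing
  denominators.\<close>

definition dependent_over :: "'a::field set \<Rightarrow> nat \<Rightarrow> bool"
  where "dependent_over F d \<longleftrightarrow> (\<forall>(I :: nat set) g. finite I \<longrightarrow> card I > d \<longrightarrow>
      (\<exists>c. (\<forall>i\<in>I. c i \<in> F) \<and> (\<exists>i\<in>I. c i \<noteq> 0) \<and> (\<Sum>i\<in>I. c i * g i) = 0))"

text \<open>Translates bases given by lists into indexed families. The same \<open>d\<close> bounds
  independent families and is the length of one; the counting arguments rely on this
  exactness.\<close>

lemma finite_extension_basis: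
  fixes F :: "'a::field set"
  assumes F: "subfield F KR" "finite_extension_of F"
  obtains d and y :: "nat \<Rightarrow> 'a" where "dependent_over F d"
    "\<And>c. (\<And>i. i < d \<Longrightarrow> c i \<in> F) \<Longrightarrow> (\<Sum>i<d. c i * y i) = 0 \<Longrightarrow> \<forall>i<d. c i = 0"
proof -
  obtain d where d: "KR.dimension d F (carrier KR)" using F(2) by (auto simp: KR.finite_dimension_def)
  obtain Vs where Vs: "KR.independent F Vs" "length Vs = d" using KR.exists_base[OF F(1) d] by blast
  show ?thesis
  proof (rule that[of d "\<lambda>i. Vs ! i"])
    show "dependent_over F d"
      unfolding dependent_over_def
    proof (intro allI impI)
      fix I :: "nat set" and g :: "nat \<Rightarrow> 'a"
      assume I: "finite I" "card I > d"
      define Js where "Js = sorted_list_of_set I"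
      have Js: "set Js = I" "distinct Js" "length Js = card I" using I by (auto simp: Js_def)
      define Us where "Us = map g Js"
      have "\<not> KR.independent F Us"
        using KR.independent_length_le_dimension[OF F(1) d] I Js(3) by (fastforce simp: Us_def)
      then obtain Ks where Ks: "length Ks = length Us" "KR.combine Ks Us = 0" "set Ks \<subseteq> F" "set Ks \<noteq> {0}"
        using KR.dependent_imp_non_trivial_combine[OF F(1), of Us] by auto
      have bij: "bij_betw (\<lambda>i. Js ! i) {..<card I} I"
        using Js by (auto simp: bij_betw_def inj_on_nth set_conv_nth)
      define idx where "idx j = (THE i. i < card I \<and> Js ! i = j)" for j
      have idx: "idx (Js ! i) = i" if "i < card I" for i
        unfolding idx_def by (rule the_equality) (use that Js nth_eq_iff_index_eq[OF Js(2)] in auto)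
      define c where "c j = Ks ! idx j" for j
      have cKs: "c (Js ! i) = Ks ! i" if "i < card I" for i using idx[OF that] by (simp add: c_def)
      have len: "length Ks = card I" "length Us = card I" using Ks(1) Js by (auto simp: Us_def)
      have "(\<Sum>j\<in>I. c j * g j) = (\<Sum>i<card I. c (Js ! i) * g (Js ! i))"
        by (rule sum.reindex_bij_betw[OF bij, symmetric])
      also have "\<dots> = KR.combine Ks Us"
        unfolding combine_KR[OF Ks(1)] len by (rule sum.cong) (auto simp: cKs Us_def Js)
      finally have "(\<Sum>j\<in>I. c j * g j) = 0" using Ks(2) by simp
      moreover have "\<forall>j\<in>I. c j \<in> F"
      proof
        fix j assume "j \<in> I"
        then obtain i where "i < card I" "j = Js ! i" using bij by (auto simp: bij_betw_def)
        then show "c j \<in> F" using cKs Ks(3) len nth_mem by fastforce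
      qed
      moreover have "\<exists>j\<in>I. c j \<noteq> 0"
      proof -
        have "set Ks \<noteq> {}" using len I by auto
        then have "\<not> set Ks \<subseteq> {0}" using Ks(4) by (simp add: subset_singleton_iff)
        then obtain k where "k \<in> set Ks" "k \<noteq> 0" by blast
        then obtain i where "i < card I" "Ks ! i \<noteq> 0" using len by (metis in_set_conv_nth)
        then show ?thesis using cKs bij by (metis bij_betwE lessThan_iff)
      qed
      ultimately show "\<exists>c. (\<forall>i\<in>I. c i \<in> F) \<and> (\<exists>i\<in>I. c i \<noteq> 0) \<and> (\<Sum>i\<in>I. c i * g i) = 0" by blast
    qed
  next
    fix c assume c: "\<And>i. i < d \<Longrightarrow> c i \<in> F" "(\<Sum>i<d. c i * Vs ! i) = 0"
    have "KR.combine (map c [0..<d]) Vs = 0" using c(2) Vs(2) by (simp add: combine_KR)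
    moreover have "set (map c [0..<d]) \<subseteq> F" using c(1) by auto
    ultimately have "set (take (length Vs) (map c [0..<d])) \<subseteq> {0}"
      using KR.independent_imp_trivial_combine[OF F(1) Vs(1), of "map c [0..<d]"] by simp
    then show "\<forall>i<d. c i = 0" using Vs(2) by (auto simp: image_subset_iff)
  qed
qed

lemma (in coeff_ring) dependent_over_fractions:
  assumes "dependent_over (fractions R) d"
  shows "dependent_over R d"
  unfolding dependent_over_def
proof (intro allI impI)
  fix I :: "nat set" and g assume I: "finite I" "card I > d"
  obtain c where c: "\<forall>i\<in>I. c i \<in> fractions R" "\<exists>i\<in>I. c i \<noteq> 0" "(\<Sum>i\<in>I. c i * g i) = 0"
    using assms I unfolding dependent_over_def by blast
  have "\<forall>i\<in>I. \<exists>b. b \<in> R \<and> b \<noteq> 0 \<and> c i * b \<in> R" using c(1) by (fastforce simp: fractions_def)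
  then obtain b where b: "\<And>i. i \<in> I \<Longrightarrow> b i \<in> R \<and> b i \<noteq> 0 \<and> c i * b i \<in> R" by metis
  define e where "e i = c i * prod b I" for i
  have "e i \<in> R" if "i \<in> I" for i
  proof -
    have "e i = (c i * b i) * prod b (I - {i})"
      using prod.remove[OF I(1) that, of b] by (simp add: e_def mult.assoc)
    also have "\<dots> \<in> R" using b that by (intro R_mult[of "c i * b i"] R_prod) auto
    finally show ?thesis .
  qed
  moreover have "\<exists>i\<in>I. e i \<noteq> 0" using c(2) b I by (auto simp: e_def)
  moreover have "(\<Sum>i\<in>I. e i * g i) = prod b I * (\<Sum>i\<in>I. c i * g i)"
    by (simp add: e_def sum_distrib_left mult_ac)
  ultimately show "\<exists>c. (\<forall>i\<in>I. c i \<in> R) \<and> (\<exists>i\<in>I. c i \<noteq> 0) \<and> (\<Sum>i\<in>I. c i * g i) = 0"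
    using c(3) by (intro exI[of _ e]) simp
qed

section \<open>Minimal polynomials of integral elements\<close>

text \<open>Take the first coefficient of least value in each factor. Their product dominates the
  corresponding coefficient of \<open>m * q\<close>, so the two least values have nonnegative sum.
  The factors being monic, both are at most 0, hence equal to 0.\<close>

lemma (in nval) gauss_lemma:
  assumes m: "Polynomial.lead_coeff m = 1" and q: "Polynomial.lead_coeff q = 1"
    and mq: "\<And>i. Polynomial.coeff (m * q) i \<in> ball 0"
  shows "Polynomial.coeff m i \<in> ball 0"
proof -
  have content: "\<exists>\<mu> i0. \<mu> \<le> 0 \<and> Polynomial.coeff p i0 \<noteq> 0 \<and> v (Polynomial.coeff p i0) = \<mu> \<and>
      (\<forall>i. Polynomial.coeff p i \<in> ball \<mu>) \<and> (\<forall>i<i0. Polynomial.coeff p i \<in> ball (\<mu> + 1))"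
    if p: "Polynomial.lead_coeff p = 1" for p
  proof -
    define S where "S = {i. Polynomial.coeff p i \<noteq> 0}"
    have S: "finite S" "S \<noteq> {}"
      using p le_degree[of p] by (auto simp: S_def intro!: finite_subset[of _ "{..Polynomial.degree p}"])
        (metis zero_neq_one)
    define \<mu> where "\<mu> = Min ((\<lambda>i. v (Polynomial.coeff p i)) ` S)"
    have all: "\<mu> \<le> v (Polynomial.coeff p i)" if "i \<in> S" for i
      using S that by (simp add: \<mu>_def)
    have "\<mu> \<in> (\<lambda>i. v (Polynomial.coeff p i)) ` S" unfolding \<mu>_def using S by (intro Min_in) auto
    then have ex: "\<exists>i. Polynomial.coeff p i \<noteq> 0 \<and> v (Polynomial.coeff p i) = \<mu>" by (auto simp: S_def)
    define i0 where "i0 = (LEAST i. Polynomial.coeff p i \<noteq> 0 \<and> v (Polynomial.coeff p i) = \<mu>)"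
    have i0: "Polynomial.coeff p i0 \<noteq> 0 \<and> v (Polynomial.coeff p i0) = \<mu>"
      unfolding i0_def by (rule LeastI_ex[OF ex])
    have "Polynomial.coeff p i \<in> ball (\<mu> + 1)" if "i < i0" for i
      using not_less_Least[OF that[unfolded i0_def]] all[of i] by (fastforce simp: ball_def S_def)
    moreover have "\<mu> \<le> 0" using all[of "Polynomial.degree p"] p by (simp add: S_def)
    moreover have "Polynomial.coeff p i \<in> ball \<mu>" for i using all[of i] by (auto simp: ball_def S_def)
    ultimately show ?thesis using i0 by (intro exI[of _ \<mu>] exI[of _ i0]) simp
  qed
  obtain \<mu> i0 where \<mu>: "\<mu> \<le> 0" "Polynomial.coeff m i0 \<noteq> 0" "v (Polynomial.coeff m i0) = \<mu>"
      "\<forall>i. Polynomial.coeff m i \<in> ball \<mu>" "\<forall>i<i0. Polynomial.coeff m i \<in> ball (\<mu> + 1)"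
    using content[OF m] by blast
  obtain \<kappa> j0 where \<kappa>: "\<kappa> \<le> 0" "Polynomial.coeff q j0 \<noteq> 0" "v (Polynomial.coeff q j0) = \<kappa>"
      "\<forall>i. Polynomial.coeff q i \<in> ball \<kappa>" "\<forall>i<j0. Polynomial.coeff q i \<in> ball (\<kappa> + 1)"
    using content[OF q] by blast
  let ?t = "\<lambda>i. Polynomial.coeff m i * Polynomial.coeff q (i0 + j0 - i)"
  have t0: "?t i0 \<noteq> 0" "v (?t i0) = \<mu> + \<kappa>" using \<mu> \<kappa> by (auto simp: v_mult)
  have "(\<Sum>i\<in>{..i0 + j0} - {i0}. ?t i) \<in> ball (v (?t i0) + 1)"
  proof (rule ball_sum)
    fix i assume i: "i \<in> {..i0 + j0} - {i0}"
    show "?t i \<in> ball (v (?t i0) + 1)"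
    proof (cases "i < i0")
      case True
      then have "?t i \<in> ball ((\<mu> + 1) + \<kappa>)" using \<mu> \<kappa> by (intro ball_mult) auto
      then show ?thesis using t0 by (simp add: algebra_simps)
    next
      case False
      then have "?t i \<in> ball (\<mu> + (\<kappa> + 1))" using \<mu> \<kappa> i by (intro ball_mult) auto
      then show ?thesis using t0 by (simp add: algebra_simps)
    qed
  qed
  from v_add_eq[OF t0(1) this] have "(\<Sum>i\<le>i0 + j0. ?t i) \<noteq> 0 \<and> v (\<Sum>i\<le>i0 + j0. ?t i) = \<mu> + \<kappa>"
    using t0 by (simp add: sum.remove[of "{..i0 + j0}" i0])
  then have "\<mu> + \<kappa> \<ge> 0" using mq[of "i0 + j0"] by (auto simp: coeff_mult ball_def)
  then have "\<mu> = 0" using \<mu>(1) \<kappa>(1) by simp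
  then show ?thesis using \<mu> by simp
qed

lemma (in coeff_ring) monic_division:
  assumes m: "m \<in> polys_over R" "Polynomial.lead_coeff m = 1" and p: "p \<in> polys_over R"
  obtains q r where "q \<in> polys_over R" "r \<in> polys_over R" "p = m * q + r"
    "r = 0 \<or> Polynomial.degree r < Polynomial.degree m"
proof -
  have "\<exists>q r. q \<in> polys_over R \<and> r \<in> polys_over R \<and> p = m * q + r \<and> (r = 0 \<or> Polynomial.degree r < Polynomial.degree m)"
    using p
  proof (induction "if p = 0 then 0 else Suc (Polynomial.degree p)" arbitrary: p rule: less_induct)
    case less
    show ?case
    proof (cases "p = 0 \<or> Polynomial.degree p < Polynomial.degree m")
      case True
      then show ?thesis using less.prems by (intro exI[of _ 0] exI[of _ p]) auto
    next
      case False
      define k where "k = Polynomial.degree p - Polynomial.degree m"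
      define u where "u = Polynomial.monom (Polynomial.lead_coeff p) k"
      define p' where "p' = p - m * u"
      have u: "u \<in> polys_over R" using less.prems by (simp add: u_def)
      have p': "p' \<in> polys_over R" using less.prems u m by (simp add: p'_def)
      have dmu: "Polynomial.degree (m * u) = Polynomial.degree p" "Polynomial.lead_coeff (m * u) = Polynomial.lead_coeff p"
      proof -
        have "m \<noteq> 0" "u \<noteq> 0" using m(2) False by (auto simp: u_def)
        then show "Polynomial.degree (m * u) = Polynomial.degree p"
          using False by (simp add: degree_mult_eq u_def degree_monom_eq k_def)
        show "Polynomial.lead_coeff (m * u) = Polynomial.lead_coeff p"
          using False m(2) by (simp add: lead_coeff_mult u_def degree_monom_eq)
      qed
      have "p' = 0 \<or> Polynomial.degree p' < Polynomial.degree p"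
      proof (rule disjCI)
        assume "\<not> Polynomial.degree p' < Polynomial.degree p"
        moreover have "Polynomial.degree p' \<le> Polynomial.degree p"
          unfolding p'_def using dmu by (intro degree_diff_le) auto
        ultimately have "Polynomial.lead_coeff p' = 0" using dmu by (simp add: p'_def)
        then show "p' = 0" by simp
      qed
      then have "(if p' = 0 then 0 else Suc (Polynomial.degree p')) < (if p = 0 then 0 else Suc (Polynomial.degree p))"
        using False by auto
      from less.hyps[OF this p'] obtain q r where qr: "q \<in> polys_over R" "r \<in> polys_over R" "p' = m * q + r"
        "r = 0 \<or> Polynomial.degree r < Polynomial.degree m" by blast
      then have "p = m * (q + u) + r" by (simp add: p'_def algebra_simps)
      then show ?thesis using qr u by (intro exI[of _ "q + u"] exI[of _ r]) auto
    qed
  qed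
  then show ?thesis using that by blast
qed

context euclid_ext
begin

text \<open>A common denominator of all powers of \<open>z\<close> of least size is an ideal generator, hence a unit.\<close>

lemma integral_fraction_in_R:
  assumes z: "z \<in> Oc" "z \<in> fractions R"
  shows "z \<in> R"
proof -
  obtain a b where ab: "a \<in> R" "b \<in> R" "b \<noteq> 0" "z = a / b" using z(2) by (auto simp: fractions_def)
  obtain p where p: "p \<in> polys_over R" "Polynomial.lead_coeff p = 1" "poly p z = 0"
    using z(1) by (auto simp: integral_closure_def)
  define n where "n = Polynomial.degree p"
  have rec: "z ^ n = - (\<Sum>i<n. Polynomial.coeff p i * z ^ i)"
  proof -
    have "poly p z = (\<Sum>i<n. Polynomial.coeff p i * z ^ i) + z ^ n"
      using p unfolding poly_altdef n_def[symmetric]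
      by (simp add: n_def lessThan_Suc_atMost[symmetric])
    then show ?thesis using p(3) by (simp add: eq_neg_iff_add_eq_0 add.commute)
  qed
  have b_den: "b ^ n * z ^ i \<in> R" for i
  proof (induction i rule: less_induct)
    case (less i)
    show ?case
    proof (cases "i < n")
      case True
      then have "b ^ n * z ^ i = b ^ (n - i) * a ^ i"
        using ab by (simp add: power_divide power_diff)
      then show ?thesis using ab by simp
    next
      case False
      then have "z ^ i = z ^ (i - n) * z ^ n" by (simp flip: power_add)
      then have "b ^ n * z ^ i = - (\<Sum>j<n. Polynomial.coeff p j * (b ^ n * z ^ (i - n + j)))"
        by (simp add: rec sum_distrib_left power_add mult_ac)
      also have "\<dots> \<in> R"
      proof (intro R_uminus R_sum)
        fix j assume "j \<in> {..<n}"
        then have "b ^ n * z ^ (i - n + j) \<in> R" using False by (intro less.IH) auto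
        then show "Polynomial.coeff p j * (b ^ n * z ^ (i - n + j)) \<in> R"
          by (rule R_mult[OF polys_over_coeff[OF p(1)]])
      qed
      finally show ?thesis .
    qed
  qed
  define den where "den s \<longleftrightarrow> s \<in> R \<and> s \<noteq> 0 \<and> (\<forall>i. s * z ^ i \<in> R)" for s
  have "den (b ^ n)" using ab b_den by (auto simp: den_def)
  then obtain s where s: "den s" and least: "\<And>r. den r \<Longrightarrow> \<delta> s \<le> \<delta> r"
    using ex_has_least_nat[of den "b ^ n" \<delta>] by blast
  have sR: "s \<in> R" "s \<noteq> 0" "s * z ^ 1 \<in> R" "\<And>i. s * z ^ i \<in> R" using s unfolding den_def by blast+
  obtain q where q: "q \<in> R" "s * z ^ 1 - q * s = 0 \<or> \<delta> (s * z ^ 1 - q * s) < \<delta> s"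
    using euclid[OF sR(3,1,2)] by blast
  have "s * z ^ 1 - q * s = 0"
  proof (rule ccontr)
    assume nz: "s * z ^ 1 - q * s \<noteq> 0"
    have "(s * z ^ 1 - q * s) * z ^ i \<in> R" for i
    proof -
      have "(s * z ^ 1 - q * s) * z ^ i = s * z ^ Suc i - q * (s * z ^ i)" by (simp add: algebra_simps)
      also have "\<dots> \<in> R" by (rule R_diff[OF sR(4) R_mult[OF q(1) sR(4)]])
      finally show ?thesis .
    qed
    then have "den (s * z ^ 1 - q * s)" using nz sR q by (simp add: den_def)
    then show False using least q(2) nz by (meson not_le)
  qed
  then have "z = q" using sR(2) by (simp add: algebra_simps)
  then show ?thesis using q by simp
qed

text \<open>The minimal polynomial over the fraction field divides a monic equation over
  \<open>R\<close>. The Gauss lemma at every \<open>v\<close> in \<open>VV\<close> makes its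
  coefficients integral, and integral fractions of elements of \<open>R\<close> are in
  \<open>R\<close>.\<close>

lemma minpoly_exists:
  assumes z: "z \<in> Oc"
  obtains m where "m \<in> polys_over R" "Polynomial.lead_coeff m = 1" "poly m z = 0"
    "\<And>p. p \<in> polys_over (fractions R) \<Longrightarrow> p \<noteq> 0 \<Longrightarrow> poly p z = 0 \<Longrightarrow> Polynomial.degree m \<le> Polynomial.degree p"
    "Polynomial.degree m \<le> d"
proof -
  let ?F = "fractions R"
  have F: "subfield ?F KR" by (rule subfield_fractions)
  have sub: "R \<subseteq> ?F" using R_fractions by blast
  interpret F: coeff_ring ?F by (rule coeff_ring_subfield[OF F])
  have F_inv: "1 / a \<in> ?F" if "a \<in> ?F" for a by (rule subfield_inverse[OF F that])
  obtain f where f: "f \<in> polys_over R" "Polynomial.lead_coeff f = 1" "poly f z = 0"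
    using z by (auto simp: integral_closure_def)
  define ann where "ann p \<longleftrightarrow> p \<in> polys_over ?F \<and> p \<noteq> 0 \<and> poly p z = 0" for p
  obtain p1 where p1: "p1 \<in> polys_over R" "p1 \<noteq> 0" "poly p1 z = 0" "Polynomial.degree p1 \<le> d"
    by (rule annihilator_exists)
  then have "ann p1" using sub by (auto simp: ann_def intro: polys_over_mono)
  then obtain p0 where p0: "ann p0" "\<And>p. ann p \<Longrightarrow> Polynomial.degree p0 \<le> Polynomial.degree p"
    using ex_has_least_nat[of ann p1 Polynomial.degree] by blast
  define m where "m = Polynomial.smult (1 / Polynomial.lead_coeff p0) p0"
  have p0': "p0 \<in> polys_over ?F" "p0 \<noteq> 0" "poly p0 z = 0" using p0(1) by (auto simp: ann_def)
  have m: "m \<in> polys_over ?F" "Polynomial.lead_coeff m = 1" "poly m z = 0" "Polynomial.degree m = Polynomial.degree p0"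
    using p0' F_inv by (auto simp: m_def)
  have f_F: "f \<in> polys_over ?F" by (rule polys_over_mono[OF f(1) sub])
  obtain q r where qr: "q \<in> polys_over ?F" "r \<in> polys_over ?F" "f = m * q + r" "r = 0 \<or> Polynomial.degree r < Polynomial.degree m"
    by (rule F.monic_division[OF m(1,2) f_F])
  have "poly r z = 0" using f(3) m(3) qr(3) by simp
  have r0: "r = 0"
  proof (rule ccontr)
    assume "r \<noteq> 0"
    then have "ann r" using \<open>poly r z = 0\<close> qr(2) by (simp add: ann_def)
    then show False using p0(2)[of r] qr(4) m(4) \<open>r \<noteq> 0\<close> by auto
  qed
  then have fmq: "f = m * q" using qr by simp
  then have q1: "Polynomial.lead_coeff q = 1" using f(2) m(2) by (simp add: lead_coeff_mult)
  have "Polynomial.coeff m i \<in> R" for i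
  proof (rule integral_fraction_in_R)
    show "Polynomial.coeff m i \<in> ?F" using m by simp
    have "v (Polynomial.coeff m i) \<ge> 0" if v: "v \<in> VV" "Polynomial.coeff m i \<noteq> 0" for v
    proof -
      interpret nval v by (rule VV_nval[OF v(1)])
      have "Polynomial.coeff (m * q) j \<in> ball 0" for j
        using R_Oc[OF polys_over_coeff[OF f(1)]] VV_ring[OF v(1)] unfolding fmq[symmetric] valuation_ring_ball by blast
      then have "Polynomial.coeff m i \<in> ball 0" by (rule gauss_lemma[OF m(2) q1])
      then show ?thesis using v(2) by (simp add: ball_def)
    qed
    then show "Polynomial.coeff m i \<in> Oc" using Oc_eq by blast
  qed
  then have "m \<in> polys_over R" by (rule polys_overI)
  then show ?thesis
    by (rule that) (use m p0(2) p0(2)[OF \<open>ann p1\<close>] p1(4) in \<open>auto simp: ann_def\<close>)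
qed

end

section \<open>Embeddings of number fields\<close>

locale number_field_ext = euclid_ext "\<int> :: 'a::field set" \<delta> d for \<delta> d +
  assumes char0: "CHAR('a) = 0"
begin

lemma of_int_inj: "(of_int m :: 'a) = of_int n \<longleftrightarrow> m = n"
  using of_int_eq_0_iff_char_dvd[where 'a = 'a, of "m - n"] char0 by simp

definition zint :: "'a \<Rightarrow> int" where "zint a = (THE k. a = of_int k)"

lemma zint [simp]: "zint (of_int k) = k"
  unfolding zint_def by (rule the_equality) (auto simp: of_int_inj)

lemma of_int_zint: "a \<in> \<int> \<Longrightarrow> of_int (zint a) = a"
  by (auto elim!: Ints_cases)

lemma annihilator_const:
  assumes "(z::'a) \<noteq> 0"
  obtains c p where "c \<in> \<int>" "c \<noteq> 0" "p \<in> polys_over \<int>" "c + z * poly p z = 0"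
proof -
  obtain p where p: "p \<in> polys_over \<int>" "p \<noteq> 0" "poly p z = 0" by (rule annihilator_exists[of z])
  then have "\<exists>c p. c \<in> \<int> \<and> c \<noteq> 0 \<and> p \<in> polys_over \<int> \<and> c + z * poly p z = 0"
  proof (induction p)
    case (pCons a p)
    show ?case
    proof (cases "a = 0")
      case True
      then show ?thesis using pCons assms by simp
    next
      case False
      then show ?thesis using pCons.prems by (intro exI[of _ a] exI[of _ p]) simp
    qed
  qed simp
  then show ?thesis using that by blast
qed

lemma embedding_iff: "\<sigma> \<in> complex_embeddings \<longleftrightarrow>
    (\<forall>x y. \<sigma> (x * y) = \<sigma> x * \<sigma> y) \<and> (\<forall>x y. \<sigma> (x + y) = \<sigma> x + \<sigma> y) \<and> \<sigma> (1::'a) = 1"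
  by (auto simp: complex_embeddings_def Ring.ring_hom_def)

lemma
  assumes "\<sigma> \<in> complex_embeddings"
  shows emb_mult: "\<sigma> (x * y :: 'a) = \<sigma> x * \<sigma> y" and emb_add: "\<sigma> (x + y) = \<sigma> x + \<sigma> y" and emb_1: "\<sigma> 1 = 1"
    and emb_0: "\<sigma> 0 = 0" and emb_uminus: "\<sigma> (- x) = - \<sigma> x" and emb_diff: "\<sigma> (x - y) = \<sigma> x - \<sigma> y"
    and emb_eq_0: "\<sigma> x = 0 \<longleftrightarrow> x = 0" and emb_of_int: "\<sigma> (of_int k) = of_int k"
    and emb_sum: "\<sigma> (sum f I) = (\<Sum>i\<in>I. \<sigma> (f i))" and emb_power: "\<sigma> (x ^ n) = \<sigma> x ^ n"
proof -
  note e = assms[unfolded embedding_iff]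
  show m: "\<sigma> (x * y) = \<sigma> x * \<sigma> y" for x y using e by blast
  show a: "\<sigma> (x + y) = \<sigma> x + \<sigma> y" for x y using e by blast
  show o: "\<sigma> 1 = 1" using e by blast
  show z: "\<sigma> 0 = 0" using a[of 0 0] by simp
  show u: "\<sigma> (- x) = - \<sigma> x" for x using a[of x "- x"] z by (simp add: eq_neg_iff_add_eq_0 add.commute)
  show "\<sigma> (x - y) = \<sigma> x - \<sigma> y" using a[of x "- y"] u by simp
  show "\<sigma> x = 0 \<longleftrightarrow> x = 0" using m[of x "1 / x"] z o by (cases "x = 0") auto
  have n: "\<sigma> (of_nat k) = of_nat k" for k by (induction k) (simp_all add: a o z)
  show "\<sigma> (of_int k) = of_int k" by (cases k) (simp_all add: n u a o del: of_nat_Suc)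
  show "\<sigma> (sum f I) = (\<Sum>i\<in>I. \<sigma> (f i))" by (induction I rule: infinite_finite_induct) (auto simp: a z)
  show "\<sigma> (x ^ n) = \<sigma> x ^ n" by (induction n) (auto simp: m o)
qed

text \<open>A partial embedding into the complex numbers, defined on a ring containing the
  rationals. Being closed under differences, such a relation is single-valued as soon as it is so at
  0. Inverses come from algebraicity, in \<open>graph_inverse\<close>.\<close>

definition graph :: "('a \<times> complex) set \<Rightarrow> bool"
  where "graph G \<longleftrightarrow> (\<forall>a b a' b'. (a, b) \<in> G \<longrightarrow> (a', b') \<in> G \<longrightarrow> (a + a', b + b') \<in> G \<and> (a * a', b * b') \<in> G) \<and>
    (\<forall>a b. (a, b) \<in> G \<longrightarrow> (- a, - b) \<in> G) \<and> (\<forall>b. (0, b) \<in> G \<longrightarrow> b = 0) \<and>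
    (\<forall>p q. of_int q \<noteq> (0::'a) \<longrightarrow> (of_int p / of_int q, of_int p / of_int q) \<in> G)"

lemma
  assumes "graph G"
  shows graph_add: "(a, b) \<in> G \<Longrightarrow> (a', b') \<in> G \<Longrightarrow> (a + a', b + b') \<in> G"
    and graph_mult: "(a, b) \<in> G \<Longrightarrow> (a', b') \<in> G \<Longrightarrow> (a * a', b * b') \<in> G"
    and graph_uminus: "(a, b) \<in> G \<Longrightarrow> (- a, - b) \<in> G"
    and graph_0D: "(0, b) \<in> G \<Longrightarrow> b = 0"
    and graph_rat: "of_int q \<noteq> (0::'a) \<Longrightarrow> (of_int p / of_int q, of_int p / of_int q) \<in> G"
    and graph_int: "(of_int p, of_int p) \<in> G"
    and graph_0: "(0, 0) \<in> G" and graph_1: "(1, 1) \<in> G"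
proof -
  note g = assms[unfolded graph_def]
  note g1 = conjunct1[OF g] and g2 = conjunct1[OF conjunct2[OF g]]
    and g3 = conjunct1[OF conjunct2[OF conjunct2[OF g]]] and g4 = conjunct2[OF conjunct2[OF conjunct2[OF g]]]
  show "(a, b) \<in> G \<Longrightarrow> (a', b') \<in> G \<Longrightarrow> (a + a', b + b') \<in> G"
    and "(a, b) \<in> G \<Longrightarrow> (a', b') \<in> G \<Longrightarrow> (a * a', b * b') \<in> G"
    using g1 by simp_all
  show "(a, b) \<in> G \<Longrightarrow> (- a, - b) \<in> G" using g2 by simp
  show "(0, b) \<in> G \<Longrightarrow> b = 0" using g3 by simp
  have rat: "(of_int p / of_int q, of_int p / of_int q) \<in> G" if "of_int q \<noteq> (0::'a)" for p q
    using g4 that by simp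
  then show "of_int q \<noteq> (0::'a) \<Longrightarrow> (of_int p / of_int q, of_int p / of_int q) \<in> G" .
  show "(of_int p, of_int p) \<in> G" using rat[of 1 p] by simp
  show "(0, 0) \<in> G" using rat[of 1 0] by simp
  show "(1, 1) \<in> G" using rat[of 1 1] by simp
qed

lemma graph_functional:
  assumes "graph G" "(a, b) \<in> G" "(a, b') \<in> G"
  shows "b = b'"
  using graph_0D[OF assms(1), of "b - b'"] graph_add[OF assms(1,2) graph_uminus[OF assms(1,3)]] by simp

lemma graph_sum: "graph G \<Longrightarrow> (\<And>i. i \<in> I \<Longrightarrow> (f i, g i) \<in> G) \<Longrightarrow> (sum f I, sum g I) \<in> G"
  by (induction I rule: infinite_finite_induct) (auto simp: graph_0 intro: graph_add)

section \<open>Conjugate polynomials and the extension of partial embeddings\<close>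

definition pairs :: "('a \<times> complex) set \<Rightarrow> ('a poly \<times> complex poly) set"
  where "pairs G = {(p, q). \<forall>i. (Polynomial.coeff p i, Polynomial.coeff q i) \<in> G}"

lemma pairs_coeff: "(p, q) \<in> pairs G \<Longrightarrow> (Polynomial.coeff p i, Polynomial.coeff q i) \<in> G"
  by (simp add: pairs_def)

lemma
  assumes G: "graph G"
  shows pairs_add: "(p, q) \<in> pairs G \<Longrightarrow> (p', q') \<in> pairs G \<Longrightarrow> (p + p', q + q') \<in> pairs G"
    and pairs_mult: "(p, q) \<in> pairs G \<Longrightarrow> (p', q') \<in> pairs G \<Longrightarrow> (p * p', q * q') \<in> pairs G"
    and pairs_uminus: "(p, q) \<in> pairs G \<Longrightarrow> (- p, - q) \<in> pairs G"
    and pairs_monom: "(a, b) \<in> G \<Longrightarrow> (Polynomial.monom a n, Polynomial.monom b n) \<in> pairs G"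
  using graph_add[OF G] graph_uminus[OF G] graph_0[OF G]
  by (auto simp: pairs_def coeff_mult intro!: graph_sum[OF G] graph_mult[OF G])

lemma pairs_degree:
  assumes G: "graph G" and pq: "(p, q) \<in> pairs G"
  shows "Polynomial.degree q \<le> Polynomial.degree p"
    and "Polynomial.lead_coeff p = 1 \<Longrightarrow> Polynomial.degree q = Polynomial.degree p \<and> Polynomial.lead_coeff q = 1"
proof -
  show le: "Polynomial.degree q \<le> Polynomial.degree p"
    by (rule degree_le) (use pairs_coeff[OF pq] graph_0D[OF G] coeff_eq_0 in metis)
  assume "Polynomial.lead_coeff p = 1"
  then have "(1, Polynomial.coeff q (Polynomial.degree p)) \<in> G"
    using pairs_coeff[OF pq, of "Polynomial.degree p"] by simp
  then have 1: "Polynomial.coeff q (Polynomial.degree p) = 1"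
    using graph_functional[OF G graph_1[OF G]] by metis
  then have "Polynomial.degree p \<le> Polynomial.degree q" by (intro le_degree) simp
  then show "Polynomial.degree q = Polynomial.degree p \<and> Polynomial.lead_coeff q = 1" using le 1 by simp
qed

definition cpoly :: "'a poly \<Rightarrow> complex poly"
  where "cpoly p = map_poly (\<lambda>a. of_int (zint a)) p"

lemma zint_0 [simp]: "zint 0 = 0"
  using zint[of 0] by simp

lemma coeff_cpoly: "Polynomial.coeff (cpoly p) i = of_int (zint (Polynomial.coeff p i))"
  by (simp add: cpoly_def coeff_map_poly)

lemma cpoly_pairs: "graph G \<Longrightarrow> p \<in> polys_over \<int> \<Longrightarrow> (p, cpoly p) \<in> pairs G"
proof -
  assume G: "graph G" and p: "p \<in> polys_over \<int>"
  have "(Polynomial.coeff p i, Polynomial.coeff (cpoly p) i) \<in> G" for i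
    using graph_int[OF G, of "zint (Polynomial.coeff p i)"] of_int_zint[OF polys_over_coeff[OF p, of i]]
    by (simp add: coeff_cpoly)
  then show ?thesis by (simp add: pairs_def)
qed

lemma pairs_poly: "graph G \<Longrightarrow> (p, q) \<in> pairs G \<Longrightarrow> (a, b) \<in> G \<Longrightarrow> (poly p a, poly q b) \<in> G"
proof -
  assume G: "graph G" and pq: "(p, q) \<in> pairs G" and ab: "(a, b) \<in> G"
  have pow: "(a ^ i, b ^ i) \<in> G" for i
    by (induction i) (auto simp: graph_1[OF G] intro: graph_mult[OF G ab])
  have "poly p a = (\<Sum>i\<le>Polynomial.degree p. Polynomial.coeff p i * a ^ i)" by (simp add: poly_altdef)
  moreover have "poly q b = (\<Sum>i\<le>Polynomial.degree p. Polynomial.coeff q i * b ^ i)"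
    unfolding poly_altdef
    by (rule sum.mono_neutral_left) (use pairs_degree(1)[OF G pq] in \<open>auto simp: coeff_eq_0\<close>)
  ultimately show ?thesis
    using pairs_coeff[OF pq] pow by (auto intro!: graph_sum[OF G] graph_mult[OF G])
qed

text \<open>An equation with integer coefficients and nonzero constant term \<open>c\<close> gives
  \<open>1 / a = - poly p a / c\<close>, a polynomial expression in \<open>a\<close> with rational
  coefficients.\<close>

lemma graph_inverse:
  assumes G: "graph G" and ab: "(a, b) \<in> G" "a \<noteq> 0"
  obtains b' where "(1 / a, b') \<in> G"
proof -
  obtain c p where cp: "c \<in> \<int>" "c \<noteq> 0" "p \<in> polys_over \<int>" "c + a * poly p a = 0"
    by (rule annihilator_const[OF ab(2)])
  have "(poly p a, poly (cpoly p) b) \<in> G" by (rule pairs_poly[OF G cpoly_pairs[OF G cp(3)] ab(1)])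
  moreover have c: "of_int (zint c) = c" by (rule of_int_zint[OF cp(1)])
  then have "(of_int (- 1) / c, of_int (- 1) / of_int (zint c)) \<in> G"
    using graph_rat[OF G, of "zint c" "- 1"] cp(2) by simp
  ultimately have "(of_int (- 1) / c * poly p a, of_int (- 1) / of_int (zint c) * poly (cpoly p) b) \<in> G"
    by (rule graph_mult[OF G, rotated])
  moreover have "of_int (- 1) / c * poly p a = 1 / a"
  proof -
    have "c = - (a * poly p a)" using cp(4) by (simp add: eq_neg_iff_add_eq_0)
    then show ?thesis using cp(2) ab(2) by (simp add: field_simps)
  qed
  ultimately show ?thesis using that by metis
qed

definition minimal_pair :: "('a \<times> complex) set \<Rightarrow> 'a \<Rightarrow> 'a poly \<Rightarrow> complex poly \<Rightarrow> bool"
  where "minimal_pair G z m mc \<longleftrightarrow> (m, mc) \<in> pairs G \<and> Polynomial.lead_coeff m = 1 \<and> poly m z = 0 \<and>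
    (\<forall>p q. (p, q) \<in> pairs G \<longrightarrow> p \<noteq> 0 \<longrightarrow> poly p z = 0 \<longrightarrow> Polynomial.degree m \<le> Polynomial.degree p)"

lemma minimal_pair_exists:
  assumes G: "graph G"
  obtains m mc where "minimal_pair G z m mc"
proof -
  obtain p where p: "p \<in> polys_over \<int>" "p \<noteq> 0" "poly p z = 0" by (rule annihilator_exists[of z])
  define ann where "ann x \<longleftrightarrow> x \<in> pairs G \<and> fst x \<noteq> 0 \<and> poly (fst x) z = 0" for x
  have "ann (p, cpoly p)" using p cpoly_pairs[OF G p(1)] by (simp add: ann_def)
  then obtain x where x: "ann x" "\<And>y. ann y \<Longrightarrow> Polynomial.degree (fst x) \<le> Polynomial.degree (fst y)"
    using ex_has_least_nat[of ann "(p, cpoly p)" "\<lambda>x. Polynomial.degree (fst x)"] by blast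
  obtain m q where mq: "x = (m, q)" by (cases x)
  have m: "(m, q) \<in> pairs G" "m \<noteq> 0" "poly m z = 0" using x(1) mq by (auto simp: ann_def)
  obtain b' where b': "(1 / Polynomial.lead_coeff m, b') \<in> G"
    using graph_inverse[OF G pairs_coeff[OF m(1), of "Polynomial.degree m"]] m(2) by auto
  have "minimal_pair G z (Polynomial.monom (1 / Polynomial.lead_coeff m) 0 * m) (Polynomial.monom b' 0 * q)"
    unfolding minimal_pair_def
  proof (intro conjI allI impI)
    show "(Polynomial.monom (1 / Polynomial.lead_coeff m) 0 * m, Polynomial.monom b' 0 * q) \<in> pairs G"
      by (intro pairs_mult[OF G] pairs_monom[OF G] b' m)
    fix p r assume "(p, r) \<in> pairs G" "p \<noteq> 0" "poly p z = 0"
    then have "Polynomial.degree m \<le> Polynomial.degree p" using x(2)[of "(p, r)"] mq by (simp add: ann_def)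
    then show "Polynomial.degree (Polynomial.monom (1 / Polynomial.lead_coeff m) 0 * m) \<le> Polynomial.degree p"
      using m(2) by (simp add: monom_0)
  qed (use m in \<open>auto simp: monom_0\<close>)
  then show ?thesis using that by blast
qed

text \<open>The extension sends \<open>poly p z\<close> to \<open>poly q \<omega>\<close> for
  conjugate polynomials. It is well defined since division by the minimal polynomial can be carried
  out on both members of a pair simultaneously, and no nonzero remainder of smaller degree vanishes
  at \<open>z\<close>.\<close>

lemma graph_extend:
  assumes G: "graph G" and m: "minimal_pair G z m mc" and \<omega>: "poly mc \<omega> = 0"
  shows "\<exists>G'. graph G' \<and> G \<subseteq> G' \<and> (z, \<omega>) \<in> G'"
proof -
  have m': "(m, mc) \<in> pairs G" "Polynomial.lead_coeff m = 1" "poly m z = 0"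
    "\<And>p q. (p, q) \<in> pairs G \<Longrightarrow> p \<noteq> 0 \<Longrightarrow> poly p z = 0 \<Longrightarrow> Polynomial.degree m \<le> Polynomial.degree p"
    using m unfolding minimal_pair_def by blast+
  have ev: "poly q \<omega> = 0" if "(p, q) \<in> pairs G" "poly p z = 0" for p q
    using that
  proof (induction "if p = 0 then 0 else Suc (Polynomial.degree p)" arbitrary: p q rule: less_induct)
    case less
    show ?case
    proof (cases "p = 0")
      case True
      then have "q = 0" using less.prems(1) graph_0D[OF G] by (simp add: pairs_def poly_eq_iff)
      then show ?thesis by simp
    next
      case False
      define k where "k = Polynomial.degree p - Polynomial.degree m"
      define u where "u = Polynomial.monom (Polynomial.lead_coeff p) k"
      define w where "w = Polynomial.monom (Polynomial.coeff q (Polynomial.degree p)) k"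
      have uw: "(u, w) \<in> pairs G" unfolding u_def w_def by (intro pairs_monom[OF G] pairs_coeff[OF less.prems(1)])
      have le: "Polynomial.degree m \<le> Polynomial.degree p" using m'(4)[OF less.prems(1) False less.prems(2)] .
      define p' where "p' = p + - (m * u)"
      define q' where "q' = q + - (mc * w)"
      have pq': "(p', q') \<in> pairs G" unfolding p'_def q'_def
        by (intro pairs_add[OF G] pairs_uminus[OF G] pairs_mult[OF G] less.prems m'(1) uw)
      have nz: "m \<noteq> 0" "u \<noteq> 0" using m'(2) False by (auto simp: u_def)
      have dmu: "Polynomial.degree (m * u) = Polynomial.degree p"
        using nz le False by (simp add: degree_mult_eq u_def degree_monom_eq k_def)
      have lmu: "Polynomial.lead_coeff (m * u) = Polynomial.lead_coeff p"
        using False m'(2) by (simp add: lead_coeff_mult u_def degree_monom_eq)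
      have "p' = 0 \<or> Polynomial.degree p' < Polynomial.degree p"
      proof (rule disjCI)
        assume "\<not> Polynomial.degree p' < Polynomial.degree p"
        moreover have "Polynomial.degree p' \<le> Polynomial.degree p"
          unfolding p'_def using dmu by (intro degree_add_le) auto
        ultimately have "Polynomial.lead_coeff p' = 0" using dmu lmu by (simp add: p'_def)
        then show "p' = 0" by simp
      qed
      then have "(if p' = 0 then 0 else Suc (Polynomial.degree p')) < (if p = 0 then 0 else Suc (Polynomial.degree p))"
        using False by auto
      moreover have "poly p' z = 0" using less.prems m'(3) by (simp add: p'_def)
      ultimately have "poly q' \<omega> = 0" using less.hyps pq' by blast
      then show ?thesis using \<omega> by (simp add: q'_def)
    qed
  qed
  define G' where "G' = {(poly p z, poly q \<omega>) | p q. (p, q) \<in> pairs G}"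
  have sub: "G \<subseteq> G'"
  proof
    fix x assume "x \<in> G"
    then have "(Polynomial.monom (fst x) 0, Polynomial.monom (snd x) 0) \<in> pairs G"
      by (intro pairs_monom[OF G]) simp
    then show "x \<in> G'" unfolding G'_def
      by (intro CollectI exI conjI[rotated], assumption) (simp add: poly_monom)
  qed
  have "(Polynomial.monom 1 1, Polynomial.monom 1 1) \<in> pairs G" by (intro pairs_monom[OF G] graph_1[OF G])
  then have z: "(z, \<omega>) \<in> G'" unfolding G'_def
    by (intro CollectI exI conjI[rotated], assumption) (simp add: poly_monom)
  have "graph G'"
    unfolding graph_def
  proof (intro conjI allI impI)
    fix a b a' b' assume "(a, b) \<in> G'" "(a', b') \<in> G'"
    then obtain p q p' q' where *: "a = poly p z" "b = poly q \<omega>" "(p, q) \<in> pairs G"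
      "a' = poly p' z" "b' = poly q' \<omega>" "(p', q') \<in> pairs G" by (auto simp: G'_def)
    show "(a + a', b + b') \<in> G'" unfolding G'_def
      using * pairs_add[OF G *(3,6)] by (intro CollectI exI[of _ "p + p'"] exI[of _ "q + q'"]) simp
    show "(a * a', b * b') \<in> G'" unfolding G'_def
      using * pairs_mult[OF G *(3,6)] by (intro CollectI exI[of _ "p * p'"] exI[of _ "q * q'"]) simp
  next
    fix a b assume "(a, b) \<in> G'"
    then obtain p q where *: "a = poly p z" "b = poly q \<omega>" "(p, q) \<in> pairs G" by (auto simp: G'_def)
    show "(- a, - b) \<in> G'" unfolding G'_def
      using * pairs_uminus[OF G *(3)] by (intro CollectI exI[of _ "- p"] exI[of _ "- q"]) simp
  next
    fix b assume "(0, b) \<in> G'"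
    then obtain p q where "0 = poly p z" "b = poly q \<omega>" "(p, q) \<in> pairs G" by (auto simp: G'_def)
    then show "b = 0" using ev[of p q] by simp
  next
    fix p q :: int assume "of_int q \<noteq> (0::'a)"
    then show "(of_int p / of_int q, of_int p / of_int q) \<in> G'" using subsetD[OF sub graph_rat[OF G]] by simp
  qed
  then show ?thesis using sub z by blast
qed

text \<open>A graph maximal by Zorn's lemma is total: the conjugate of the minimal polynomial of a
  missing element has a complex root, which would allow an extension.\<close>

lemma graph_total_exists:
  assumes G0: "graph G0"
  obtains \<sigma> where "\<sigma> \<in> complex_embeddings" "\<And>a b. (a, b) \<in> G0 \<Longrightarrow> \<sigma> a = b"
proof -
  define \<A> where "\<A> = {G. graph G \<and> G0 \<subseteq> G}"
  have "\<exists>M\<in>\<A>. \<forall>G\<in>\<A>. M \<subseteq> G \<longrightarrow> G = M"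
  proof (rule subset_Zorn_nonempty)
    show "\<A> \<noteq> {}" using G0 by (auto simp: \<A>_def)
    fix \<C> assume ne: "\<C> \<noteq> {}" and ch: "subset.chain \<A> \<C>"
    have sub: "\<And>G. G \<in> \<C> \<Longrightarrow> graph G \<and> G0 \<subseteq> G" and tot: "\<And>G H. G \<in> \<C> \<Longrightarrow> H \<in> \<C> \<Longrightarrow> G \<subseteq> H \<or> H \<subseteq> G"
      using ch by (auto simp: subset_chain_def \<A>_def)
    obtain G where G: "G \<in> \<C>" using ne by blast
    have "graph (\<Union>\<C>)"
      unfolding graph_def
    proof (intro conjI allI impI)
      fix a b a' b' assume "(a, b) \<in> \<Union>\<C>" "(a', b') \<in> \<Union>\<C>"
      then obtain G H where "(a, b) \<in> G" "G \<in> \<C>" "(a', b') \<in> H" "H \<in> \<C>" by blast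
      then obtain L where L: "L \<in> \<C>" "(a, b) \<in> L" "(a', b') \<in> L" using tot by blast
      have gL: "graph L" using sub[OF L(1)] by simp
      show "(a + a', b + b') \<in> \<Union>\<C>" by (rule UnionI[OF L(1) graph_add[OF gL L(2,3)]])
      show "(a * a', b * b') \<in> \<Union>\<C>" by (rule UnionI[OF L(1) graph_mult[OF gL L(2,3)]])
    next
      fix a b assume "(a, b) \<in> \<Union>\<C>"
      then obtain L where L: "L \<in> \<C>" "(a, b) \<in> L" by blast
      show "(- a, - b) \<in> \<Union>\<C>" by (rule UnionI[OF L(1) graph_uminus]) (use sub[OF L(1)] L(2) in auto)
    next
      fix b assume "(0, b) \<in> \<Union>\<C>"
      then obtain L where L: "L \<in> \<C>" "(0, b) \<in> L" by blast
      show "b = 0" by (rule graph_0D[of L]) (use sub[OF L(1)] L(2) in auto)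
    next
      fix p q :: int assume "of_int q \<noteq> (0::'a)"
      then show "(of_int p / of_int q, of_int p / of_int q) \<in> \<Union>\<C>" by (intro UnionI[OF G] graph_rat) (use sub[OF G] in auto)
    qed
    then show "\<Union>\<C> \<in> \<A>" using sub G by (auto simp: \<A>_def)
  qed
  then obtain M where M: "graph M" "G0 \<subseteq> M" and max: "\<And>G. graph G \<Longrightarrow> M \<subseteq> G \<Longrightarrow> G = M"
    by (auto simp: \<A>_def)
  have total: "\<exists>b. (z, b) \<in> M" for z
  proof -
    obtain m mc where m: "minimal_pair M z m mc" by (rule minimal_pair_exists[OF M(1)])
    then have m': "(m, mc) \<in> pairs M" "Polynomial.lead_coeff m = 1" "poly m z = 0" by (auto simp: minimal_pair_def)
    have "Polynomial.degree m \<noteq> 0"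
    proof
      assume "Polynomial.degree m = 0"
      then obtain a where "m = [:a:]" by (metis degree_eq_zeroE)
      then show False using m' by simp
    qed
    then have "Polynomial.degree mc \<noteq> 0" using pairs_degree(2)[OF M(1) m'(1,2)] by simp
    then obtain \<omega> where "poly mc \<omega> = 0"
      using fundamental_theorem_of_algebra[of mc] constant_degree[of mc] by auto
    then obtain G' where "graph G'" "M \<subseteq> G'" "(z, \<omega>) \<in> G'" using graph_extend[OF M(1) m] by blast
    then show ?thesis using max by blast
  qed
  define \<sigma> where "\<sigma> z = (THE b. (z, b) \<in> M)" for z
  have \<sigma>I: "\<sigma> z = b" if "(z, b) \<in> M" for z b
    unfolding \<sigma>_def by (rule the_equality) (auto intro: that graph_functional[OF M(1) _ that])
  have \<sigma>: "(z, \<sigma> z) \<in> M" for z using total[of z] \<sigma>I by auto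
  have "\<sigma> \<in> complex_embeddings"
    unfolding embedding_iff
    using \<sigma>I[OF graph_mult[OF M(1) \<sigma> \<sigma>]] \<sigma>I[OF graph_add[OF M(1) \<sigma> \<sigma>]] \<sigma>I[OF graph_1[OF M(1)]] by simp
  then show ?thesis using that \<sigma>I M(2) by blast
qed

definition rat_graph :: "('a \<times> complex) set"
  where "rat_graph = {(of_int p / of_int q, of_int p / of_int q) | p q. of_int q \<noteq> (0::'a)}"

lemma graph_rat_graph: "graph rat_graph"
proof -
  have nz: "q \<noteq> 0" if "of_int q \<noteq> (0::'a)" for q using that by auto
  have c: "of_int q \<noteq> (0::complex)" if "of_int q \<noteq> (0::'a)" for q using nz[OF that] by simp
  have I: "(of_int p / of_int q, of_int p / of_int q) \<in> rat_graph" if "of_int q \<noteq> (0::'a)" for p q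
    using that by (auto simp: rat_graph_def)
  show ?thesis
    unfolding graph_def
  proof (intro conjI allI impI)
    fix a b a' b' assume "(a, b) \<in> rat_graph" "(a', b') \<in> rat_graph"
    then obtain p q p' q' where *: "of_int q \<noteq> (0::'a)" "of_int q' \<noteq> (0::'a)" "a = of_int p / of_int q" "b = of_int p / of_int q"
      "a' = of_int p' / of_int q'" "b' = of_int p' / of_int q'" by (auto simp: rat_graph_def)
    note cs = c[OF *(1)] c[OF *(2)]
    have qq: "of_int (q * q') \<noteq> (0::'a)" using * by simp
    have "a + a' = of_int (p * q' + p' * q) / of_int (q * q')" "b + b' = of_int (p * q' + p' * q) / of_int (q * q')"
      using * cs by (auto simp: field_simps)
    then show "(a + a', b + b') \<in> rat_graph" using I[OF qq] by metis
    have "a * a' = of_int (p * p') / of_int (q * q')" "b * b' = of_int (p * p') / of_int (q * q')"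
      using * by auto
    then show "(a * a', b * b') \<in> rat_graph" using I[OF qq] by metis
  next
    fix a b assume "(a, b) \<in> rat_graph"
    then obtain p q where *: "of_int q \<noteq> (0::'a)" "a = of_int p / of_int q" "b = of_int p / of_int q"
      by (auto simp: rat_graph_def)
    then have "- a = of_int (- p) / of_int q" "- b = of_int (- p) / of_int q" by auto
    then show "(- a, - b) \<in> rat_graph" using I[OF *(1)] by metis
  next
    fix b assume "(0, b) \<in> rat_graph"
    then obtain p q where "of_int q \<noteq> (0::'a)" "0 = (of_int p / of_int q :: 'a)" "b = of_int p / of_int q"
      by (auto simp: rat_graph_def)
    then show "b = 0" using of_int_inj[of p 0] by simp
  qed (rule I)
qed

text \<open>The root extends the embedding of the rationals to \<open>z\<close>, and then to the
  whole field. So bounds on all embeddings of an element bound all roots of its minimal polynomial,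
  and with them the coefficients.\<close>

lemma minpoly_root_embedding:
  assumes m: "m \<in> polys_over \<int>" "Polynomial.lead_coeff m = 1" "poly m z = 0"
    and min: "\<And>p. p \<in> polys_over (fractions \<int>) \<Longrightarrow> p \<noteq> 0 \<Longrightarrow> poly p z = 0 \<Longrightarrow> Polynomial.degree m \<le> Polynomial.degree p"
    and \<omega>: "poly (cpoly m) \<omega> = 0"
  obtains \<sigma> where "\<sigma> \<in> complex_embeddings" "\<sigma> z = \<omega>"
proof -
  have "minimal_pair rat_graph z m (cpoly m)"
    unfolding minimal_pair_def
  proof (intro conjI allI impI)
    show "(m, cpoly m) \<in> pairs rat_graph" by (rule cpoly_pairs[OF graph_rat_graph m(1)])
    fix p q assume pq: "(p, q) \<in> pairs rat_graph" "p \<noteq> 0" "poly p z = 0"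
    have "Polynomial.coeff p i \<in> fractions \<int>" for i
    proof -
      obtain a b where "Polynomial.coeff p i = of_int a / of_int b" "of_int b \<noteq> (0::'a)"
        using pairs_coeff[OF pq(1), of i] by (auto simp: rat_graph_def)
      then show ?thesis unfolding fractions_def
        by (intro CollectI exI[of _ "of_int a"] exI[of _ "of_int b"]) simp
    qed
    then show "Polynomial.degree m \<le> Polynomial.degree p" using pq by (intro min polys_overI) auto
  qed (use m in auto)
  then obtain G where G: "graph G" "(z, \<omega>) \<in> G" using graph_extend[OF graph_rat_graph _ \<omega>] by blast
  show ?thesis by (rule graph_total_exists[OF G(1)]) (use that G(2) in blast)
qed

end

section \<open>Finiteness of bounded sets of algebraic integers\<close>

text \<open>Each linear factor enlarges a common bound of the coefficients by at most the factor
  \<open>1 + T\<close>.\<close>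

lemma coeff_bound_of_roots:
  fixes A :: "complex multiset"
  assumes "T \<ge> 0" "\<And>x. x \<in># A \<Longrightarrow> cmod x \<le> T"
  shows "cmod (Polynomial.coeff (\<Prod>x\<in>#A. [:- x, 1:]) i) \<le> (1 + T) ^ size A"
  using assms(2)
proof (induction A arbitrary: i)
  case empty
  then show ?case by (simp add: coeff_1)
next
  case (add x A)
  let ?p = "\<Prod>x\<in>#A. [:- x, 1:]"
  have IH: "cmod (Polynomial.coeff ?p i) \<le> (1 + T) ^ size A" for i using add by simp
  have x: "cmod x \<le> T" using add by simp
  have "Polynomial.coeff ([:- x, 1:] * ?p) i = - x * Polynomial.coeff ?p i + (case i of 0 \<Rightarrow> 0 | Suc j \<Rightarrow> Polynomial.coeff ?p j)"
    by (cases i) simp_all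
  also have "cmod \<dots> \<le> T * (1 + T) ^ size A + (1 + T) ^ size A"
  proof (rule norm_triangle_le[OF add_mono])
    show "cmod (- x * Polynomial.coeff ?p i) \<le> T * (1 + T) ^ size A"
      using mult_mono[OF x IH[of i] assms(1)] by (simp add: norm_mult)
    show "cmod (case i of 0 \<Rightarrow> 0 | Suc j \<Rightarrow> Polynomial.coeff ?p j) \<le> (1 + T) ^ size A"
      using IH assms(1) by (cases i) auto
  qed
  finally show ?case by (simp add: algebra_simps)
qed

lemma coeff_bound_monic:
  fixes p :: "complex poly"
  assumes "Polynomial.lead_coeff p = 1" "T \<ge> 0" "\<And>x. poly p x = 0 \<Longrightarrow> cmod x \<le> T"
  shows "cmod (Polynomial.coeff p i) \<le> (1 + T) ^ Polynomial.degree p"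
proof -
  have "p \<noteq> 0" using assms(1) by auto
  obtain A where A: "size A = Polynomial.degree p" "p = Polynomial.smult (Polynomial.lead_coeff p) (\<Prod>x\<in>#A. [:- x, 1:])"
    using alg_closed_imp_factorization[OF \<open>p \<noteq> 0\<close>] by blast
  then have p: "p = (\<Prod>x\<in>#A. [:- x, 1:])" using assms(1) by simp
  have "cmod x \<le> T" if "x \<in># A" for x
    using that by (intro assms(3)) (subst p, auto simp: poly_prod_mset)
  from coeff_bound_of_roots[OF assms(2) this, of A i] show ?thesis using p A(1) by simp
qed

context number_field_ext
begin

text \<open>The roots of the minimal polynomial are conjugates of \<open>h\<close>, so its integer
  coefficients are bounded in terms of \<open>T\<close> and \<open>d\<close>; finitely many nonzero
  polynomials have finitely many roots.\<close>

lemma finite_bounded_integers: "finite {h \<in> Oc. \<forall>\<sigma>\<in>complex_embeddings. cmod (\<sigma> h) \<le> T}"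
proof (cases "T \<ge> 0")
  case True
  define B where "B = \<lceil>(1 + T) ^ d\<rceil>"
  define \<P> where "\<P> = (\<lambda>f. \<Sum>i\<le>d. Polynomial.monom (of_int (f i)) i :: 'a poly) ` ({..d} \<rightarrow>\<^sub>E {-B..B})"
  have "finite \<P>" unfolding \<P>_def by (intro finite_imageI finite_PiE) auto
  have "{h \<in> Oc. \<forall>\<sigma>\<in>complex_embeddings. cmod (\<sigma> h) \<le> T} \<subseteq> (\<Union>p\<in>\<P> - {0}. {h. poly p h = 0})"
  proof
    fix h assume "h \<in> {h \<in> Oc. \<forall>\<sigma>\<in>complex_embeddings. cmod (\<sigma> h) \<le> T}"
    then have h: "h \<in> Oc" "\<And>\<sigma>. \<sigma> \<in> complex_embeddings \<Longrightarrow> cmod (\<sigma> h) \<le> T" by auto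
    obtain m where m: "m \<in> polys_over \<int>" "Polynomial.lead_coeff m = 1" "poly m h = 0"
      "\<And>p. p \<in> polys_over (fractions \<int>) \<Longrightarrow> p \<noteq> 0 \<Longrightarrow> poly p h = 0 \<Longrightarrow> Polynomial.degree m \<le> Polynomial.degree p"
      "Polynomial.degree m \<le> d" using minpoly_exists[OF h(1)] by metis
    have cm: "Polynomial.degree (cpoly m) = Polynomial.degree m" "Polynomial.lead_coeff (cpoly m) = 1"
      using pairs_degree(2)[OF graph_rat_graph cpoly_pairs[OF graph_rat_graph m(1)] m(2)] by auto
    have "cmod x \<le> T" if x: "poly (cpoly m) x = 0" for x
    proof -
      obtain \<sigma> where "\<sigma> \<in> complex_embeddings" "\<sigma> h = x"
        using minpoly_root_embedding[OF m(1-4) x] by metis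
      then show ?thesis using h(2) by blast
    qed
    then have bd: "cmod (Polynomial.coeff (cpoly m) i) \<le> (1 + T) ^ Polynomial.degree m" for i
      using coeff_bound_monic[OF cm(2) True, of i] cm(1) by simp
    have "\<bar>zint (Polynomial.coeff m i)\<bar> \<le> B" for i
    proof -
      have "real_of_int \<bar>zint (Polynomial.coeff m i)\<bar> = cmod (Polynomial.coeff (cpoly m) i)"
        by (simp add: coeff_cpoly)
      also have "\<dots> \<le> (1 + T) ^ Polynomial.degree m" by (rule bd)
      also have "\<dots> \<le> (1 + T) ^ d" using True m(5) by (intro power_increasing) auto
      finally show ?thesis unfolding B_def by linarith
    qed
    then have f: "restrict (\<lambda>i. zint (Polynomial.coeff m i)) {..d} \<in> {..d} \<rightarrow>\<^sub>E {-B..B}"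
      by (auto simp: abs_le_iff) (metis abs_le_iff minus_le_iff)
    have "m = (\<Sum>i\<le>d. Polynomial.monom (of_int (restrict (\<lambda>i. zint (Polynomial.coeff m i)) {..d} i)) i)"
    proof (rule poly_eqI)
      fix j
      show "Polynomial.coeff m j = Polynomial.coeff (\<Sum>i\<le>d. Polynomial.monom (of_int (restrict (\<lambda>i. zint (Polynomial.coeff m i)) {..d} i)) i) j"
        using m(5) of_int_zint[OF polys_over_coeff[OF m(1)], of j] by (simp add: coeff_sum coeff_eq_0)
    qed
    then have "m \<in> \<P>" unfolding \<P>_def using f by blast
    moreover have "m \<noteq> 0" using m(2) by auto
    ultimately show "h \<in> (\<Union>p\<in>\<P> - {0}. {h. poly p h = 0})" using m(3) by blast
  qed
  moreover have "finite (\<Union>p\<in>\<P> - {0}. {h. poly p h = 0})"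
    using \<open>finite \<P>\<close> by (auto intro: poly_roots_finite)
  ultimately show ?thesis by (rule finite_subset)
next
  case False
  \<comment> \<open>At least one embedding has to exist here, as the condition would otherwise be
    void and the set all of \<open>Oc\<close>.\<close>
  obtain \<sigma> :: "'a \<Rightarrow> complex" where "\<sigma> \<in> complex_embeddings"
    using graph_total_exists[OF graph_rat_graph] by metis
  moreover have "\<not> cmod z \<le> T" for z using False norm_ge_zero[of z] by linarith
  ultimately have "{h \<in> Oc. \<forall>\<sigma>\<in>complex_embeddings. cmod (\<sigma> h) \<le> T} = {}" by blast
  then show ?thesis by (metis finite.emptyI)
qed

lemma poly_cpoly_emb:
  assumes \<sigma>: "\<sigma> \<in> complex_embeddings" and p: "p \<in> polys_over \<int>"
  shows "poly (cpoly p) (\<sigma> z) = \<sigma> (poly p z)"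
proof -
  have c: "\<sigma> (Polynomial.coeff p i) = of_int (zint (Polynomial.coeff p i))" for i
    using emb_of_int[OF \<sigma>, of "zint (Polynomial.coeff p i)"] of_int_zint[OF polys_over_coeff[OF p]] by simp
  have le: "Polynomial.degree (cpoly p) \<le> Polynomial.degree p"
    by (rule degree_le) (simp add: coeff_cpoly coeff_eq_0)
  have "poly (cpoly p) (\<sigma> z) = (\<Sum>i\<le>Polynomial.degree p. Polynomial.coeff (cpoly p) i * \<sigma> z ^ i)"
    unfolding poly_altdef by (rule sum.mono_neutral_left) (use le in \<open>auto simp: coeff_eq_0\<close>)
  also have "\<dots> = \<sigma> (poly p z)"
    unfolding poly_altdef by (simp add: emb_sum[OF \<sigma>] emb_mult[OF \<sigma>] emb_power[OF \<sigma>] c coeff_cpoly)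
  finally show ?thesis .
qed

text \<open>Some integral combination of elements separating the embeddings pairwise separates them all.\<close>

lemma separating_element:
  assumes F: "finite F" "F \<subseteq> (complex_embeddings :: ('a \<Rightarrow> complex) set)"
  obtains \<theta> where "inj_on (\<lambda>\<sigma>. \<sigma> \<theta>) F"
proof -
  define Q where "Q = {(\<sigma>, \<tau>). \<sigma> \<in> F \<and> \<tau> \<in> F \<and> \<sigma> \<noteq> \<tau>}"
  have "finite Q" by (rule finite_subset[of _ "F \<times> F"]) (use F in \<open>auto simp: Q_def\<close>)
  then obtain e where e: "bij_betw e {..<card Q} Q"
    using ex_bij_betw_nat_finite by (metis atLeast0LessThan)
  have eQ: "e l \<in> Q" if "l < card Q" for l using e that by (auto simp: bij_betw_def)
  have "\<forall>l\<in>{..<card Q}. \<exists>z. fst (e l) z \<noteq> snd (e l) z"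
    using eQ by (fastforce simp: Q_def fun_eq_iff)
  then obtain z where z: "\<And>l. l < card Q \<Longrightarrow> fst (e l) (z l) \<noteq> snd (e l) (z l)"
    by (metis lessThan_iff)
  \<comment> \<open>At the integer \<open>N\<close> this polynomial takes the difference of the two
    embeddings at \<open>\<theta>\<close> as its value. It is not zero, so all but finitely many
    \<open>N\<close> keep the embeddings of every pair apart.\<close>
  define pp where "pp x = (\<Sum>l<card Q. Polynomial.monom (fst x (z l) - snd x (z l)) l)" for x :: "('a \<Rightarrow> complex) \<times> ('a \<Rightarrow> complex)"
  have pp_nz: "pp x \<noteq> 0" if x: "x \<in> Q" for x
  proof -
    obtain l where l: "l < card Q" "x = e l" using e x by (auto simp: bij_betw_def)
    then have "Polynomial.coeff (pp x) l \<noteq> 0" using z by (simp add: pp_def coeff_sum)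
    then show ?thesis by auto
  qed
  have "finite (\<Union>x\<in>Q. {w. poly (pp x) w = 0})"
    using \<open>finite Q\<close> pp_nz by (auto intro: poly_roots_finite)
  then have "finite ((of_nat :: nat \<Rightarrow> complex) -` (\<Union>x\<in>Q. {w. poly (pp x) w = 0}))"
    by (intro finite_vimageI) (auto simp: inj_on_def)
  then obtain N :: nat where "N \<notin> of_nat -` (\<Union>x\<in>Q. {w. poly (pp x) w = 0})"
    using ex_new_if_finite[OF infinite_UNIV_nat] by blast
  then have N: "poly (pp x) (of_nat N) \<noteq> 0" if "x \<in> Q" for x using that by auto
  define \<theta> where "\<theta> = (\<Sum>l<card Q. of_int (int N) ^ l * z l)"
  have "inj_on (\<lambda>\<sigma>. \<sigma> \<theta>) F"
  proof (rule inj_onI, rule ccontr)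
    fix \<sigma> \<tau> assume st: "\<sigma> \<in> F" "\<tau> \<in> F" "\<sigma> \<theta> = \<tau> \<theta>" "\<sigma> \<noteq> \<tau>"
    then have em: "\<sigma> \<in> complex_embeddings" "\<tau> \<in> complex_embeddings" and Q: "(\<sigma>, \<tau>) \<in> Q" using F by (auto simp: Q_def)
    have val: "\<rho> \<theta> = (\<Sum>l<card Q. of_nat N ^ l * \<rho> (z l))" if "\<rho> \<in> complex_embeddings" for \<rho>
      unfolding \<theta>_def by (simp add: emb_sum[OF that] emb_mult[OF that] emb_power[OF that] emb_of_int[OF that] del: of_int_of_nat_eq)
        simp
    have "poly (pp (\<sigma>, \<tau>)) (of_nat N) = \<sigma> \<theta> - \<tau> \<theta>"
      unfolding val[OF em(1)] val[OF em(2)]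
      by (simp add: pp_def poly_sum poly_monom algebra_simps flip: sum_subtractf)
    then show False using N[OF Q] st(3) by simp
  qed
  then show ?thesis using that by blast
qed

text \<open>A separating element takes different values under finitely many given embeddings, all of
  them roots of one polynomial of degree at most \<open>d\<close>.\<close>

lemma card_embeddings: "finite (complex_embeddings :: ('a \<Rightarrow> complex) set)" "card (complex_embeddings :: ('a \<Rightarrow> complex) set) \<le> d"
proof -
  have "card F \<le> d" if F: "F \<subseteq> (complex_embeddings :: ('a \<Rightarrow> complex) set)" "finite F" for F
  proof -
    obtain \<theta> where \<theta>: "inj_on (\<lambda>\<sigma>. \<sigma> \<theta>) F" using separating_element[OF F(2,1)] by blast
    obtain p where p: "p \<in> polys_over \<int>" "p \<noteq> 0" "poly p \<theta> = 0" "Polynomial.degree p \<le> d"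
      by (rule annihilator_exists[of \<theta>])
    have le: "Polynomial.degree (cpoly p) \<le> Polynomial.degree p"
      by (rule degree_le) (simp add: coeff_cpoly coeff_eq_0)
    have "cpoly p \<noteq> 0"
    proof
      assume "cpoly p = 0"
      then have "zint (Polynomial.coeff p i) = 0" for i using coeff_cpoly[of p i] by simp
      then have "Polynomial.coeff p i = 0" for i using of_int_zint[OF polys_over_coeff[OF p(1), of i]] by (metis of_int_0)
      then show False using p(2) by (simp add: poly_eq_iff)
    qed
    have "(\<lambda>\<sigma>. \<sigma> \<theta>) ` F \<subseteq> {x. poly (cpoly p) x = 0}"
      using poly_cpoly_emb[OF _ p(1)] p(3) F emb_0 by auto
    then have "card ((\<lambda>\<sigma>. \<sigma> \<theta>) ` F) \<le> card {x. poly (cpoly p) x = 0}"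
      using poly_roots_finite[OF \<open>cpoly p \<noteq> 0\<close>] by (intro card_mono)
    also have "\<dots> \<le> Polynomial.degree (cpoly p)" by (rule poly_roots_degree[OF \<open>cpoly p \<noteq> 0\<close>])
    finally show ?thesis using card_image[OF \<theta>] le p(4) by simp
  qed
  then show "finite (complex_embeddings :: ('a \<Rightarrow> complex) set)" "card (complex_embeddings :: ('a \<Rightarrow> complex) set) \<le> d"
    using finite_if_finite_subsets_card_bdd[of complex_embeddings d] by blast+
qed

end

section \<open>Residue fields and indices of ideals\<close>

context euclid_ext
begin

text \<open>The ideals of elements divisible by a power of \<open>v\<close> and by powers of the places in \<open>B\<close> are comaximal.\<close>

lemma approximation:
  assumes v: "v \<in> VV" and B: "finite B" "B \<subseteq> VV" "v \<notin> B" and k: "k \<ge> 0"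
  obtains \<epsilon> where "\<epsilon> \<in> Oc" "\<epsilon> - 1 \<in> nval.ball v k" "\<And>w. w \<in> B \<Longrightarrow> \<epsilon> \<in> nval.ball w k"
proof -
  define A where "A = {f \<in> Oc. \<forall>w\<in>B. f \<in> nval.ball w k}"
  define C where "C = {f \<in> Oc. f \<in> nval.ball v k}"
  have ball: "nval.ball w k = {f. f = 0 \<or> w f \<ge> k}" if "w \<in> VV" for w
    using nval.ball_def[OF VV_nval[OF that]] by blast
  have smult: "a * f \<in> nval.ball w k" if w: "w \<in> VV" and "a \<in> Oc" "f \<in> nval.ball w k" for w a f
  proof -
    interpret nval w by (rule VV_nval[OF w])
    show ?thesis using ball_mult[of a 0 f k] that VV_ring[OF w] by (auto simp: valuation_ring_ball)
  qed
  have add: "f + g \<in> nval.ball w k" if w: "w \<in> VV" and "f \<in> nval.ball w k" "g \<in> nval.ball w k" for w f g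
    using nval.ball_add[OF VV_nval[OF w]] that by blast
  have zero: "0 \<in> nval.ball w k" if "w \<in> VV" for w using nval.ball_0[OF VV_nval[OF that]] .
  note BVV = subsetD[OF B(2)]
  have A: "is_ideal A" unfolding is_ideal_def A_def
    using smult[OF BVV] add[OF BVV] zero[OF BVV] by simp
  have C: "is_ideal C" unfolding is_ideal_def C_def
    using smult[OF v] add[OF v] zero[OF v] by simp
  define S where "S = {a + c | a c. a \<in> A \<and> c \<in> C}"
  have AS: "A \<subseteq> S" and CS: "C \<subseteq> S"
  proof -
    have "0 \<in> A" "0 \<in> C" using A C by (auto simp: is_ideal_def)
    then show "A \<subseteq> S" "C \<subseteq> S" unfolding S_def by force+
  qed
  \<comment> \<open>A place whose ideal contains \<open>S\<close> would be neither \<open>v\<close>,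
    where the element \<open>f0\<close> of \<open>A\<close> is a unit, nor any other place, where
    some element of \<open>C\<close> is a unit.\<close>
  have "1 \<in> S"
  proof (rule ccontr)
    assume "1 \<notin> S"
    have "is_ideal S"
      unfolding is_ideal_def
    proof (intro conjI ballI)
      show "0 \<in> S" using AS A by (auto simp: is_ideal_def)
      fix x y assume "x \<in> S" "y \<in> S"
      then obtain a c a' c' where *: "x = a + c" "y = a' + c'" "a \<in> A" "a' \<in> A" "c \<in> C" "c' \<in> C"
        unfolding S_def by blast
      have "x + y = (a + a') + (c + c')" using * by simp
      moreover have "a + a' \<in> A" "c + c' \<in> C" using * A C unfolding is_ideal_def by blast+
      ultimately show "x + y \<in> S" unfolding S_def by blast
    next
      fix r x assume r: "r \<in> Oc" "x \<in> S"
      then obtain a c where *: "x = a + c" "a \<in> A" "c \<in> C" unfolding S_def by blast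
      have "r * x = r * a + r * c" using * by (simp add: distrib_left)
      moreover have "r * a \<in> A" "r * c \<in> C" using * r A C unfolding is_ideal_def by blast+
      ultimately show "r * x \<in> S" unfolding S_def by blast
    qed
    moreover have "S \<subseteq> Oc" by (auto simp: S_def A_def C_def)
    moreover obtain f0 where f0: "f0 \<in> Oc" "f0 \<noteq> 0" "v f0 = 0" "\<And>w. w \<in> B \<Longrightarrow> w f0 \<ge> k"
      using VV_separate_finite[OF B(1,2) v B(3), of k] by metis
    have "f0 \<in> A" unfolding A_def using f0 ball B by auto
    then have "S \<noteq> {0}" using AS f0(2) by blast
    ultimately obtain u where u: "u \<in> VV" "S \<subseteq> valuation_ideal u"
      using proper_ideal_VV \<open>1 \<notin> S\<close> by metis
    show False
    proof (cases "u = v")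
      case True
      then show False using u AS \<open>f0 \<in> A\<close> f0 by (auto simp: valuation_ideal_def)
    next
      case False
      obtain f where f: "f \<in> Oc" "f \<noteq> 0" "u f = 0" "\<And>w. w \<in> {v} \<Longrightarrow> w f \<ge> k"
        using VV_separate_finite[of "{v}" u k] u(1) v False by (metis empty_subsetI finite.emptyI finite_insert insert_subset singletonD)
      then have "f \<in> C" unfolding C_def using ball[OF v] by auto
      then show False using u CS f by (auto simp: valuation_ideal_def)
    qed
  qed
  then obtain a c where ac: "1 = a + c" "a \<in> A" "c \<in> C" unfolding S_def by blast
  have "a - 1 = - c" using ac(1) by (simp add: algebra_simps)
  then have "a - 1 \<in> nval.ball v k" using ac(3) nval.ball_uminus[OF VV_nval[OF v]] by (simp add: C_def)
  then show ?thesis using that[of a] ac(2) by (simp add: A_def)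
qed

section \<open>Residue systems and indices of ideals\<close>

definition transversal :: "'a set \<Rightarrow> 'a set \<Rightarrow> 'a set \<Rightarrow> bool"
  where "transversal A B Xs \<longleftrightarrow> finite Xs \<and> Xs \<subseteq> A \<and> (\<forall>x\<in>A. \<exists>y\<in>Xs. x - y \<in> B) \<and> (\<forall>x\<in>Xs. \<forall>y\<in>Xs. x - y \<in> B \<longrightarrow> x = y)"

definition kap :: "('a \<Rightarrow> int) \<Rightarrow> nat" where "kap v = card (carrier (residue_field v))"

lemma residue_carrier:
  fixes v :: "'a \<Rightarrow> int"
  shows "carrier (residue_field v) = (\<lambda>x. {y. y - x \<in> valuation_ideal v}) ` valuation_ring v"
proof -
  have "{y. y - x \<in> valuation_ideal v} = {h + x | h. h \<in> valuation_ideal v}" for x :: 'a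
    by (auto simp: algebra_simps) (metis diff_add_cancel add.commute)
  then show ?thesis
    by (auto simp: residue_field_def FactRing_def A_RCOSETS_def' a_r_coset_def' simp del: Collect_mem_eq)
qed

text \<open>Division by an element \<open>t\<close> with the exact value \<open>e v\<close>
  identifies the quotient of the two ideals with the residue field. Surjectivity is the point:
  \<open>t\<close> times a representative may violate \<open>e\<close> elsewhere, and
  \<open>approximation\<close> corrects it by a factor congruent to 1 at \<open>v\<close>.\<close>

lemma idl_step:
  assumes v: "v \<in> VV" and e: "finite {w \<in> VV. e w \<noteq> 0}" and fin: "finite (carrier (residue_field v))"
  obtains Xs where "transversal (idl e) (idl (e(v := e v + 1))) Xs" "card Xs = kap v"
proof -
  interpret nval v by (rule VV_nval[OF v])
  obtain t where t: "t \<in> idl e" "t \<noteq> 0" "v t = e v" by (rule idl_attained[OF e v])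
  define cs where "cs x = {y. y - x \<in> valuation_ideal v}" for x
  have cs_eq: "cs x = cs y \<longleftrightarrow> x - y \<in> valuation_ideal v" for x y
  proof
    assume "cs x = cs y"
    moreover have "x \<in> cs x" by (simp add: cs_def valuation_ideal_ball)
    ultimately show "x - y \<in> valuation_ideal v" by (auto simp: cs_def)
  next
    assume xy: "x - y \<in> valuation_ideal v"
    have "z - x \<in> ball 1 \<longleftrightarrow> z - y \<in> ball 1" for z
      using ball_add[of "z - x" 1 "x - y"] ball_diff[of "z - y" 1 "x - y"] xy by (auto simp: valuation_ideal_ball)
    then show "cs x = cs y" by (auto simp: cs_def valuation_ideal_ball)
  qed
  have diff: "f - g \<in> idl e" if "f \<in> idl e" "g \<in> idl e" for f g
  proof -
    have "- g \<in> idl e" using that(2) is_ideal_idl[of e] unfolding is_ideal_def by (metis O.R_one O.R_uminus mult_minus1)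
    then show ?thesis using that(1) is_ideal_idl[of e] unfolding is_ideal_def by (metis diff_conv_add_uminus)
  qed
  have key: "f \<in> idl (e(v := e v + 1)) \<longleftrightarrow> f / t \<in> valuation_ideal v" if "f \<in> idl e" for f
    using that t by (cases "f = 0") (auto simp: idl_def valuation_ideal_def v_divide v)
  have surj: "\<exists>f\<in>idl e. f / t - x \<in> valuation_ideal v" if x: "x \<in> valuation_ring v" for x
  proof (cases "x = 0")
    case True
    then show ?thesis by (intro bexI[of _ 0]) (auto simp: valuation_ideal_ball idl_def)
  next
    case False
    define B where "B = {w \<in> VV. w (t * x) < e w} - {v}"
    have "B \<subseteq> {w \<in> VV. e w \<noteq> 0} \<union> {w \<in> VV. w (t * x) \<noteq> 0}" by (auto simp: B_def)
    then have "finite B" by (rule finite_subset[OF _ finite_UnI[OF e finite_VV_support]])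
    moreover have "B \<subseteq> VV" "v \<notin> B" by (auto simp: B_def)
    ultimately have B: "finite B" "B \<subseteq> VV" "v \<notin> B" by auto
    \<comment> \<open>At least 1, to preserve the residue at \<open>v\<close>, and large enough to
      make up for every deficit on \<open>B\<close>.\<close>
    define k where "k = Max (insert 1 ((\<lambda>w. e w - w (t * x)) ` B))"
    have k: "k \<ge> 1" "\<And>w. w \<in> B \<Longrightarrow> e w - w (t * x) \<le> k" using B(1) by (auto simp: k_def)
    obtain \<epsilon> where \<epsilon>: "\<epsilon> \<in> Oc" "\<epsilon> - 1 \<in> ball k" "\<And>w. w \<in> B \<Longrightarrow> \<epsilon> \<in> nval.ball w k"
      using approximation[OF v B, of k] k(1) by (metis order_trans zero_le_one)
    have \<epsilon>1: "\<epsilon> - 1 \<in> ball 1" by (rule ball_mono[OF k(1) \<epsilon>(2)])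
    have xb: "x \<in> ball 0" using x by (simp add: valuation_ring_ball)
    have "\<epsilon> * (t * x) / t - x = (\<epsilon> - 1) * x" using t(2) by (simp add: algebra_simps)
    then have 1: "\<epsilon> * (t * x) / t - x \<in> valuation_ideal v"
      using ball_mult[OF \<epsilon>1 xb] by (simp add: valuation_ideal_ball)
    have "\<epsilon> * (t * x) \<in> idl e"
    proof (cases "\<epsilon> = 0")
      case True then show ?thesis by (simp add: idl_def)
    next
      case \<epsilon>0: False
      have "e w \<le> w (\<epsilon> * (t * x))" if w: "w \<in> VV" for w
      proof -
        have m: "w (\<epsilon> * (t * x)) = w \<epsilon> + w (t * x)" "w \<epsilon> \<ge> 0"
          using nval.v_mult[OF VV_nval[OF w]] t False \<epsilon>0 VV_nonneg[OF w \<epsilon>(1)] by auto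
        consider "w = v" | "w \<in> B" | "e w \<le> w (t * x)"
          using w unfolding B_def by (cases "e w \<le> w (t * x)"; cases "w = v") auto
        then show ?thesis
        proof cases
          case 1
          then have "w (t * x) \<ge> e w" using t(3) xb False t(2) by (simp add: v_mult ball_def)
          then show ?thesis using m by linarith
        next
          case 2
          then have "w \<epsilon> \<ge> k" using \<epsilon>(3)[OF 2] \<epsilon>0 nval.ball_def[OF VV_nval[OF w]] by auto
          then show ?thesis using m k(2)[OF 2] by linarith
        qed (use m in linarith)
      qed
      then show ?thesis by (simp add: idl_def)
    qed
    then show ?thesis using 1 by blast
  qed
  have "\<forall>K\<in>carrier (residue_field v). \<exists>f. f \<in> idl e \<and> cs (f / t) = K"
    unfolding residue_carrier using surj cs_eq by (fastforce simp: cs_def)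
  then obtain r where r: "\<And>K. K \<in> carrier (residue_field v) \<Longrightarrow> r K \<in> idl e \<and> cs (r K / t) = K" by metis
  show ?thesis
  proof (rule that[of "r ` carrier (residue_field v)"])
    have "inj_on r (carrier (residue_field v))" using r by (metis inj_onI)
    then show "card (r ` carrier (residue_field v)) = kap v" by (simp add: card_image kap_def)
    show "transversal (idl e) (idl (e(v := e v + 1))) (r ` carrier (residue_field v))"
      unfolding transversal_def
    proof (intro conjI ballI impI)
      show "finite (r ` carrier (residue_field v))" using fin by simp
      show "r ` carrier (residue_field v) \<subseteq> idl e" using r by auto
    next
      fix f assume f: "f \<in> idl e"
      have "f / t \<in> valuation_ring v"
        using f t by (cases "f = 0") (auto simp: idl_def valuation_ring_def v_divide v)
      then have K: "cs (f / t) \<in> carrier (residue_field v)" by (simp add: residue_carrier cs_def)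
      have "f / t - r (cs (f / t)) / t \<in> valuation_ideal v" using r[OF K] cs_eq by metis
      then have "f - r (cs (f / t)) \<in> idl (e(v := e v + 1))"
        using key[OF diff[OF f]] r[OF K] by (simp add: diff_divide_distrib)
      then show "\<exists>y\<in>r ` carrier (residue_field v). f - y \<in> idl (e(v := e v + 1))" using K by blast
    next
      fix x y assume "x \<in> r ` carrier (residue_field v)" "y \<in> r ` carrier (residue_field v)"
        and xy: "x - y \<in> idl (e(v := e v + 1))"
      then obtain K L where KL: "x = r K" "y = r L" "K \<in> carrier (residue_field v)" "L \<in> carrier (residue_field v)" by auto
      then have "x / t - y / t \<in> valuation_ideal v"
        using key[OF diff, of x y] r xy by (auto simp: diff_divide_distrib)
      then have "K = L" using cs_eq[of "x / t" "y / t"] r[OF KL(3)] r[OF KL(4)] KL by simp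
      then show "x = y" using KL by simp
    qed
  qed
qed

text \<open>The norm of the ideal \<open>idl e\<close> for nonnegative \<open>e\<close>, read off
  from the factorization; \<open>transversal_exists\<close> identifies it with the number of residue
  classes.\<close>

definition index :: "(('a \<Rightarrow> int) \<Rightarrow> int) \<Rightarrow> real"
  where "index e = (\<Prod>v | v \<in> VV \<and> e v \<noteq> 0. real (kap v) ^ nat (e v))"

text \<open>Induction on the sum of the exponents: lowering one exponent by 1 gives a larger ideal,
  and sums of representatives for the two successive quotients represent the whole quotient.\<close>

lemma transversal_exists:
  assumes fin: "\<And>v. v \<in> VV \<Longrightarrow> finite (carrier (residue_field v))"
    and e: "finite {w \<in> VV. e w \<noteq> 0}" "\<And>w. w \<in> VV \<Longrightarrow> e w \<ge> 0"
  obtains Xs where "transversal Oc (idl e) Xs" "real (card Xs) = index e"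
proof -
  have "\<exists>Xs. transversal Oc (idl e) Xs \<and> real (card Xs) = index e"
    using e
  proof (induction "\<Sum>w | w \<in> VV \<and> e w \<noteq> 0. nat (e w)" arbitrary: e)
    case 0
    then have z: "e w = 0" if "w \<in> VV" for w using that by (metis (mono_tags, lifting) mem_Collect_eq nat_0_iff order_antisym sum_eq_0_iff)
    have "idl e = Oc" using z Oc_eq by (auto simp: idl_def)
    then have "transversal Oc (idl e) {0}" by (auto simp: transversal_def)
    moreover have "{v. v \<in> VV \<and> e v \<noteq> 0} = {}" using z by auto
    ultimately show ?case by (intro exI[of _ "{0}"]) (simp add: index_def)
  next
    case (Suc N)
    obtain v where v: "v \<in> VV" "e v \<noteq> 0"
      using Suc.hyps(2) by (metis (mono_tags, lifting) mem_Collect_eq nat.simps(3) sum.neutral)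
    have ev: "e v \<ge> 1" using v Suc.prems(2)[OF v(1)] by simp
    define e' where "e' = e(v := e v - 1)"
    have e: "e = e'(v := e' v + 1)" by (simp add: e'_def)
    let ?S = "{w \<in> VV. e w \<noteq> 0}"
    have sub: "{w \<in> VV. e' w \<noteq> 0} \<subseteq> ?S" using v by (auto simp: e'_def)
    have fin': "finite {w \<in> VV. e' w \<noteq> 0}" using Suc.prems(1) sub by (rule finite_subset[rotated])
    have sum_e': "(\<Sum>w | w \<in> VV \<and> e' w \<noteq> 0. nat (e' w)) = (\<Sum>w\<in>?S. nat (e' w))"
      by (rule sum.mono_neutral_left) (use Suc.prems(1) sub in auto)
    have vS: "v \<in> ?S" using v by simp
    have "(\<Sum>w\<in>?S. nat (e w)) = Suc (\<Sum>w\<in>?S. nat (e' w))"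
      unfolding sum.remove[OF Suc.prems(1) vS] using ev by (simp add: e'_def nat_diff_distrib)
    then have "N = (\<Sum>w | w \<in> VV \<and> e' w \<noteq> 0. nat (e' w))" using Suc.hyps(2) sum_e' by simp
    moreover have "e' w \<ge> 0" if "w \<in> VV" for w using Suc.prems(2)[OF that] ev by (simp add: e'_def)
    ultimately obtain Xs where Xs: "transversal Oc (idl e') Xs" "real (card Xs) = index e'"
      using Suc.hyps(1)[of e'] fin' by blast
    obtain Y where Y: "transversal (idl e') (idl e) Y" "card Y = kap v"
      using idl_step[OF v(1) fin' fin[OF v(1)]] e by metis
    have I: "is_ideal (idl e)" "is_ideal (idl e')" by (rule is_ideal_idl)+
    have addI: "a + b \<in> idl f" if "a \<in> idl f" "b \<in> idl f" for a b f
      using is_ideal_idl[of f] that unfolding is_ideal_def by blast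
    have unI: "- a \<in> idl f" if "a \<in> idl f" for a f
      using is_ideal_idl[of f] that unfolding is_ideal_def by (metis O.R_one O.R_uminus mult_minus1)
    have sub_idl: "idl e \<subseteq> idl e'"
    proof
      fix f assume f: "f \<in> idl e"
      have "e' w \<le> e w" for w by (simp add: e'_def)
      then show "f \<in> idl e'" using f unfolding idl_def by (auto intro: order_trans)
    qed
    have idl_Oc: "idl e' \<subseteq> Oc"
      using \<open>\<And>w. w \<in> VV \<Longrightarrow> e' w \<ge> 0\<close> by (subst Oc_eq) (auto simp: idl_def intro: order_trans)
    have XO: "Xs \<subseteq> Oc" "finite Xs" "\<And>f. f \<in> Oc \<Longrightarrow> \<exists>x\<in>Xs. f - x \<in> idl e'" "\<And>x x'. x \<in> Xs \<Longrightarrow> x' \<in> Xs \<Longrightarrow> x - x' \<in> idl e' \<Longrightarrow> x = x'"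
      using Xs(1) by (auto simp: transversal_def)
    have YO: "Y \<subseteq> idl e'" "finite Y" "\<And>f. f \<in> idl e' \<Longrightarrow> \<exists>y\<in>Y. f - y \<in> idl e" "\<And>y y'. y \<in> Y \<Longrightarrow> y' \<in> Y \<Longrightarrow> y - y' \<in> idl e \<Longrightarrow> y = y'"
      using Y(1) by (auto simp: transversal_def)
    have uniq: "x = x' \<and> y = y'"
      if "x \<in> Xs" "x' \<in> Xs" "y \<in> Y" "y' \<in> Y" "(x + y) - (x' + y') \<in> idl e" for x x' y y'
    proof -
      have "(x + y - (x' + y')) + (y' + - y) \<in> idl e'"
        using that sub_idl YO(1) by (intro addI unI) auto
      then have xx: "x = x'" using XO(4)[OF that(1,2)] by (simp add: algebra_simps)
      then show ?thesis using YO(4)[OF that(3,4)] that(5) by (simp add: algebra_simps)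
    qed
    define Z where "Z = (\<lambda>(x, y). x + y) ` (Xs \<times> Y)"
    have inj: "inj_on (\<lambda>(x, y). x + y) (Xs \<times> Y)"
    proof (rule inj_onI)
      fix p q assume pq: "p \<in> Xs \<times> Y" "q \<in> Xs \<times> Y" "(\<lambda>(x, y). x + y) p = (\<lambda>(x, y). x + y) q"
      have "0 \<in> idl e" by (simp add: idl_def)
      then show "p = q" using uniq[of "fst p" "fst q" "snd p" "snd q"] pq by (auto simp: case_prod_beta prod_eq_iff)
    qed
    have "transversal Oc (idl e) Z"
      unfolding transversal_def
    proof (intro conjI ballI impI)
      show "finite Z" using XO(2) YO(2) by (simp add: Z_def)
      show "Z \<subseteq> Oc" using XO(1) YO(1) idl_Oc unfolding Z_def by (auto intro!: O.R_add)
    next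
      fix f assume "f \<in> Oc"
      then obtain x where x: "x \<in> Xs" "f - x \<in> idl e'" using XO(3) by blast
      then obtain y where y: "y \<in> Y" "f - x - y \<in> idl e" using YO(3) by blast
      have "x + y \<in> Z" using x y by (auto simp: Z_def)
      then show "\<exists>z\<in>Z. f - z \<in> idl e" using y(2) by (metis diff_diff_eq)
    next
      fix z z' assume "z \<in> Z" "z' \<in> Z" "z - z' \<in> idl e"
      then show "z = z'" using uniq by (auto simp: Z_def)
    qed
    moreover have "real (card Z) = index e"
    proof -
      have "index e' = (\<Prod>w\<in>?S. real (kap w) ^ nat (e' w))"
        unfolding index_def by (rule prod.mono_neutral_left) (use Suc.prems(1) sub in auto)
      then have "index e' * real (kap v) = index e"
        unfolding index_def prod.remove[OF Suc.prems(1) vS] using ev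
        by (simp add: e'_def nat_diff_distrib power_diff) (simp flip: power_Suc2 add: Suc_nat_eq_nat_zadd1)
      moreover have "card Z = card Xs * card Y"
        unfolding Z_def card_image[OF inj] by (rule card_cartesian_product)
      ultimately show ?thesis using Xs(2) Y(2) by simp
    qed
    ultimately show ?case by blast
  qed
  then show ?thesis using that by blast
qed

end

section \<open>Reduction modulo primes of the base ring\<close>

lemma (in euclid_ext) is_ideal_diff: "is_ideal I \<Longrightarrow> a \<in> I \<Longrightarrow> b \<in> I \<Longrightarrow> a - b \<in> I"
proof -
  assume I: "is_ideal I" and a: "a \<in> I" and b: "b \<in> I"
  have "(- 1) * b \<in> I" using I b O.R_uminus[OF O.R_one] unfolding is_ideal_def by blast
  then have "a + (- 1) * b \<in> I" using I a unfolding is_ideal_def by blast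
  then show ?thesis by simp
qed

context euclid_ext_prime
begin

text \<open>By division with remainder, the combinations of \<open>r\<close> and \<open>gen\<close>
  are multiples of one \<open>g\<close>. It is outside \<open>M\<close>, like \<open>r\<close>, so
  writing \<open>gen = q2 * g\<close> forces \<open>gen\<close> to divide \<open>q2\<close> and
  \<open>g\<close> to be a unit. Thus \<open>R\<close> modulo \<open>gen\<close> is a field.\<close>

lemma residue_inverse:
  assumes r: "r \<in> R" "r \<notin> M"
  obtains c where "c \<in> R" "c * r - 1 \<in> M"
proof -
  define S where "S = {a * r + b * gen | a b. a \<in> R \<and> b \<in> R}"
  have "r \<in> S" unfolding S_def by (rule CollectI, rule exI[of _ 1], rule exI[of _ 0]) simp
  moreover have "gen \<in> S" unfolding S_def by (rule CollectI, rule exI[of _ 0], rule exI[of _ 1]) simp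
  ultimately have S0: "r \<in> S" "gen \<in> S" by auto
  have r0: "r \<noteq> 0" using r by auto
  define ok where "ok x \<longleftrightarrow> x \<in> S \<and> x \<noteq> 0" for x
  obtain g where g: "ok g" "\<And>x. ok x \<Longrightarrow> \<delta> g \<le> \<delta> x"
    using ex_has_least_nat[of ok r \<delta>] S0 r0 by (auto simp: ok_def)
  obtain a b where ab: "g = a * r + b * gen" "a \<in> R" "b \<in> R" "g \<noteq> 0" using g(1) by (auto simp: ok_def S_def)
  have gR: "g \<in> R" using ab r gen by simp
  have dv: "\<exists>q\<in>R. x = q * g" if x: "x \<in> S" for x
  proof -
    obtain a' b' where x': "x = a' * r + b' * gen" "a' \<in> R" "b' \<in> R" using x by (auto simp: S_def)
    have xR: "x \<in> R" using x' r gen by simp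
    obtain q where q: "q \<in> R" "x - q * g = 0 \<or> \<delta> (x - q * g) < \<delta> g" using euclid[OF xR gR ab(4)] by blast
    have "x - q * g = (a' - q * a) * r + (b' - q * b) * gen" using x' ab by (simp add: algebra_simps)
    moreover have "a' - q * a \<in> R" "b' - q * b \<in> R" using x' q(1) ab(2,3) by simp_all
    ultimately have "x - q * g \<in> S" unfolding S_def by blast
    then have "x - q * g = 0" using g(2)[of "x - q * g"] q(2) unfolding ok_def by (meson not_le)
    then show ?thesis using q by auto
  qed
  obtain q1 q2 where q: "q1 \<in> R" "r = q1 * g" "q2 \<in> R" "gen = q2 * g" using dv S0 by metis
  have "g \<notin> M" using M_mult[of q1 g] q r R_Oc by auto
  then have "q2 \<in> M" using M_prime[of q2 g] q gen(2) gR R_Oc by metis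
  then obtain q' where q': "q' \<in> R" "q2 = q' * gen" using gen(4) q(3) by blast
  then have "q' * g = 1" using q(4) gen(3) by (simp add: mult_ac)
  then have "q' * a * r - 1 = - (q' * b) * gen" using ab by (simp add: algebra_simps)
  moreover have "- (q' * b) * gen \<in> M" using q' ab gen R_Oc by (intro M_mult) auto
  ultimately show ?thesis using that[of "q' * a"] q' ab by simp
qed

text \<open>A family in \<open>V\<close> that is maximal among those independent modulo \<open>U\<close> spans \<open>V\<close> modulo \<open>U\<close>.\<close>

lemma span_modulo:
  assumes U: "0 \<in> U" "\<And>x y. x \<in> U \<Longrightarrow> y \<in> U \<Longrightarrow> x + y \<in> U" "\<And>a x. a \<in> R \<Longrightarrow> x \<in> U \<Longrightarrow> a * x \<in> U"
    and V: "\<And>x. x \<in> V \<Longrightarrow> gen * x \<in> U"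
  obtains r g where "r \<le> d" "\<And>i. i < r \<Longrightarrow> g i \<in> V"
    "\<And>x. x \<in> V \<Longrightarrow> \<exists>c. (\<forall>i<r. c i \<in> R) \<and> x - (\<Sum>i<r. c i * g i) \<in> U"
proof -
  define ind where "ind r g \<longleftrightarrow> (\<forall>i<r. g i \<in> V) \<and>
    (\<forall>c. (\<forall>i<r. c i \<in> R) \<longrightarrow> (\<Sum>i<r. c i * g i) \<in> U \<longrightarrow> (\<forall>i<r. c i \<in> M))" for r and g :: "nat \<Rightarrow> 'a"
  have bd: "r \<le> d" if "ind r g" for r g
  proof (rule ccontr)
    assume "\<not> r \<le> d"
    then obtain c where c: "\<forall>i\<in>{..<r}. c i \<in> R" "\<exists>i\<in>{..<r}. c i \<notin> M" "(\<Sum>i<r. c i * g i) = 0"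
      using primitive_dep[of "{..<r}" g] by auto
    then show False using that U(1) unfolding ind_def by (metis lessThan_iff)
  qed
  have "\<exists>r g. ind r g" by (intro exI[of _ 0]) (simp add: ind_def)
  then obtain r where r: "\<exists>g. ind r g" "\<And>r'. \<exists>g. ind r' g \<Longrightarrow> r' \<le> r"
    using ex_has_greatest_nat[of "\<lambda>r. \<exists>g. ind r g" _ id "Suc d"] bd by (metis id_apply le_imp_less_Suc)
  obtain g where g: "ind r g" using r(1) by blast
  show ?thesis
  proof (rule that[of r g])
    show "r \<le> d" by (rule bd[OF g])
    show "g i \<in> V" if "i < r" for i using g that by (simp add: ind_def)
    fix x assume x: "x \<in> V"
    have "\<not> ind (Suc r) (g(r := x))" using r(2)[of "Suc r"] by fastforce
    moreover have "\<forall>i<Suc r. (g(r := x)) i \<in> V" using g x by (auto simp: ind_def less_Suc_eq)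
    ultimately obtain c where c: "\<forall>i<Suc r. c i \<in> R" "(\<Sum>i<Suc r. c i * (g(r := x)) i) \<in> U" "\<exists>i<Suc r. c i \<notin> M"
      unfolding ind_def by blast
    have sum: "(\<Sum>i<Suc r. c i * (g(r := x)) i) = (\<Sum>i<r. c i * g i) + c r * x" by simp
    have neg: "- y \<in> U" if "y \<in> U" for y using U(3)[of "-1" y] that by simp
    have "c r \<notin> M"
    proof
      assume "c r \<in> M"
      then obtain q where q: "q \<in> R" "c r = q * gen" using gen(4) c(1) by blast
      then have "c r * x \<in> U" using U(3)[OF q(1) V[OF x]] by (simp add: mult.assoc)
      then have "(\<Sum>i<r. c i * g i) \<in> U" using U(2)[OF c(2) neg[of "c r * x"]] sum by simp
      then have "\<forall>i<r. c i \<in> M" using g c(1) unfolding ind_def by (meson less_Suc_eq)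
      then show False using c(3) \<open>c r \<in> M\<close> less_Suc_eq by auto
    qed
    moreover have "c r \<in> R" using c(1) by simp
    ultimately obtain c' where c': "c' \<in> R" "c' * c r - 1 \<in> M" by (metis residue_inverse)
    then obtain q where q: "q \<in> R" "c' * c r - 1 = q * gen" using gen(4)[of "c' * c r - 1"] \<open>c r \<in> R\<close> by auto
    \<comment> \<open>The relation is multiplied by an inverse \<open>c'\<close> of
      \<open>c r\<close> modulo \<open>gen\<close>; the error is a multiple of
      \<open>gen * x\<close>, which lies in \<open>U\<close>.\<close>
    have "x - (\<Sum>i<r. (- c' * c i) * g i) = c' * ((\<Sum>i<r. c i * g i) + c r * x) + - ((c' * c r - 1) * x)"
      by (simp add: sum_distrib_left sum_negf algebra_simps)
    also have "\<dots> = c' * ((\<Sum>i<r. c i * g i) + c r * x) + - (q * (gen * x))"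
      using q by (simp add: mult.assoc)
    also have "\<dots> \<in> U"
      by (rule U(2)[OF U(3)[OF c'(1) c(2)[unfolded sum]] neg[OF U(3)[OF q(1) V[OF x]]]])
    finally show "\<exists>c. (\<forall>i<r. c i \<in> R) \<and> x - (\<Sum>i<r. c i * g i) \<in> U"
      using c' c(1) by (intro exI[of _ "\<lambda>i. - c' * c i"]) auto
  qed
qed

end

locale number_field_prime = number_field_ext \<delta> d + euclid_ext_prime "\<int>" \<delta> d M for \<delta> :: "'a::field \<Rightarrow> nat" and d and M
begin

lemma zgen: "of_int (zint gen) = gen" "zint gen \<noteq> 0"
  using of_int_zint[OF gen(1)] gen(3) by (auto simp del: zint)

text \<open>\<open>V\<close> modulo \<open>U\<close> is spanned by at most \<open>d\<close> elements
  over the integers, and reducing the coefficients modulo \<open>\<bar>zint gen\<bar>\<close>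
  changes a combination only by elements of \<open>U\<close>.\<close>

lemma quotient_bound:
  assumes U: "0 \<in> U" "\<And>x y. x \<in> U \<Longrightarrow> y \<in> U \<Longrightarrow> x + y \<in> U" "\<And>a x. a \<in> \<int> \<Longrightarrow> x \<in> U \<Longrightarrow> a * x \<in> U"
    and V: "\<And>x. x \<in> V \<Longrightarrow> gen * x \<in> U"
  obtains Y where "finite Y" "card Y \<le> nat \<bar>zint gen\<bar> ^ d" "\<And>x. x \<in> V \<Longrightarrow> \<exists>y\<in>Y. x - y \<in> U"
proof (rule span_modulo[OF U V])
  fix r :: nat and g
  assume rg: "r \<le> d" "\<And>i. i < r \<Longrightarrow> g i \<in> V"
    "\<And>x. x \<in> V \<Longrightarrow> \<exists>c. (\<forall>i<r. c i \<in> \<int>) \<and> x - (\<Sum>i<r. c i * g i) \<in> U"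
  define m where "m = \<bar>zint gen\<bar>"
  have m: "m > 0" using zgen by (simp add: m_def)
  define F where "F = {..<r} \<rightarrow>\<^sub>E {0..<m}"
  have F: "finite F" "card F = nat m ^ r" unfolding F_def by (auto intro: finite_PiE simp: card_PiE)
  define Y where "Y = (\<lambda>f. \<Sum>i<r. of_int (f i) * g i) ` F"
  show thesis
  proof (rule that[of Y])
    show "finite Y" using F by (simp add: Y_def)
    have "card Y \<le> nat m ^ r" unfolding Y_def using card_image_le[OF F(1)] F(2) by metis
    also have "\<dots> \<le> nat m ^ d" using m rg(1) by (intro power_increasing) auto
    finally show "card Y \<le> nat \<bar>zint gen\<bar> ^ d" by (simp add: m_def)
    fix x assume "x \<in> V"
    then obtain c where c: "\<forall>i<r. c i \<in> \<int>" "x - (\<Sum>i<r. c i * g i) \<in> U" using rg(3) by blast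
    define f where "f = restrict (\<lambda>i. zint (c i) mod m) {..<r}"
    have fF: "f \<in> F" using m by (auto simp: F_def f_def)
    have single: "(c i - of_int (f i)) * g i \<in> U" if i: "i < r" for i
    proof -
      have "zint (c i) - zint (c i) mod m = m * (zint (c i) div m)" by (simp add: minus_mod_eq_mult_div)
      moreover have "m = sgn (zint gen) * zint gen" by (simp add: m_def abs_sgn mult.commute)
      ultimately have "zint (c i) - f i = sgn (zint gen) * (zint (c i) div m) * zint gen"
        using i by (simp add: f_def mult_ac)
      then have "c i - of_int (f i) = of_int (sgn (zint gen) * (zint (c i) div m)) * gen"
        using of_int_zint[of "c i"] c(1) i zgen(1) by (metis of_int_diff of_int_mult)
      then have "(c i - of_int (f i)) * g i = of_int (sgn (zint gen) * (zint (c i) div m)) * (gen * g i)"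
        by (simp only: mult.assoc)
      also have "\<dots> \<in> U" by (rule U(3)[OF _ V[OF rg(2)[OF i]]]) simp
      finally show ?thesis .
    qed
    have sums: "(\<Sum>i\<in>I. (c i - of_int (f i)) * g i) \<in> U" if "I \<subseteq> {..<r}" for I
      using finite_subset[OF that finite_lessThan] that
    proof (induction I rule: finite_induct)
      case (insert i I)
      then show ?case using U(2)[OF single[of i]] by simp
    qed (simp add: U(1))
    have "x - (\<Sum>i<r. of_int (f i) * g i) = (x - (\<Sum>i<r. c i * g i)) + (\<Sum>i<r. (c i - of_int (f i)) * g i)"
      by (simp add: left_diff_distrib sum_subtractf)
    also have "\<dots> \<in> U" by (rule U(2)[OF c(2) sums]) simp
    finally show "\<exists>y\<in>Y. x - y \<in> U" using fF by (auto simp: Y_def)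
  qed
qed

end

context number_field_ext
begin

lemma VV_number_field_prime: "v \<in> VV \<Longrightarrow> number_field_prime \<delta> d (valuation_ideal v \<inter> Oc)"
  by (intro number_field_prime.intro VV_prime) unfold_locales

lemma Ints_VV: "v \<in> VV \<Longrightarrow> a \<in> \<int> \<Longrightarrow> a \<in> nval.ball v 0"
  using VV_ring[of v] R_Oc[of a] nval.valuation_ring_ball[OF VV_nval] by blast

lemma residue_finite:
  assumes v: "v \<in> VV"
  shows "finite (carrier (residue_field v))"
proof -
  interpret nval v by (rule VV_nval[OF v])
  interpret p: number_field_prime \<delta> d "valuation_ideal v \<inter> Oc" by (rule VV_number_field_prime[OF v])
  have gen1: "p.gen \<in> ball 1" using p.gen(2) by (simp add: valuation_ideal_ball)
  obtain Y where Y: "finite Y" "\<And>x. x \<in> valuation_ring v \<Longrightarrow> \<exists>y\<in>Y. x - y \<in> valuation_ideal v"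
  proof (rule p.quotient_bound[of "valuation_ideal v" "valuation_ring v"])
    show "a * x \<in> valuation_ideal v" if "a \<in> \<int>" "x \<in> valuation_ideal v" for a x
      using ball_mult[OF Ints_VV[OF v that(1)], of x 1] that(2) by (simp add: valuation_ideal_ball)
    show "p.gen * x \<in> valuation_ideal v" if "x \<in> valuation_ring v" for x
      using ball_mult[OF gen1, of x 0] that by (simp add: valuation_ideal_ball valuation_ring_ball)
  qed (auto simp: valuation_ideal_ball ball_add)
  have "carrier (residue_field v) \<subseteq> (\<lambda>x. {y. y - x \<in> valuation_ideal v}) ` Y"
  proof
    fix K assume "K \<in> carrier (residue_field v)"
    then obtain x where x: "x \<in> valuation_ring v" "K = {y. y - x \<in> valuation_ideal v}" by (auto simp: residue_carrier)
    obtain y where y: "y \<in> Y" "x - y \<in> ball 1" using Y(2)[OF x(1)] by (auto simp: valuation_ideal_ball)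
    have "z - x \<in> ball 1 \<longleftrightarrow> z - y \<in> ball 1" for z
      using ball_add[of "z - x" 1 "x - y"] ball_diff[of "z - y" 1 "x - y"] y(2) by auto
    then show "K \<in> (\<lambda>x. {y. y - x \<in> valuation_ideal v}) ` Y" using x(2) y(1) by (auto simp: valuation_ideal_ball)
  qed
  then show ?thesis using Y(1) finite_subset by blast
qed

lemma transversal_finite_index:
  assumes "finite {w \<in> VV. e w \<noteq> 0}" "\<forall>w\<in>VV. e w \<ge> 0"
  shows "\<exists>Xs. transversal Oc (idl e) Xs \<and> real (card Xs) = index e"
proof -
  have nn: "e w \<ge> 0" if "w \<in> VV" for w using assms(2) that by blast
  show ?thesis by (rule transversal_exists[of e]) (use assms(1) nn residue_finite in blast)+
qed

lemma kap_pos: "v \<in> VV \<Longrightarrow> kap v \<ge> 1"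
proof -
  assume v: "v \<in> VV"
  have "0 \<in> valuation_ring v" by (simp add: valuation_ring_def)
  then have "carrier (residue_field v) \<noteq> {}" by (auto simp: residue_carrier)
  then show ?thesis using residue_finite[OF v] by (simp add: kap_def Suc_le_eq card_gt_0_iff)
qed

lemma index_pos: "index e > 0"
  unfolding index_def using kap_pos by (intro prod_pos zero_less_power) force

lemma index_superset:
  assumes "finite S" "{v \<in> VV. e v \<noteq> 0} \<subseteq> S" "S \<subseteq> VV"
  shows "index e = (\<Prod>v\<in>S. real (kap v) ^ nat (e v))"
  unfolding index_def by (rule prod.mono_neutral_left) (use assms in auto)

lemma index_mult:
  assumes "f \<in> Oc" "f \<noteq> 0" "g \<in> Oc" "g \<noteq> 0"
  shows "index (\<lambda>v. v (f * g)) = index (\<lambda>v. v f) * index (\<lambda>v. v g)"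
proof -
  let ?S = "{v \<in> VV. v f \<noteq> 0} \<union> {v \<in> VV. v g \<noteq> 0}"
  have S: "finite ?S" "?S \<subseteq> VV" using finite_VV_support by auto
  have mult: "v (f * g) = v f + v g" if "v \<in> VV" for v
    using nval.v_mult[OF VV_nval[OF that]] assms by simp
  have "index (\<lambda>v. v (f * g)) = (\<Prod>v\<in>?S. real (kap v) ^ nat (v (f * g)))"
    by (rule index_superset[OF S(1) _ S(2)]) (auto simp: mult)
  also have "\<dots> = (\<Prod>v\<in>?S. real (kap v) ^ nat (v f) * real (kap v) ^ nat (v g))"
  proof (rule prod.cong)
    fix v assume "v \<in> ?S"
    then have v: "v \<in> VV" by auto
    show "real (kap v) ^ nat (v (f * g)) = real (kap v) ^ nat (v f) * real (kap v) ^ nat (v g)"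
      using VV_nonneg[OF v assms(1)] VV_nonneg[OF v assms(3)]
      by (simp add: mult[OF v] nat_add_distrib power_add)
  qed simp
  also have "\<dots> = index (\<lambda>v. v f) * index (\<lambda>v. v g)"
    unfolding prod.distrib
    using index_superset[OF S(1) _ S(2), of "\<lambda>v. v f"] index_superset[OF S(1) _ S(2), of "\<lambda>v. v g"] by auto
  finally show ?thesis .
qed

lemma index_power: "f \<in> Oc \<Longrightarrow> f \<noteq> 0 \<Longrightarrow> index (\<lambda>v. v (f ^ m)) = index (\<lambda>v. v f) ^ m"
proof (induction m)
  case 0
  have "{v. v \<in> VV \<and> v 1 \<noteq> 0} = {}" using nval.v_one[OF VV_nval] by blast
  then have "index (\<lambda>v. v 1) = 1" unfolding index_def by (simp only: prod.empty)
  then show ?case by simp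
next
  case (Suc m)
  then show ?case using index_mult[of f "f ^ m"] by simp
qed

lemma idl_principal: "f \<noteq> 0 \<Longrightarrow> h \<in> idl (\<lambda>v. v f) \<longleftrightarrow> h / f \<in> Oc"
proof -
  assume f: "f \<noteq> 0"
  have "v f \<le> v h \<longleftrightarrow> 0 \<le> v (h / f)" if "v \<in> VV" "h \<noteq> 0" for v
    using nval.v_divide[OF VV_nval[OF that(1)], of h f] that f by auto
  moreover have "h / f \<in> Oc \<longleftrightarrow> h / f = 0 \<or> (\<forall>v\<in>VV. 0 \<le> v (h / f))" using Oc_eq by blast
  ultimately show ?thesis using f by (auto simp: idl_def)
qed

text \<open>Multiplication by the generator maps \<open>Oc\<close> into the ideal it generates, so
  \<open>quotient_bound\<close> applies. This upper estimate of the index complements the lower one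
  from the pigeonhole principle.\<close>

lemma index_gen_le:
  assumes v0: "v0 \<in> VV"
  defines "\<gamma> \<equiv> euclid_ext_prime.gen \<int> (valuation_ideal v0 \<inter> Oc)"
  shows "index (\<lambda>v. v \<gamma>) \<le> real_of_int \<bar>zint \<gamma>\<bar> ^ d"
proof -
  interpret p: number_field_prime \<delta> d "valuation_ideal v0 \<inter> Oc" by (rule VV_number_field_prime[OF v0])
  have \<gamma>: "\<gamma> \<in> Oc" "\<gamma> \<noteq> 0" "\<gamma> = p.gen" using p.gen R_Oc by (auto simp: \<gamma>_def)
  have I: "is_ideal (idl (\<lambda>v. v \<gamma>))" by (rule is_ideal_idl)
  obtain Xs where Xs: "transversal Oc (idl (\<lambda>v. v \<gamma>)) Xs" "real (card Xs) = index (\<lambda>v. v \<gamma>)"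
    using transversal_finite_index[OF finite_VV_support[of \<gamma>]] VV_nonneg[OF _ \<gamma>(1)] by blast
  obtain Y where Y: "finite Y" "card Y \<le> nat \<bar>zint p.gen\<bar> ^ d" "\<And>x. x \<in> Oc \<Longrightarrow> \<exists>y\<in>Y. x - y \<in> idl (\<lambda>v. v \<gamma>)"
  proof (rule p.quotient_bound[of "idl (\<lambda>v. v \<gamma>)" Oc])
    show "a * x \<in> idl (\<lambda>v. v \<gamma>)" if "a \<in> \<int>" "x \<in> idl (\<lambda>v. v \<gamma>)" for a x
      using that I R_Oc unfolding is_ideal_def by blast
    show "p.gen * x \<in> idl (\<lambda>v. v \<gamma>)" if "x \<in> Oc" for x
      using that \<gamma> idl_principal[OF \<gamma>(2), of "p.gen * x"] by simp
  qed (use I in \<open>auto simp: is_ideal_def\<close>)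
  have Xs_Oc: "Xs \<subseteq> Oc" and Xs_inj: "\<forall>x\<in>Xs. \<forall>y\<in>Xs. x - y \<in> idl (\<lambda>v. v \<gamma>) \<longrightarrow> x = y"
    using Xs(1) by (simp_all add: transversal_def)
  have "\<forall>x\<in>Xs. \<exists>y. y \<in> Y \<and> x - y \<in> idl (\<lambda>v. v \<gamma>)" using Y(3)[OF subsetD[OF Xs_Oc]] by blast
  then obtain \<eta> where \<eta>: "\<And>x. x \<in> Xs \<Longrightarrow> \<eta> x \<in> Y \<and> x - \<eta> x \<in> idl (\<lambda>v. v \<gamma>)" by metis
  have "inj_on \<eta> Xs"
  proof (rule inj_onI)
    fix x x' assume xx: "x \<in> Xs" "x' \<in> Xs" "\<eta> x = \<eta> x'"
    have "(x - \<eta> x) - (x' - \<eta> x') \<in> idl (\<lambda>v. v \<gamma>)"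
      using is_ideal_diff[OF I, of "x - \<eta> x" "x' - \<eta> x'"] \<eta>[OF xx(1)] \<eta>[OF xx(2)] by blast
    then have "x - x' \<in> idl (\<lambda>v. v \<gamma>)" using xx(3) by (simp add: algebra_simps)
    then show "x = x'" using Xs_inj xx(1,2) by simp
  qed
  then have "card Xs \<le> card Y" using \<eta> Y(1) by (intro card_inj_on_le[of \<eta>]) auto
  then have "card Xs \<le> nat \<bar>zint \<gamma>\<bar> ^ d" using Y(2) \<gamma>(3) by simp
  then have "real (card Xs) \<le> real (nat \<bar>zint \<gamma>\<bar> ^ d)" by (rule of_nat_mono)
  then show ?thesis using Xs(2) by simp
qed

end

section \<open>Counting in number fields\<close>

locale number_field_places = number_field_ext \<delta> d for \<delta> :: "'a::field \<Rightarrow> nat" and d +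
  fixes P :: "nat \<Rightarrow> 'a place" and n :: nat and y :: "nat \<Rightarrow> 'a"
  assumes enum: "bij_betw P {1..Suc n} (SS Number_Field)"
    and y_Oc: "\<And>j. j < d \<Longrightarrow> y j \<in> Oc"
    and y_indep: "\<And>c. (\<Sum>j<d. of_int (c j) * y j) = 0 \<Longrightarrow> \<forall>j<d. c j = 0"
begin

section \<open>Archimedean places and local degrees\<close>

definition sg :: "nat \<Rightarrow> 'a \<Rightarrow> complex"
  where "sg i = (SOME \<sigma>. P i = Arch {\<sigma>, cnj \<circ> \<sigma>} \<and> \<sigma> \<in> complex_embeddings)"

text \<open>The embedding that \<open>nu\<close> and \<open>place_deg\<close> actually use is an
  arbitrary member of the place. It agrees with \<open>sg i\<close> up to complex conjugation, which
  affects neither absolute values nor the test for a real image.\<close>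

definition pick :: "nat \<Rightarrow> 'a \<Rightarrow> complex"
  where "pick i = (case P i of Arch E \<Rightarrow> (SOME \<sigma>. \<sigma> \<in> E))"

definition dn :: "nat \<Rightarrow> nat" where "dn i = (if range (sg i) \<subseteq> \<real> then 1 else 2)"

lemma sg:
  assumes "i \<in> {1..Suc n}"
  shows "P i = Arch {sg i, cnj \<circ> sg i}" "sg i \<in> complex_embeddings"
proof -
  have "P i \<in> SS Number_Field" using enum assms by (auto simp: bij_betw_def)
  then have "\<exists>\<sigma>. P i = Arch {\<sigma>, cnj \<circ> \<sigma>} \<and> \<sigma> \<in> complex_embeddings" by auto
  from someI_ex[OF this] show "P i = Arch {sg i, cnj \<circ> sg i}" "sg i \<in> complex_embeddings"
    by (auto simp: sg_def)
qed

lemma cnj_embedding: "\<sigma> \<in> complex_embeddings \<Longrightarrow> cnj \<circ> \<sigma> \<in> (complex_embeddings :: ('a \<Rightarrow> complex) set)"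
  by (simp add: embedding_iff)

lemma pick:
  assumes "i \<in> {1..Suc n}"
  shows "pick i = sg i \<or> pick i = cnj \<circ> sg i"
proof -
  have "(SOME \<sigma>. \<sigma> \<in> {sg i, cnj \<circ> sg i}) \<in> {sg i, cnj \<circ> sg i}" by (rule someI[of _ "sg i"]) simp
  then show ?thesis unfolding pick_def sg(1)[OF assms] by (simp only: place.case insert_iff empty_iff simp_thms)
qed

lemma nu_P: "i \<in> {1..Suc n} \<Longrightarrow> nu (P i) f = - ln (cmod (sg i f))"
  using pick[of i] by (auto simp: sg(1) pick_def)

lemma place_deg_P: "i \<in> {1..Suc n} \<Longrightarrow> place_deg Number_Field (P i) = real (dn i)"
proof -
  assume i: "i \<in> {1..Suc n}"
  have "range (pick i) \<subseteq> \<real> \<longleftrightarrow> range (sg i) \<subseteq> \<real>" using pick[OF i] by (auto simp: image_subset_iff)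
  then show ?thesis by (simp add: sg(1)[OF i] pick_def dn_def)
qed

lemma embedding_sg:
  assumes "\<sigma> \<in> complex_embeddings"
  shows "\<exists>i\<in>{1..Suc n}. \<sigma> = sg i \<or> \<sigma> = cnj \<circ> sg i"
proof -
  have "Arch {\<sigma>, cnj \<circ> \<sigma>} \<in> P ` {1..Suc n}" using enum assms by (auto simp: bij_betw_def)
  then obtain i where i: "i \<in> {1..Suc n}" "P i = Arch {\<sigma>, cnj \<circ> \<sigma>}" by auto
  then have "{sg i, cnj \<circ> sg i} = {\<sigma>, cnj \<circ> \<sigma>}" using sg(1)[OF i(1)] by simp
  then have "\<sigma> \<in> {sg i, cnj \<circ> sg i}" by simp
  then show ?thesis using i(1) by blast
qed

text \<open>A real place gives one embedding, a complex place two different ones, and different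
  places share none. Equality has to wait for \<open>sum_dn\<close>, since the embeddings have been
  counted from above only.\<close>

lemma sum_dn_le: "(\<Sum>i=1..Suc n. dn i) \<le> d"
proof -
  define f where "f = (\<lambda>(i, j::nat). if j = 0 then sg i else cnj \<circ> sg i)"
  let ?S = "SIGMA i:{1..Suc n}. {..<dn i}"
  have "inj_on f ?S"
  proof (rule inj_onI)
    fix u u' assume u: "u \<in> ?S" "u' \<in> ?S" "f u = f u'"
    obtain i j where ij: "u = (i, j)" by (cases u)
    obtain i' j' where ij': "u' = (i', j')" by (cases u')
    have a: "i \<in> {1..Suc n}" "j \<in> {..<dn i}" "i' \<in> {1..Suc n}" "j' \<in> {..<dn i'}" "f (i, j) = f (i', j')"
      using u unfolding ij ij' by simp_all
    have cc: "cnj \<circ> (cnj \<circ> sg k) = sg k" for k by auto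
    have set: "{sg k, cnj \<circ> sg k} = {f (k, l), cnj \<circ> f (k, l)}" for k l
      by (cases "l = 0") (simp_all only: f_def prod.case if_True if_False simp_thms cc insert_commute)
    have "{sg i, cnj \<circ> sg i} = {sg i', cnj \<circ> sg i'}" unfolding set[of i j] set[of i' j'] a(5) by (rule refl)
    then have "P i = P i'" using sg(1) a by simp
    then have ii: "i = i'" using enum a by (auto simp: bij_betw_def dest: inj_onD)
    have "j = j'"
    proof (rule ccontr)
      assume ne: "j \<noteq> j'"
      have "dn i \<le> 2" by (simp add: dn_def)
      then have "dn i = 2" "sg i = cnj \<circ> sg i" using a(2,4,5) ii ne by (auto simp: f_def split: if_splits)
      then have "sg i z \<in> \<real>" for z by (metis Reals_cnj_iff comp_apply)
      then show False using \<open>dn i = 2\<close> by (auto simp: dn_def split: if_splits)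
    qed
    then show "u = u'" using ii ij ij' by simp
  qed
  moreover have "f ` ?S \<subseteq> complex_embeddings" using sg(2) cnj_embedding by (auto simp: f_def)
  ultimately have "card ?S \<le> card (complex_embeddings :: ('a \<Rightarrow> complex) set)"
    by (intro card_inj_on_le card_embeddings)
  then show ?thesis using card_embeddings(2) by simp
qed

text \<open>Two images in the same grid cell of side \<open>T i\<close> differ by at most
  \<open>T i\<close> in real and imaginary part, hence by at most \<open>2 * T i\<close> in absolute
  value: the origin of the factor 2.\<close>

definition small :: "(('a \<Rightarrow> int) \<Rightarrow> int) \<Rightarrow> (nat \<Rightarrow> real) \<Rightarrow> 'a set"
  where "small e T = {h \<in> idl e. \<forall>i\<in>{1..Suc n}. cmod (sg i h) \<le> 2 * T i}"

lemma idl_Oc: "(\<And>v. v \<in> VV \<Longrightarrow> e v \<ge> 0) \<Longrightarrow> idl e \<subseteq> Oc"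
  by (subst Oc_eq) (force simp: idl_def)

lemma finite_Oc_bounded: "finite {h \<in> Oc. \<forall>i\<in>{1..Suc n}. cmod (sg i h) \<le> T i}"
proof (rule finite_subset)
  show "{h \<in> Oc. \<forall>i\<in>{1..Suc n}. cmod (sg i h) \<le> T i}
    \<subseteq> {h \<in> Oc. \<forall>\<sigma>\<in>complex_embeddings. cmod (\<sigma> h) \<le> (\<Sum>i=1..Suc n. \<bar>T i\<bar>)}"
  proof safe
    fix h and \<sigma> :: "'a \<Rightarrow> complex" assume h: "h \<in> Oc" "\<forall>i\<in>{1..Suc n}. cmod (sg i h) \<le> T i" "\<sigma> \<in> complex_embeddings"
    obtain i where i: "i \<in> {1..Suc n}" "\<sigma> = sg i \<or> \<sigma> = cnj \<circ> sg i" using embedding_sg[OF h(3)] by blast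
    then have "cmod (\<sigma> h) = cmod (sg i h)" by auto
    also have "\<dots> \<le> \<bar>T i\<bar>" using h(2) i(1) by force
    also have "\<dots> \<le> (\<Sum>i=1..Suc n. \<bar>T i\<bar>)" by (rule member_le_sum[OF i(1)]) auto
    finally show "cmod (\<sigma> h) \<le> (\<Sum>i=1..Suc n. \<bar>T i\<bar>)" .
  qed
qed (rule finite_bounded_integers)

lemma finite_small:
  assumes "\<And>v. v \<in> VV \<Longrightarrow> e v \<ge> 0"
  shows "finite (small e T)"
  by (rule finite_subset[OF _ finite_Oc_bounded[of "\<lambda>i. 2 * T i"]]) (use idl_Oc[of e, OF assms] in \<open>auto simp: small_def\<close>)

definition ybd :: real where "ybd = (\<Sum>i=1..Suc n. \<Sum>j<d. cmod (sg i (y j)))"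

text \<open>For coefficients up to \<open>Q\<close>, each real coordinate of the images at the place
  \<open>P i\<close> meets at most \<open>(2 * ybd + 2) * Q / T i\<close> cells, and there will turn
  out to be \<open>d\<close> coordinates.\<close>

definition cst :: real where "cst = (2 * ybd + 2) ^ d"

lemma ybd_nonneg: "ybd \<ge> 0"
  unfolding ybd_def by (intro sum_nonneg) auto

lemma sg_combination_le:
  assumes i: "i \<in> {1..Suc n}" and a: "\<And>j. j < d \<Longrightarrow> \<bar>a j\<bar> \<le> int Q"
  shows "cmod (sg i (\<Sum>j<d. of_int (a j) * y j)) \<le> ybd * real Q"
proof -
  have "sg i (\<Sum>j<d. of_int (a j) * y j) = (\<Sum>j<d. of_int (a j) * sg i (y j))"
    using sg(2)[OF i] by (simp add: emb_sum emb_mult emb_of_int)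
  also have "cmod \<dots> \<le> (\<Sum>j<d. cmod (sg i (y j)) * real Q)"
  proof (rule sum_norm_le)
    fix j assume "j \<in> {..<d}"
    then have "\<bar>a j\<bar> \<le> int Q" using a by simp
    then have "real_of_int \<bar>a j\<bar> \<le> real Q" by linarith
    then show "cmod (of_int (a j) * sg i (y j)) \<le> cmod (sg i (y j)) * real Q"
      by (simp add: norm_mult mult.commute mult_right_mono)
  qed
  also have "\<dots> = (\<Sum>j<d. cmod (sg i (y j))) * real Q" by (simp add: sum_distrib_right)
  also have "\<dots> \<le> ybd * real Q"
    unfolding ybd_def by (intro mult_right_mono member_le_sum[OF i]) (auto intro: sum_nonneg)
  finally show ?thesis .
qed

text \<open>Rounding costs at most 2 cells, which \<open>T \<le> Q\<close> converts into a multiple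
  of \<open>Q / T\<close>.\<close>

lemma floor_card:
  assumes T: "T > 0" "T \<le> real Q"
  shows "real (card {\<lfloor>- (ybd * real Q / T)\<rfloor>..\<lfloor>ybd * real Q / T\<rfloor>}) \<le> (2 * ybd + 2) * real Q / T"
proof -
  let ?w = "ybd * real Q / T"
  have w: "?w \<ge> 0" using T ybd_nonneg by simp
  then have "\<lfloor>- ?w\<rfloor> \<le> \<lfloor>?w\<rfloor>" by (intro floor_mono) simp
  then have "real (card {\<lfloor>- ?w\<rfloor>..\<lfloor>?w\<rfloor>}) = of_int \<lfloor>?w\<rfloor> + 1 - of_int \<lfloor>- ?w\<rfloor>" by simp
  also have "\<dots> \<le> 2 * ?w + 2" by linarith
  also have "\<dots> \<le> 2 * ?w + 2 * (real Q / T)"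
  proof -
    have "1 \<le> real Q / T" using T by simp
    then show ?thesis by linarith
  qed
  also have "\<dots> = (2 * ybd + 2) * real Q / T" by (simp add: distrib_right add_divide_distrib)
  finally show ?thesis .
qed

text \<open>
  Elements of a box of side \<open>Q\<close> in the lattice spanned by the family \<open>y\<close> are classified by their
  residue and by the grid cells of side \<open>T i\<close> which contain their images.
\<close>

lemma pigeonhole_bound:
  assumes e: "finite {v \<in> VV. e v \<noteq> 0}" "\<And>v. v \<in> VV \<Longrightarrow> e v \<ge> 0"
    and T: "\<And>i. i \<in> {1..Suc n} \<Longrightarrow> T i > 0" "\<And>i. i \<in> {1..Suc n} \<Longrightarrow> T i \<le> real Q"
  shows "real Q ^ d * (\<Prod>i=1..Suc n. T i ^ dn i)
    \<le> real (card (small e T)) * index e * ((2 * ybd + 2) * real Q) ^ (\<Sum>i=1..Suc n. dn i)"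
proof -
  have e': "\<forall>v\<in>VV. e v \<ge> 0" using e(2) by blast
  obtain Xs where Xs: "transversal Oc (idl e) Xs" "real (card Xs) = index e"
    using transversal_finite_index[OF e(1) e'] by blast
  define A where "A = {..<d} \<rightarrow>\<^sub>E {0..<int Q}"
  define \<xi> where "\<xi> a = (\<Sum>j<d. of_int (a j) * y j)" for a
  have A: "finite A" "card A = Q ^ d" by (auto simp: A_def card_PiE intro: finite_PiE)
  have Abd: "\<bar>a j\<bar> \<le> int Q" if "a \<in> A" "j < d" for a j
  proof -
    have "a j \<in> {0..<int Q}" using PiE_mem[OF that(1)[unfolded A_def]] that(2) by blast
    then show ?thesis by auto
  qed
  have \<xi>Oc: "\<xi> a \<in> Oc" for a
    unfolding \<xi>_def by (intro O.R_sum O.R_mult) (auto simp: y_Oc R_Oc)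
  have \<xi>diff: "\<xi> a - \<xi> a' = \<xi> (\<lambda>j. a j - a' j)" for a a'
    by (simp add: \<xi>_def left_diff_distrib sum_subtractf)
  define W where "W i = {\<lfloor>- (ybd * real Q / T i)\<rfloor>..\<lfloor>ybd * real Q / T i\<rfloor>}" for i
  define rep where "rep z = (SOME x. x \<in> Xs \<and> z - x \<in> idl e)" for z
  have rep: "rep z \<in> Xs" "z - rep z \<in> idl e" if "z \<in> Oc" for z
  proof -
    have "\<exists>x. x \<in> Xs \<and> z - x \<in> idl e" using Xs(1) that unfolding transversal_def by blast
    from someI_ex[OF this] show "rep z \<in> Xs" "z - rep z \<in> idl e" by (auto simp: rep_def)
  qed
  \<comment> \<open>A real place has the coordinate \<open>j = 0\<close> only; a complex place also
    has its imaginary part, at \<open>j = 1\<close>.\<close>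
  define cell where "cell z = (\<lambda>(i, j::nat)\<in>(SIGMA i:{1..Suc n}. {..<dn i}).
    \<lfloor>(if j = 0 then Re (sg i z) else Im (sg i z)) / T i\<rfloor>)" for z
  define C where "C = (\<Pi>\<^sub>E (i, j)\<in>(SIGMA i:{1..Suc n}. {..<dn i}). W i)"
  define lab where "lab a = (rep (\<xi> a), cell (\<xi> a))" for a
  have cellC: "cell (\<xi> a) \<in> C" if a: "a \<in> A" for a
  proof -
    have "\<lfloor>w / T i\<rfloor> \<in> W i" if i: "i \<in> {1..Suc n}" and w: "w = Re (sg i (\<xi> a)) \<or> w = Im (sg i (\<xi> a))" for i w
    proof -
      have "\<bar>w\<bar> \<le> cmod (sg i (\<xi> a))" using w abs_Re_le_cmod abs_Im_le_cmod by auto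
      also have "\<dots> \<le> ybd * real Q" unfolding \<xi>_def by (rule sg_combination_le[OF i Abd[OF a]])
      finally have "- (ybd * real Q / T i) \<le> w / T i" "w / T i \<le> ybd * real Q / T i"
        using T(1)[OF i] by (auto simp: field_simps abs_le_iff)
      then show ?thesis unfolding W_def by (auto intro!: floor_mono)
    qed
    then show ?thesis unfolding cell_def C_def by (intro restrict_PiE_iff[THEN iffD2]) auto
  qed
  have finC: "finite C" unfolding C_def by (rule finite_PiE) (auto simp: W_def)
  have "real (card C) = (\<Prod>(i, j)\<in>(SIGMA i:{1..Suc n}. {..<dn i}). real (card (W i)))"
    unfolding C_def by (subst card_PiE) (simp_all add: case_prod_beta)
  also have "\<dots> = (\<Prod>i=1..Suc n. \<Prod>j<dn i. real (card (W i)))"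
    by (rule prod.Sigma[symmetric]) auto
  also have "\<dots> = (\<Prod>i=1..Suc n. real (card (W i)) ^ dn i)"
    by simp
  also have "\<dots> \<le> (\<Prod>i=1..Suc n. ((2 * ybd + 2) * real Q / T i) ^ dn i)"
    unfolding W_def by (intro prod_mono conjI power_mono floor_card T zero_le_power) auto
  also have "\<dots> = ((2 * ybd + 2) * real Q) ^ (\<Sum>i=1..Suc n. dn i) / (\<Prod>i=1..Suc n. T i ^ dn i)"
    by (simp only: power_divide prod_dividef power_sum)
  finally have cardC: "real (card C) \<le> ((2 * ybd + 2) * real Q) ^ (\<Sum>i=1..Suc n. dn i) / (\<Prod>i=1..Suc n. T i ^ dn i)" .
  have fiber: "card {a \<in> A. lab a = l} \<le> card (small e T)" for l
  proof (cases "{a \<in> A. lab a = l} = {}")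
    case True then show ?thesis unfolding True by simp
  next
    case False
    then obtain a0 where a0: "a0 \<in> A" "lab a0 = l" by blast
    \<comment> \<open>Subtracting one fixed member embeds a class of equal labels into
      \<open>small e T\<close>: equal residues put the difference into the ideal, equal cells make
      it small.\<close>
    have "inj_on (\<lambda>a. \<xi> a - \<xi> a0) {a \<in> A. lab a = l}"
    proof (rule inj_onI)
      fix a a' assume aa: "a \<in> {a \<in> A. lab a = l}" "a' \<in> {a \<in> A. lab a = l}" "\<xi> a - \<xi> a0 = \<xi> a' - \<xi> a0"
      then have "\<xi> (\<lambda>j. a j - a' j) = 0" using \<xi>diff[of a a'] by simp
      then have "a j = a' j" if "j < d" for j using y_indep[of "\<lambda>j. a j - a' j"] that by (auto simp: \<xi>_def)
      then show "a = a'" using aa(1,2) by (intro PiE_ext[of _ "{..<d}" "\<lambda>_. {0..<int Q}"]) (auto simp: A_def)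
    qed
    moreover have "\<xi> a - \<xi> a0 \<in> small e T" if a: "a \<in> A" "lab a = l" for a
    proof -
      have lb: "rep (\<xi> a) = rep (\<xi> a0)" "cell (\<xi> a) = cell (\<xi> a0)" using a a0 by (auto simp: lab_def)
      have "(\<xi> a - rep (\<xi> a)) - (\<xi> a0 - rep (\<xi> a0)) \<in> idl e"
        by (rule is_ideal_diff[OF is_ideal_idl rep(2)[OF \<xi>Oc] rep(2)[OF \<xi>Oc]])
      then have "\<xi> a - \<xi> a0 \<in> idl e" using lb by simp
      moreover have "cmod (sg i (\<xi> a - \<xi> a0)) \<le> 2 * T i" if i: "i \<in> {1..Suc n}" for i
      proof -
        have close: "\<bar>w - w'\<bar> \<le> T i" if "\<lfloor>w / T i\<rfloor> = \<lfloor>w' / T i\<rfloor>" for w w'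
        proof -
          have "\<bar>w / T i - w' / T i\<bar> \<le> 1" using that by linarith
          then show ?thesis using T(1)[OF i] by (simp add: diff_divide_distrib[symmetric])
        qed
        have at: "\<lfloor>(if j = 0 then Re (sg i (\<xi> a)) else Im (sg i (\<xi> a))) / T i\<rfloor>
            = \<lfloor>(if j = 0 then Re (sg i (\<xi> a0)) else Im (sg i (\<xi> a0))) / T i\<rfloor>" if "j < dn i" for j
          using fun_cong[OF lb(2), of "(i, j)"] that i by (simp add: cell_def)
        have "dn i > 0" by (simp add: dn_def)
        then have re: "\<bar>Re (sg i (\<xi> a)) - Re (sg i (\<xi> a0))\<bar> \<le> T i" using at[of 0] by (intro close) simp
        have im: "\<bar>Im (sg i (\<xi> a)) - Im (sg i (\<xi> a0))\<bar> \<le> T i"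
        proof (cases "range (sg i) \<subseteq> \<real>")
          case True
          then have "sg i z \<in> \<real>" for z by auto
          then show ?thesis using T(1)[OF i] by (simp add: complex_is_Real_iff)
        next
          case False
          then have "dn i = 2" by (simp add: dn_def)
          then show ?thesis using at[of 1] by (intro close) simp
        qed
        have "sg i (\<xi> a - \<xi> a0) = sg i (\<xi> a) - sg i (\<xi> a0)" by (rule emb_diff[OF sg(2)[OF i]])
        then show ?thesis using cmod_le[of "sg i (\<xi> a - \<xi> a0)"] re im by simp
      qed
      ultimately show ?thesis by (simp add: small_def)
    qed
    ultimately show ?thesis by (intro card_inj_on_le[of "\<lambda>a. \<xi> a - \<xi> a0"] finite_small e) auto
  qed
  have finXs: "finite Xs" using Xs(1) by (simp add: transversal_def)
  have "A = (\<Union>l\<in>Xs \<times> C. {a \<in> A. lab a = l})" using rep(1)[OF \<xi>Oc] cellC by (auto simp: lab_def)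
  then have "card A \<le> (\<Sum>l\<in>Xs \<times> C. card {a \<in> A. lab a = l})"
    using card_UN_le[of "Xs \<times> C" "\<lambda>l. {a \<in> A. lab a = l}"] finXs finC by simp
  also have "\<dots> \<le> card (Xs \<times> C) * card (small e T)" using fiber sum_bounded_above[of "Xs \<times> C" _ "card (small e T)"] by simp
  finally have "real (Q ^ d) \<le> real (card Xs * card C * card (small e T))"
    unfolding A(2) card_cartesian_product by (rule of_nat_mono)
  also have "\<dots> = real (card (small e T)) * index e * real (card C)" using Xs(2) by simp
  also have "\<dots> \<le> real (card (small e T)) * index e *
      (((2 * ybd + 2) * real Q) ^ (\<Sum>i=1..Suc n. dn i) / (\<Prod>i=1..Suc n. T i ^ dn i))"
    using index_pos[of e] by (intro mult_left_mono cardC) auto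
  finally show ?thesis using prod_pos[of "{1..Suc n}" "\<lambda>i. T i ^ dn i"] T(1) by (simp add: field_simps)
qed

text \<open>For the unit ideal and all \<open>T i = 1\<close>, the pigeonhole bound compares
  \<open>Q ^ d\<close> with a constant times \<open>Q\<close> to the sum of the local degrees, for
  arbitrarily large \<open>Q\<close>; so that sum is at least \<open>d\<close>.\<close>

lemma sum_dn: "(\<Sum>i=1..Suc n. dn i) = d"
proof (rule ccontr)
  let ?D = "\<Sum>i=1..Suc n. dn i"
  assume "?D \<noteq> d"
  then have D: "Suc ?D \<le> d" using sum_dn_le by simp
  define K where "K = real (card (small (\<lambda>_. 0) (\<lambda>_. 1))) * index (\<lambda>_. 0) * (2 * ybd + 2) ^ ?D"
  obtain Q :: nat where Q: "real Q > max 1 K" using reals_Archimedean2 by blast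
  have "real Q * real Q ^ ?D \<le> real Q ^ d" using Q D power_increasing[OF D, of "real Q"] by simp
  also have "real Q ^ d \<le> K * real Q ^ ?D"
    using pigeonhole_bound[of "\<lambda>_. 0" "\<lambda>_. 1" Q] Q by (simp add: K_def power_mult_distrib mult_ac)
  finally show False using Q by simp
qed

text \<open>Since the local degrees sum to \<open>d\<close>, the powers of \<open>Q\<close> cancel
  from the pigeonhole bound, and the remaining constant depends neither on the ideal nor on the
  box.\<close>

lemma small_bound:
  assumes e: "finite {v \<in> VV. e v \<noteq> 0}" "\<And>v. v \<in> VV \<Longrightarrow> e v \<ge> 0"
    and T: "\<And>i. i \<in> {1..Suc n} \<Longrightarrow> T i > 0"
  shows "(\<Prod>i=1..Suc n. T i ^ dn i) \<le> real (card (small e T)) * index e * cst"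
proof -
  obtain Q :: nat where Q: "real Q > max 1 (\<Sum>i=1..Suc n. T i)" using reals_Archimedean2 by blast
  have "T i \<le> real Q" if i: "i \<in> {1..Suc n}" for i
    using member_le_sum[OF i, of T] T Q by (auto simp: less_imp_le)
  from pigeonhole_bound[OF e T this]
  have "real Q ^ d * (\<Prod>i=1..Suc n. T i ^ dn i) \<le> real Q ^ d * (real (card (small e T)) * index e * cst)"
    unfolding sum_dn cst_def by (simp add: power_mult_distrib mult_ac)
  then show ?thesis using Q by (subst (asm) mult_le_cancel_left_pos) auto
qed

end

section \<open>Norms, indices and the product formula\<close>

context number_field_places
begin

definition Nm :: "'a \<Rightarrow> real" where "Nm f = (\<Prod>i=1..Suc n. cmod (sg i f) ^ dn i)"

definition Ix :: "'a \<Rightarrow> real" where "Ix f = index (\<lambda>v. v f)"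

lemma sg_pos: "i \<in> {1..Suc n} \<Longrightarrow> f \<noteq> 0 \<Longrightarrow> cmod (sg i f) > 0"
  using emb_eq_0[OF sg(2)] by simp

lemma Nm_pos: "f \<noteq> 0 \<Longrightarrow> Nm f > 0"
  unfolding Nm_def by (intro prod_pos zero_less_power sg_pos) auto

lemma Nm_mult: "Nm (f * g) = Nm f * Nm g"
  unfolding Nm_def prod.distrib[symmetric]
proof (rule prod.cong)
  fix i assume "i \<in> {1..Suc n}"
  from emb_mult[OF sg(2)[OF this]]
  show "cmod (sg i (f * g)) ^ dn i = cmod (sg i f) ^ dn i * cmod (sg i g) ^ dn i"
    by (simp add: norm_mult power_mult_distrib)
qed simp

lemma Nm_of_int: "Nm (of_int k) = real_of_int \<bar>k\<bar> ^ d"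
proof -
  have "Nm (of_int k) = (\<Prod>i=1..Suc n. real_of_int \<bar>k\<bar> ^ dn i)"
    unfolding Nm_def
  proof (rule prod.cong)
    fix i assume "i \<in> {1..Suc n}"
    from emb_of_int[OF sg(2)[OF this]]
    show "cmod (sg i (of_int k)) ^ dn i = real_of_int \<bar>k\<bar> ^ dn i" by simp
  qed simp
  then show ?thesis unfolding power_sum[symmetric] sum_dn .
qed

lemma Ix_mult: "f \<in> Oc \<Longrightarrow> f \<noteq> 0 \<Longrightarrow> g \<in> Oc \<Longrightarrow> g \<noteq> 0 \<Longrightarrow> Ix (f * g) = Ix f * Ix g"
  unfolding Ix_def by (rule index_mult)

lemma power_growth:
  fixes a b K :: real
  assumes "a > 0" "b > 0" "\<And>m. a ^ m \<le> K * b ^ m"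
  shows "a \<le> b"
proof (rule ccontr)
  assume "\<not> a \<le> b"
  then have "a / b > 1" using assms by simp
  then obtain m where "K < (a / b) ^ m" using real_arch_pow by blast
  then show False using assms(3)[of m] assms(2) by (simp add: power_divide field_simps)
qed

text \<open>For the ideal of \<open>f ^ m\<close> and the bounds \<open>cmod (sg i f) ^ m\<close>,
  division by \<open>f ^ m\<close> maps the small elements into one finite set that does not depend
  on \<open>m\<close>. So \<open>small_bound\<close> compares the powers of both sides up to a
  constant, which \<open>power_growth\<close> removes.\<close>

lemma Nm_le_Ix:
  assumes f: "f \<in> Oc" "f \<noteq> 0"
  shows "Nm f \<le> Ix f"
proof (rule power_growth)
  show "Nm f > 0" "Ix f > 0" using Nm_pos f index_pos by (auto simp: Ix_def)
  fix m
  let ?F = "small (\<lambda>_. 0) (\<lambda>_. 1)"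
  define e where "e = (\<lambda>v :: 'a \<Rightarrow> int. v (f ^ m))"
  define T where "T i = cmod (sg i f) ^ m" for i
  have fm: "f ^ m \<in> Oc" "f ^ m \<noteq> 0" using f by (auto intro: O.R_power)
  have sgm: "sg i (f ^ m) = sg i f ^ m" if "i \<in> {1..Suc n}" for i by (rule emb_power[OF sg(2)[OF that]])
  have "small e T \<subseteq> (\<lambda>h. f ^ m * h) ` ?F"
  proof
    fix h assume h: "h \<in> small e T"
    have "h / f ^ m \<in> Oc" using h idl_principal[OF fm(2), of h] by (simp add: small_def e_def)
    then have "h / f ^ m \<in> idl (\<lambda>_. 0)" using idl_principal[of 1] Oc_eq by (auto simp: idl_def)
    moreover have "cmod (sg i (h / f ^ m)) \<le> 2 * 1" if i: "i \<in> {1..Suc n}" for i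
    proof -
      have "sg i h = sg i f ^ m * sg i (h / f ^ m)" using emb_mult[OF sg(2)[OF i], of "f ^ m" "h / f ^ m"] f(2) sgm[OF i] by simp
      then have "T i * cmod (sg i (h / f ^ m)) = cmod (sg i h)" by (simp add: T_def norm_mult norm_power)
      also have "\<dots> \<le> T i * 2" using h i unfolding small_def by (simp add: mult.commute)
      finally have "T i * cmod (sg i (h / f ^ m)) \<le> T i * 2" .
      moreover have "T i > 0" using sg_pos[OF i f(2)] by (simp add: T_def)
      ultimately show ?thesis by simp
    qed
    ultimately have "h / f ^ m \<in> ?F" by (simp add: small_def)
    then show "h \<in> (\<lambda>h. f ^ m * h) ` ?F" using fm by (intro image_eqI[of _ _ "h / f ^ m"]) auto
  qed
  from surj_card_le[OF _ this] have card: "card (small e T) \<le> card ?F" using finite_small[of "\<lambda>_. 0"] by simp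
  have "Nm f ^ m = (\<Prod>i=1..Suc n. T i ^ dn i)"
    unfolding Nm_def T_def prod_power_distrib by (simp add: power_mult[symmetric] mult.commute del: prod.cl_ivl_Suc)
  also have "\<dots> \<le> real (card (small e T)) * index e * cst"
  proof (rule small_bound)
    show "finite {v \<in> VV. e v \<noteq> 0}" unfolding e_def by (rule finite_VV_support)
    show "e v \<ge> 0" if "v \<in> VV" for v unfolding e_def by (rule VV_nonneg[OF that fm(1)])
    show "T i > 0" if "i \<in> {1..Suc n}" for i using sg_pos[OF that f(2)] by (simp add: T_def)
  qed
  also have "index e = Ix f ^ m" unfolding e_def Ix_def by (rule index_power[OF f])
  also have "real (card (small e T)) * Ix f ^ m * cst \<le> real (card ?F) * Ix f ^ m * cst"
    using card index_pos[of "\<lambda>v. v f"] ybd_nonneg by (intro mult_right_mono) (auto simp: Ix_def cst_def)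
  finally show "Nm f ^ m \<le> real (card ?F) * cst * Ix f ^ m" by (simp add: mult_ac)
qed

text \<open>For a generator below a prime, \<open>index_gen_le\<close> gives the missing inequality;
  descent and multiplicativity extend the equality. If no place divides \<open>N\<close>, the index
  is 1 while the norm is at least 1, and \<open>Nm_le_Ix\<close> closes the case.\<close>

lemma Nm_eq_Ix_Ints:
  assumes "N \<in> \<int>" "N \<noteq> 0"
  shows "Nm N = Ix N"
  using assms
proof (induction "\<delta> N" arbitrary: N rule: less_induct)
  case less
  note N = less.prems
  have NOc: "N \<in> Oc" using N(1) by (rule R_Oc)
  show ?case
  proof (cases "\<exists>v0\<in>VV. v0 N > 0")
    case True
    then obtain v0 where v0: "v0 \<in> VV" "v0 N > 0" by blast
    interpret p: number_field_prime \<delta> d "valuation_ideal v0 \<inter> Oc" by (rule VV_number_field_prime[OF v0(1)])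
    have "N \<in> valuation_ideal v0 \<inter> Oc" using v0 NOc by (simp add: valuation_ideal_def)
    then obtain q where q: "q \<in> \<int>" "N = q * p.gen" "\<delta> q < \<delta> N" using p.gen_descent[OF N(1) _ N(2)] by blast
    have q0: "q \<noteq> 0" "q \<in> Oc" using q N(2) R_Oc by auto
    have g: "p.gen \<in> Oc" "p.gen \<noteq> 0" using p.gen(1,3) R_Oc by auto
    have "Ix p.gen \<le> Nm p.gen"
      using index_gen_le[OF v0(1)] Nm_of_int[of "zint p.gen"] p.zgen(1) by (simp add: Ix_def)
    then have "Ix p.gen = Nm p.gen" using Nm_le_Ix[OF g] by simp
    then show ?thesis using less.hyps[OF q(3) q(1) q0(1)] Ix_mult[OF q0(2,1) g] Nm_mult q(2) by simp
  next
    case False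
    then have "v N = 0" if "v \<in> VV" for v using VV_nonneg[OF that NOc] that by force
    then have "{v. v \<in> VV \<and> v N \<noteq> 0} = {}" by blast
    then have "Ix N = 1" unfolding Ix_def index_def by (simp only: prod.empty)
    moreover have "Nm N \<ge> 1"
    proof -
      have "zint N \<noteq> 0" "of_int (zint N) = N" using of_int_zint[OF N(1)] N(2) by (auto simp del: zint)
      then have "1 \<le> real_of_int \<bar>zint N\<bar>" "Nm N = real_of_int \<bar>zint N\<bar> ^ d" using Nm_of_int[of "zint N"] by simp_all
      then show ?thesis using one_le_power by metis
    qed
    ultimately show ?thesis using Nm_le_Ix[OF NOc N(2)] by simp
  qed
qed

text \<open>A multiple \<open>f * w\<close> in the integers satisfies the equality, and neither
  factor can make up for a strict inequality in the other.\<close>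

lemma Nm_eq_Ix:
  assumes f: "f \<in> Oc" "f \<noteq> 0"
  shows "Nm f = Ix f"
proof -
  obtain w where w: "w \<in> Oc" "f * w \<in> \<int>" "f * w \<noteq> 0" by (rule divides_R[OF f])
  have w0: "w \<noteq> 0" using w by auto
  have "Nm f * Nm w = Ix f * Ix w"
    using Nm_eq_Ix_Ints[OF w(2,3)] unfolding Nm_mult Ix_mult[OF f w(1) w0] .
  moreover have "Nm f * Nm w \<le> Nm f * Ix w" using Nm_le_Ix[OF w(1) w0] Nm_pos[OF f(2)] by simp
  ultimately have "Ix f * Ix w \<le> Nm f * Ix w" by simp
  moreover have "Ix w > 0" unfolding Ix_def by (rule index_pos)
  ultimately have "Ix f \<le> Nm f" by simp
  then show ?thesis using Nm_le_Ix[OF f] by simp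
qed

text \<open>The finite places contribute the logarithm of the index and the archimedean ones minus
  the logarithm of the norm, so \<open>Nm_eq_Ix\<close> is the product formula.\<close>

lemma div_deg_principal_integral:
  assumes pl: "places Number_Field - SS Number_Field = Nonarch ` VV" and f: "(f::'a) \<in> Oc" "f \<noteq> 0"
  shows "finite {p. principal_div Number_Field f p \<noteq> 0}" "div_deg Number_Field (principal_div Number_Field f) = 0"
proof -
  let ?s = "Number_Field :: 'a setting"
  let ?V = "{v \<in> VV. v f \<noteq> 0}"
  let ?A = "Nonarch ` ?V \<union> P ` {1..Suc n}"
  have PS: "P ` {1..Suc n} = SS ?s" using enum by (simp add: bij_betw_def)
  have fin: "finite ?A" using finite_VV_support[of f] by blast
  have sub: "{p. principal_div ?s f p \<noteq> 0} \<subseteq> ?A"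
  proof
    fix p assume "p \<in> {p. principal_div ?s f p \<noteq> 0}"
    then have p: "p \<in> places ?s" "nu p f \<noteq> 0" by (auto simp: principal_div_def split: if_splits)
    show "p \<in> ?A"
    proof (cases "p \<in> SS ?s")
      case False
      then obtain v where "p = Nonarch v" "v \<in> VV" using p(1) pl by blast
      then show ?thesis using p(2) by auto
    qed (use PS in blast)
  qed
  show "finite {p. principal_div ?s f p \<noteq> 0}" using fin sub by (rule finite_subset[rotated])
  have plV: "normalized_valuation v" if "v \<in> VV" for v using that by (simp add: VV_def)
  have SSp: "p \<in> SS ?s \<Longrightarrow> p \<in> places ?s" for p by auto
  have "div_deg ?s (principal_div ?s f) = (\<Sum>p\<in>?A. principal_div ?s f p * place_deg ?s p)"
    by (rule div_deg_superset[OF fin sub])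
  also have "\<dots> = (\<Sum>p\<in>Nonarch ` ?V. principal_div ?s f p * place_deg ?s p)
      + (\<Sum>p\<in>P ` {1..Suc n}. principal_div ?s f p * place_deg ?s p)"
  proof (rule sum.union_disjoint)
    show "Nonarch ` ?V \<inter> P ` {1..Suc n} = {}" unfolding PS by auto
  qed (use finite_VV_support[of f] in auto)
  also have "(\<Sum>p\<in>Nonarch ` ?V. principal_div ?s f p * place_deg ?s p) = (\<Sum>v\<in>?V. real_of_int (v f) * ln (real (kap v)))"
    by (subst sum.reindex) (auto simp: inj_on_def principal_div_def plV kap_def intro!: sum.cong)
  also have "\<dots> = ln (Ix f)"
  proof -
    have "ln (Ix f) = (\<Sum>v\<in>?V. ln (real (kap v) ^ nat (v f)))"
      unfolding Ix_def index_def
    proof (rule ln_prod)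
      fix v assume "v \<in> ?V"
      then have "real (kap v) \<ge> 1" using kap_pos by simp
      then show "real (kap v) ^ nat (v f) \<noteq> 0" by simp
    qed (rule finite_VV_support)
    also have "\<dots> = (\<Sum>v\<in>?V. real_of_int (v f) * ln (real (kap v)))"
    proof (rule sum.cong)
      fix v assume "v \<in> ?V"
      then have "real (kap v) \<ge> 1" "v f \<ge> 0" using kap_pos VV_nonneg[OF _ f(1)] by auto
      then show "ln (real (kap v) ^ nat (v f)) = real_of_int (v f) * ln (real (kap v))" by (simp add: ln_realpow)
    qed simp
    finally show ?thesis by simp
  qed
  also have "(\<Sum>p\<in>P ` {1..Suc n}. principal_div ?s f p * place_deg ?s p)
      = (\<Sum>i=1..Suc n. - ln (cmod (sg i f)) * real (dn i))"
  proof (subst sum.reindex)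
    show "inj_on P {1..Suc n}" using enum by (simp add: bij_betw_def)
    have "principal_div ?s f (P i) * place_deg ?s (P i) = - ln (cmod (sg i f)) * real (dn i)" if i: "i \<in> {1..Suc n}" for i
    proof -
      have "P i \<in> SS ?s" using PS i by blast
      then show ?thesis unfolding principal_div_def place_deg_P[OF i] nu_P[OF i] using SSp by simp
    qed
    then show "sum ((\<lambda>p. principal_div ?s f p * place_deg ?s p) \<circ> P) {1..Suc n} = (\<Sum>i=1..Suc n. - ln (cmod (sg i f)) * real (dn i))"
      by (intro sum.cong) (simp_all del: atLeastAtMost_iff)
  qed
  also have "\<dots> = - ln (Nm f)"
  proof -
    have "ln (Nm f) = (\<Sum>i=1..Suc n. ln (cmod (sg i f) ^ dn i))"
      unfolding Nm_def
    proof (rule ln_prod)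
      show "cmod (sg i f) ^ dn i \<noteq> 0" if "i \<in> {1..Suc n}" for i using sg_pos[OF that f(2)] by simp
    qed simp
    also have "\<dots> = (\<Sum>i=1..Suc n. ln (cmod (sg i f)) * real (dn i))"
    proof (rule sum.cong)
      show "ln (cmod (sg i f) ^ dn i) = ln (cmod (sg i f)) * real (dn i)" if "i \<in> {1..Suc n}" for i
        using sg_pos[OF that f(2)] by (simp add: ln_realpow)
    qed simp
    finally show ?thesis by (simp add: sum_negf del: sum.cl_ivl_Suc)
  qed
  finally show "div_deg ?s (principal_div ?s f) = 0" using Nm_eq_Ix[OF f] by simp
qed

lemma div_deg_principal:
  assumes pl: "places Number_Field - SS Number_Field = Nonarch ` VV" and f: "(f::'a) \<noteq> 0"
  shows "div_deg Number_Field (principal_div Number_Field f) = 0"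
proof -
  let ?s = "Number_Field :: 'a setting"
  obtain a c where ac: "a \<in> Oc" "c \<in> \<int>" "c \<noteq> 0" "f = a / c" by (rule fraction_exists)
  have a0: "a \<noteq> 0" using ac f by auto
  have mult: "nu p (g * h) = nu p g + nu p h" if p: "p \<in> places ?s" and gh: "g \<noteq> 0" "h \<noteq> 0" for p g h
  proof (cases "p \<in> SS ?s")
    case True
    then have "p \<in> P ` {1..Suc n}" using enum by (simp only: bij_betw_def)
    then obtain i where i: "i \<in> {1..Suc n}" "p = P i" by blast
    then show ?thesis
      using sg_pos[OF i(1)] gh emb_mult[OF sg(2)[OF i(1)]] unfolding i(2) nu_P[OF i(1)] by (simp add: norm_mult ln_mult)
  next
    case False
    then obtain v where "p = Nonarch v" "v \<in> VV" using p pl by blast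
    then show ?thesis using nval.v_mult[OF VV_nval gh, of v] by (simp del: of_int_add add: of_int_add[symmetric])
  qed
  have "principal_div ?s a = (\<lambda>p. principal_div ?s f p + principal_div ?s c p)"
    using mult[of _ f c] f ac by (auto simp: principal_div_def fun_eq_iff)
  moreover have fc: "finite {p. principal_div ?s c p \<noteq> 0}" "div_deg ?s (principal_div ?s c) = 0"
    using div_deg_principal_integral[OF pl R_Oc[OF ac(2)] ac(3)] by auto
  moreover have fa: "finite {p. principal_div ?s a p \<noteq> 0}" "div_deg ?s (principal_div ?s a) = 0"
    using div_deg_principal_integral[OF pl ac(1) a0] by auto
  moreover have "finite {p. principal_div ?s f p \<noteq> 0}"
  proof (rule finite_subset[OF _ finite_UnI[OF fc(1) fa(1)]])
    show "{p. principal_div ?s f p \<noteq> 0} \<subseteq> {p. principal_div ?s c p \<noteq> 0} \<union> {p. principal_div ?s a p \<noteq> 0}"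
      using \<open>principal_div ?s a = _\<close> by (auto simp: fun_eq_iff)
  qed
  ultimately show ?thesis using div_deg_add[of "principal_div ?s f" "principal_div ?s c" ?s] by simp
qed

end

lemma (in euclid_ext) integral_multiple:
  obtains r where "r \<in> R" "r \<noteq> 0" "\<And>j. j < (m::nat) \<Longrightarrow> r * y j \<in> Oc"
proof -
  have "\<exists>r\<in>R. r \<noteq> 0 \<and> (\<forall>j<m. r * y j \<in> Oc)"
  proof (induction m)
    case (Suc m)
    then obtain r where r: "r \<in> R" "r \<noteq> 0" "\<forall>j<m. r * y j \<in> Oc" by blast
    obtain a s where as: "a \<in> Oc" "s \<in> R" "s \<noteq> 0" "y m = a / s" by (rule fraction_exists)
    have "\<forall>j<Suc m. s * r * y j \<in> Oc"
    proof (intro allI impI)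
      fix j assume "j < Suc m"
      then consider "j < m" | "j = m" by linarith
      then show "s * r * y j \<in> Oc"
      proof cases
        case 1
        then show ?thesis using O.R_mult[OF R_Oc[OF as(2)], of "r * y j"] r(3) by (simp add: mult.assoc)
      next
        case 2
        then show ?thesis using O.R_mult[OF R_Oc[OF r(1)] as(1)] as by simp
      qed
    qed
    then show ?case using as(2,3) r(1,2) by (intro bexI[of _ "s * r"]) simp_all
  qed (auto intro!: bexI[of _ 1])
  then show ?thesis using that by blast
qed

section \<open>The conditions on boxes for number fields\<close>

context number_field_places
begin

lemma absval_P_le:
  assumes i: "i \<in> {1..Suc n}" and f: "f \<noteq> 0"
  shows "absval Number_Field (P i) f \<le> base (Number_Field :: 'a setting) powr (t * place_deg Number_Field (P i))
    \<longleftrightarrow> cmod (sg i f) \<le> exp t"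
proof -
  have dn: "real (dn i) > 0" by (simp add: dn_def)
  have "absval Number_Field (P i) f = exp (ln (cmod (sg i f)) * real (dn i))"
    using f unfolding absval_def nu_P[OF i] place_deg_P[OF i] by (simp add: powr_def)
  moreover have "cmod (sg i f) \<le> exp t \<longleftrightarrow> ln (cmod (sg i f)) \<le> t"
    using exp_le_cancel_iff[of "ln (cmod (sg i f))" t] unfolding exp_ln[OF sg_pos[OF i f]] .
  ultimately show ?thesis using dn unfolding place_deg_P[OF i]
    by (simp add: powr_def mult_le_cancel_right)
qed

text \<open>Once the product of the bounds exceeds the index times \<open>cst\<close>,
  \<open>small_bound\<close> leaves room for more than the element 0; the bound at the last place is
  free to be enlarged until this happens.\<close>

lemma level_exists_number_field:
  assumes b: "fideal b"
  shows "\<exists>l. Box Number_Field P n b (t(Suc n := l)) - {0} \<noteq> {}"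
proof -
  \<comment> \<open>Nonnegative exponents that are at least those of \<open>b\<close>: the ideal
    lies in both \<open>b\<close> and \<open>Oc\<close>, as the counting takes place inside
    \<open>Oc\<close>.\<close>
  define e where "e = (\<lambda>v. max 0 (vmin b v))"
  \<comment> \<open>What the bound at the last place must exceed. The halves offset the factor 2 in
    \<open>small\<close>, and \<open>l\<close> is chosen to make this bound
    \<open>K + 1\<close>.\<close>
  define K where "K = index e * cst / (\<Prod>i=1..n. (exp (t i) / 2) ^ dn i)"
  define l where "l = ln (2 * (K + 1))"
  define T where "T = (\<lambda>i. exp ((t(Suc n := l)) i) / 2)"
  have "{v \<in> VV. e v \<noteq> 0} \<subseteq> {v \<in> VV. vmin b v \<noteq> 0}" by (auto simp: e_def)
  then have e: "finite {v \<in> VV. e v \<noteq> 0}" "\<And>v. e v \<ge> 0" using finite_vmin[OF b] finite_subset by (auto simp: e_def)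
  have prod0: "(\<Prod>i=1..n. (exp (t i) / 2) ^ dn i) > 0" by (intro prod_pos) auto
  have cst: "cst > 0" unfolding cst_def using ybd_nonneg by simp
  have K: "K \<ge> 0" using prod0 cst index_pos[of e] by (simp add: K_def)
  have TS: "T (Suc n) = K + 1" using K by (simp add: T_def l_def)
  have "dn (Suc n) > 0" by (simp add: dn_def)
  then have "(K + 1) ^ 1 \<le> (K + 1) ^ dn (Suc n)" using K by (intro power_increasing) auto
  then have "K < T (Suc n) ^ dn (Suc n)" using TS by simp
  then have "K * (\<Prod>i=1..n. (exp (t i) / 2) ^ dn i) < T (Suc n) ^ dn (Suc n) * (\<Prod>i=1..n. (exp (t i) / 2) ^ dn i)"
    using prod0 by (rule mult_strict_right_mono)
  also have "(\<Prod>i=1..n. (exp (t i) / 2) ^ dn i) = (\<Prod>i=1..n. T i ^ dn i)" by (rule prod.cong) (auto simp: T_def)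
  also have "T (Suc n) ^ dn (Suc n) * \<dots> = (\<Prod>i=1..Suc n. T i ^ dn i)" by simp
  also have "\<dots> \<le> real (card (small e T)) * index e * cst"
    by (rule small_bound[OF e(1) e(2)]) (simp add: T_def)
  also have "K * (\<Prod>i=1..n. T i ^ dn i) = 1 * (index e * cst)"
    using prod0 \<open>(\<Prod>i=1..n. (exp (t i) / 2) ^ dn i) = _\<close> unfolding K_def
    by (metis mult_1 nonzero_eq_divide_eq less_irrefl)
  finally have "1 * (index e * cst) < real (card (small e T)) * (index e * cst)" by (simp add: mult.assoc)
  then have "1 < card (small e T)" using mult_less_cancel_right[of 1 "index e * cst"] cst index_pos[of e] by simp
  then have "\<not> small e T \<subseteq> {0}" using card_mono[of "{0}" "small e T"] by auto
  then obtain h where h: "h \<in> small e T" "h \<noteq> 0" by blast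
  have "h \<in> b"
  proof -
    have "vmin b v \<le> v h" if v: "v \<in> VV" for v
    proof -
      have "e v \<le> v h" using h v by (auto simp: small_def idl_def)
      then show ?thesis by (simp add: e_def)
    qed
    then show ?thesis by (subst fideal_eq[OF b]) blast
  qed
  moreover have "absval Number_Field (P i) h \<le> base (Number_Field :: 'a setting) powr ((t(Suc n := l)) i * place_deg Number_Field (P i))"
    if i: "i \<in> {1..Suc n}" for i
    unfolding absval_P_le[OF i h(2)] using h(1) i unfolding small_def T_def by simp
  ultimately have "h \<in> Box Number_Field P n b (t(Suc n := l)) - {0}" using h(2) by (simp only: Box_def) blast
  then show ?thesis by blast
qed

lemma finite_Box: "fideal b \<Longrightarrow> finite (Box Number_Field P n b t - {0})"
proof -
  assume b: "fideal b"
  then obtain c where c: "c \<in> Oc" "c \<noteq> 0" "\<And>f. f \<in> b \<Longrightarrow> c * f \<in> Oc" by (auto simp: fideal_def)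
  let ?F = "{h \<in> Oc. \<forall>i\<in>{1..Suc n}. cmod (sg i h) \<le> cmod (sg i c) * exp (t i)}"
  have "(\<lambda>h. c * h) ` (Box Number_Field P n b t - {0}) \<subseteq> ?F"
  proof
    fix z assume "z \<in> (\<lambda>h. c * h) ` (Box Number_Field P n b t - {0})"
    then obtain h where h: "z = c * h" "h \<in> Box Number_Field P n b t" "h \<noteq> 0" by blast
    have "cmod (sg i z) \<le> cmod (sg i c) * exp (t i)" if i: "i \<in> {1..Suc n}" for i
    proof -
      have "absval Number_Field (P i) h \<le> base (Number_Field :: 'a setting) powr (t i * place_deg Number_Field (P i))"
        using h(2) i unfolding Box_def by blast
      then have "cmod (sg i h) \<le> exp (t i)" by (rule absval_P_le[OF i h(3), THEN iffD1])
      then show ?thesis unfolding h(1) emb_mult[OF sg(2)[OF i]] norm_mult by (intro mult_left_mono) auto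
    qed
    moreover have "z \<in> Oc" using h c(3) by (auto simp: Box_def)
    ultimately show "z \<in> ?F" by blast
  qed
  moreover have "finite ?F" by (rule finite_Oc_bounded)
  ultimately have "finite ((\<lambda>h. c * h) ` (Box Number_Field P n b t - {0}))" by (rule finite_subset)
  then show ?thesis by (rule finite_imageD) (use c in \<open>auto simp: inj_on_def\<close>)
qed

lemma places_number_field: "places Number_Field - SS Number_Field = Nonarch ` (VV :: ('a \<Rightarrow> int) set)"
proof -
  have "v \<in> VV" if "normalized_valuation v" for v :: "'a \<Rightarrow> int"
  proof -
    interpret nval v by unfold_locales fact
    have one: "1 \<in> ball 0" by (simp add: ball_def)
    have nat: "of_nat k \<in> ball 0" for k by (induction k) (simp_all add: ball_add one)
    have "of_int k \<in> ball 0" for k by (cases k) (use nat ball_uminus[OF nat] in \<open>auto simp del: of_nat_Suc\<close>)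
    then show ?thesis using that by (force simp: VV_def ball_def elim!: Ints_cases)
  qed
  then show ?thesis by (auto simp: VV_def)
qed

lemma rep_setting_number_field: "rep_setting \<int> \<delta> d (Number_Field :: 'a setting) P n"
proof
  show "OK Number_Field = Oc" by simp
  show "places Number_Field - SS Number_Field = Nonarch ` (VV :: ('a \<Rightarrow> int) set)" by (rule places_number_field)
  show "bij_betw P {1..Suc n} (SS Number_Field)" by (rule enum)
  show "SS (Number_Field :: 'a setting) \<subseteq> places Number_Field" by auto
  show "1 < base (Number_Field :: 'a setting)" by simp
  have SS: "\<exists>i\<in>{1..Suc n}. p = P i" if "p \<in> SS Number_Field" for p using enum that by (auto simp: bij_betw_def simp del: SS.simps)
  show "0 < place_deg Number_Field p" if "p \<in> SS Number_Field" for p :: "'a place"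
    using SS[OF that] place_deg_P by (fastforce simp: dn_def)
  show "nu p (f * g) = nu p f + nu p g" if p: "p \<in> SS Number_Field" and f: "f \<noteq> 0" "g \<noteq> 0" for p :: "'a place" and f g
  proof -
    obtain i where i: "i \<in> {1..Suc n}" "p = P i" using SS[OF p] by blast
    show ?thesis
      using sg_pos[OF i(1)] f emb_mult[OF sg(2)[OF i(1)]] unfolding i(2) nu_P[OF i(1)] by (simp add: norm_mult ln_mult)
  qed
  show "nu p f \<in> GG Number_Field" for p :: "'a place" and f by simp
  show "finite (nu (P (Suc n)) ` (Box Number_Field P n b t - {0}))" if "fideal b" for b t
    by (rule finite_imageI[OF finite_Box[OF that]])
  show "\<exists>l\<in>GG Number_Field. Box Number_Field P n b (t(Suc n := l)) - {0} \<noteq> {}" if "fideal b" for b t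
    using level_exists_number_field[OF that] by simp
  show "div_deg Number_Field (principal_div Number_Field f) = 0" if "f \<noteq> 0" for f :: 'a
    by (rule div_deg_principal[OF places_number_field that])
qed

end

lemma rational_subfield_fractions: "rational_subfield = fractions (\<int> :: 'a::field set)"
  by (force simp: rational_subfield_def fractions_def elim!: Ints_cases)

lemma number_field_rep_setting:
  fixes P :: "nat \<Rightarrow> 'a::field place"
  assumes nf: "is_number_field TYPE('a)" and enum: "bij_betw P {1..Suc n} (SS Number_Field)"
  shows "\<exists>\<delta> d. rep_setting \<int> \<delta> d (Number_Field :: 'a setting) P n"
proof -
  interpret Z: coeff_ring "\<int> :: 'a set" by unfold_locales auto
  have char0: "CHAR('a) = 0" and fin: "finite_extension_of (fractions (\<int> :: 'a set))"
    using nf by (simp_all add: is_number_field_def rational_subfield_fractions)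
  have of_int_inj: "(of_int m :: 'a) = of_int k \<longleftrightarrow> m = k" for m k
    using of_int_eq_0_iff_char_dvd[where 'a = 'a, of "m - k"] char0 by simp
  obtain d and y :: "nat \<Rightarrow> 'a" where dy: "dependent_over (fractions (\<int> :: 'a set)) d"
    "\<And>c. (\<And>i. i < d \<Longrightarrow> c i \<in> fractions (\<int> :: 'a set)) \<Longrightarrow> (\<Sum>i<d. c i * y i) = 0 \<Longrightarrow> \<forall>i<d. c i = 0"
    by (rule finite_extension_basis[OF Z.subfield_fractions fin]) blast
  define \<delta> where "\<delta> = (\<lambda>a :: 'a. nat \<bar>THE k. a = of_int k\<bar>)"
  have \<delta>: "\<delta> (of_int k) = nat \<bar>k\<bar>" for k unfolding \<delta>_def by (subst the_equality[of _ k]) (auto simp: of_int_inj)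
  interpret number_field_ext \<delta> d
  proof
    fix a b :: 'a assume ab: "a \<in> \<int>" "b \<in> \<int>"
    obtain A B where AB: "a = of_int A" "b = of_int B" using ab by (auto elim!: Ints_cases)
    show "\<exists>q\<in>\<int>. a - q * b = 0 \<or> \<delta> (a - q * b) < \<delta> b" if "b \<noteq> 0"
    proof -
      have "B \<noteq> 0" using that AB by auto
      then have "\<bar>A mod B\<bar> < \<bar>B\<bar>" by (rule abs_mod_less)
      moreover have "a - of_int (A div B) * b = of_int (A mod B)"
        unfolding AB by (metis minus_div_mult_eq_mod of_int_diff of_int_mult)
      ultimately show ?thesis using AB by (intro bexI[of _ "of_int (A div B)"]) (auto simp: \<delta>)
    qed
    show "\<delta> a < \<delta> (a * b)" if "a \<noteq> 0" "b \<noteq> 0" "1 / b \<notin> \<int>"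
    proof -
      have "A \<noteq> 0" "B \<noteq> 0" "B \<noteq> 1" "B \<noteq> -1" using that AB by auto
      then have "\<bar>A\<bar> * 1 < \<bar>A\<bar> * \<bar>B\<bar>" by (intro mult_strict_left_mono) auto
      then show ?thesis unfolding AB by (simp add: \<delta> abs_mult flip: of_int_mult)
    qed
  next
    show "\<exists>c. (\<forall>i\<in>I. c i \<in> \<int>) \<and> (\<exists>i\<in>I. c i \<noteq> 0) \<and> (\<Sum>i\<in>I. c i * g i) = 0"
      if "finite I" "d < card I" for I :: "nat set" and g :: "nat \<Rightarrow> 'a"
      using Z.dependent_over_fractions[OF dy(1)] that by (simp add: dependent_over_def)
  qed (rule char0)
  obtain r where r: "r \<in> \<int>" "r \<noteq> 0" "\<And>j. j < d \<Longrightarrow> r * y j \<in> Oc" by (rule integral_multiple[of d y]) blast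
  interpret number_field_places \<delta> d P n "\<lambda>j. r * y j"
  proof
    show "\<forall>j<d. c j = 0" if "(\<Sum>j<d. of_int (c j) * (r * y j)) = 0" for c
    proof -
      have "r * (\<Sum>j<d. of_int (c j) * y j) = 0" using that by (simp add: sum_distrib_left mult_ac)
      then have "(\<Sum>j<d. of_int (c j) * y j) = 0" using r by simp
      then have "\<forall>j<d. of_int (c j) = (0 :: 'a)" by (intro dy(2)) (auto intro: Z.R_fractions)
      then show ?thesis using of_int_inj[of _ 0] by simp
    qed
  qed (use r enum in auto)
  show ?thesis using rep_setting_number_field by blast
qed

section \<open>Rational functions\<close>

definition polys_at :: "'a::field set \<Rightarrow> 'a \<Rightarrow> 'a set"
  where "polys_at k x = {poly p x | p. p \<in> polys_over k}"

context coeff_ring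
begin

lemma coeff_ring_polys_at: "coeff_ring (polys_at R x)"
proof
  show "0 \<in> polys_at R x" unfolding polys_at_def by (rule CollectI, rule exI[of _ 0]) simp
  show "1 \<in> polys_at R x" unfolding polys_at_def by (rule CollectI, rule exI[of _ 1]) simp
  fix a b assume "a \<in> polys_at R x" "b \<in> polys_at R x"
  then obtain p q where pq: "a = poly p x" "b = poly q x" "p \<in> polys_over R" "q \<in> polys_over R"
    by (auto simp: polys_at_def)
  show "a + b \<in> polys_at R x" unfolding polys_at_def by (rule CollectI, rule exI[of _ "p + q"]) (simp add: pq)
  show "a * b \<in> polys_at R x" unfolding polys_at_def by (rule CollectI, rule exI[of _ "p * q"]) (simp add: pq)
  show "- a \<in> polys_at R x" unfolding polys_at_def by (rule CollectI, rule exI[of _ "- p"]) (simp add: pq)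
qed

lemma polys_at_const: "c \<in> R \<Longrightarrow> c \<in> polys_at R x"
  unfolding polys_at_def by (rule CollectI, rule exI[of _ "[:c:]"]) simp

lemma polys_at_gen: "x \<in> polys_at R x"
  unfolding polys_at_def by (rule CollectI, rule exI[of _ "[:0, 1:]"]) simp

end

lemma rational_functions_eq:
  assumes k: "subfield k KR"
  shows "rational_functions k x = fractions (polys_at k x)"
proof
  interpret field KR by (rule field_from_type_algebra)
  interpret k: coeff_ring k by (rule coeff_ring_subfield[OF k])
  interpret kx: coeff_ring "polys_at k x" by (rule k.coeff_ring_polys_at)
  show "rational_functions k x \<subseteq> fractions (polys_at k x)"
    unfolding rational_functions_def
  proof (rule generate_field_min_subfield1)
    show "subfield (fractions (polys_at k x)) KR" by (rule kx.subfield_fractions)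
    show "insert x k \<subseteq> fractions (polys_at k x)"
      using k.polys_at_const k.polys_at_gen kx.R_fractions by blast
  qed simp
  have sf: "subfield (rational_functions k x) KR"
    unfolding rational_functions_def by (rule generate_field_is_subfield) simp
  interpret F: coeff_ring "rational_functions k x" by (rule coeff_ring_subfield[OF sf])
  have kF: "k \<subseteq> rational_functions k x" "x \<in> rational_functions k x"
    unfolding rational_functions_def by (auto intro: generate_field.incl)
  have pF: "a \<in> rational_functions k x" if "a \<in> polys_at k x" for a
    using that F.poly_in_R[OF polys_over_mono[OF _ kF(1)] kF(2)] by (auto simp: polys_at_def)
  show "fractions (polys_at k x) \<subseteq> rational_functions k x"
  proof
    fix z assume "z \<in> fractions (polys_at k x)"
    then obtain a b where "a \<in> polys_at k x" "b \<in> polys_at k x" "z = a / b" by (auto simp: fractions_def)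
    then show "z \<in> rational_functions k x"
      using F.R_mult[OF pF subfield_inverse[OF sf pF], of a b] by simp
  qed
qed

lemma algebraic_KR:
  fixes z :: "'a::field"
  assumes F: "subfield F KR" and p: "p \<in> polys_over F" "p \<noteq> 0" "poly p z = 0"
  shows "(ring.algebraic KR over F) z"
proof -
  interpret field KR by (rule field_from_type_algebra)
  \<comment> \<open>HOL-Algebra lists the coefficients of a polynomial from the leading one
    downwards, hence the reversal.\<close>
  have eval: "KR.eval (rev xs) z = poly (Poly xs) z" for xs
  proof (induction xs)
    case (Cons a xs)
    then show ?case using KR.eval_append_aux[of "rev xs" a z] by (simp add: algebra_simps)
  qed simp
  show ?thesis
  proof (rule KR.algebraicI)
    show "rev (Polynomial.coeffs p) \<in> carrier (F[X]\<^bsub>KR\<^esub>)"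
      using p by (auto simp: univ_poly_carrier[symmetric] polynomial_def polys_over_def hd_rev Polynomial.last_coeffs_eq_coeff_degree
          Polynomial.coeffs_def)
    show "rev (Polynomial.coeffs p) \<noteq> []" using p by simp
    show "KR.eval (rev (Polynomial.coeffs p)) z = \<zero>\<^bsub>KR\<^esub>" using eval[of "Polynomial.coeffs p"] p(3) by simp
  qed
qed

text \<open>A relation in powers of \<open>x\<close> with coefficients in \<open>k[y]\<close> is
  reordered by powers of \<open>y\<close>. Some new coefficient comes from a nonzero polynomial over
  \<open>k\<close>, and \<open>x\<close> is transcendental, so the equation for \<open>y\<close>
  does not collapse.\<close>

lemma algebraic_exchange:
  fixes x y :: "'a::field"
  assumes k: "coeff_ring k" and x: "\<And>p. p \<in> polys_over k \<Longrightarrow> poly p x = 0 \<Longrightarrow> p = 0"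
    and I: "finite I" "\<And>i. i \<in> I \<Longrightarrow> c i \<in> polys_at k y" "i0 \<in> I" "c i0 \<noteq> 0"
      "(\<Sum>i\<in>I. c i * x ^ i) = 0"
  obtains p where "p \<in> polys_over (polys_at k x)" "p \<noteq> 0" "poly p y = 0"
proof -
  interpret k: coeff_ring k by (rule k)
  interpret kx: coeff_ring "polys_at k x" by (rule k.coeff_ring_polys_at)
  have "\<forall>i\<in>I. \<exists>p. p \<in> polys_over k \<and> c i = poly p y" using I(2) by (auto simp: polys_at_def)
  then obtain p where p: "\<And>i. i \<in> I \<Longrightarrow> p i \<in> polys_over k" "\<And>i. i \<in> I \<Longrightarrow> c i = poly (p i) y" by metis
  define m where "m = (\<Sum>i\<in>I. Polynomial.degree (p i))"
  have m: "Polynomial.degree (p i) \<le> m" if "i \<in> I" for i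
    unfolding m_def using I(1) that by (intro member_le_sum) auto
  define q where "q j = (\<Sum>i\<in>I. Polynomial.monom (Polynomial.coeff (p i) j) i)" for j
  have q: "q j \<in> polys_over k" for j unfolding q_def using p by (intro k.polys_over_sum) simp
  have qc: "Polynomial.coeff (q j) i = Polynomial.coeff (p i) j" if "i \<in> I" for i j
    using I(1) that by (simp add: q_def coeff_sum if_distrib cong: if_cong)
  define f where "f = (\<Sum>j\<le>m. Polynomial.monom (poly (q j) x) j)"
  show ?thesis
  proof (rule that[of f])
    show "f \<in> polys_over (polys_at k x)"
      unfolding f_def using q by (intro kx.polys_over_sum kx.polys_over_monom) (auto simp: polys_at_def)
    have "p i0 \<noteq> 0" using I(3,4) p(2) by auto
    then obtain j where j: "Polynomial.coeff (p i0) j \<noteq> 0" by (auto simp: poly_eq_iff)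
    then have "q j \<noteq> 0" using qc[OF I(3), of j] by auto
    then have "poly (q j) x \<noteq> 0" using x[OF q] by blast
    moreover have "j \<le> m" using le_degree[OF j] m[OF I(3)] by simp
    ultimately have "Polynomial.coeff f j \<noteq> 0" by (simp add: f_def coeff_sum if_distrib cong: if_cong)
    then show "f \<noteq> 0" by auto
    have "poly f y = (\<Sum>j\<le>m. poly (q j) x * y ^ j)" by (simp add: f_def poly_sum poly_monom)
    also have "\<dots> = (\<Sum>j\<le>m. \<Sum>i\<in>I. Polynomial.coeff (p i) j * y ^ j * x ^ i)"
      by (simp add: q_def poly_sum poly_monom sum_distrib_left mult_ac)
    also have "\<dots> = (\<Sum>i\<in>I. \<Sum>j\<le>m. Polynomial.coeff (p i) j * y ^ j * x ^ i)" by (rule sum.swap)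
    also have "\<dots> = (\<Sum>i\<in>I. c i * x ^ i)"
    proof (rule sum.cong)
      fix i assume i: "i \<in> I"
      have "poly (p i) y = (\<Sum>j\<le>m. Polynomial.coeff (p i) j * y ^ j)"
        unfolding poly_altdef using m[OF i] by (intro sum.mono_neutral_left) (auto simp: coeff_eq_0)
      then show "(\<Sum>j\<le>m. Polynomial.coeff (p i) j * y ^ j * x ^ i) = c i * x ^ i"
        using p(2)[OF i] by (simp add: sum_distrib_right)
    qed simp
    finally show "poly f y = 0" using I(5) by simp
  qed
qed

text \<open>The definition of a function field provides some \<open>y\<close> over whose rational
  functions the field is finite, whereas everything refers to the given \<open>x\<close>. A relation
  between \<open>x\<close> and \<open>y\<close> makes \<open>y\<close> algebraic over
  \<open>k(x)\<close>, and the resulting finite extension of \<open>k(x)\<close> contains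
  \<open>k(y)\<close>.\<close>

lemma finite_extension_rational_functions:
  fixes x y :: "'a::field"
  assumes k: "subfield k KR" and x: "\<And>p. p \<in> polys_over k \<Longrightarrow> poly p x = 0 \<Longrightarrow> p = 0"
    and fin: "finite_extension_of (rational_functions k y)"
  shows "finite_extension_of (fractions (polys_at k x))"
proof -
  interpret field KR by (rule field_from_type_algebra)
  interpret k: coeff_ring k by (rule coeff_ring_subfield[OF k])
  interpret kx: coeff_ring "polys_at k x" by (rule k.coeff_ring_polys_at)
  interpret ky: coeff_ring "polys_at k y" by (rule k.coeff_ring_polys_at)
  let ?F = "fractions (polys_at k x)" and ?E = "fractions (polys_at k y)"
  have F: "subfield ?F KR" and E: "subfield ?E KR" by (rule kx.subfield_fractions, rule ky.subfield_fractions)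
  have finE: "finite_extension_of ?E" using fin unfolding rational_functions_eq[OF k] .
  obtain D where "dependent_over ?E D" by (rule finite_extension_basis[OF E finE])
  then have "dependent_over (polys_at k y) D" by (rule ky.dependent_over_fractions)
  then have "\<exists>c. (\<forall>i\<in>{..D}. c i \<in> polys_at k y) \<and> (\<exists>i\<in>{..D}. c i \<noteq> 0) \<and> (\<Sum>i\<in>{..D}. c i * x ^ i) = 0"
    unfolding dependent_over_def by simp
  then obtain c i0 where c: "\<forall>i\<in>{..D}. c i \<in> polys_at k y" "i0 \<in> {..D}" "c i0 \<noteq> 0" "(\<Sum>i\<in>{..D}. c i * x ^ i) = 0" by blast
  obtain p where p: "p \<in> polys_over (polys_at k x)" "p \<noteq> 0" "poly p y = 0"
    by (rule algebraic_exchange[of k x "{..D}" c y i0]) (use x c k.coeff_ring_axioms in auto)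
  have "(ring.algebraic KR over ?F) y"
    by (rule algebraic_KR[OF F polys_over_mono[OF p(1)] p(2,3)]) (use kx.R_fractions in blast)
  then have L: "subfield (KR.simple_extension ?F y) KR" "KR.finite_dimension ?F (KR.simple_extension ?F y)"
    using simple_extension_is_subfield[OF F, of y] finite_dimension_simple_extension[OF F, of y] by auto
  have "?E \<subseteq> KR.simple_extension ?F y"
    unfolding rational_functions_eq[OF k, of y, symmetric] unfolding rational_functions_def[of k y]
  proof (rule generate_field_min_subfield1)
    have "subring ?F KR" using F by (simp add: subfield_def subcring_def subdomain_def)
    then have "y \<in> KR.simple_extension ?F y" by (intro KR.simple_extension_mem) auto
    moreover have "k \<subseteq> ?F" using k.polys_at_const kx.R_fractions by blast
    moreover have "?F \<subseteq> KR.simple_extension ?F y" by (rule KR.simple_extension_incl) auto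
    ultimately show "insert y k \<subseteq> KR.simple_extension ?F y" by blast
    show "subfield (KR.simple_extension ?F y) KR" by (rule L(1))
  qed simp
  moreover obtain m where "KR.dimension m ?E (carrier KR)" using finE by (auto simp: KR.finite_dimension_def)
  then obtain Vs where Vs: "KR.Span ?E Vs = carrier KR" using KR.exists_base[OF E] by blast
  moreover have "KR.Span ?E Vs = {KR.combine Ks Vs | Ks. set Ks \<subseteq> ?E}"
    "KR.Span (KR.simple_extension ?F y) Vs = {KR.combine Ks Vs | Ks. set Ks \<subseteq> KR.simple_extension ?F y}"
    by (rule KR.Span_eq_combine_set[OF E], simp, rule KR.Span_eq_combine_set[OF L(1)], simp)
  ultimately have "carrier KR \<subseteq> KR.Span (KR.simple_extension ?F y) Vs" by blast
  then have "KR.Span (KR.simple_extension ?F y) Vs = carrier KR" by auto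
  then have "finite_extension_of (KR.simple_extension ?F y)" using KR.Span_finite_dimension[OF L(1), of Vs] by simp
  then show ?thesis using KR.telescopic_base_dim(1)[OF F L] by blast
qed

section \<open>The polynomial ring and the infinite place of k(x)\<close>

locale rational_function_field = coeff_ring k for k :: "'a::field set" +
  fixes x :: 'a
  assumes k_inverse: "c \<in> k \<Longrightarrow> 1 / c \<in> k"
    and transcendental: "p \<in> polys_over k \<Longrightarrow> poly p x = 0 \<Longrightarrow> p = 0"
begin

abbreviation "kx \<equiv> polys_at k x"
abbreviation "F \<equiv> fractions kx"
abbreviation "Ri \<equiv> infinite_valuation_ring k x"

sublocale kx: coeff_ring kx by (rule coeff_ring_polys_at)

lemma k_divide: "a \<in> k \<Longrightarrow> b \<in> k \<Longrightarrow> a / b \<in> k"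
  using R_mult[of a "1 / b"] k_inverse by simp

lemma poly_x_inject: "p \<in> polys_over k \<Longrightarrow> q \<in> polys_over k \<Longrightarrow> poly p x = poly q x \<longleftrightarrow> p = q"
  using transcendental[of "p - q"] by auto

lemma poly_x_0: "p \<in> polys_over k \<Longrightarrow> poly p x = 0 \<longleftrightarrow> p = 0"
  using transcendental by auto

lemma x_nonzero: "x \<noteq> 0"
  using transcendental[of "[:0, 1:]"] by auto

lemma poly_kx: "p \<in> polys_over k \<Longrightarrow> poly p x \<in> kx"
  by (auto simp: polys_at_def)

lemma kxE:
  assumes "z \<in> kx"
  obtains p where "p \<in> polys_over k" "z = poly p x"
  using assms by (auto simp: polys_at_def)

definition dg :: "'a \<Rightarrow> nat"
  where "dg z = Polynomial.degree (THE p. p \<in> polys_over k \<and> z = poly p x)"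

lemma dg: "p \<in> polys_over k \<Longrightarrow> dg (poly p x) = Polynomial.degree p"
  unfolding dg_def by (subst the_equality[of _ p]) (auto simp: poly_x_inject)

lemma euclid_kx:
  assumes a: "a \<in> kx" and b: "b \<in> kx" "b \<noteq> 0"
  shows "\<exists>q\<in>kx. a - q * b = 0 \<or> dg (a - q * b) < dg b"
proof -
  obtain f where f: "f \<in> polys_over k" "a = poly f x" using a by (rule kxE)
  obtain g where g: "g \<in> polys_over k" "b = poly g x" using b(1) by (rule kxE)
  define l where "l = Polynomial.lead_coeff g"
  have l: "l \<noteq> 0" "l \<in> k" "1 / l \<in> k" using b g k_inverse by (auto simp: l_def)
  have m: "Polynomial.smult (1 / l) g \<in> polys_over k" "Polynomial.lead_coeff (Polynomial.smult (1 / l) g) = 1"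
    using l g by (auto simp: l_def)
  obtain q r where qr: "q \<in> polys_over k" "r \<in> polys_over k" "f = Polynomial.smult (1 / l) g * q + r"
    "r = 0 \<or> Polynomial.degree r < Polynomial.degree (Polynomial.smult (1 / l) g)"
    by (rule monic_division[OF m f(1)])
  have "a - poly (Polynomial.smult (1 / l) q) x * b = poly r x"
    unfolding f(2) g(2) qr(3) by (simp add: mult_ac)
  moreover have "r = 0 \<or> Polynomial.degree r < Polynomial.degree g" using qr(4) l by simp
  moreover have "poly (Polynomial.smult (1 / l) q) x \<in> kx" using l qr(1) by (intro poly_kx) simp
  ultimately show ?thesis using dg qr(2) g by (intro bexI[of _ "poly (Polynomial.smult (1 / l) q) x"]) auto
qed

lemma dg_mult:
  assumes a: "a \<in> kx" "a \<noteq> 0" and b: "b \<in> kx" "b \<noteq> 0" "1 / b \<notin> kx"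
  shows "dg a < dg (a * b)"
proof -
  obtain f where f: "f \<in> polys_over k" "a = poly f x" using a(1) by (rule kxE)
  obtain g where g: "g \<in> polys_over k" "b = poly g x" using b(1) by (rule kxE)
  have nz: "f \<noteq> 0" "g \<noteq> 0" using a b f g by auto
  have "Polynomial.degree g \<noteq> 0"
  proof
    assume "Polynomial.degree g = 0"
    then obtain c where "g = [:c:]" by (rule degree_eq_zeroE)
    then have "1 / b \<in> k" using g k_inverse[of c] by simp
    then show False using b(3) polys_at_const by blast
  qed
  then show ?thesis using nz dg[OF f(1)] dg[of "f * g"] f g by (simp add: degree_mult_eq)
qed

lemma F_cases:
  assumes "z \<in> F"
  obtains f g where "f \<in> polys_over k" "g \<in> polys_over k" "g \<noteq> 0" "z = poly f x / poly g x"
proof -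
  obtain a b where ab: "a \<in> kx" "b \<in> kx" "b \<noteq> 0" "z = a / b" using assms by (auto simp: fractions_def)
  obtain f where f: "f \<in> polys_over k" "a = poly f x" using ab(1) by (rule kxE)
  obtain g where g: "g \<in> polys_over k" "b = poly g x" using ab(2) by (rule kxE)
  have "g \<noteq> 0" using ab(3) g(2) by auto
  then show ?thesis using that[of f g] f g ab by simp
qed

lemma F_frac: "f \<in> polys_over k \<Longrightarrow> g \<in> polys_over k \<Longrightarrow> poly f x / poly g x \<in> F"
proof (cases "poly g x = 0")
  case True
  then show ?thesis using kx.R_fractions[of 0] by simp
next
  case False
  assume "f \<in> polys_over k" "g \<in> polys_over k"
  then show ?thesis using False poly_kx unfolding fractions_def by blast
qed

text \<open>The valuation of \<open>k(x)\<close> at infinity; \<open>ord_frac\<close> shows that it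
  does not depend on the fraction chosen.\<close>

definition ord :: "'a \<Rightarrow> int"
  where "ord z = (THE m. \<exists>f g. f \<in> polys_over k \<and> g \<in> polys_over k \<and> f \<noteq> 0 \<and> g \<noteq> 0 \<and>
    z = poly f x / poly g x \<and> m = int (Polynomial.degree g) - int (Polynomial.degree f))"

lemma ord_frac:
  assumes f: "f \<in> polys_over k" "f \<noteq> 0" and g: "g \<in> polys_over k" "g \<noteq> 0"
  shows "ord (poly f x / poly g x) = int (Polynomial.degree g) - int (Polynomial.degree f)"
  unfolding ord_def
proof (rule the_equality)
  fix m assume "\<exists>f' g'. f' \<in> polys_over k \<and> g' \<in> polys_over k \<and> f' \<noteq> 0 \<and> g' \<noteq> 0 \<and>
    poly f x / poly g x = poly f' x / poly g' x \<and> m = int (Polynomial.degree g') - int (Polynomial.degree f')"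
  then obtain f' g' where *: "f' \<in> polys_over k" "g' \<in> polys_over k" "f' \<noteq> 0" "g' \<noteq> 0"
    "poly f x / poly g x = poly f' x / poly g' x" "m = int (Polynomial.degree g') - int (Polynomial.degree f')" by blast
  have "poly (f * g') x = poly (f' * g) x"
    using * g by (simp add: poly_x_0 frac_eq_eq)
  then have "f * g' = f' * g" by (rule poly_x_inject[THEN iffD1, rotated 2]) (use f g * in simp_all)
  then have "Polynomial.degree (f * g') = Polynomial.degree (f' * g)" by simp
  then show "m = int (Polynomial.degree g) - int (Polynomial.degree f)"
    using f g * by (simp add: degree_mult_eq)
qed (use assms in blast)

lemma F_cases':
  assumes "z \<in> F" "z \<noteq> 0"
  obtains f g where "f \<in> polys_over k" "f \<noteq> 0" "g \<in> polys_over k" "g \<noteq> 0" "z = poly f x / poly g x"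
    "ord z = int (Polynomial.degree g) - int (Polynomial.degree f)"
proof -
  obtain f g where fg: "f \<in> polys_over k" "g \<in> polys_over k" "g \<noteq> 0" "z = poly f x / poly g x"
    using assms(1) by (rule F_cases)
  then have "f \<noteq> 0" using assms(2) by auto
  then show ?thesis using that[of f g] fg ord_frac by simp
qed

lemma ord_mult: "z \<in> F \<Longrightarrow> z \<noteq> 0 \<Longrightarrow> w \<in> F \<Longrightarrow> w \<noteq> 0 \<Longrightarrow> ord (z * w) = ord z + ord w"
proof -
  assume z: "z \<in> F" "z \<noteq> 0" and w: "w \<in> F" "w \<noteq> 0"
  obtain f g where fg: "f \<in> polys_over k" "f \<noteq> 0" "g \<in> polys_over k" "g \<noteq> 0" "z = poly f x / poly g x"
    "ord z = int (Polynomial.degree g) - int (Polynomial.degree f)" using z by (rule F_cases')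
  obtain f' g' where fg': "f' \<in> polys_over k" "f' \<noteq> 0" "g' \<in> polys_over k" "g' \<noteq> 0" "w = poly f' x / poly g' x"
    "ord w = int (Polynomial.degree g') - int (Polynomial.degree f')" using w by (rule F_cases')
  have "z * w = poly (f * f') x / poly (g * g') x" using fg(5) fg'(5) by simp
  then show ?thesis using ord_frac[of "f * f'" "g * g'"] fg fg' by (simp add: degree_mult_eq)
qed

lemma subfield_F: "subfield F KR" by (rule kx.subfield_fractions)

sublocale F: coeff_ring F by (rule coeff_ring_subfield[OF subfield_F])

lemma F_inverse: "z \<in> F \<Longrightarrow> 1 / z \<in> F"
  by (rule subfield_inverse[OF subfield_F])

lemma F_divide: "z \<in> F \<Longrightarrow> w \<in> F \<Longrightarrow> z / w \<in> F"
  using F.R_mult[of z "1 / w"] F_inverse by simp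

lemma ord_1: "ord 1 = 0"
  using ord_frac[of 1 1] by simp

lemma ord_inverse: "z \<in> F \<Longrightarrow> z \<noteq> 0 \<Longrightarrow> ord (1 / z) = - ord z"
  using ord_mult[of z "1 / z"] F_inverse ord_1 by simp

lemma ord_divide: "z \<in> F \<Longrightarrow> z \<noteq> 0 \<Longrightarrow> w \<in> F \<Longrightarrow> w \<noteq> 0 \<Longrightarrow> ord (z / w) = ord z - ord w"
  using ord_mult[of z "1 / w"] F_inverse ord_inverse by simp

lemma Ri_iff: "z \<in> Ri \<longleftrightarrow> z \<in> F \<and> (z = 0 \<or> 0 \<le> ord z)"
proof
  assume "z \<in> Ri"
  then obtain f g where fg: "f \<in> polys_over k" "g \<in> polys_over k" "g \<noteq> 0" "z = poly f x / poly g x"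
    "Polynomial.degree f \<le> Polynomial.degree g" by (auto simp: infinite_valuation_ring_def)
  then show "z \<in> F \<and> (z = 0 \<or> 0 \<le> ord z)" using F_frac ord_frac[of f g] by (cases "f = 0") auto
next
  assume z: "z \<in> F \<and> (z = 0 \<or> 0 \<le> ord z)"
  show "z \<in> Ri"
  proof (cases "z = 0")
    case True
    have "0 \<in> Ri" unfolding infinite_valuation_ring_def
      by (rule CollectI, rule exI[of _ 0], rule exI[of _ 1]) simp
    then show ?thesis using True by simp
  next
    case False
    then obtain f g where "f \<in> polys_over k" "f \<noteq> 0" "g \<in> polys_over k" "g \<noteq> 0" "z = poly f x / poly g x"
      "ord z = int (Polynomial.degree g) - int (Polynomial.degree f)" using z F_cases' by metis
    then show ?thesis using z False unfolding infinite_valuation_ring_def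
      by (intro CollectI exI[of _ f] exI[of _ g]) simp
  qed
qed

lemma Ri_F: "z \<in> Ri \<Longrightarrow> z \<in> F" by (simp add: Ri_iff)

lemma k_F: "c \<in> k \<Longrightarrow> c \<in> F" and x_F: "x \<in> F"
  using polys_at_const polys_at_gen kx.R_fractions by blast+

lemma k_Ri: "c \<in> k \<Longrightarrow> c \<in> Ri"
proof (cases "c = 0")
  case False
  assume "c \<in> k"
  then show ?thesis using ord_frac[of "[:c:]" 1] False k_F by (simp add: Ri_iff)
qed (simp add: Ri_iff)

lemma ord_x: "ord x = - 1"
  using ord_frac[of "[:0, 1:]" 1] by simp

lemma inverse_x_Ri: "1 / x \<in> Ri"
  using ord_inverse[OF x_F x_nonzero] ord_x F_inverse[OF x_F] by (simp add: Ri_iff)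

sublocale Ri: coeff_ring Ri
proof
  show "0 \<in> Ri" "1 \<in> Ri" using k_Ri by auto
  fix a b assume a: "a \<in> Ri" and b: "b \<in> Ri"
  show "a * b \<in> Ri" using a b ord_mult[of a b] by (auto simp: Ri_iff)
  show "- a \<in> Ri"
  proof (cases "a = 0")
    case False
    have "ord (- 1 * a) = ord (-1) + ord a" using a False by (intro ord_mult) (auto simp: Ri_iff)
    moreover have "ord (- 1) = 0" using ord_frac[of "[:-1:]" 1] by simp
    ultimately show ?thesis using a by (auto simp: Ri_iff)
  qed (use a in simp)
  obtain f g where fg: "f \<in> polys_over k" "g \<in> polys_over k" "g \<noteq> 0" "a = poly f x / poly g x"
    "Polynomial.degree f \<le> Polynomial.degree g" using a by (auto simp: infinite_valuation_ring_def)
  obtain f' g' where fg': "f' \<in> polys_over k" "g' \<in> polys_over k" "g' \<noteq> 0" "b = poly f' x / poly g' x"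
    "Polynomial.degree f' \<le> Polynomial.degree g'" using b by (auto simp: infinite_valuation_ring_def)
  have "poly g x \<noteq> 0" "poly g' x \<noteq> 0" using fg fg' poly_x_0 by auto
  then have "a + b = poly (f * g' + f' * g) x / poly (g * g') x"
    unfolding fg(4) fg'(4) by (simp add: add_frac_eq)
  moreover have "Polynomial.degree (f * g' + f' * g) \<le> Polynomial.degree (g * g')"
  proof (rule degree_add_le)
    have "Polynomial.degree (f * g') \<le> Polynomial.degree f + Polynomial.degree g'"
      "Polynomial.degree (f' * g) \<le> Polynomial.degree f' + Polynomial.degree g" by (rule degree_mult_le)+
    then show "Polynomial.degree (f * g') \<le> Polynomial.degree (g * g')"
      "Polynomial.degree (f' * g) \<le> Polynomial.degree (g * g')"
      using fg fg' by (simp_all add: degree_mult_eq)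
  qed
  ultimately show "a + b \<in> Ri" unfolding infinite_valuation_ring_def
    using fg fg' by (intro CollectI exI[of _ "f * g' + f' * g"] exI[of _ "g * g'"]) simp
qed

text \<open>Either \<open>b\<close> divides \<open>a\<close>, or \<open>a\<close> has smaller order
  and quotient 0 will do. Being Euclidean, the ring at infinity can serve as base ring just like
  \<open>k[x]\<close>, and its integral closure accounts for the places in S.\<close>

lemma euclid_Ri:
  assumes "a \<in> Ri" "b \<in> Ri" "b \<noteq> 0"
  shows "\<exists>q\<in>Ri. a - q * b = 0 \<or> nat (ord (a - q * b)) < nat (ord b)"
proof (cases "a = 0 \<or> ord b \<le> ord a")
  case True
  then have "a / b \<in> Ri" using assms ord_divide[of a b] F_divide[of a b] by (auto simp: Ri_iff)
  then show ?thesis using assms by (intro bexI[of _ "a / b"]) simp_all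
next
  case False
  then show ?thesis using assms by (intro bexI[of _ 0]) (auto simp: Ri_iff)
qed

lemma ord_mult_less:
  assumes "a \<in> Ri" "b \<in> Ri" "a \<noteq> 0" "b \<noteq> 0" "1 / b \<notin> Ri"
  shows "nat (ord a) < nat (ord (a * b))"
proof -
  have "ord b > 0" using assms ord_inverse[of b] F_inverse[of b] by (auto simp: Ri_iff)
  then show ?thesis using assms ord_mult[of a b] by (auto simp: Ri_iff)
qed

lemma fractions_Ri: "fractions Ri = F"
proof
  show "fractions Ri \<subseteq> F" using F_divide Ri_F by (auto simp: fractions_def)
  show "F \<subseteq> fractions Ri"
  proof
    fix z assume z: "z \<in> F"
    show "z \<in> fractions Ri"
    proof (cases "z \<in> Ri")
      case True then show ?thesis by (rule Ri.R_fractions)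
    next
      case False
      then have "z \<noteq> 0" "1 / z \<in> Ri" using z ord_inverse[of z] F_inverse[of z] by (auto simp: Ri_iff)
      moreover have "z = 1 / (1 / z)" by simp
      ultimately show ?thesis unfolding fractions_def
        by (intro CollectI exI[of _ 1] exI[of _ "1 / z"]) auto
    qed
  qed
qed

text \<open>The residue field at infinity is \<open>k\<close>: the quotient of the coefficients of
  index \<open>degree g\<close> is the residue of \<open>c\<close>. The factor \<open>x\<close>
  expresses that the difference lies in the maximal ideal, which \<open>1 / x\<close>
  generates.\<close>

lemma Ri_reduce:
  assumes "c \<in> Ri"
  obtains a where "a \<in> k" "x * (c - a) \<in> Ri"
proof -
  obtain f g where fg: "f \<in> polys_over k" "g \<in> polys_over k" "g \<noteq> 0" "c = poly f x / poly g x"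
    "Polynomial.degree f \<le> Polynomial.degree g" using assms by (auto simp: infinite_valuation_ring_def)
  define m where "m = Polynomial.degree g"
  define a where "a = Polynomial.coeff f m / Polynomial.coeff g m"
  have a: "a \<in> k" using fg by (auto simp: a_def intro: k_divide)
  define h where "h = f - Polynomial.smult a g"
  have h: "h \<in> polys_over k" using fg a by (simp add: h_def)
  have "Polynomial.coeff h i = 0" if "i \<ge> m" for i
  proof (cases "i = m")
    case True then show ?thesis using fg(3) by (simp add: h_def a_def m_def)
  next
    case False
    then have "i > Polynomial.degree g" "i > Polynomial.degree f" using that fg(5) by (auto simp: m_def)
    then show ?thesis by (simp add: h_def coeff_eq_0)
  qed
  then have "Polynomial.coeff (pCons 0 h) i = 0" if "i > m" for i
    using that by (cases i) auto
  then have "Polynomial.degree (pCons 0 h) \<le> m" by (rule degree_le[rule_format])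
  moreover have "x * (c - a) = poly (pCons 0 h) x / poly g x"
  proof -
    have "poly g x \<noteq> 0" using fg poly_x_0 by auto
    then show ?thesis using fg(4) by (simp add: h_def field_simps)
  qed
  ultimately have "x * (c - a) \<in> Ri" unfolding infinite_valuation_ring_def
    using fg h by (intro CollectI exI[of _ "pCons 0 h"] exI[of _ g]) (simp add: m_def)
  then show ?thesis using that a by blast
qed

end

section \<open>Places of a function field\<close>

context nval
begin

lemma subring_valuation_ring: "subring (valuation_ring v) KR"
proof -
  interpret V: coeff_ring "valuation_ring v" by (rule coeff_ring_valuation_ring)
  show ?thesis by (rule KR.subringI) auto
qed

lemma cring_valuation_ring: "cring (valuation_ring_rec v)"
  using KR.subcring_iff[of "valuation_ring v"] KR.subcringI'[OF subring_valuation_ring] by simp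

lemma ideal_valuation_ideal: "ideal (valuation_ideal v) (valuation_ring_rec v)"
proof -
  interpret V: cring "valuation_ring_rec v" by (rule cring_valuation_ring)
  have sub: "valuation_ideal v \<subseteq> valuation_ring v" by (auto simp: valuation_ideal_def valuation_ring_def)
  have uminus: "\<ominus>\<^bsub>valuation_ring_rec v\<^esub> a = - a" if "a \<in> valuation_ideal v" for a
    by (rule V.minus_equality) (use that sub in \<open>auto simp: valuation_ideal_def valuation_ring_def\<close>)
  have one: "a + b \<in> valuation_ideal v" "- a \<in> valuation_ideal v"
    if "a \<in> valuation_ideal v" "b \<in> valuation_ideal v" for a b
    using that by (simp_all add: valuation_ideal_ball ball_add ball_uminus)
  have mult: "a * b \<in> valuation_ideal v" if "a \<in> valuation_ideal v" "b \<in> valuation_ring v" for a b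
    using ball_mult[of a 1 b 0] that by (simp add: valuation_ideal_ball valuation_ring_ball)
  show ?thesis
  proof (rule idealI)
    show "subgroup (valuation_ideal v) (add_monoid (valuation_ring_rec v))"
    proof (rule V.add.subgroupI)
      show "valuation_ideal v \<noteq> {}" by (auto simp: valuation_ideal_def)
    qed (use sub uminus one in \<open>auto simp: a_inv_def\<close>)
  qed (use mult in \<open>auto simp: V.ring_axioms mult.commute\<close>)
qed

end

locale function_field_ext = rational_function_field k x for k :: "'a::field set" and x +
  fixes d :: nat
  assumes subfield_k: "subfield k KR" and dep_F: "dependent_over F d"
begin

text \<open>The theory of integral closures is used twice: over \<open>k[x]\<close> for the places
  outside S, and over the valuation ring at infinity for the places in S, as
  \<open>places_function_field\<close>, \<open>SS_iff\<close> and \<open>VV_B\<close> show.\<close>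

sublocale A: euclid_ext kx dg d
  by unfold_locales (use euclid_kx dg_mult kx.dependent_over_fractions[OF dep_F] in \<open>auto simp: dependent_over_def\<close>)

sublocale B: euclid_ext Ri "\<lambda>z. nat (ord z)" d
  by unfold_locales (use euclid_Ri ord_mult_less Ri.dependent_over_fractions[unfolded fractions_Ri, OF dep_F] in
    \<open>auto simp: dependent_over_def\<close>)

definition trivial_on_k :: "('a \<Rightarrow> int) \<Rightarrow> bool"
  where "trivial_on_k v \<longleftrightarrow> normalized_valuation v \<and> (\<forall>c\<in>k - {0}. v c = 0)"

lemma v_poly:
  assumes v: "trivial_on_k v" "v x < 0" and p: "p \<in> polys_over k" "p \<noteq> 0"
  shows "v (poly p x) = int (Polynomial.degree p) * v x"
proof -
  interpret nval v using v(1) by (simp add: trivial_on_k_def nval_def)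
  show ?thesis
    using p
  proof (induction p)
    case (pCons a p)
    have a: "a \<in> k" "p \<in> polys_over k" using pCons.prems by auto
    have va: "v a = 0" using a v(1) by (cases "a = 0") (auto simp: trivial_on_k_def)
    show ?case
    proof (cases "p = 0")
      case True
      then show ?thesis using va by simp
    next
      case False
      have px: "poly p x \<noteq> 0" using poly_x_0[OF a(2)] False by simp
      have xp: "x * poly p x \<noteq> 0" "v (x * poly p x) = int (Suc (Polynomial.degree p)) * v x"
        using px x_nonzero v_mult[OF x_nonzero px] pCons.IH[OF a(2) False] by (simp_all add: distrib_right)
      have "int (Suc (Polynomial.degree p)) * v x \<le> 1 * v x" using v(2) by (intro mult_right_mono_neg) auto
      then have "v (x * poly p x) + 1 \<le> 0" using v(2) xp(2) by linarith
      then have "a \<in> ball (v (x * poly p x) + 1)" using va by (simp add: ball_def)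
      from v_add_eq[OF xp(1) this] show ?thesis using xp(2) False by (simp add: add.commute)
    qed
  qed simp
qed

lemma v_frac:
  assumes v: "trivial_on_k v" "v x < 0" and z: "z \<in> F" "z \<noteq> 0"
  shows "v z = ord z * (- v x)"
proof -
  interpret nval v using v(1) by (simp add: trivial_on_k_def nval_def)
  obtain f g where fg: "f \<in> polys_over k" "f \<noteq> 0" "g \<in> polys_over k" "g \<noteq> 0" "z = poly f x / poly g x"
    "ord z = int (Polynomial.degree g) - int (Polynomial.degree f)" using z by (rule F_cases')
  have "v z = v (poly f x) - v (poly g x)"
    unfolding fg(5) using fg poly_x_0 by (intro v_divide) auto
  also have "\<dots> = int (Polynomial.degree f) * v x - int (Polynomial.degree g) * v x"
    using v_poly[OF v] fg by simp
  finally show ?thesis unfolding fg(6) by (simp add: algebra_simps)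
qed

text \<open>On \<open>k(x)\<close> a place with a pole at \<open>x\<close> is a positive multiple of
  \<open>ord\<close>, so the condition on valuation rings amounts to the sign of
  \<open>v x\<close>.\<close>

lemma SS_iff: "Nonarch v \<in> SS (Function_Field k x q) \<longleftrightarrow> trivial_on_k v \<and> v x < 0"
proof -
  have eq: "rational_functions k x = F" by (rule rational_functions_eq[OF subfield_k])
  have "valuation_ring v \<inter> F = Ri \<longleftrightarrow> v x < 0" if v: "trivial_on_k v"
  proof
    assume "valuation_ring v \<inter> F = Ri"
    moreover have "x \<notin> Ri" using ord_x x_nonzero by (simp add: Ri_iff)
    ultimately have "x \<notin> valuation_ring v" using x_F by blast
    then show "v x < 0" by (auto simp: valuation_ring_def)
  next
    assume vx: "v x < 0"
    have "z \<in> valuation_ring v \<longleftrightarrow> z \<in> Ri" if z: "z \<in> F" for z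
    proof (cases "z = 0")
      case False
      have "0 \<le> v z \<longleftrightarrow> 0 \<le> ord z" using v_frac[OF v vx z False] vx by (simp add: mult_le_0_iff)
      then show ?thesis using False z by (simp add: valuation_ring_def Ri_iff)
    qed (simp add: valuation_ring_def)
    then show "valuation_ring v \<inter> F = Ri" using Ri_F by blast
  qed
  then show ?thesis unfolding SS.simps places.simps eq by (auto simp: trivial_on_k_def)
qed

lemma SS_Nonarch: "p \<in> SS (Function_Field k x q) \<Longrightarrow> \<exists>v. p = Nonarch v"
  by auto

lemma v_const_zero:
  assumes "normalized_valuation v" "\<And>c. c \<in> k \<Longrightarrow> c \<noteq> 0 \<Longrightarrow> 0 \<le> v c" "c \<in> k" "c \<noteq> 0"
  shows "v c = 0"
proof -
  interpret nval v by unfold_locales fact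
  have "0 \<le> v (1 / c)" using assms k_inverse by simp
  then show ?thesis using assms(2)[OF assms(3,4)] by (simp add: v_inverse)
qed

lemma VV_A: "v \<in> A.VV \<longleftrightarrow> trivial_on_k v \<and> 0 \<le> v x"
proof
  assume v: "v \<in> A.VV"
  then have nv: "normalized_valuation v" and nn: "\<And>z. z \<in> kx \<Longrightarrow> z \<noteq> 0 \<Longrightarrow> 0 \<le> v z" by (auto simp: A.VV_def)
  have "v c = 0" if "c \<in> k" "c \<noteq> 0" for c
    by (rule v_const_zero[OF nv nn that]) (use polys_at_const in blast)+
  moreover have "0 \<le> v x" by (rule nn[OF polys_at_gen x_nonzero])
  ultimately show "trivial_on_k v \<and> 0 \<le> v x" using nv by (simp add: trivial_on_k_def)
next
  assume v: "trivial_on_k v \<and> 0 \<le> v x"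
  then interpret nval v by (simp add: trivial_on_k_def nval_def)
  have k0: "k \<subseteq> ball 0" using v by (auto simp: trivial_on_k_def ball_def)
  note coeff_ring_valuation_ring[unfolded valuation_ring_ball]
  moreover have "x \<in> ball 0" using v by (simp add: ball_def)
  ultimately have "z \<in> ball 0" if "z \<in> kx" for z
    using that coeff_ring.poly_in_R[OF _ polys_over_mono[OF _ k0]] by (metis kxE)
  then show "v \<in> A.VV" using v by (auto simp: A.VV_def trivial_on_k_def ball_def)
qed

lemma x_power_F: "x ^ m \<in> F"
  using x_F by (rule F.R_power)

lemma ord_x_power: "ord (x ^ m) = - int m"
proof (induction m)
  case (Suc m)
  then show ?case using ord_mult[OF x_F x_nonzero x_power_F[of m]] x_nonzero ord_x by simp
qed (simp add: ord_1)

lemma VV_B: "v \<in> B.VV \<longleftrightarrow> trivial_on_k v \<and> v x < 0"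
proof
  assume v: "v \<in> B.VV"
  then interpret nval v by (rule B.VV_nval)
  have nv: "normalized_valuation v" and nn: "\<And>z. z \<in> Ri \<Longrightarrow> z \<noteq> 0 \<Longrightarrow> 0 \<le> v z" using v by (auto simp: B.VV_def)
  have "v c = 0" if "c \<in> k" "c \<noteq> 0" for c
    by (rule v_const_zero[OF nv nn that]) (use k_Ri in blast)+
  then have triv: "trivial_on_k v" using nv by (simp add: trivial_on_k_def)
  have "0 \<le> v (1 / x)" using nn[OF inverse_x_Ri] x_nonzero by simp
  then have le: "v x \<le> 0" by (simp add: v_inverse)
  \<comment> \<open>Otherwise an element \<open>r\<close> of the ring with positive value,
    multiplied by the power of \<open>x\<close> that brings its order to 0, would be a unit of the
    ring with positive value.\<close>
  have "v x \<noteq> 0"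
  proof
    assume v0: "v x = 0"
    have pr: "B.is_prime (valuation_ideal v \<inter> B.Oc)" by (rule B.center_prime[OF v])
    then obtain m where m: "m \<in> valuation_ideal v \<inter> B.Oc" "m \<noteq> 0" by (auto simp: B.is_prime_def)
    obtain w where w: "w \<in> B.Oc" "m * w \<in> Ri" "m * w \<noteq> 0" using B.divides_R[of m] m by auto
    define r where "r = m * w"
    have "v m > 0" "v w \<ge> 0" using m B.VV_nonneg[OF v w(1)] by (auto simp: valuation_ideal_def)
    then have vr: "v r > 0" "r \<in> Ri" "r \<noteq> 0" using w m(2) v_mult[of m w] by (auto simp: r_def)
    have rF: "r \<in> F" by (rule Ri_F[OF vr(2)])
    define u where "u = r * x ^ nat (ord r)"
    have u: "u \<in> F" "u \<noteq> 0" using rF x_power_F vr x_nonzero by (auto simp: u_def)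
    have "ord r \<ge> 0" using vr by (simp add: Ri_iff)
    then have "ord u = 0" using ord_mult[OF rF vr(3) x_power_F] ord_x_power x_nonzero by (simp add: u_def)
    then have "1 / u \<in> Ri" using u F_inverse[OF u(1)] ord_inverse[OF u] by (simp add: Ri_iff)
    then have "0 \<le> v (1 / u)" using nn u by simp
    moreover have "v u = v r" using v_mult[of r "x ^ nat (ord r)"] v_power[OF x_nonzero] v0 vr x_nonzero by (simp add: u_def)
    ultimately show False using vr by (simp add: v_inverse)
  qed
  then show "trivial_on_k v \<and> v x < 0" using triv le by simp
next
  assume v: "trivial_on_k v \<and> v x < 0"
  have "0 \<le> v z" if "z \<in> Ri" "z \<noteq> 0" for z
    using v_frac[of v z] v that by (auto simp: Ri_iff mult_le_0_iff)
  then show "v \<in> B.VV" using v by (auto simp: B.VV_def trivial_on_k_def)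
qed

lemma places_function_field:
  "places (Function_Field k x q) - SS (Function_Field k x q) = Nonarch ` A.VV"
proof -
  have pl: "p \<in> places (Function_Field k x q) \<longleftrightarrow> (\<exists>v. p = Nonarch v \<and> trivial_on_k v)" for p
    by (auto simp: trivial_on_k_def)
  show ?thesis
  proof (intro equalityI subsetI)
    fix p assume "p \<in> places (Function_Field k x q) - SS (Function_Field k x q)"
    then have p: "p \<in> places (Function_Field k x q)" "p \<notin> SS (Function_Field k x q)" by (simp_all only: Diff_iff simp_thms)
    obtain v where "p = Nonarch v" "trivial_on_k v" using pl[of p, THEN iffD1, OF p(1)] by blast
    then have "v \<in> A.VV" using p(2) unfolding VV_A by (simp only: SS_iff simp_thms not_less)
    then show "p \<in> Nonarch ` A.VV" using \<open>p = Nonarch v\<close> by blast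
  next
    fix p assume "p \<in> Nonarch ` A.VV"
    then obtain v where v: "p = Nonarch v" "v \<in> A.VV" by blast
    then have "trivial_on_k v" "\<not> v x < 0" using VV_A by auto
    then have "p \<in> places (Function_Field k x q)" by (intro pl[THEN iffD2] exI[of _ v] conjI v(1))
    moreover have "p \<notin> SS (Function_Field k x q)"
      unfolding v(1) SS_iff using \<open>\<not> v x < 0\<close> by simp
    ultimately show "p \<in> places (Function_Field k x q) - SS (Function_Field k x q)" by (rule DiffI)
  qed
qed

text \<open>\<open>span_modulo\<close> gives finitely many generators over the ring at infinity;
  modulo its maximal ideal the coefficients may be replaced by constants, so the same generators
  span over \<open>k\<close>.\<close>

lemma residue_span:
  assumes v: "v \<in> B.VV"
  obtains r :: nat and g where "\<And>i. i < r \<Longrightarrow> g i \<in> valuation_ring v"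
    "\<And>z. z \<in> valuation_ring v \<Longrightarrow> \<exists>a. (\<forall>i<r. a i \<in> k) \<and> z - (\<Sum>i<r. a i * g i) \<in> valuation_ideal v"
proof -
  interpret nval v by (rule B.VV_nval[OF v])
  interpret p: euclid_ext_prime Ri "\<lambda>z. nat (ord z)" d "valuation_ideal v \<inter> B.Oc" by (rule B.VV_prime[OF v])
  have Ri0: "c \<in> ball 0" if "c \<in> Ri" for c
    using B.R_Oc[OF that] B.VV_ring[OF v] unfolding valuation_ring_ball by blast
  have vx: "v x < 0" using v VV_B by blast
  show ?thesis
  proof (rule p.span_modulo[of "valuation_ideal v" "valuation_ring v"])
    show "a * z \<in> valuation_ideal v" if "a \<in> Ri" "z \<in> valuation_ideal v" for a z
      using ball_mult[OF Ri0[OF that(1)], of z 1] that(2) by (simp add: valuation_ideal_ball)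
    have "p.gen \<in> ball 1" using p.gen(2) by (simp add: valuation_ideal_ball)
    then show "p.gen * z \<in> valuation_ideal v" if "z \<in> valuation_ring v" for z
      using ball_mult[of p.gen 1 z 0] that by (simp add: valuation_ideal_ball valuation_ring_ball)
  next
    fix r :: nat and g assume rg: "\<And>i. i < r \<Longrightarrow> g i \<in> valuation_ring v"
      "\<And>z. z \<in> valuation_ring v \<Longrightarrow> \<exists>c. (\<forall>i<r. c i \<in> Ri) \<and> z - (\<Sum>i<r. c i * g i) \<in> valuation_ideal v"
    show thesis
    proof (rule that[of r g])
      show "g i \<in> valuation_ring v" if "i < r" for i by (rule rg(1)[OF that])
    next
      fix z assume "z \<in> valuation_ring v"
      then obtain c where c: "\<forall>i<r. c i \<in> Ri" "z - (\<Sum>i<r. c i * g i) \<in> valuation_ideal v" using rg(2) by blast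
      have "\<forall>i<r. \<exists>a. a \<in> k \<and> x * (c i - a) \<in> Ri" using c(1) Ri_reduce by metis
      then obtain a where a: "\<And>i. i < r \<Longrightarrow> a i \<in> k" "\<And>i. i < r \<Longrightarrow> x * (c i - a i) \<in> Ri" by metis
      have "(c i - a i) * g i \<in> ball 1" if i: "i < r" for i
      proof -
        have "1 / x \<in> ball 1" using vx by (simp add: ball_def v_inverse)
        from ball_mult[OF this Ri0[OF a(2)[OF i]]] have "c i - a i \<in> ball 1" using x_nonzero by simp
        from ball_mult[OF this, of "g i" 0] show ?thesis using rg(1)[OF i] by (simp add: valuation_ring_ball)
      qed
      then have "(\<Sum>i<r. (c i - a i) * g i) \<in> ball 1" by (intro ball_sum) simp
      from ball_add[OF c(2)[unfolded valuation_ideal_ball] this]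
      have "z - (\<Sum>i<r. a i * g i) \<in> valuation_ideal v"
        by (simp add: valuation_ideal_ball left_diff_distrib sum_subtractf)
      then show "\<exists>a. (\<forall>i<r. a i \<in> k) \<and> z - (\<Sum>i<r. a i * g i) \<in> valuation_ideal v" using a(1) by blast
    qed
  qed (auto simp: valuation_ideal_ball ball_add)
qed

text \<open>The dimension carries meaning once the residue field is known to be finite-dimensional
  over the constants, which the generators from \<open>residue_span\<close> provide; it is not 0
  because 1 and 0 are different classes.\<close>

lemma residue_dim_pos:
  assumes v: "v \<in> B.VV"
  shows "ring.dim (residue_field v) (residue_constants k v) (carrier (residue_field v)) > 0"
proof -
  interpret nval v by (rule B.VV_nval[OF v])
  let ?V = "valuation_ring_rec v" and ?I = "valuation_ideal v"
  interpret V: cring ?V by (rule cring_valuation_ring)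
  interpret I: ideal ?I ?V by (rule ideal_valuation_ideal)
  define cls where "cls = (+>\<^bsub>?V\<^esub>) ?I"
  interpret h: ring_hom_ring ?V "?V Quot ?I" cls unfolding cls_def by (rule I.rcos_ring_hom_ring)
  let ?Q = "?V Quot ?I"
  define C where "C = cls ` k"
  have CQ: "residue_constants k v = C" "residue_field v = ?Q"
    by (simp_all add: residue_constants_def residue_field_def C_def cls_def)
  have kV: "k \<subseteq> valuation_ring v" using k_Ri B.R_Oc B.VV_ring[OF v] by blast
  have subV: "subfield k ?V"
  proof (rule V.subfield_iff(1))
    show "field (?V\<lparr>carrier := k\<rparr>)" using KR.subfield_iff(2)[OF subfield_k] by simp
    show "k \<subseteq> carrier ?V" using kV by simp
  qed
  have cls_eq: "cls z = cls w \<longleftrightarrow> z - w \<in> ?I" for z w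
  proof -
    have cls: "cls z = {y. y - z \<in> ?I}" for z
      unfolding cls_def a_r_coset_def' by (force simp: algebra_simps)
    show ?thesis
    proof
      assume "cls z = cls w"
      moreover have "z \<in> cls z" unfolding cls by (simp add: valuation_ideal_def)
      ultimately show "z - w \<in> ?I" unfolding cls by blast
    next
      assume zw: "z - w \<in> ?I"
      have "y - z \<in> ball 1 \<longleftrightarrow> y - w \<in> ball 1" for y
        using ball_add[of "y - z" 1 "z - w"] ball_diff[of "y - w" 1 "z - w"] zw by (auto simp: valuation_ideal_ball)
      then show "cls z = cls w" unfolding cls valuation_ideal_ball by simp
    qed
  qed
  have one0: "\<one>\<^bsub>?Q\<^esub> \<noteq> \<zero>\<^bsub>?Q\<^esub>"
  proof -
    have "cls 1 = \<one>\<^bsub>?Q\<^esub>" "cls 0 = \<zero>\<^bsub>?Q\<^esub>" using h.hom_one h.hom_zero by simp_all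
    moreover have "(1::'a) - 0 \<notin> ?I" by (simp add: valuation_ideal_def)
    ultimately show ?thesis using cls_eq by metis
  qed
  have subC: "subfield C ?Q" unfolding C_def by (rule h.img_is_subfield(2)[OF subV one0])
  obtain r :: nat and g where g: "\<And>i. i < r \<Longrightarrow> g i \<in> valuation_ring v"
    "\<And>z. z \<in> valuation_ring v \<Longrightarrow> \<exists>a. (\<forall>i<r. a i \<in> k) \<and> z - (\<Sum>i<r. a i * g i) \<in> ?I"
    by (rule residue_span[OF v]) blast
  define Us where "Us = map (\<lambda>i. cls (g i)) [0..<r]"
  have Us: "set Us \<subseteq> carrier ?Q" using g(1) h.hom_closed by (auto simp: Us_def)
  have span: "cls (\<Sum>i<m. a i * g i) \<in> h.S.Span C Us" if "m \<le> r" "\<forall>i<r. a i \<in> k" for m a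
    using that
  proof (induction m)
    case 0
    then show ?case using h.hom_zero h.S.Span_subgroup_props(2)[OF subC Us] by simp
  next
    case (Suc m)
    have mem: "a i * g i \<in> valuation_ring v" "a i \<in> valuation_ring v" "g i \<in> valuation_ring v" if "i < r" for i
      using g(1)[OF that] Suc.prems(2) that kV ball_mult[of "a i" 0 "g i" 0] by (auto simp: valuation_ring_ball)
    have "(\<Sum>i<m. a i * g i) \<in> valuation_ring v"
      using mem(1) Suc.prems(1) unfolding valuation_ring_ball by (intro ball_sum) auto
    then have "cls (\<Sum>i<Suc m. a i * g i) = cls (\<Sum>i<m. a i * g i) \<oplus>\<^bsub>?Q\<^esub> (cls (a m) \<otimes>\<^bsub>?Q\<^esub> cls (g m))"
      using h.hom_add[of "\<Sum>i<m. a i * g i" "a m * g m"] h.hom_mult[of "a m" "g m"] mem[of m] Suc.prems(1) by simp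
    moreover have "cls (g m) \<in> h.S.Span C Us"
      using h.S.Span_base_incl[OF subC Us] Suc.prems(1) by (auto simp: Us_def)
    then have "cls (a m) \<otimes>\<^bsub>?Q\<^esub> cls (g m) \<in> h.S.Span C Us"
      using h.S.Span_smult_closed[OF subC Us] Suc.prems by (auto simp: C_def)
    moreover have "cls (\<Sum>i<m. a i * g i) \<in> h.S.Span C Us" using Suc by simp
    ultimately show ?case using h.S.Span_subgroup_props(3)[OF subC Us] by simp
  qed
  have "carrier ?Q \<subseteq> h.S.Span C Us"
  proof
    fix K assume "K \<in> carrier ?Q"
    then obtain z where z: "z \<in> valuation_ring v" "K = cls z"
      by (auto simp: FactRing_def A_RCOSETS_def' cls_def)
    obtain a where a: "\<forall>i<r. a i \<in> k" "z - (\<Sum>i<r. a i * g i) \<in> ?I" using g(2)[OF z(1)] by blast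
    have "(\<Sum>i<r. a i * g i) \<in> valuation_ring v"
      using g(1) kV a(1) ball_mult[of _ 0 _ 0] unfolding valuation_ring_ball by (intro ball_sum) (auto simp: subset_iff)
    then have "K = cls (\<Sum>i<r. a i * g i)" using cls_eq z a(2) by simp
    then show "K \<in> h.S.Span C Us" using span[OF order.refl a(1)] by simp
  qed
  then have "h.S.Span C Us = carrier ?Q" using h.S.Span_subgroup_props(1)[OF subC Us] by blast
  then have "h.S.finite_dimension C (carrier ?Q)" using h.S.Span_finite_dimension[OF subC Us] by simp
  from h.S.finite_dimensionE[OF subC this]
  have dim: "h.S.dimension (h.S.dim C (carrier ?Q)) C (carrier ?Q)" by (simp add: over_def)
  have "h.S.dim C (carrier ?Q) \<noteq> 0"
  proof
    assume "h.S.dim C (carrier ?Q) = 0"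
    then have "carrier ?Q = {\<zero>\<^bsub>?Q\<^esub>}" using dim h.S.dimension_zero[OF subC] by simp
    then show False using one0 h.S.one_closed by blast
  qed
  then show ?thesis unfolding CQ by simp
qed

end

section \<open>Dimension counts modulo subspaces\<close>

context coeff_ring
begin

text \<open>Over a field of coefficients, with \<open>U\<close> a subspace: the image of
  \<open>V\<close> modulo \<open>U\<close> has no more than \<open>m\<close> independent elements,
  phrased without quotient spaces.\<close>

definition dependent_mod :: "'a set \<Rightarrow> 'a set \<Rightarrow> nat \<Rightarrow> bool"
  where "dependent_mod V U m \<longleftrightarrow> (\<forall>(I :: nat set) g. finite I \<longrightarrow> card I > m \<longrightarrow> (\<forall>i\<in>I. g i \<in> V) \<longrightarrow>
    (\<exists>c. (\<forall>i\<in>I. c i \<in> R) \<and> (\<exists>i\<in>I. c i \<noteq> 0) \<and> (\<Sum>i\<in>I. c i * g i) \<in> U))"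

lemma dependent_modD:
  assumes "dependent_mod V U m" "finite (I :: nat set)" "card I > m" "\<forall>i\<in>I. g i \<in> V"
  shows "\<exists>c. (\<forall>i\<in>I. c i \<in> R) \<and> (\<exists>i\<in>I. c i \<noteq> 0) \<and> (\<Sum>i\<in>I. c i * g i) \<in> U"
  using assms unfolding dependent_mod_def by simp

definition submodule_set :: "'a set \<Rightarrow> bool"
  where "submodule_set U \<longleftrightarrow> 0 \<in> U \<and> (\<forall>a\<in>U. \<forall>b\<in>U. a + b \<in> U) \<and> (\<forall>c\<in>R. \<forall>a\<in>U. c * a \<in> U)"

lemma submodule_set_sum:
  assumes "submodule_set U" "\<And>i. i \<in> I \<Longrightarrow> f i \<in> U"
  shows "sum f I \<in> U"
  using assms(2)
proof (induction I rule: infinite_finite_induct)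
  case (insert i I)
  then have "f i \<in> U" "sum f I \<in> U" by auto
  then show ?case using assms(1) insert.hyps unfolding submodule_set_def by simp
qed (use assms(1) in \<open>simp_all add: submodule_set_def\<close>)

lemma dependent_mod_refl: "submodule_set U \<Longrightarrow> dependent_mod U U 0"
  unfolding dependent_mod_def
proof (intro allI impI)
  fix I :: "nat set" and g assume U: "submodule_set U" and I: "finite I" "card I > 0" "\<forall>i\<in>I. g i \<in> U"
  have "(\<Sum>i\<in>I. 1 * g i) \<in> U" using submodule_set_sum[OF U, of I g] I(3) by simp
  moreover have "I \<noteq> {}" using I(2) by auto
  ultimately show "\<exists>c. (\<forall>i\<in>I. c i \<in> R) \<and> (\<exists>i\<in>I. c i \<noteq> 0) \<and> (\<Sum>i\<in>I. c i * g i) \<in> U"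
    by (intro exI[of _ "\<lambda>_. 1"]) auto
qed

text \<open>
  For a maximal subfamily independent modulo \<open>U\<close>, the other members of the family can be moved
  into \<open>U\<close> by adding combinations of this subfamily.
\<close>

lemma dependent_mod_trans:
  assumes inverse: "\<And>c. c \<in> R \<Longrightarrow> 1 / c \<in> R"
    and VU: "dependent_mod V U a" and UT: "dependent_mod U T b" and U: "submodule_set U"
  shows "dependent_mod V T (a + b)"
  unfolding dependent_mod_def
proof (intro allI impI)
  fix I :: "nat set" and g assume I: "finite I" "card I > a + b" "\<forall>i\<in>I. g i \<in> V"
  define ind where "ind J \<longleftrightarrow> J \<subseteq> I \<and> (\<forall>c. (\<forall>i\<in>J. c i \<in> R) \<longrightarrow> (\<Sum>i\<in>J. c i * g i) \<in> U \<longrightarrow> (\<forall>i\<in>J. c i = 0))" for J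
  have "ind {}" by (simp add: ind_def)
  then obtain J where J: "ind J" "\<And>J'. ind J' \<Longrightarrow> card J' \<le> card J"
    using ex_has_greatest_nat[of ind "{}" card "Suc (card I)"] card_mono[OF I(1)] by (metis ind_def le_imp_less_Suc)
  have JI: "J \<subseteq> I" "finite J" using J(1) I(1) finite_subset by (auto simp: ind_def)
  have cJ: "card J \<le> a"
  proof (rule ccontr)
    assume "\<not> card J \<le> a"
    then have "card J > a" by simp
    moreover have "\<forall>i\<in>J. g i \<in> V" using I(3) JI by blast
    ultimately have "\<exists>c. (\<forall>i\<in>J. c i \<in> R) \<and> (\<exists>i\<in>J. c i \<noteq> 0) \<and> (\<Sum>i\<in>J. c i * g i) \<in> U"
      by (rule dependent_modD[OF VU JI(2)])
    then show False using J(1) unfolding ind_def by blast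
  qed
  have "\<exists>u. (\<forall>i\<in>J. u i \<in> R) \<and> g j + (\<Sum>i\<in>J. u i * g i) \<in> U" if j: "j \<in> I - J" for j
  proof -
    have "\<not> ind (insert j J)" using J(2)[of "insert j J"] j JI(2) by auto
    then obtain c where c: "\<forall>i\<in>insert j J. c i \<in> R" "(\<Sum>i\<in>insert j J. c i * g i) \<in> U" "\<exists>i\<in>insert j J. c i \<noteq> 0"
      using j JI(1) unfolding ind_def by blast
    have sum: "(\<Sum>i\<in>insert j J. c i * g i) = c j * g j + (\<Sum>i\<in>J. c i * g i)" using j JI(2) by simp
    have cj: "c j \<noteq> 0"
    proof
      assume "c j = 0"
      then have "\<forall>i\<in>J. c i = 0" using J(1) c sum unfolding ind_def by simp
      then show False using c(3) \<open>c j = 0\<close> by blast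
    qed
    have inv: "1 / c j \<in> R" using inverse c(1) by blast
    then have "(1 / c j) * (c j * g j + (\<Sum>i\<in>J. c i * g i)) \<in> U"
      using U c(2) unfolding sum submodule_set_def by blast
    also have "(1 / c j) * (c j * g j + (\<Sum>i\<in>J. c i * g i)) = g j + (\<Sum>i\<in>J. (1 / c j * c i) * g i)"
      using cj by (simp add: distrib_left sum_distrib_left mult.assoc)
    finally have "g j + (\<Sum>i\<in>J. (1 / c j * c i) * g i) \<in> U" .
    moreover have "\<forall>i\<in>J. 1 / c j * c i \<in> R" using inv c(1) by (intro ballI R_mult) auto
    ultimately show ?thesis by (intro exI[of _ "\<lambda>i. 1 / c j * c i"] conjI)
  qed
  then obtain u where u: "\<And>j i. j \<in> I - J \<Longrightarrow> i \<in> J \<Longrightarrow> u j i \<in> R"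
    "\<And>j. j \<in> I - J \<Longrightarrow> g j + (\<Sum>i\<in>J. u j i * g i) \<in> U" by metis
  have cIJ: "card (I - J) > b" using cJ I(2) card_Diff_subset[OF JI(2,1)] by simp
  have "\<exists>e. (\<forall>j\<in>I-J. e j \<in> R) \<and> (\<exists>j\<in>I-J. e j \<noteq> 0) \<and> (\<Sum>j\<in>I-J. e j * (g j + (\<Sum>i\<in>J. u j i * g i))) \<in> T"
    by (rule dependent_modD[OF UT _ cIJ]) (use I(1) u(2) in auto)
  then obtain e where e: "\<forall>j\<in>I-J. e j \<in> R" "\<exists>j\<in>I-J. e j \<noteq> 0"
    "(\<Sum>j\<in>I-J. e j * (g j + (\<Sum>i\<in>J. u j i * g i))) \<in> T" by blast
  define c where "c i = (if i \<in> J then \<Sum>j\<in>I-J. e j * u j i else e i)" for i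
  have "(\<Sum>j\<in>I-J. e j * (g j + (\<Sum>i\<in>J. u j i * g i))) = (\<Sum>j\<in>I-J. e j * g j) + (\<Sum>j\<in>I-J. \<Sum>i\<in>J. e j * u j i * g i)"
    by (simp add: distrib_left sum.distrib sum_distrib_left mult.assoc)
  also have "(\<Sum>j\<in>I-J. \<Sum>i\<in>J. e j * u j i * g i) = (\<Sum>i\<in>J. c i * g i)"
    by (subst sum.swap) (simp add: c_def sum_distrib_right)
  also have "(\<Sum>j\<in>I-J. e j * g j) = (\<Sum>j\<in>I-J. c j * g j)" by (rule sum.cong) (auto simp: c_def)
  also have "(\<Sum>j\<in>I-J. c j * g j) + (\<Sum>i\<in>J. c i * g i) = (\<Sum>i\<in>I. c i * g i)"
    by (rule sum.subset_diff[OF JI(1) I(1), symmetric])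
  finally have "(\<Sum>i\<in>I. c i * g i) \<in> T" using e(3) by simp
  moreover have "\<forall>i\<in>I. c i \<in> R" using e(1) u(1) by (auto simp: c_def intro!: R_sum)
  moreover have "\<exists>i\<in>I. c i \<noteq> 0" using e(2) by (auto simp: c_def)
  ultimately show "\<exists>c. (\<forall>i\<in>I. c i \<in> R) \<and> (\<exists>i\<in>I. c i \<noteq> 0) \<and> (\<Sum>i\<in>I. c i * g i) \<in> T" by blast
qed

end

locale function_field_places = function_field_ext k x d for k :: "'a::field set" and x d +
  fixes q :: real and P :: "nat \<Rightarrow> 'a place" and n :: nat and y :: "nat \<Rightarrow> 'a"
  assumes enum: "bij_betw P {1..Suc n} (SS (Function_Field k x q))"
    and q: "q > 1"
    and y_indep: "\<And>c. (\<And>i. i < d \<Longrightarrow> c i \<in> F) \<Longrightarrow> (\<Sum>i<d. c i * y i) = 0 \<Longrightarrow> \<forall>i<d. c i = 0"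
begin

definition vv :: "nat \<Rightarrow> 'a \<Rightarrow> int" where "vv i = (SOME v. P i = Nonarch v)"

lemma P_vv: "i \<in> {1..Suc n} \<Longrightarrow> P i = Nonarch (vv i)"
proof -
  assume i: "i \<in> {1..Suc n}"
  have "P ` {1..Suc n} = SS (Function_Field k x q)" using enum by (simp only: bij_betw_def)
  then have "P i \<in> SS (Function_Field k x q)" using i by blast
  then have "\<exists>v. P i = Nonarch v" by (rule SS_Nonarch)
  then show ?thesis unfolding vv_def by (rule someI_ex)
qed

lemma vv_image: "vv ` {1..Suc n} = B.VV"
proof -
  have im: "P ` {1..Suc n} = SS (Function_Field k x q)" using enum by (simp only: bij_betw_def)
  have "v \<in> B.VV \<longleftrightarrow> Nonarch v \<in> P ` {1..Suc n}" for v unfolding im SS_iff VV_B ..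
  also have "Nonarch v \<in> P ` {1..Suc n} \<longleftrightarrow> v \<in> vv ` {1..Suc n}" for v
    using P_vv by (auto simp: image_iff simp del: atLeastAtMost_iff)
  finally show ?thesis by blast
qed

lemma vv_VV: "i \<in> {1..Suc n} \<Longrightarrow> vv i \<in> B.VV"
  using vv_image by blast

lemma vv_nval: "i \<in> {1..Suc n} \<Longrightarrow> nval (vv i)"
  by (rule B.VV_nval[OF vv_VV])

lemma vv_x: "i \<in> {1..Suc n} \<Longrightarrow> vv i x < 0"
  using vv_VV VV_B by blast

lemma vv_const: "i \<in> {1..Suc n} \<Longrightarrow> c \<in> k \<Longrightarrow> vv i c = 0"
  using vv_VV[of i] VV_B[of "vv i"] nval.v_zero[OF vv_nval[of i]] by (cases "c = 0") (auto simp: trivial_on_k_def)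

lemma vv_inj: "inj_on vv {1..Suc n}"
proof (rule inj_onI)
  fix i j assume ij: "i \<in> {1..Suc n}" "j \<in> {1..Suc n}" "vv i = vv j"
  then have "P i = P j" using P_vv by simp
  then show "i = j" using enum ij unfolding bij_betw_def by (meson inj_onD)
qed

lemma d_pos: "d > 0"
proof (rule ccontr)
  assume "\<not> d > 0"
  then obtain c where "\<exists>i\<in>{0::nat}. c i \<noteq> (0::'a)" "(\<Sum>i\<in>{0::nat}. c i * 1) = 0"
    using B.dep[of "{0}" "\<lambda>_. 1"] by auto
  then show False by simp
qed

text \<open>Elements with poles at the first \<open>n\<close> places of S bounded by those of
  \<open>x ^ m\<close>, without condition at the last place. Measuring by multiples of
  \<open>vv i x\<close> makes multiplication by \<open>x\<close> shift the index by 1.\<close>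

definition Zs :: "int \<Rightarrow> 'a set"
  where "Zs m = {h. \<forall>i\<in>{1..n}. h \<in> nval.ball (vv i) (m * vv i x)}"

lemma submodule_Zs: "submodule_set (Zs m)"
  unfolding submodule_set_def
proof (intro conjI ballI)
  show "0 \<in> Zs m" by (auto simp: Zs_def intro!: nval.ball_0 vv_nval)
  show "a + b \<in> Zs m" if "a \<in> Zs m" "b \<in> Zs m" for a b
    using that nval.ball_add[OF vv_nval] by (auto simp: Zs_def)
  show "c * a \<in> Zs m" if c: "c \<in> k" and a: "a \<in> Zs m" for c a
  proof -
    have "c * a \<in> nval.ball (vv i) (m * vv i x)" if i: "i \<in> {1..n}" for i
    proof -
      have i': "i \<in> {1..Suc n}" using i by simp
      interpret nval "vv i" by (rule vv_nval[OF i'])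
      have "c \<in> ball 0" using vv_const[OF i' c] by (simp add: ball_def)
      from ball_mult[OF this, of a "m * vv i x"] show ?thesis using a i by (simp add: Zs_def)
    qed
    then show ?thesis by (simp add: Zs_def)
  qed
qed

text \<open>
  The element \<open>\<eta>\<close> is near \<open>1\<close> at the last place and near \<open>0\<close> at the others. Together with
  the products \<open>(1 - \<eta>) * z i\<close> it gives a family of more than \<open>d\<close> elements integral at infinity.
\<close>

lemma dependent_mod_step0:
  assumes I: "finite I" "card I \<ge> d" "\<And>i. i \<in> (I :: nat set) \<Longrightarrow> z i \<in> Zs 0"
  shows "\<exists>c. (\<forall>i\<in>I. c i \<in> k) \<and> (\<exists>i\<in>I. c i \<noteq> 0) \<and> (\<Sum>i\<in>I. c i * z i) \<in> Zs (- 1)"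
proof -
  define w where "w = vv (Suc n)"
  have w: "w \<in> B.VV" "nval w" "w x < 0" using vv_VV[of "Suc n"] vv_nval[of "Suc n"] vv_x[of "Suc n"] by (auto simp: w_def)
  interpret w: nval w by (rule w(2))
  interpret p: euclid_ext_prime Ri "\<lambda>z. nat (ord z)" d "valuation_ideal w \<inter> B.Oc" by (rule B.VV_prime[OF w(1)])
  define S1 where "S1 = (\<Sum>i=1..Suc n. \<bar>vv i x\<bar>)"
  define S2 where "S2 = (\<Sum>j\<in>I. \<bar>w (z j)\<bar>)"
  \<comment> \<open>Large enough for two purposes: \<open>\<eta>\<close> vanishes at the first
    \<open>n\<close> places at least to the order of \<open>1 / x\<close>, and so does
    \<open>(1 - \<eta>) * z j\<close> at the last place.\<close>
  define K where "K = S1 + S2 + 1"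
  have s1: "\<bar>vv i x\<bar> \<le> S1" if "i \<in> {1..Suc n}" for i
    unfolding S1_def by (rule member_le_sum[OF that]) auto
  have s2: "\<bar>w (z j)\<bar> \<le> S2" if "j \<in> I" for j
    unfolding S2_def by (rule member_le_sum[OF that]) (use I(1) in auto)
  have s0: "0 \<le> S1" "0 \<le> S2" unfolding S1_def S2_def by (rule sum_nonneg, simp)+
  have K: "K \<ge> 1" "\<And>i. i \<in> {1..Suc n} \<Longrightarrow> - vv i x \<le> K" "\<And>j. j \<in> I \<Longrightarrow> - w x \<le> K + w (z j)"
  proof -
    show "K \<ge> 1" using s0 by (simp add: K_def)
    show "- vv i x \<le> K" if "i \<in> {1..Suc n}" for i using s1[OF that] s0 unfolding K_def by linarith
    show "- w x \<le> K + w (z j)" if "j \<in> I" for j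
    proof -
      have "\<bar>w x\<bar> \<le> S1" using s1[of "Suc n"] by (simp add: w_def)
      then show ?thesis using s2[OF that] unfolding K_def by linarith
    qed
  qed
  have wB: "w \<notin> vv ` {1..n}"
  proof
    assume "w \<in> vv ` {1..n}"
    then obtain i where "i \<in> {1..n}" "vv (Suc n) = vv i" by (auto simp: w_def)
    then show False using inj_onD[OF vv_inj, of "Suc n" i] by auto
  qed
  have Bsub: "vv ` {1..n} \<subseteq> B.VV" using vv_VV by auto
  obtain \<eta> where \<eta>: "\<eta> \<in> B.Oc" "\<eta> - 1 \<in> nval.ball w K" "\<And>v. v \<in> vv ` {1..n} \<Longrightarrow> \<eta> \<in> nval.ball v K"
  proof (rule B.approximation[OF w(1) _ Bsub wB])
    show "0 \<le> K" using K(1) by simp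
  qed auto
  have B_cases: "v = w \<or> v \<in> vv ` {1..n}" if v: "v \<in> B.VV" for v
  proof -
    obtain i where i: "i \<in> {1..Suc n}" "v = vv i" using v vv_image by blast
    show ?thesis
    proof (cases "i = Suc n")
      case False
      then have "i \<in> {1..n}" using i(1) by auto
      then show ?thesis using i(2) by blast
    qed (simp add: i(2) w_def)
  qed
  have Oc0: "u \<in> nval.ball v 0" if "u \<in> B.Oc" "v \<in> B.VV" for u v
    using B.VV_ring[OF that(2)] that(1) nval.valuation_ring_ball[OF B.VV_nval[OF that(2)]] by blast
  define \<zeta> where "\<zeta> j = (1 - \<eta>) * z j" for j
  have \<zeta>w: "\<zeta> j \<in> w.ball (- w x)" if j: "j \<in> I" for j
  proof (cases "z j = 0")
    case False
    have "1 - \<eta> \<in> w.ball K" using w.ball_uminus[OF \<eta>(2)] by simp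
    moreover have "z j \<in> w.ball (w (z j))" by (simp add: w.ball_def)
    ultimately have "\<zeta> j \<in> w.ball (K + w (z j))" unfolding \<zeta>_def by (rule w.ball_mult)
    then show ?thesis by (rule w.ball_mono[OF K(3)[OF j]])
  qed (simp add: \<zeta>_def)
  have \<zeta>v: "\<zeta> j \<in> nval.ball v 0" if j: "j \<in> I" and v: "v \<in> vv ` {1..n}" for j v
  proof -
    interpret nval v using v Bsub B.VV_nval by blast
    have "1 \<in> ball 0" by (simp add: ball_def)
    then have "1 - \<eta> \<in> ball 0" using Oc0[OF \<eta>(1)] v Bsub by (intro ball_diff) auto
    moreover have "z j \<in> ball 0" using I(3)[OF j] v by (auto simp: Zs_def)
    ultimately have "\<zeta> j \<in> ball (0 + 0)" unfolding \<zeta>_def by (rule ball_mult)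
    then show ?thesis by simp
  qed
  \<comment> \<open>Index 0 goes to \<open>\<eta>\<close>, so that \<open>d\<close> elements
    \<open>z i\<close> already yield a family of more than \<open>d\<close>; this saves one
    dimension in each step.\<close>
  define J where "J = insert 0 (Suc ` I)"
  define g where "g = case_nat \<eta> \<zeta>"
  have g: "g j \<in> nval.ball v 0" if j: "j \<in> J" and v: "v \<in> B.VV" for j v
  proof (cases j)
    case 0
    then show ?thesis using Oc0[OF \<eta>(1) v] by (simp add: g_def)
  next
    case (Suc i)
    then have i: "i \<in> I" using j by (auto simp: J_def)
    have "\<zeta> i \<in> w.ball 0" by (rule w.ball_mono[OF _ \<zeta>w[OF i]]) (use w(3) in simp)
    then have "\<zeta> i \<in> nval.ball v 0" using B_cases[OF v] \<zeta>v[OF i] by blast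
    then show ?thesis using Suc by (simp add: g_def)
  qed
  have J: "finite J" "card J > d" using I(1,2) by (simp_all add: J_def card_image)
  obtain c where c: "\<forall>j\<in>J. c j \<in> Ri" "\<exists>j\<in>J. c j \<notin> valuation_ideal w \<inter> B.Oc" "(\<Sum>j\<in>J. c j * g j) = 0"
    by (rule p.primitive_dep[OF J])
  \<comment> \<open>The coefficients are replaced by their residues in \<open>k\<close>. The
    relation then holds up to an element that vanishes at every place of S at least to the order of
    \<open>1 / x\<close>.\<close>
  have "\<forall>j\<in>J. \<exists>a. a \<in> k \<and> x * (c j - a) \<in> Ri" using c(1) Ri_reduce by metis
  then obtain a where a: "\<And>j. j \<in> J \<Longrightarrow> a j \<in> k" "\<And>j. j \<in> J \<Longrightarrow> x * (c j - a j) \<in> Ri" by metis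
  have diff: "c j - a j \<in> nval.ball v (- v x)" if j: "j \<in> J" and v: "v \<in> B.VV" for j v
  proof -
    interpret nval v by (rule B.VV_nval[OF v])
    have "1 / x \<in> ball (- v x)" by (simp add: ball_def v_inverse)
    from ball_mult[OF this Oc0[OF B.R_Oc[OF a(2)[OF j]] v]] show ?thesis using x_nonzero by simp
  qed
  have a_nz: "\<exists>j\<in>J. a j \<noteq> 0"
  proof (rule ccontr)
    assume "\<not> (\<exists>j\<in>J. a j \<noteq> 0)"
    then have "c j \<in> w.ball (- w x)" if "j \<in> J" for j using diff[OF that w(1)] that by simp
    then have "c j \<in> valuation_ideal w \<inter> B.Oc" if "j \<in> J" for j
      using w.ball_mono[of 1 "- w x" "c j"] w(3) that c(1) B.R_Oc by (auto simp: w.valuation_ideal_ball)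
    then show False using c(2) by blast
  qed
  have total: "(\<Sum>j\<in>J. a j * g j) \<in> nval.ball v (- v x)" if v: "v \<in> B.VV" for v
  proof -
    interpret nval v by (rule B.VV_nval[OF v])
    have "(\<Sum>j\<in>J. (c j - a j) * g j) \<in> ball (- v x)"
      using ball_mult[OF diff[OF _ v] g[OF _ v]] by (intro ball_sum) simp
    then have "- (\<Sum>j\<in>J. (c j - a j) * g j) \<in> ball (- v x)" by (rule ball_uminus)
    then show ?thesis using c(3) by (simp add: left_diff_distrib sum_subtractf)
  qed
  have sumJ: "(\<Sum>j\<in>J. a j * g j) = a 0 * \<eta> + (\<Sum>i\<in>I. a (Suc i) * \<zeta> i)"
    unfolding J_def using I(1) by (subst sum.insert) (auto simp: g_def sum.reindex)
  have ak: "a (Suc i) \<in> k" if "i \<in> I" for i using a(1)[of "Suc i"] that by (simp add: J_def)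
  \<comment> \<open>At the last place \<open>\<eta>\<close> is a unit while all
    \<open>\<zeta> i\<close> and the whole sum vanish, so \<open>\<eta>\<close> cannot
    occur.\<close>
  have a0: "a 0 = 0"
  proof (rule ccontr)
    assume nz: "a 0 \<noteq> 0"
    have "a (Suc i) * \<zeta> i \<in> w.ball (- w x)" if i: "i \<in> I" for i
    proof -
      have "w (a (Suc i)) = 0" using vv_const[of "Suc n", OF _ ak[OF i]] by (simp add: w_def)
      then have "a (Suc i) \<in> w.ball 0" by (simp add: w.ball_def)
      from w.ball_mult[OF this \<zeta>w[OF i]] show ?thesis by simp
    qed
    then have "(\<Sum>i\<in>I. a (Suc i) * \<zeta> i) \<in> w.ball (- w x)" by (rule w.ball_sum)
    from w.ball_diff[OF total[OF w(1)] this] have "a 0 * \<eta> \<in> w.ball (- w x)" by (simp add: sumJ)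
    have "1 + (\<eta> - 1) \<noteq> 0 \<and> w (1 + (\<eta> - 1)) = w 1"
      by (rule w.v_add_eq) (use w.ball_mono[of 1 K "\<eta> - 1"] K(1) \<eta>(2) in simp_all)
    then have "\<eta> \<noteq> 0" "w \<eta> = 0" by simp_all
    moreover have "w (a 0) = 0" using vv_const[of "Suc n", OF _ a(1)[of 0]] by (simp add: w_def J_def)
    ultimately have "w (a 0 * \<eta>) = 0" "a 0 * \<eta> \<noteq> 0" using w.v_mult[OF nz] nz by simp_all
    with \<open>a 0 * \<eta> \<in> w.ball (- w x)\<close> show False using w(3) by (simp add: w.ball_def)
  qed
  show ?thesis
  proof (intro exI[of _ "\<lambda>i. a (Suc i)"] conjI)
    show "\<forall>i\<in>I. a (Suc i) \<in> k" using ak by blast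
    show "\<exists>i\<in>I. a (Suc i) \<noteq> 0" using a_nz a0 by (auto simp: J_def)
    show "(\<Sum>i\<in>I. a (Suc i) * z i) \<in> Zs (- 1)"
      unfolding Zs_def
    proof (intro CollectI ballI)
      fix i assume i: "i \<in> {1..n}"
      then have i': "i \<in> {1..Suc n}" by simp
      interpret nval "vv i" by (rule vv_nval[OF i'])
      have "(\<Sum>j\<in>I. a (Suc j) * \<zeta> j) \<in> ball (- vv i x)" using total[OF vv_VV[OF i']] by (simp add: sumJ a0)
      \<comment> \<open>Returning from \<open>\<zeta> j\<close> to \<open>z j\<close> adds multiples
        of \<open>\<eta>\<close>, which are small at the first \<open>n\<close> places.\<close>
      moreover have "(\<Sum>j\<in>I. a (Suc j) * (\<eta> * z j)) \<in> ball (- vv i x)"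
      proof (rule ball_sum)
        fix j assume j: "j \<in> I"
        have "a (Suc j) \<in> ball 0" using vv_const[OF i' ak[OF j]] by (simp add: ball_def)
        moreover have "z j \<in> ball 0" using I(3)[OF j] i by (simp add: Zs_def)
        moreover have "\<eta> \<in> ball (- vv i x)" by (rule ball_mono[OF K(2)[OF i'] \<eta>(3)]) (use i in blast)
        ultimately have "a (Suc j) * (\<eta> * z j) \<in> ball (0 + (- vv i x + 0))" by (intro ball_mult)
        then show "a (Suc j) * (\<eta> * z j) \<in> ball (- vv i x)" by simp
      qed
      ultimately have "(\<Sum>j\<in>I. a (Suc j) * \<zeta> j) + (\<Sum>j\<in>I. a (Suc j) * (\<eta> * z j)) \<in> ball (- vv i x)" by (rule ball_add)
      also have "(\<Sum>j\<in>I. a (Suc j) * \<zeta> j) + (\<Sum>j\<in>I. a (Suc j) * (\<eta> * z j)) = (\<Sum>j\<in>I. a (Suc j) * z j)"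
        by (simp add: sum.distrib[symmetric] \<zeta>_def algebra_simps)
      finally show "(\<Sum>j\<in>I. a (Suc j) * z j) \<in> ball (- 1 * vv i x)" by simp
    qed
  qed
qed

lemma Zs_scale: "h \<in> Zs m \<Longrightarrow> x powi l * h \<in> Zs (m + l)"
proof -
  assume h: "h \<in> Zs m"
  have "x powi l * h \<in> nval.ball (vv i) ((m + l) * vv i x)" if i: "i \<in> {1..n}" for i
  proof -
    interpret nval "vv i" using i by (intro vv_nval) auto
    have "x powi l \<in> ball (l * vv i x)" using v_powi[OF x_nonzero] by (simp add: ball_def)
    from ball_mult[OF this, of h "m * vv i x"] show ?thesis using h i by (simp add: Zs_def algebra_simps)
  qed
  then show ?thesis by (simp add: Zs_def)
qed

lemma dependent_mod_step: "dependent_mod (Zs (m + 1)) (Zs m) (d - 1)"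
  unfolding dependent_mod_def
proof (intro allI impI)
  fix I :: "nat set" and g assume I: "finite I" "card I > d - 1" "\<forall>i\<in>I. g i \<in> Zs (m + 1)"
  have z: "x powi (- (m + 1)) * g i \<in> Zs 0" if "i \<in> I" for i
    using Zs_scale[of "g i" "m + 1" "- (m + 1)"] I(3) that by simp
  have "card I \<ge> d" using I(2) by simp
  then have "\<exists>c. (\<forall>i\<in>I. c i \<in> k) \<and> (\<exists>i\<in>I. c i \<noteq> 0) \<and> (\<Sum>i\<in>I. c i * (x powi (- (m + 1)) * g i)) \<in> Zs (- 1)"
    by (rule dependent_mod_step0[OF I(1)]) (rule z)
  then obtain c
    where c: "\<forall>i\<in>I. c i \<in> k" "\<exists>i\<in>I. c i \<noteq> 0" "(\<Sum>i\<in>I. c i * (x powi (- (m + 1)) * g i)) \<in> Zs (- 1)" by blast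
  have "(\<Sum>i\<in>I. c i * (x powi (- (m + 1)) * g i)) = x powi (- (m + 1)) * (\<Sum>i\<in>I. c i * g i)"
    by (simp add: sum_distrib_left mult_ac)
  then have "x powi (m + 1) * (x powi (- (m + 1)) * (\<Sum>i\<in>I. c i * g i)) \<in> Zs m"
    using Zs_scale[OF c(3), of "m + 1"] by simp
  moreover have "x powi (m + 1) * x powi (- (m + 1)) = 1"
    using x_nonzero power_int_minus[of x "m + 1"] by (simp del: minus_add_distrib)
  ultimately have "(\<Sum>i\<in>I. c i * g i) \<in> Zs m" by (simp only: mult.assoc[symmetric] mult_1)
  then show "\<exists>c. (\<forall>i\<in>I. c i \<in> k) \<and> (\<exists>i\<in>I. c i \<noteq> 0) \<and> (\<Sum>i\<in>I. c i * g i) \<in> Zs m" using c by blast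
qed

lemma dependent_mod_Zs: "dependent_mod (Zs (m + int r)) (Zs m) (r * (d - 1))"
proof (induction r)
  case 0
  then show ?case using dependent_mod_refl[OF submodule_Zs, of m] by simp
next
  case (Suc r)
  have "dependent_mod (Zs (m + int r + 1)) (Zs (m + int r)) (d - 1)" by (rule dependent_mod_step)
  from dependent_mod_trans[OF k_inverse this Suc submodule_Zs]
  have "dependent_mod (Zs (m + int r + 1)) (Zs m) (d - 1 + r * (d - 1))" by simp
  moreover have "m + int (Suc r) = m + int r + 1" by simp
  ultimately show ?case by (simp only: mult_Suc)
qed

lemma Zs_exists: "\<exists>m::nat. h \<in> Zs (int m)"
proof -
  define m where "m = nat (\<Sum>i=1..n. \<bar>vv i h\<bar>)"
  have "h \<in> nval.ball (vv i) (int m * vv i x)" if i: "i \<in> {1..n}" for i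
  proof -
    have i': "i \<in> {1..Suc n}" using i by simp
    have "\<bar>vv i h\<bar> \<le> (\<Sum>i=1..n. \<bar>vv i h\<bar>)" by (rule member_le_sum[OF i]) auto
    then have "- vv i h \<le> int m" by (simp add: m_def)
    moreover have "int m * vv i x \<le> int m * (- 1)" using vv_x[OF i'] by (intro mult_left_mono) auto
    ultimately show ?thesis by (simp add: nval.ball_def[OF vv_nval[OF i']])
  qed
  then show ?thesis by (intro exI[of _ m]) (simp add: Zs_def)
qed

lemma Zs_mono: "m \<le> l \<Longrightarrow> h \<in> Zs m \<Longrightarrow> h \<in> Zs l"
proof -
  assume "m \<le> l" and h: "h \<in> Zs m"
  have "h \<in> nval.ball (vv i) (l * vv i x)" if i: "i \<in> {1..n}" for i
  proof -
    have i': "i \<in> {1..Suc n}" using i by simp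
    have "l * vv i x \<le> m * vv i x" using vv_x[OF i'] \<open>m \<le> l\<close> by (intro mult_right_mono_neg) auto
    then show ?thesis by (rule nval.ball_mono[OF vv_nval[OF i']]) (use h i in \<open>simp add: Zs_def\<close>)
  qed
  then show ?thesis by (simp add: Zs_def)
qed

text \<open>A family of \<open>d\<close> independent elements times the powers of \<open>x\<close>
  below \<open>N\<close> gives \<open>d * N\<close> elements of \<open>b\<close> independent over
  \<open>k\<close>, while the conditions to be imposed cost at most \<open>d - 1\<close> dimensions
  per step of the filtration. For large \<open>N\<close> some nontrivial combination satisfies all
  of them.\<close>

lemma element_vanishing:
  assumes b: "A.fideal b"
  shows "\<exists>h\<in>b. h \<noteq> 0 \<and> h \<in> Zs (- int T)"
proof -
  obtain f where f: "f \<in> b" "f \<noteq> 0" using A.fideal_nonzero[OF b] by blast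
  obtain r where r: "r \<in> kx" "r \<noteq> 0" "\<And>j. j < d \<Longrightarrow> r * y j \<in> A.Oc" by (rule A.integral_multiple[of d y]) blast
  define w where "w j = r * y j * f" for j
  have bI: "A.is_ideal b" using b by (simp add: A.fideal_def)
  have wb: "w j \<in> b" if "j < d" for j using bI f(1) r(3)[OF that] unfolding A.is_ideal_def w_def by blast
  have "\<forall>j. \<exists>m. w j \<in> Zs (int m)" using Zs_exists by blast
  from choice[OF this] obtain M where M: "\<And>j. w j \<in> Zs (int (M j))" by blast
  define C where "C = (\<Sum>j<d. M j)"
  have C: "w j \<in> Zs (int C)" if "j < d" for j
  proof (rule Zs_mono[OF _ M])
    have "M j \<le> C" unfolding C_def using that by (intro member_le_sum) auto
    then show "int (M j) \<le> int C" by simp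
  qed
  \<comment> \<open>Chosen so that \<open>(N + C + T) * (d - 1) < d * N\<close>. The elements lie in
    \<open>Zs (int (N + C))\<close>, and \<open>N + C + T\<close> steps lead from there to
    \<open>Zs (- int T)\<close>.\<close>
  define N where "N = (d - 1) * (C + T) + 1"
  define S where "S = {..<d} \<times> {..<N}"
  define G where "G = (\<lambda>(i, j). x ^ j * w i)"
  have GZ: "G p \<in> Zs (int (N + C))" if p: "p \<in> S" for p
  proof -
    obtain i j where ij: "p = (i, j)" "i < d" "j < N" using p by (auto simp: S_def)
    have "x powi int j * w i \<in> Zs (int C + int j)" by (rule Zs_scale[OF C[OF ij(2)]])
    then have "x ^ j * w i \<in> Zs (int C + int j)" by simp
    then show ?thesis unfolding G_def ij(1) prod.case by (rule Zs_mono[rotated]) (use ij(3) in simp)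
  qed
  have Gb: "G p \<in> b" if p: "p \<in> S" for p
  proof -
    have "x ^ j \<in> A.Oc" for j using A.R_Oc[OF kx.R_power[OF polys_at_gen]] .
    then show ?thesis using p wb bI unfolding A.is_ideal_def by (auto simp: S_def G_def)
  qed
  have finS: "finite S" by (simp add: S_def)
  obtain e where e: "bij_betw e {0..<card S} S" using ex_bij_betw_nat_finite[OF finS] by blast
  have eS: "e t \<in> S" if "t \<in> {0..<card S}" for t using e that by (auto simp: bij_betw_def)
  have "(N + C + T) * (d - 1) < d * N"
  proof -
    have "(d - 1) * (C + T) < N" by (simp add: N_def)
    then have "(d - 1) * N + (d - 1) * (C + T) < (d - 1) * N + N" by simp
    also have "\<dots> = d * N" using d_pos by (cases d) auto
    finally show ?thesis by (simp only: add.assoc distrib_right mult.commute distrib_left)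
  qed
  then have "card {0..<card S} > (N + C + T) * (d - 1)" by (simp add: S_def)
  moreover have "dependent_mod (Zs (- int T + int (N + C + T))) (Zs (- int T)) ((N + C + T) * (d - 1))"
    by (rule dependent_mod_Zs)
  moreover have "- int T + int (N + C + T) = int (N + C)" by simp
  ultimately have "dependent_mod (Zs (int (N + C))) (Zs (- int T)) ((N + C + T) * (d - 1))"
    "card {0..<card S} > (N + C + T) * (d - 1)" by (simp_all only:)
  from dependent_modD[OF this(1) finite_atLeastLessThan this(2), of "\<lambda>t. G (e t)"]
  have "\<exists>a. (\<forall>t\<in>{0..<card S}. a t \<in> k) \<and> (\<exists>t\<in>{0..<card S}. a t \<noteq> 0) \<and>
      (\<Sum>t\<in>{0..<card S}. a t * G (e t)) \<in> Zs (- int T)"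
    using GZ[OF eS] by blast
  then obtain a where a: "\<forall>t\<in>{0..<card S}. a t \<in> k" "\<exists>t\<in>{0..<card S}. a t \<noteq> 0"
    "(\<Sum>t\<in>{0..<card S}. a t * G (e t)) \<in> Zs (- int T)" by blast
  define h where "h = (\<Sum>t\<in>{0..<card S}. a t * G (e t))"
  define a' where "a' p = a (inv_into {0..<card S} e p)" for p
  have a'e: "a' (e t) = a t" if "t \<in> {0..<card S}" for t
    using bij_betw_inv_into_left[OF e that] by (simp add: a'_def)
  have a'k: "a' p \<in> k" if "p \<in> S" for p
    using a(1) bij_betw_apply[OF bij_betw_inv_into[OF e] that] by (simp add: a'_def)
  have "h = (\<Sum>t\<in>{0..<card S}. a' (e t) * G (e t))" unfolding h_def by (rule sum.cong) (simp_all add: a'e)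
  also have "\<dots> = (\<Sum>p\<in>S. a' p * G p)" by (rule sum.reindex_bij_betw[OF e])
  also have "\<dots> = (\<Sum>i<d. \<Sum>j<N. a' (i, j) * (x ^ j * w i))"
    unfolding S_def by (subst sum.cartesian_product) (auto simp: G_def intro!: sum.cong)
  also have "\<dots> = (\<Sum>i<d. (\<Sum>j<N. a' (i, j) * x ^ j) * y i) * (r * f)"
    by (simp add: w_def sum_distrib_left sum_distrib_right mult_ac)
  finally have h: "h = (\<Sum>i<d. (\<Sum>j<N. a' (i, j) * x ^ j) * y i) * (r * f)" .
  define p where "p i = (\<Sum>j<N. Polynomial.monom (a' (i, j)) j)" for i
  have pk: "p i \<in> polys_over k" if "i < d" for i
    unfolding p_def using that a'k by (intro polys_over_sum polys_over_monom) (auto simp: S_def)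
  have px: "(\<Sum>j<N. a' (i, j) * x ^ j) = poly (p i) x" for i by (simp add: p_def poly_sum poly_monom)
  \<comment> \<open>The family \<open>y\<close> is independent over \<open>k(x)\<close> and the
    powers of \<open>x\<close> are so over \<open>k\<close>; a vanishing sum would make all
    coefficients vanish.\<close>
  have "h \<noteq> 0"
  proof
    assume "h = 0"
    then have "(\<Sum>i<d. poly (p i) x * y i) = 0" using h r(2) f(2) px by simp
    then have "\<forall>i<d. poly (p i) x = 0" using pk poly_kx kx.R_fractions by (intro y_indep) auto
    then have p0: "p i = 0" if "i < d" for i using that poly_x_0[OF pk] by blast
    have "a' (i, j) = 0" if "i < d" "j < N" for i j
    proof -
      have "Polynomial.coeff (p i) j = a' (i, j)" using that(2) by (simp add: p_def coeff_sum if_distrib cong: if_cong)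
      then show ?thesis using p0[OF that(1)] by simp
    qed
    then have "a' p = 0" if "p \<in> S" for p using that by (auto simp: S_def)
    then show False using a(2) a'e eS by metis
  qed
  moreover have "h \<in> b"
  proof -
    have "a t * G (e t) \<in> b" if "t \<in> {0..<card S}" for t
    proof -
      have "a t \<in> A.Oc" using a(1) that polys_at_const A.R_Oc by blast
      then show ?thesis using Gb[OF eS[OF that]] bI unfolding A.is_ideal_def by blast
    qed
    moreover have "submodule_set b"
      using bI polys_at_const A.R_Oc unfolding submodule_set_def A.is_ideal_def by blast
    ultimately show ?thesis unfolding h_def by (intro submodule_set_sum)
  qed
  ultimately show ?thesis using a(3) unfolding h_def by blast
qed

end

section \<open>Bounds for the values of integral elements at infinity\<close>

definition scale_roots :: "'a::field \<Rightarrow> 'a poly \<Rightarrow> 'a poly"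
  where "scale_roots c p = (\<Sum>i\<le>Polynomial.degree p. Polynomial.monom (Polynomial.coeff p i * c ^ (Polynomial.degree p - i)) i)"

lemma coeff_scale_roots:
  "Polynomial.coeff (scale_roots c p) i = Polynomial.coeff p i * c ^ (Polynomial.degree p - i)"
proof (cases "i \<le> Polynomial.degree p")
  case False
  then show ?thesis by (simp add: scale_roots_def coeff_sum coeff_eq_0)
qed (simp add: scale_roots_def coeff_sum if_distrib cong: if_cong)

lemma degree_scale_roots: "Polynomial.degree (scale_roots c p) = Polynomial.degree p"
proof (cases "p = 0")
  case False
  show ?thesis
  proof (rule antisym)
    show "Polynomial.degree (scale_roots c p) \<le> Polynomial.degree p"
      by (rule degree_le) (simp add: coeff_scale_roots coeff_eq_0)
    show "Polynomial.degree p \<le> Polynomial.degree (scale_roots c p)"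
      using False by (intro le_degree) (simp add: coeff_scale_roots)
  qed
qed (simp add: scale_roots_def)

lemma poly_scale_roots: "poly (scale_roots c p) (c * z) = c ^ Polynomial.degree p * poly p z"
proof -
  have "poly (scale_roots c p) (c * z) = (\<Sum>i\<le>Polynomial.degree p. Polynomial.coeff p i * c ^ (Polynomial.degree p - i) * (c * z) ^ i)"
    by (simp add: scale_roots_def poly_sum poly_monom)
  also have "\<dots> = (\<Sum>i\<le>Polynomial.degree p. c ^ Polynomial.degree p * (Polynomial.coeff p i * z ^ i))"
  proof (rule sum.cong)
    fix i assume "i \<in> {..Polynomial.degree p}"
    then have "c ^ Polynomial.degree p = c ^ (Polynomial.degree p - i) * c ^ i" by (simp flip: power_add)
    then show "Polynomial.coeff p i * c ^ (Polynomial.degree p - i) * (c * z) ^ i = c ^ Polynomial.degree p * (Polynomial.coeff p i * z ^ i)"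
      by (simp add: power_mult_distrib mult_ac)
  qed simp
  finally show ?thesis by (simp add: poly_altdef sum_distrib_left)
qed

lemma (in coeff_ring) scale_roots_polys_over: "p \<in> polys_over R \<Longrightarrow> c \<in> R \<Longrightarrow> scale_roots c p \<in> polys_over R"
  unfolding scale_roots_def by (intro polys_over_sum polys_over_monom R_mult R_power) auto

context function_field_ext
begin

text \<open>
  The minimal polynomials over \<open>k[x]\<close> and over the valuation ring of the infinite place are
  related by scaling, which bounds the degrees of the coefficients of the former. The constant
  coefficient then gives the bound, as its value is not positive.
\<close>

lemma integral_value_bound:
  assumes z: "z \<in> A.Oc" "z \<noteq> 0" and zN: "z / x ^ N \<in> B.Oc" and v: "v \<in> B.VV"
  shows "v z \<le> 2 * int (d * N) * (- v x)"
proof -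
  interpret nval v by (rule B.VV_nval[OF v])
  have vx: "v x < 0" and triv: "trivial_on_k v" using v VV_B by blast+
  obtain m where m: "m \<in> polys_over kx" "Polynomial.lead_coeff m = 1" "poly m z = 0"
    "\<And>p. p \<in> polys_over F \<Longrightarrow> p \<noteq> 0 \<Longrightarrow> poly p z = 0 \<Longrightarrow> Polynomial.degree m \<le> Polynomial.degree p"
    "Polynomial.degree m \<le> d" by (rule A.minpoly_exists[OF z(1)]) blast
  obtain l where l: "l \<in> polys_over Ri" "Polynomial.lead_coeff l = 1" "poly l (z / x ^ N) = 0"
    "\<And>p. p \<in> polys_over F \<Longrightarrow> p \<noteq> 0 \<Longrightarrow> poly p (z / x ^ N) = 0 \<Longrightarrow> Polynomial.degree l \<le> Polynomial.degree p"
    by (rule B.minpoly_exists[OF zN]) (unfold fractions_Ri, blast)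
  have mF: "m \<in> polys_over F" by (rule polys_over_mono[OF m(1)]) (use kx.R_fractions in blast)
  have lF: "l \<in> polys_over F" by (rule polys_over_mono[OF l(1)]) (use Ri_F in blast)
  have xN: "x ^ N \<noteq> 0" using x_nonzero by simp
  \<comment> \<open>Scaling turns the minimal polynomial of \<open>z / x ^ N\<close> into an
    equation of \<open>z\<close>, and conversely with \<open>m'\<close>. Minimality on both sides
    makes the degrees agree, and two monic equations of minimal degree coincide.\<close>
  define p where "p = scale_roots (x ^ N) l"
  have p: "p \<in> polys_over F" "Polynomial.degree p = Polynomial.degree l" "Polynomial.lead_coeff p = 1" "poly p z = 0"
    using F.scale_roots_polys_over[OF lF x_power_F] l(2,3) poly_scale_roots[of "x ^ N" l "z / x ^ N"] x_nonzero
    by (simp_all add: p_def degree_scale_roots coeff_scale_roots)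
  define m' where "m' = scale_roots (1 / x ^ N) m"
  have m': "m' \<in> polys_over F" "Polynomial.degree m' = Polynomial.degree m" "Polynomial.lead_coeff m' = 1" "poly m' (z / x ^ N) = 0"
    using F.scale_roots_polys_over[OF mF F_inverse[OF x_power_F]] m(2,3) poly_scale_roots[of "1 / x ^ N" m z]
    by (simp_all add: m'_def degree_scale_roots coeff_scale_roots)
  have "p \<noteq> 0" "m' \<noteq> 0" using p(3) m'(3) by auto
  then have deg: "Polynomial.degree m = Polynomial.degree p"
    using m(4)[OF p(1) _ p(4)] l(4)[OF m'(1) _ m'(4)] p(2) m'(2) by simp
  have "m - p = 0"
  proof (rule ccontr)
    assume ne: "m - p \<noteq> 0"
    have "Polynomial.degree m \<le> Polynomial.degree (m - p)"
      by (rule m(4)) (use mF p m(3) ne in simp_all)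
    moreover have "Polynomial.degree (m - p) \<le> Polynomial.degree m" using deg by (intro degree_diff_le) auto
    ultimately have dmp: "Polynomial.degree (m - p) = Polynomial.degree m" by simp
    have "Polynomial.coeff (m - p) (Polynomial.degree m) = 0" using m(2) p(3) deg by simp
    then have "Polynomial.lead_coeff (m - p) = 0" unfolding dmp .
    then show False using ne unfolding leading_coeff_0_iff by blast
  qed
  then have mp: "m = p" by simp
  \<comment> \<open>A lower bound both for the values of the coefficients of \<open>m\<close> and
    for those of the powers of \<open>z\<close> up to exponent \<open>d\<close>; their product
    accounts for the factor 2 in the bound.\<close>
  define L where "L = int (d * N) * v x"
  have vxN: "v (x ^ j) = int j * v x" for j using v_power[OF x_nonzero] .
  have coeff: "Polynomial.coeff m i \<in> ball L" for i
  proof -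
    have "Polynomial.coeff l i \<in> ball 0"
      using Ri.polys_over_coeff[OF l(1)] B.R_Oc B.VV_ring[OF v] unfolding valuation_ring_ball by blast
    moreover have "(x ^ N) ^ (Polynomial.degree l - i) \<in> ball L"
    proof -
      have "Polynomial.degree l - i \<le> d" using deg p(2) m(5) by simp
      then have "N * (Polynomial.degree l - i) \<le> d * N" by simp
      then have "int (N * (Polynomial.degree l - i)) \<le> int (d * N)" by (rule of_nat_mono)
      then have "L \<le> int (N * (Polynomial.degree l - i)) * v x" unfolding L_def using vx by (intro mult_right_mono_neg) auto
      then show ?thesis by (simp only: ball_def power_mult[symmetric] vxN mem_Collect_eq simp_thms)
    qed
    ultimately have "Polynomial.coeff l i * (x ^ N) ^ (Polynomial.degree l - i) \<in> ball (0 + L)" by (rule ball_mult)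
    then show ?thesis by (simp add: mp p_def coeff_scale_roots)
  qed
  have zp: "z ^ i \<in> ball L" if i: "i \<le> d" for i
  proof -
    have "z / x ^ N \<in> ball 0" using zN B.VV_ring[OF v] unfolding valuation_ring_ball by blast
    then have "0 \<le> v z - v (x ^ N)" using v_divide[OF z(2) xN] z(2) x_nonzero by (simp add: ball_def)
    then have "int N * v x \<le> v z" by (simp add: vxN)
    then have "int i * (int N * v x) \<le> int i * v z" by (intro mult_left_mono) auto
    moreover have "L \<le> int i * (int N * v x)"
    proof -
      have "i * N \<le> d * N" using i by simp
      then have "int (i * N) \<le> int (d * N)" by (rule of_nat_mono)
      then have "int (d * N) * v x \<le> int (i * N) * v x" using vx by (intro mult_right_mono_neg) auto
      then show ?thesis by (simp add: L_def mult.assoc)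
    qed
    ultimately show ?thesis by (simp add: ball_def v_power[OF z(2)])
  qed
  obtain a r where ar: "m = pCons a r" by (cases m)
  have r0: "r \<noteq> 0"
  proof
    assume "r = 0"
    then have "m = [:1:]" using m(2) ar by simp
    then show False using m(3) by simp
  qed
  have az: "a = - (z * poly r z)" using m(3) ar by (simp add: eq_neg_iff_add_eq_0)
  have degr: "Polynomial.degree r \<le> d" using m(5) ar r0 by simp
  have s0: "poly r z \<noteq> 0"
  proof
    assume "poly r z = 0"
    moreover have "r \<in> polys_over F" using mF ar by simp
    ultimately show False using m(4)[of r] r0 ar by simp
  qed
  have "poly r z \<in> ball (L + L)"
    unfolding poly_altdef
  proof (rule ball_sum)
    fix i assume "i \<in> {..Polynomial.degree r}"
    then have "z ^ i \<in> ball L" using degr by (intro zp) simp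
    moreover have "Polynomial.coeff r i \<in> ball L" using coeff[of "Suc i"] by (simp add: ar)
    ultimately show "Polynomial.coeff r i * z ^ i \<in> ball (L + L)" by (intro ball_mult)
  qed
  then have "L + L \<le> v (poly r z)" using s0 by (simp add: ball_def)
  moreover have "v a = v z + v (poly r z)" using v_mult[OF z(2) s0] by (simp add: az)
  moreover have "v a \<le> 0"
  proof -
    have "a \<in> kx" using m(1) ar by simp
    then obtain f where f: "f \<in> polys_over k" "a = poly f x" by (rule kxE)
    have "f \<noteq> 0" using az s0 z(2) f(2) by auto
    then have "v a = int (Polynomial.degree f) * v x" using v_poly[OF triv vx f(1)] f(2) by simp
    then show ?thesis using vx by (simp add: mult_nonneg_nonpos)
  qed
  moreover have "2 * int (d * N) * (- v x) = - (L + L)" by (simp add: L_def)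
  ultimately show ?thesis by linarith
qed

end

section \<open>The conditions on boxes for function fields\<close>

context function_field_places
begin

text \<open>The box bounds the values at the last place from below. For the other side, a
  denominator of \<open>b\<close> makes the elements integral over \<open>k[x]\<close>, and division
  by one power of \<open>x\<close>, the same for the whole box, makes them integral at infinity, so
  \<open>integral_value_bound\<close> applies.\<close>

lemma finite_levels_function_field:
  assumes b: "A.fideal b" and w: "w = vv (Suc n)"
  shows "finite (w ` {h \<in> b. h \<noteq> 0 \<and> (\<forall>i\<in>{1..Suc n}. - t i \<le> real_of_int (vv i h))})"
proof -
  obtain c where c: "c \<in> A.Oc" "c \<noteq> 0" "\<And>f. f \<in> b \<Longrightarrow> c * f \<in> A.Oc" using b by (auto simp: A.fideal_def)
  have "\<exists>N::nat. \<forall>i\<in>{1..Suc n}. t i - real_of_int (vv i c) \<le> real N"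
  proof -
    obtain N :: nat where N: "(\<Sum>i=1..Suc n. \<bar>t i - real_of_int (vv i c)\<bar>) \<le> real N" using real_arch_simple by blast
    have "t i - real_of_int (vv i c) \<le> real N" if i: "i \<in> {1..Suc n}" for i
      using member_le_sum[OF i, of "\<lambda>i. \<bar>t i - real_of_int (vv i c)\<bar>"] N by simp
    then show ?thesis by blast
  qed
  then obtain N :: nat where N: "\<And>i. i \<in> {1..Suc n} \<Longrightarrow> t i - real_of_int (vv i c) \<le> real N" by blast
  have wV: "w \<in> B.VV" unfolding w by (rule vv_VV) simp
  define U where "U = 2 * int (d * N) * (- w x)"
  have "w ` {h \<in> b. h \<noteq> 0 \<and> (\<forall>i\<in>{1..Suc n}. - t i \<le> real_of_int (vv i h))} \<subseteq> {\<lceil>- t (Suc n)\<rceil>..U - w c}"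
  proof
    fix r assume "r \<in> w ` {h \<in> b. h \<noteq> 0 \<and> (\<forall>i\<in>{1..Suc n}. - t i \<le> real_of_int (vv i h))}"
    then obtain h where h: "r = w h" "h \<in> b" "h \<noteq> 0" "\<And>i. i \<in> {1..Suc n} \<Longrightarrow> - t i \<le> real_of_int (vv i h)" by blast
    have ch: "c * h \<in> A.Oc" "c * h \<noteq> 0" using c h by auto
    have "(c * h) / x ^ N \<in> B.Oc"
    proof -
      have "0 \<le> v ((c * h) / x ^ N)" if v: "v \<in> B.VV" for v
      proof -
        obtain i where i: "i \<in> {1..Suc n}" "v = vv i" using v vv_image by blast
        interpret nval v by (rule B.VV_nval[OF v])
        have "- real N \<le> real_of_int (v c + v h)" using N[OF i(1)] h(4)[OF i(1)] i(2) by simp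
        then have "- int N \<le> v c + v h" by linarith
        moreover have "int N * v x \<le> int N * (- 1)" using i vv_x[OF i(1)] by (intro mult_left_mono) auto
        ultimately have "0 \<le> v (c * h) - v (x ^ N)" using v_mult[OF c(2) h(3)] v_power[OF x_nonzero] by simp
        then show ?thesis using v_divide[of "c * h" "x ^ N"] ch x_nonzero by simp
      qed
      then show ?thesis by (subst B.Oc_eq) blast
    qed
    from integral_value_bound[OF ch this wV] have "w c + w h \<le> U"
      using nval.v_mult[OF B.VV_nval[OF wV] c(2) h(3)] by (simp add: U_def)
    moreover have "- t (Suc n) \<le> real_of_int (w h)" unfolding w by (rule h(4)) simp
    ultimately show "r \<in> {\<lceil>- t (Suc n)\<rceil>..U - w c}" using h(1) by (auto simp: ceiling_le_iff)
  qed
  then show ?thesis by (rule finite_subset) simp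
qed

lemma place_deg_pos: "i \<in> {1..Suc n} \<Longrightarrow> place_deg (Function_Field k x q) (P i) > 0"
  using residue_dim_pos[OF vv_VV] P_vv by simp

lemma absval_function_field:
  assumes i: "i \<in> {1..Suc n}" and h: "h \<noteq> 0"
  shows "absval (Function_Field k x q) (P i) h \<le> base (Function_Field k x q) powr (r * place_deg (Function_Field k x q) (P i))
    \<longleftrightarrow> - r \<le> real_of_int (vv i h)"
proof -
  have "absval (Function_Field k x q) (P i) h = q powr (- real_of_int (vv i h) * place_deg (Function_Field k x q) (P i))"
    using h P_vv[OF i] by (simp add: absval_def)
  moreover have "q powr (- real_of_int (vv i h) * D) \<le> q powr (r * D) \<longleftrightarrow> - r \<le> real_of_int (vv i h)" if "D > 0" for D
    using q that by (auto simp: mult_le_cancel_right simp del: mult_minus_left)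
  ultimately show ?thesis using place_deg_pos[OF i] by simp
qed

lemma rep_setting_function_field: "rep_setting kx dg d (Function_Field k x q) P n"
proof
  let ?s = "Function_Field k x q"
  show "OK ?s = A.Oc" by (simp add: polys_at_def)
  show "places ?s - SS ?s = Nonarch ` A.VV" by (rule places_function_field)
  show "bij_betw P {1..Suc n} (SS ?s)" by (rule enum)
  show "SS ?s \<subseteq> places ?s" by auto
  show "1 < base ?s" using q by simp
  have SS: "\<exists>i\<in>{1..Suc n}. p = P i" if "p \<in> SS ?s" for p
  proof -
    have "P ` {1..Suc n} = SS ?s" using enum by (simp only: bij_betw_def)
    then show ?thesis using that by blast
  qed
  show "0 < place_deg ?s p" if "p \<in> SS ?s" for p
    using SS[OF that] place_deg_pos by blast
  show "nu p (f * g) = nu p f + nu p g" if p: "p \<in> SS ?s" and fg: "f \<noteq> 0" "g \<noteq> 0" for p f g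
  proof -
    obtain i where i: "i \<in> {1..Suc n}" "p = P i" using SS[OF p] by blast
    show ?thesis using nval.v_mult[OF vv_nval[OF i(1)] fg] unfolding i(2) P_vv[OF i(1)] by simp
  qed
  show "nu p f \<in> GG ?s" if "p \<in> SS ?s" for p f
    using SS_Nonarch[OF that] by auto
  show "finite (nu (P (Suc n)) ` (Box ?s P n b t - {0}))" if b: "A.fideal b" for b t
  proof -
    have "Box ?s P n b t - {0} \<subseteq> {h \<in> b. h \<noteq> 0 \<and> (\<forall>i\<in>{1..Suc n}. - t i \<le> real_of_int (vv i h))}"
    proof
      fix h assume h: "h \<in> Box ?s P n b t - {0}"
      then have h0: "h \<noteq> 0" by blast
      have "- t i \<le> real_of_int (vv i h)" if i: "i \<in> {1..Suc n}" for i
        by (rule absval_function_field[OF i h0, THEN iffD1]) (use h i in \<open>simp only: Box_def, blast\<close>)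
      then show "h \<in> {h \<in> b. h \<noteq> 0 \<and> (\<forall>i\<in>{1..Suc n}. - t i \<le> real_of_int (vv i h))}"
        using h by (auto simp: Box_def)
    qed
    then have "finite (vv (Suc n) ` (Box ?s P n b t - {0}))"
      using finite_levels_function_field[OF b refl] by (meson finite_subset image_mono)
    then have "finite (real_of_int ` vv (Suc n) ` (Box ?s P n b t - {0}))" by (rule finite_imageI)
    also have "real_of_int ` vv (Suc n) ` (Box ?s P n b t - {0}) = nu (P (Suc n)) ` (Box ?s P n b t - {0})"
      unfolding image_image P_vv[of "Suc n", simplified] by simp
    finally show ?thesis .
  qed
  show "\<exists>l\<in>GG ?s. Box ?s P n b (t(Suc n := l)) - {0} \<noteq> {}" if b: "A.fideal b" for b t
  proof -
    obtain T :: nat where T: "(\<Sum>i=1..n. \<bar>t i\<bar>) \<le> real T" using real_arch_simple by blast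
    obtain h where h: "h \<in> b" "h \<noteq> 0" "h \<in> Zs (- int T)" using element_vanishing[OF b] by blast
    define l where "l = - real_of_int (vv (Suc n) h)"
    have "absval ?s (P i) h \<le> base ?s powr ((t(Suc n := l)) i * place_deg ?s (P i))" if i: "i \<in> {1..Suc n}" for i
    proof (rule absval_function_field[OF i h(2), THEN iffD2])
      show "- (t(Suc n := l)) i \<le> real_of_int (vv i h)"
      proof (cases "i = Suc n")
        case False
        then have i': "i \<in> {1..n}" using i by auto
        have "h \<in> nval.ball (vv i) (- int T * vv i x)" using h(3) i' unfolding Zs_def by blast
        then have "- int T * vv i x \<le> vv i h" using h(2) unfolding nval.ball_def[OF vv_nval[OF i]] by blast
        moreover have "int T * 1 \<le> int T * (- vv i x)" using vv_x[OF i] by (intro mult_left_mono) auto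
        ultimately have "int T \<le> vv i h" by simp
        moreover have "\<bar>t i\<bar> \<le> real T" using member_le_sum[OF i', of "\<lambda>i. \<bar>t i\<bar>"] T by simp
        ultimately show ?thesis using False by simp
      qed (simp add: l_def)
    qed
    then have "h \<in> Box ?s P n b (t(Suc n := l)) - {0}" using h(1,2) by (simp only: Box_def) blast
    moreover have "l \<in> GG ?s" by (simp add: l_def)
    ultimately show ?thesis by blast
  qed
qed simp

end

lemma function_field_rep_setting:
  fixes P :: "nat \<Rightarrow> 'a::field place"
  assumes valid: "valid_setting (Function_Field k x q)" and enum: "bij_betw P {1..Suc n} (SS (Function_Field k x q))"
  shows "\<exists>\<delta> d. rep_setting (polys_at k x) \<delta> d (Function_Field k x q) P n"
proof -
  have k: "subfield k KR" and x: "\<not> algebraic_over k x"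
    and q: "if finite k then q = real (card k) else q > 1"
    using valid by (auto simp: is_function_field_def split: if_splits)
  obtain y0 where y0: "finite_extension_of (rational_functions k y0)"
    using valid by (auto simp: is_function_field_def)
  have transc: "p = 0" if "p \<in> polys_over k" "poly p x = 0" for p
    using x that by (auto simp: algebraic_over_def)
  interpret rational_function_field k x
    by (intro rational_function_field.intro rational_function_field_axioms.intro coeff_ring_subfield k subfield_inverse[OF k] transc)
  have "finite_extension_of F" by (rule finite_extension_rational_functions[OF k transc y0])
  then obtain d and y :: "nat \<Rightarrow> 'a" where dy: "dependent_over F d"
    "\<And>c. (\<And>i. i < d \<Longrightarrow> c i \<in> F) \<Longrightarrow> (\<Sum>i<d. c i * y i) = 0 \<Longrightarrow> \<forall>i<d. c i = 0"
    by (rule finite_extension_basis[OF subfield_F]) blast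
  have q1: "q > 1"
  proof (cases "finite k")
    case True
    have "card {0, 1 :: 'a} \<le> card k" by (rule card_mono[OF True]) simp
    then show ?thesis using q True by simp
  qed (use q in simp)
  interpret function_field_places k x d q P n y
  proof (intro function_field_places.intro function_field_ext.intro function_field_ext_axioms.intro
      function_field_places_axioms.intro)
    show "rational_function_field k x" by (rule rational_function_field_axioms)
    show "\<forall>i<d. c i = 0" if "\<And>i. i < d \<Longrightarrow> c i \<in> F" "(\<Sum>i<d. c i * y i) = 0" for c
      using dy(2) that by blast
  qed (rule k dy(1) enum q1)+
  show ?thesis using rep_setting_function_field by blast
qed

theorem theorem7p3:
  fixes s :: "'a::field setting"
    and P :: "nat \<Rightarrow> 'a place" and n :: nat
    and b b' :: "'a set" and t t' :: "nat \<Rightarrow> real"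
  assumes setting: "valid_setting s"
    and enum: "bij_betw P {1..Suc n} (SS s)"
    and A: "(sim_class s P n b, t) \<in> Rep_f_K s P n"
    and A': "(sim_class s P n b', t') \<in> Rep_f_K s P n"
  shows
    "(let c = b \<otimes>\<^bsub>Id_group s\<^esub> b'; u = (\<lambda>i\<in>{1..n}. t i + t' i) in
       (\<exists>l. minimal_level s P n c u l) \<and>
       (\<forall>l \<mu>. minimal_level s P n c u l \<longrightarrow>
          is_smallest s P n (Box s P n c (u(Suc n := l)) - {0}) \<mu> \<longrightarrow>
          (let B = (sim_class s P n (scale_ideal (1 / \<mu>) c),
                    \<lambda>i\<in>{1..n}. t i + t' i + nu (P i) \<mu>)
           in B \<in> Rep_f_K s P n \<and>
              Phi_add s P n (sim_class s P n b, t) (sim_class s P n b', t') B)))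
     \<and>
     (let c = inv\<^bsub>Id_group s\<^esub> b; u = (\<lambda>i\<in>{1..n}. - t i) in
       (\<exists>l. minimal_level s P n c u l) \<and>
       (\<forall>l \<mu>. minimal_level s P n c u l \<longrightarrow>
          is_smallest s P n (Box s P n c (u(Suc n := l)) - {0}) \<mu> \<longrightarrow>
          (let C = (sim_class s P n (scale_ideal (1 / \<mu>) c),
                    \<lambda>i\<in>{1..n}. - t i + nu (P i) \<mu>)
           in C \<in> Rep_f_K s P n \<and> Phi_neg s P n (sim_class s P n b, t) C)))"
proof -
  have "\<exists>R \<delta> d. rep_setting R \<delta> d s P n"
  proof (cases s)
    case Number_Field
    then show ?thesis using number_field_rep_setting[of P n] setting enum by auto
  next
    case (Function_Field k x q)
    then show ?thesis using function_field_rep_setting[of k x q P n] setting enum by blast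
  qed
  then obtain R \<delta> d where "rep_setting R \<delta> d s P n" by blast
  then show ?thesis using A A' by (rule rep_setting.representation_arithmetic)
qed

end
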